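(* Let $\delta>0$. The space of traces on $\mathrm{gp}_\delta$ of functions in $H^1(\mathbb{R}^2)$ is exactly $H^{1/2}(\mathrm{gp}_\delta)$.
   Context: $H^1(\mathbb{R}^2)$ is the homogeneous Sobolev space of functions with distributional gradient in $L^2(\mathbb{R}^2)$ (modulo constants), with $\|F\|_{H^1(\mathbb{R}^2)}^2=\int|\nabla F|^2$; such functions have well-defined traces on lines. $\mathrm{gp}_\delta$ is the graph-paper metric graph with vertices $(j\delta,k\delta)$, $j,k\in\mathbb{Z}$, and horizontal and vertical edges of length $\delta$ joining $(j\delta,k\delta)$ to $((j+1)\delta,k\delta)$ and to $(j\delta,(k+1)\delta)$; the trace on $\mathrm{gp}_\delta$ is the trace on the union of these lines. $H^{1/2}(\mathrm{gp}_\delta)$ is the space of locally $L^2$ functions $f$ on $\mathrm{gp}_\delta$ (modulo constants) with finite norm $$\begin{aligned}\|f\|_{H^{1/2}(\mathrm{gp}_\delta)}^2&=\sum_{j,k}\int_0^\delta\!\!\int_0^\delta\frac{|f(j\delta+x,k\delta)-f(j\delta+y,k\delta)|^2}{|x-y|^2}dxdy+\sum_{j,k}\int_0^\delta\!\!\int_0^\delta\frac{|f(j\delta,k\delta+x)-f(j\delta,k\delta+y)|^2}{|x-y|^2}dxdy\\&+\sum_{j,k}\int_{-\delta}^\delta|f(j\delta+x,k\delta)-f(j\delta,k\delta+x)|^2\frac{dx}{|x|}+\sum_{j,k}\int_0^\delta|f(j\delta+x,k\delta)-f(j\delta-x,k\delta)|^2\frac{dx}{x}\\&+\sum_{j,k}\int_0^\delta|f(j\delta,k\delta+x)-f(j\delta,k\delta-x)|^2\frac{dx}{x}.\end{aligned}$$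 *)

theory Defs
  imports "HOL-Analysis.Analysis"
begin

definition test_fun :: "(real \<times> real \<Rightarrow> real) \<Rightarrow> (real \<times> real \<Rightarrow> real \<times> real \<Rightarrow> real) \<Rightarrow> bool" where
  "test_fun \<phi> D \<longleftrightarrow>
     (\<forall>z. (\<phi> has_derivative D z) (at z)) \<and>
     continuous_on UNIV (\<lambda>z. D z (1,0)) \<and> continuous_on UNIV (\<lambda>z. D z (0,1)) \<and>
     bounded {z. \<phi> z \<noteq> 0}"

definition weak_gradient :: "(real \<times> real \<Rightarrow> real) \<Rightarrow> (real \<times> real \<Rightarrow> real) \<Rightarrow> (real \<times> real \<Rightarrow> real) \<Rightarrow> bool" where
  "weak_gradient F G1 G2 \<longleftrightarrow>
     (\<forall>\<phi> D. test_fun \<phi> D \<longrightarrow>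
        (\<integral>z. F z * D z (1,0) \<partial>lebesgue) = - (\<integral>z. G1 z * \<phi> z \<partial>lebesgue) \<and>
        (\<integral>z. F z * D z (0,1) \<partial>lebesgue) = - (\<integral>z. G2 z * \<phi> z \<partial>lebesgue))"

text \<open>Homogeneous H^1(R^2): locally integrable functions with distributional gradient in L^2.\<close>
definition H1 :: "(real \<times> real \<Rightarrow> real) \<Rightarrow> bool" where
  "H1 F \<longleftrightarrow> (\<forall>K. compact K \<longrightarrow> set_integrable lebesgue K F) \<and>
     (\<exists>G1 G2. G1 \<in> borel_measurable lebesgue \<and> G2 \<in> borel_measurable lebesgue \<and>
        integrable lebesgue (\<lambda>z. (G1 z)\<^sup>2) \<and> integrable lebesgue (\<lambda>z. (G2 z)\<^sup>2) \<and>
        weak_gradient F G1 G2)"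

definition locL2 :: "(real \<Rightarrow> real) \<Rightarrow> bool" where
  "locL2 g \<longleftrightarrow> g \<in> borel_measurable lebesgue \<and>
     (\<forall>a b. (\<integral>\<^sup>+ x \<in> {a..b}. ennreal ((g x)\<^sup>2) \<partial>lebesgue) < \<infinity>)"

definition htrace :: "(real \<times> real \<Rightarrow> real) \<Rightarrow> real \<Rightarrow> (real \<Rightarrow> real) \<Rightarrow> bool" where
  "htrace F c g \<longleftrightarrow> locL2 g \<and>
     (\<forall>a b. \<forall>e>0. \<exists>\<eta>>0. AE t in lebesgue. \<bar>t\<bar> < \<eta> \<longrightarrow>
        (\<integral>\<^sup>+ x \<in> {a..b}. ennreal ((F (x, c + t) - g x)\<^sup>2) \<partial>lebesgue) < ennreal e)"

definition vtrace :: "(real \<times> real \<Rightarrow> real) \<Rightarrow> real \<Rightarrow> (real \<Rightarrow> real) \<Rightarrow> bool" where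
  "vtrace F c g \<longleftrightarrow> htrace (\<lambda>(x, y). F (y, x)) c g"

text \<open>f (a function on the plane, only its values on gp_delta matter) is the trace of F on gp_delta.\<close>
definition gp_trace :: "real \<Rightarrow> (real \<times> real \<Rightarrow> real) \<Rightarrow> (real \<times> real \<Rightarrow> real) \<Rightarrow> bool" where
  "gp_trace \<delta> F f \<longleftrightarrow>
     (\<forall>k::int. htrace F (of_int k * \<delta>) (\<lambda>x. f (x, of_int k * \<delta>))) \<and>
     (\<forall>j::int. vtrace F (of_int j * \<delta>) (\<lambda>y. f (of_int j * \<delta>, y)))"

definition gp_locL2 :: "real \<Rightarrow> (real \<times> real \<Rightarrow> real) \<Rightarrow> bool" where
  "gp_locL2 \<delta> f \<longleftrightarrow>
     (\<forall>k::int. locL2 (\<lambda>x. f (x, of_int k * \<delta>))) \<and>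
     (\<forall>j::int. locL2 (\<lambda>y. f (of_int j * \<delta>, y)))"

definition gp_terms :: "real \<Rightarrow> (real \<times> real \<Rightarrow> real) \<Rightarrow> int \<Rightarrow> int \<Rightarrow> ennreal" where
  "gp_terms \<delta> f j k =
     (let a = of_int j * \<delta>; b = of_int k * \<delta> in
       (\<integral>\<^sup>+ x \<in> {0..\<delta>}. (\<integral>\<^sup>+ y \<in> {0..\<delta>}.
           ennreal ((f (a + x, b) - f (a + y, b))\<^sup>2 / (x - y)\<^sup>2) \<partial>lebesgue) \<partial>lebesgue)
     + (\<integral>\<^sup>+ x \<in> {0..\<delta>}. (\<integral>\<^sup>+ y \<in> {0..\<delta>}.
           ennreal ((f (a, b + x) - f (a, b + y))\<^sup>2 / (x - y)\<^sup>2) \<partial>lebesgue) \<partial>lebesgue)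
     + (\<integral>\<^sup>+ x \<in> {-\<delta>..\<delta>}. ennreal ((f (a + x, b) - f (a, b + x))\<^sup>2 / \<bar>x\<bar>) \<partial>lebesgue)
     + (\<integral>\<^sup>+ x \<in> {0..\<delta>}. ennreal ((f (a + x, b) - f (a - x, b))\<^sup>2 / x) \<partial>lebesgue)
     + (\<integral>\<^sup>+ x \<in> {0..\<delta>}. ennreal ((f (a, b + x) - f (a, b - x))\<^sup>2 / x) \<partial>lebesgue))"

definition gp_half_norm_sq :: "real \<Rightarrow> (real \<times> real \<Rightarrow> real) \<Rightarrow> ennreal" where
  "gp_half_norm_sq \<delta> f = (\<integral>\<^sup>+ jk. gp_terms \<delta> f (fst jk) (snd jk) \<partial>count_space (UNIV :: (int \<times> int) set))"

definition H_half_gp :: "real \<Rightarrow> (real \<times> real \<Rightarrow> real) set" where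
  "H_half_gp \<delta> = {f. gp_locL2 \<delta> f \<and> gp_half_norm_sq \<delta> f < \<infinity>}"

end

theory Submission
  imports Defs
begin

text \<open>
  A function \<open>F\<close> with weak gradient \<open>(G1, G2)\<close> in \<open>L\<^sup>2\<close> and trace \<open>g\<close> on the line \<open>y = c\<close> satisfies
  \<open>F(x,y) = g(x) + \<integral>\<^sub>c\<^sup>y G2(x,s) ds\<close> for almost every \<open>(x,y)\<close>, and conversely such a formula gives both the
  weak derivative in \<open>y\<close> and the trace. So \<open>f\<close> is a trace iff its restrictions to all grid lines are represented
  in this way by one and the same \<open>F\<close>.

  Necessity. Eliminating \<open>F\<close> from the formulas for a horizontal line carrying \<open>u\<close> and a vertical line carrying \<open>v\<close>
  gives \<open>u(x) + \<integral> G2(x,s) ds = v(y) + \<integral> G1(s,y) ds\<close> almost everywhere. Taking the height \<open>y = h\<close> at \<open>x\<close> and at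
  \<open>x + h\<close> controls \<open>u(x + h) - u(x)\<close>, and Hardy's inequality bounds the Gagliardo integrals. The
  vertex integrals follow by averaging over \<open>y\<close> between \<open>x/2\<close> and \<open>x\<close>, because the diagonal \<open>y = x\<close> is a null set.
  Every term is bounded by the energy near its vertex, and these neighbourhoods overlap boundedly.

  Sufficiency. Near a corner of a square the two sides are unfolded to one interval, and the data are extended by averages
  over intervals whose length is proportional to the distance from the boundary. The four corner extensions
  are combined with bilinear weights, which sum to \<open>1\<close> and reproduce the data on the sides, so neighbouring squares fit
  together.
\<close>

section \<open>Integral inequalities and oriented integrals\<close>

text \<open>The definition of the traces gives no values at single points, and every identity
  between \<open>F\<close> and its traces holds only almost everywhere; evaluation at a vertex or on
  a diagonal is never available. Only vertical lines are treated. The horizontal direction is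
  obtained by exchanging the coordinates, which interchanges \<open>u\<close> and \<open>v\<close>;
  for this reason the extension is built so as to be invariant under this exchange almost
  everywhere, and only its derivative in \<open>y\<close> is computed. Averages with a sharp cut-off
  are chosen because this derivative is then an explicit difference quotient of the boundary data,
  so that a linear change of variables turns its energy into a Gagliardo integral; absolute
  continuity on almost every line is all that the formula with \<open>oint\<close> asks for. The
  bilinear weights cost a factor \<open>1 / d\<close> in the derivative, which a Poincare inequality
  on each square absorbs. All constants are therefore independent of \<delta>, and the bounds can be
  summed over the vertices.\<close>

lemma ennreal_2_mult_le: "2 * (a * b) \<le> a\<^sup>2 + (b::ennreal)\<^sup>2"
proof (cases "a = top \<or> b = top")
  case True
  then show ?thesis by (auto simp: power2_eq_square ennreal_mult_top)
next
  case False
  then obtain x y where xy: "a = ennreal x" "b = ennreal y" "0 \<le> x" "0 \<le> y"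
    by (metis ennreal_cases infinity_ennreal_def)
  have "2 * (x * y) \<le> x\<^sup>2 + y\<^sup>2" using sum_squares_bound[of x y] by (simp add: mult.assoc)
  then have "ennreal (2 * (x * y)) \<le> ennreal (x\<^sup>2 + y\<^sup>2)" by (rule ennreal_leI)
  then show ?thesis using xy
    by (simp add: ennreal_mult ennreal_power)
qed

text \<open>Integrate \<open>2 * (a * b) \<le> a\<^sup>2 + b\<^sup>2\<close> over \<open>s\<close>
  and \<open>t\<close>, with \<open>a = f s * g t\<close> and \<open>b = f t * g s\<close>. Every
  iterated integral factors, so infinite values require no case distinction.\<close>

lemma nn_integral_Cauchy_Schwarz:
  fixes f g :: "'a \<Rightarrow> ennreal"
  assumes [measurable]: "f \<in> borel_measurable M" "g \<in> borel_measurable M"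
  shows "(\<integral>\<^sup>+x. f x * g x \<partial>M)\<^sup>2 \<le> (\<integral>\<^sup>+x. (f x)\<^sup>2 \<partial>M) * (\<integral>\<^sup>+x. (g x)\<^sup>2 \<partial>M)"
proof -
  let ?A = "\<integral>\<^sup>+x. (f x)\<^sup>2 \<partial>M" and ?B = "\<integral>\<^sup>+x. (g x)\<^sup>2 \<partial>M" and ?C = "\<integral>\<^sup>+x. f x * g x \<partial>M"
  have "2 * ?C\<^sup>2 = (\<integral>\<^sup>+s. (\<integral>\<^sup>+t. 2 * ((f s * g t) * (f t * g s)) \<partial>M) \<partial>M)"
  proof -
    have "(\<integral>\<^sup>+s. (\<integral>\<^sup>+t. 2 * ((f s * g t) * (f t * g s)) \<partial>M) \<partial>M) = (\<integral>\<^sup>+s. (\<integral>\<^sup>+t. (2 * (f s * g s)) * (f t * g t) \<partial>M) \<partial>M)"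
      by (simp add: ac_simps)
    also have "\<dots> = (\<integral>\<^sup>+s. (2 * ?C) * (f s * g s) \<partial>M)"
      by (subst nn_integral_cmult) (auto simp: ac_simps)
    also have "\<dots> = 2 * ?C\<^sup>2"
      by (subst nn_integral_cmult) (auto simp: ac_simps power2_eq_square)
    finally show ?thesis by simp
  qed
  also have "\<dots> \<le> (\<integral>\<^sup>+s. (\<integral>\<^sup>+t. (f s * g t)\<^sup>2 + (f t * g s)\<^sup>2 \<partial>M) \<partial>M)"
    by (intro nn_integral_mono ennreal_2_mult_le)
  also have "\<dots> = (\<integral>\<^sup>+s. (f s)\<^sup>2 * ?B + ?A * (g s)\<^sup>2 \<partial>M)"
    by (simp add: nn_integral_add nn_integral_cmult nn_integral_multc power_mult_distrib)
  also have "\<dots> = 2 * (?A * ?B)"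
    by (simp add: nn_integral_add nn_integral_cmult nn_integral_multc mult_2)
  finally have "2 * ?C\<^sup>2 \<le> 2 * (?A * ?B)" .
  then show ?thesis
    by (subst (asm) ennreal_mult_le_mult_iff) auto
qed

lemma norm_integral_le_nn_integral:
  fixes f :: "'a \<Rightarrow> real"
  assumes [measurable]: "f \<in> borel_measurable M"
  shows "ennreal \<bar>integral\<^sup>L M f\<bar> \<le> (\<integral>\<^sup>+x. ennreal \<bar>f x\<bar> \<partial>M)"
\<comment> \<open>A function that is not integrable has Bochner integral 0, which makes the bound
  trivial.\<close>
proof (cases "integrable M f")
  case True then show ?thesis using integral_norm_bound_ennreal[OF True] by simp
qed (simp add: not_integrable_integral_eq)

text \<open>Cauchy-Schwarz with \<open>\<bar>k\<bar>\<close> split into two square roots. It serves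
  for \<open>oint\<close>, where \<open>k\<close> is the kernel, and for averages, where
  \<open>k\<close> is a normalised indicator and the first factor is 1.\<close>

lemma integral_square_weighted_le:
  fixes k g :: "'a \<Rightarrow> real"
  assumes [measurable]: "k \<in> borel_measurable M" "g \<in> borel_measurable M"
  shows "ennreal ((\<integral>x. k x * g x \<partial>M)\<^sup>2) \<le>
    (\<integral>\<^sup>+x. ennreal \<bar>k x\<bar> \<partial>M) * (\<integral>\<^sup>+x. ennreal (\<bar>k x\<bar> * (g x)\<^sup>2) \<partial>M)"
proof -
  have "ennreal ((\<integral>x. k x * g x \<partial>M)\<^sup>2) = (ennreal \<bar>\<integral>x. k x * g x \<partial>M\<bar>)\<^sup>2"
    by (simp add: ennreal_power)
  also have "\<dots> \<le> (\<integral>\<^sup>+x. ennreal \<bar>k x * g x\<bar> \<partial>M)\<^sup>2"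
    by (intro power_mono norm_integral_le_nn_integral) auto
  also have "\<dots> = (\<integral>\<^sup>+x. ennreal (sqrt \<bar>k x\<bar>) * ennreal (sqrt \<bar>k x\<bar> * \<bar>g x\<bar>) \<partial>M)\<^sup>2"
    by (intro arg_cong[where f="\<lambda>x. x\<^sup>2"] nn_integral_cong)
       (simp add: ennreal_mult[symmetric] abs_mult mult.assoc[symmetric])
  also have "\<dots> \<le> (\<integral>\<^sup>+x. (ennreal (sqrt \<bar>k x\<bar>))\<^sup>2 \<partial>M) * (\<integral>\<^sup>+x. (ennreal (sqrt \<bar>k x\<bar> * \<bar>g x\<bar>))\<^sup>2 \<partial>M)"
    by (intro nn_integral_Cauchy_Schwarz) auto
  also have "\<dots> = (\<integral>\<^sup>+x. ennreal \<bar>k x\<bar> \<partial>M) * (\<integral>\<^sup>+x. ennreal (\<bar>k x\<bar> * (g x)\<^sup>2) \<partial>M)"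
    by (simp add: ennreal_power power_mult_distrib)
  finally show ?thesis .
qed

text \<open>The signed indicator of the interval from \<open>c\<close> to \<open>y\<close>. It is
  half-open in both orientations, so that \<open>okern_trans\<close> holds at every point and not
  only almost everywhere.\<close>

definition okern :: "real \<Rightarrow> real \<Rightarrow> real \<Rightarrow> real" where
  "okern c y s = (if c \<le> s \<and> s < y then 1 else if y \<le> s \<and> s < c then -1 else 0)"

text \<open>Writing the oriented integral through a kernel makes it jointly measurable in both end
  points and accessible to Fubini's theorem.\<close>

definition oint :: "(real \<Rightarrow> real) \<Rightarrow> real \<Rightarrow> real \<Rightarrow> real" where
  "oint g c y = (\<integral>s. okern c y s * g s \<partial>lborel)"

lemma okern_measurable [measurable (raw)]:
  assumes [measurable]: "c \<in> borel_measurable M" "y \<in> borel_measurable M" "s \<in> borel_measurable M"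
  shows "(\<lambda>z. okern (c z) (y z) (s z)) \<in> borel_measurable M"
  unfolding okern_def by measurable

lemma oint_measurable [measurable (raw)]:
  assumes [measurable]: "c \<in> borel_measurable M" "y \<in> borel_measurable M"
    and [measurable]: "(\<lambda>(z, s). g z s) \<in> borel_measurable (M \<Otimes>\<^sub>M borel)"
  shows "(\<lambda>z. oint (g z) (c z) (y z)) \<in> borel_measurable M"
proof -
  have [measurable]: "(\<lambda>(z, s). g z s) \<in> borel_measurable (M \<Otimes>\<^sub>M lborel)"
    by simp
  show ?thesis unfolding oint_def by measurable
qed

lemma okern_self [simp]: "okern c c s = 0" by (auto simp: okern_def)
lemma oint_self [simp]: "oint g c c = 0" by (simp add: oint_def)
lemma okern_trans: "okern a b s + okern b c s = okern a c s" by (auto simp: okern_def)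
lemma abs_okern: "\<bar>okern c y s\<bar> = indicator ({c..<y} \<union> {y..<c}) s"
  by (auto simp: okern_def indicator_def)

lemma nn_integral_abs_okern: "(\<integral>\<^sup>+s. ennreal \<bar>okern c y s\<bar> \<partial>lborel) = ennreal \<bar>y - c\<bar>"
proof -
  have "(\<integral>\<^sup>+s. ennreal \<bar>okern c y s\<bar> \<partial>lborel) = emeasure lborel ({c..<y} \<union> {y..<c})"
    by (simp add: abs_okern ennreal_indicator)
  also have "\<dots> = ennreal \<bar>y - c\<bar>"
    by (cases "c \<le> y") auto
  finally show ?thesis .
qed

lemma oint_square_le:
  assumes [measurable]: "g \<in> borel_measurable borel"
  shows "ennreal ((oint g c y)\<^sup>2) \<le> ennreal \<bar>y - c\<bar> * (\<integral>\<^sup>+s. ennreal (\<bar>okern c y s\<bar> * (g s)\<^sup>2) \<partial>lborel)"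
  unfolding oint_def
  using integral_square_weighted_le[of "okern c y" lborel g] by (simp add: nn_integral_abs_okern)

lemma integrable_okern:
  assumes "set_integrable lborel {a..b} g" "c \<in> {a..b}" "y \<in> {a..b}" 
  shows "integrable lborel (\<lambda>s. okern c y s * g s)"
proof -
  have "integrable lborel (\<lambda>s. okern c y s * (indicator {a..b} s *\<^sub>R g s))"
  proof (rule Bochner_Integration.integrable_bound)
    show "integrable lborel (\<lambda>s. indicator {a..b} s *\<^sub>R g s)" using assms(1) by (simp add: set_integrable_def)
    then have [measurable]: "(\<lambda>s. indicator {a..b} s *\<^sub>R g s) \<in> borel_measurable lborel" by auto
    then show "(\<lambda>s. okern c y s * (indicator {a..b} s *\<^sub>R g s)) \<in> borel_measurable lborel" by measurable
  qed (auto simp: okern_def)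
  also have "(\<lambda>s. okern c y s * (indicator {a..b} s *\<^sub>R g s)) = (\<lambda>s. okern c y s * g s)"
    using assms(2,3) by (auto simp: okern_def fun_eq_iff)
  finally show ?thesis .
qed

lemma oint_trans:
  assumes "integrable lborel (\<lambda>s. okern a b s * g s)" "integrable lborel (\<lambda>s. okern b c s * g s)"
  shows "oint g a b + oint g b c = oint g a c"
  using assms unfolding oint_def okern_trans[of a b _ c, symmetric]
  by (subst Bochner_Integration.integral_add[symmetric]) (auto simp: algebra_simps)

section \<open>Iterated integrals and null sets in the plane\<close>

lemma nn_integral_plane:
  fixes f :: "real \<times> real \<Rightarrow> ennreal"
  assumes "f \<in> borel_measurable borel"
  shows "(\<integral>\<^sup>+z. f z \<partial>lborel) = (\<integral>\<^sup>+x. \<integral>\<^sup>+y. f (x, y) \<partial>lborel \<partial>lborel)"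
    and "(\<integral>\<^sup>+z. f z \<partial>lborel) = (\<integral>\<^sup>+y. \<integral>\<^sup>+x. f (x, y) \<partial>lborel \<partial>lborel)"
  using assms lborel.nn_integral_fst[of f lborel] lborel_pair.nn_integral_snd[of f] by (simp_all add: lborel_prod)

lemma AE_plane:
  fixes P :: "real \<times> real \<Rightarrow> bool"
  assumes "Measurable.pred borel P"
  shows "(AE z in lborel. P z) \<longleftrightarrow> (AE x in lborel. AE y in lborel. P (x, y))"
    and "(AE z in lborel. P z) \<longleftrightarrow> (AE y in lborel. AE x in lborel. P (x, y))"
proof -
  have m: "{x \<in> space (lborel \<Otimes>\<^sub>M lborel). P (fst x, snd x)} \<in> sets (lborel \<Otimes>\<^sub>M lborel)"
  proof -
    have "sets (lborel \<Otimes>\<^sub>M lborel) = sets (borel :: (real \<times> real) measure)"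
      unfolding lborel_prod by (rule sets_lborel)
    then show ?thesis using assms by (simp only: pred_def) (simp add: space_pair_measure)
  qed
  show 1: "(AE z in lborel. P z) \<longleftrightarrow> (AE x in lborel. AE y in lborel. P (x, y))"
    using lborel_pair.AE_pair_iff[of "\<lambda>x y. P (x, y)"] m unfolding lborel_prod by simp
  show "(AE z in lborel. P z) \<longleftrightarrow> (AE y in lborel. AE x in lborel. P (x, y))"
    unfolding 1 using lborel_pair.AE_commute[of "\<lambda>x y. P (x, y)"] m by simp
qed

text \<open>\<open>P\<close> may fail to be measurable, so the exceptional set is first enlarged to
  a Borel null set \<open>N\<close>, to which \<open>AE_plane\<close> applies.\<close>

lemma AE_planeD:
  fixes P :: "real \<times> real \<Rightarrow> bool"
  assumes "AE z in lborel. P z"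
  shows "AE x in lborel. AE y in lborel. P (x, y)" "AE y in lborel. AE x in lborel. P (x, y)"
proof -
  obtain N where N: "N \<in> sets lborel" "emeasure lborel N = 0" "{z. \<not> P z} \<subseteq> N"
    using assms by (auto elim!: AE_E simp: null_sets_def)
  have [measurable]: "N \<in> sets borel" using N by simp
  have "AE z in lborel. z \<notin> N" using N by (intro AE_not_in) (auto simp: null_sets_def)
  then have "AE x in lborel. AE y in lborel. (x, y) \<notin> N" "AE y in lborel. AE x in lborel. (x, y) \<notin> N"
    using AE_plane[of "\<lambda>z. z \<notin> N"] by auto
  note * = this
  have imp: "P (x, y)" if "(x, y) \<notin> N" for x y using N(3) that by blast
  show "AE x in lborel. AE y in lborel. P (x, y)"
    using *(1) by (rule eventually_mono) (erule eventually_mono, erule imp)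
  show "AE y in lborel. AE x in lborel. P (x, y)"
    using *(2) by (rule eventually_mono) (erule eventually_mono, erule imp)
qed

lemma integral_plane:
  fixes f :: "real \<times> real \<Rightarrow> real"
  assumes "integrable lborel f"
  shows "(\<integral>z. f z \<partial>lborel) = (\<integral>x. \<integral>y. f (x, y) \<partial>lborel \<partial>lborel)"
  using lborel_pair.integral_fst'[of f] assms by (simp add: lborel_prod)

section \<open>Functions given by integrals along vertical lines\<close>

text \<open>The second component of \<open>weak_gradient\<close>, over \<open>lborel\<close>. The
  first component is this condition for the function with exchanged coordinates, see
  \<open>weak_gradient_iff\<close>.\<close>

definition weak_dy :: "(real \<times> real \<Rightarrow> real) \<Rightarrow> (real \<times> real \<Rightarrow> real) \<Rightarrow> bool" where
  "weak_dy F G \<longleftrightarrow> (\<forall>\<phi> D. test_fun \<phi> D \<longrightarrow>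
     (\<integral>z. F z * D z (0,1) \<partial>lborel) = - (\<integral>z. G z * \<phi> z \<partial>lborel))"

definition loc_int :: "(real \<times> real \<Rightarrow> real) \<Rightarrow> bool" where
  "loc_int F \<longleftrightarrow> (\<forall>K. compact K \<longrightarrow> set_integrable lborel K F)"

definition slice_limit :: "(real \<times> real \<Rightarrow> real) \<Rightarrow> real \<Rightarrow> (real \<Rightarrow> real) \<Rightarrow> bool" where
  "slice_limit F c g \<longleftrightarrow> (\<forall>a b. \<forall>e>0. \<exists>\<eta>>0. AE t in lborel. \<bar>t\<bar> < \<eta> \<longrightarrow>
        (\<integral>\<^sup>+ x \<in> {a..b}. ennreal ((F (x, c + t) - g x)\<^sup>2) \<partial>lborel) < ennreal e)"

definition sq_int :: "(real \<times> real \<Rightarrow> real) \<Rightarrow> bool" where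
  "sq_int G \<longleftrightarrow> (\<integral>\<^sup>+z. ennreal ((G z)\<^sup>2) \<partial>lborel) < \<infinity>"

definition loc_sq_int :: "(real \<Rightarrow> real) \<Rightarrow> bool" where
  "loc_sq_int g \<longleftrightarrow> (\<forall>a b. (\<integral>\<^sup>+x\<in>{a..b}. ennreal ((g x)\<^sup>2) \<partial>lborel) < \<infinity>)"

definition line_rep :: "(real \<times> real \<Rightarrow> real) \<Rightarrow> real \<Rightarrow> (real \<Rightarrow> real) \<Rightarrow> (real \<times> real \<Rightarrow> real) \<Rightarrow> bool" where
  "line_rep F c g G \<longleftrightarrow> (AE z in lborel. F z = g (fst z) + oint (\<lambda>s. G (fst z, s)) c (snd z))"

lemma AE_affine:
  fixes P :: "real \<Rightarrow> bool"
  assumes "c \<noteq> 0" "AE x in lborel. P x"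
  shows "AE x in lborel. P (t + c * x)"
proof -
  obtain N where N: "N \<in> sets lborel" "emeasure lborel N = 0" "{z. \<not> P z} \<subseteq> N"
    using assms by (auto elim!: AE_E simp: null_sets_def)
  have [measurable]: "N \<in> sets borel" using N by simp
  have "AE z in lborel. z \<notin> N" using N by (intro AE_not_in) (auto simp: null_sets_def)
  then have "AE x in lborel. t + c * x \<notin> N"
    using assms by (intro AE_borel_affine) auto
  then show ?thesis using N(3) by (auto elim!: eventually_mono)
qed

lemma sets_borel_plane [measurable_cong]:
  "sets (borel :: (real \<times> real) measure) = sets (borel \<Otimes>\<^sub>M borel)"
  by (simp only: borel_prod)

lemma oint_section_measurable [measurable]:
  assumes [measurable]: "G \<in> borel_measurable (borel :: (real \<times> real) measure)"
  shows "(\<lambda>z. oint (\<lambda>s. G (fst z, s)) c (snd z)) \<in> borel_measurable borel"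
  by measurable

text \<open>Cauchy-Schwarz on each vertical segment. The bound holds over the whole line in
  \<open>x\<close> and tends to 0 as \<open>y\<close> approaches \<open>c\<close>; this is what
  makes the slices converge to the trace.\<close>

lemma oint_section_sq_le:
  assumes [measurable]: "G \<in> borel_measurable (borel :: (real \<times> real) measure)"
  shows "(\<integral>\<^sup>+x. ennreal ((oint (\<lambda>s. G (x, s)) c y)\<^sup>2) \<partial>lborel) \<le>
    ennreal \<bar>y - c\<bar> * (\<integral>\<^sup>+z. ennreal ((G z)\<^sup>2) \<partial>lborel)"
proof -
  have "(\<integral>\<^sup>+x. ennreal ((oint (\<lambda>s. G (x, s)) c y)\<^sup>2) \<partial>lborel) \<le>
    (\<integral>\<^sup>+x. ennreal \<bar>y - c\<bar> * (\<integral>\<^sup>+s. ennreal ((G (x, s))\<^sup>2) \<partial>lborel) \<partial>lborel)"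
  proof (rule nn_integral_mono)
    fix x
    have "ennreal ((oint (\<lambda>s. G (x, s)) c y)\<^sup>2) \<le>
      ennreal \<bar>y - c\<bar> * (\<integral>\<^sup>+s. ennreal (\<bar>okern c y s\<bar> * (G (x, s))\<^sup>2) \<partial>lborel)"
      by (rule oint_square_le) measurable
    also have "\<dots> \<le> ennreal \<bar>y - c\<bar> * (\<integral>\<^sup>+s. ennreal ((G (x, s))\<^sup>2) \<partial>lborel)"
      by (intro mult_left_mono nn_integral_mono ennreal_leI) (auto simp: abs_okern indicator_def)
    finally show "ennreal ((oint (\<lambda>s. G (x, s)) c y)\<^sup>2) \<le> ennreal \<bar>y - c\<bar> * (\<integral>\<^sup>+s. ennreal ((G (x, s))\<^sup>2) \<partial>lborel)" .
  qed
  also have "\<dots> = ennreal \<bar>y - c\<bar> * (\<integral>\<^sup>+z. ennreal ((G z)\<^sup>2) \<partial>lborel)"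
    by (subst nn_integral_cmult) (auto simp: nn_integral_plane(1))
  finally show ?thesis .
qed

lemma line_rep_slices:
  assumes "line_rep F c g G"
  shows "AE t in lborel. AE x in lborel. F (x, c + t) = g x + oint (\<lambda>s. G (x, s)) c (c + t)"
  using AE_affine[of 1 _ c, OF _ AE_planeD(2)[OF assms[unfolded line_rep_def]]] by simp

lemma line_rep_slice_limit:
  assumes [measurable]: "G \<in> borel_measurable (borel :: (real \<times> real) measure)"
    and fin: "sq_int G" and rep: "line_rep F c g G"
  shows "slice_limit F c g"
  unfolding slice_limit_def
proof (intro allI impI)
  fix a b e :: real assume e: "e > 0"
  define N where "N = enn2real (\<integral>\<^sup>+z. ennreal ((G z)\<^sup>2) \<partial>lborel)"
  have N: "(\<integral>\<^sup>+z. ennreal ((G z)\<^sup>2) \<partial>lborel) = ennreal N" "N \<ge> 0"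
    using fin by (auto simp: N_def sq_int_def)
  show "\<exists>\<eta>>0. AE t in lborel. \<bar>t\<bar> < \<eta> \<longrightarrow>
        (\<integral>\<^sup>+ x \<in> {a..b}. ennreal ((F (x, c + t) - g x)\<^sup>2) \<partial>lborel) < ennreal e"
  proof (intro exI conjI)
    \<comment> \<open>The summand 1 keeps the quotient positive also when the energy
      \<open>N\<close> is 0.\<close>
    show "e / (N + 1) > 0" using e N by simp
    show "AE t in lborel. \<bar>t\<bar> < e / (N + 1) \<longrightarrow>
        (\<integral>\<^sup>+ x \<in> {a..b}. ennreal ((F (x, c + t) - g x)\<^sup>2) \<partial>lborel) < ennreal e"
      using line_rep_slices[OF rep]
    proof (eventually_elim, intro impI)
      fix t assume t: "AE x in lborel. F (x, c + t) = g x + oint (\<lambda>s. G (x, s)) c (c + t)" "\<bar>t\<bar> < e / (N + 1)"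
      have "(\<integral>\<^sup>+ x \<in> {a..b}. ennreal ((F (x, c + t) - g x)\<^sup>2) \<partial>lborel) \<le>
        (\<integral>\<^sup>+ x. ennreal ((oint (\<lambda>s. G (x, s)) c (c + t))\<^sup>2) \<partial>lborel)"
        using t(1) by (intro nn_integral_mono_AE) (auto elim!: eventually_mono simp: indicator_def)
      also have "\<dots> \<le> ennreal \<bar>t\<bar> * ennreal N"
        using oint_section_sq_le[of G c "c + t"] N by simp
      also have "\<dots> < ennreal e"
      proof -
        have "\<bar>t\<bar> * N \<le> \<bar>t\<bar> * (N + 1)" by (simp add: mult_left_mono)
        also have "\<dots> < e" using t(2) N by (simp add: field_simps)
        finally show ?thesis using N e by (simp add: ennreal_mult[symmetric] ennreal_less_iff)
      qed
      finally show "(\<integral>\<^sup>+ x \<in> {a..b}. ennreal ((F (x, c + t) - g x)\<^sup>2) \<partial>lborel) < ennreal e" .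
    qed
  qed
qed

lemma abs_le_1_square: "\<bar>x\<bar> \<le> 1 + (x::real)\<^sup>2"
proof -
  have "0 \<le> (\<bar>x\<bar> - 1)\<^sup>2 + \<bar>x\<bar>" by simp
  then show ?thesis by (simp add: power2_diff)
qed

lemma power2_sum_le: "(a + b)\<^sup>2 \<le> 2 * a\<^sup>2 + 2 * (b::real)\<^sup>2"
  using sum_squares_bound[of a b] by (simp add: power2_sum)

text \<open>\<open>F\<close> is even square integrable on squares: the part \<open>g\<close> does
  not depend on \<open>y\<close>, and \<open>oint_section_sq_le\<close> bounds the other part on
  each horizontal slice. On a bounded set this implies integrability by
  \<open>abs_le_1_square\<close>.\<close>

lemma line_rep_loc_int:
  assumes [measurable]: "F \<in> borel_measurable borel" "G \<in> borel_measurable (borel :: (real \<times> real) measure)"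
    "g \<in> borel_measurable borel"
    and fin: "sq_int G" and g: "loc_sq_int g" and rep: "line_rep F c g G"
  shows "loc_int F"
  unfolding loc_int_def
proof (intro allI impI)
  fix K :: "(real \<times> real) set" assume K: "compact K"
  obtain R where R: "R > 0" "\<And>z. z \<in> K \<Longrightarrow> norm z \<le> R"
    using compact_imp_bounded[OF K] by (auto simp: bounded_pos)
  define N where "N = (\<integral>\<^sup>+z. ennreal ((G z)\<^sup>2) \<partial>lborel)"
  have N: "N < \<infinity>" using fin by (simp add: sq_int_def N_def)
  let ?Q = "\<lambda>z. indicator {-R..R} (fst z) * indicator {-R..R} (snd z) :: real"
  have Q: "indicator K z \<le> ?Q z" for z
  proof -
    have "\<bar>fst z\<bar> \<le> norm z" "\<bar>snd z\<bar> \<le> norm z"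
      by (metis norm_fst_le norm_snd_le prod.collapse real_norm_def)+
    then show ?thesis using R(2)[of z] by (auto simp: indicator_def)
  qed
  have sq: "(\<integral>\<^sup>+z. ennreal (?Q z * (F z)\<^sup>2) \<partial>lborel) < \<infinity>"
  proof -
    have "(\<integral>\<^sup>+z. ennreal (?Q z * (F z)\<^sup>2) \<partial>lborel) \<le>
      (\<integral>\<^sup>+z. ennreal (2 * (?Q z * (g (fst z))\<^sup>2)) + ennreal (2 * (?Q z * (oint (\<lambda>s. G (fst z, s)) c (snd z))\<^sup>2)) \<partial>lborel)"
      using rep[unfolded line_rep_def]
    proof (intro nn_integral_mono_AE, eventually_elim)
      fix z assume z: "F z = g (fst z) + oint (\<lambda>s. G (fst z, s)) c (snd z)"
      have "?Q z * (F z)\<^sup>2 \<le> ?Q z * (2 * (g (fst z))\<^sup>2 + 2 * (oint (\<lambda>s. G (fst z, s)) c (snd z))\<^sup>2)"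
        unfolding z by (intro mult_left_mono power2_sum_le) auto
      then show "ennreal (?Q z * (F z)\<^sup>2) \<le> ennreal (2 * (?Q z * (g (fst z))\<^sup>2)) + ennreal (2 * (?Q z * (oint (\<lambda>s. G (fst z, s)) c (snd z))\<^sup>2))"
        by (simp add: ennreal_plus[symmetric] ennreal_leI algebra_simps del: ennreal_plus)
    qed
    also have "\<dots> = (\<integral>\<^sup>+z. ennreal (2 * (?Q z * (g (fst z))\<^sup>2)) \<partial>lborel) +
      (\<integral>\<^sup>+z. ennreal (2 * (?Q z * (oint (\<lambda>s. G (fst z, s)) c (snd z))\<^sup>2)) \<partial>lborel)"
      by (subst nn_integral_add) (auto intro: oint_section_measurable)
    also have "(\<integral>\<^sup>+z. ennreal (2 * (?Q z * (g (fst z))\<^sup>2)) \<partial>lborel) =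
      (\<integral>\<^sup>+y. 2 * indicator {-R..R} y * (\<integral>\<^sup>+x\<in>{-R..R}. ennreal ((g x)\<^sup>2) \<partial>lborel) \<partial>lborel)"
      apply (subst nn_integral_plane(2))
       apply measurable
      apply (subst nn_integral_cmult[symmetric])
       apply measurable
      apply (auto intro!: nn_integral_cong simp: indicator_def ennreal_mult)
      done
    also have "\<dots> = 2 * ennreal (2 * R) * (\<integral>\<^sup>+x\<in>{-R..R}. ennreal ((g x)\<^sup>2) \<partial>lborel)"
      using R by (simp add: nn_integral_multc nn_integral_cmult)
    also have "(\<integral>\<^sup>+z. ennreal (2 * (?Q z * (oint (\<lambda>s. G (fst z, s)) c (snd z))\<^sup>2)) \<partial>lborel) \<le>
      (\<integral>\<^sup>+y. indicator {-R..R} y * (2 * (ennreal (R + \<bar>c\<bar>) * N)) \<partial>lborel)"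
    proof (subst nn_integral_plane(2))
      show "(\<lambda>z. ennreal (2 * (?Q z * (oint (\<lambda>s. G (fst z, s)) c (snd z))\<^sup>2))) \<in> borel_measurable borel"
        by measurable
      show "(\<integral>\<^sup>+ y. \<integral>\<^sup>+ x. ennreal (2 * (?Q (x, y) * (oint (\<lambda>s. G (fst (x, y), s)) c (snd (x, y)))\<^sup>2)) \<partial>lborel \<partial>lborel) \<le>
        (\<integral>\<^sup>+y. indicator {-R..R} y * (2 * (ennreal (R + \<bar>c\<bar>) * N)) \<partial>lborel)"
      proof (rule nn_integral_mono)
        fix y
        show "(\<integral>\<^sup>+ x. ennreal (2 * (?Q (x, y) * (oint (\<lambda>s. G (fst (x, y), s)) c (snd (x, y)))\<^sup>2)) \<partial>lborel) \<le> indicator {-R..R} y * (2 * (ennreal (R + \<bar>c\<bar>) * N))"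
        proof (cases "y \<in> {-R..R}")
          case True
          have "(\<integral>\<^sup>+ x. ennreal (2 * (?Q (x, y) * (oint (\<lambda>s. G (fst (x, y), s)) c (snd (x, y)))\<^sup>2)) \<partial>lborel)
            \<le> (\<integral>\<^sup>+ x. 2 * ennreal ((oint (\<lambda>s. G (x, s)) c y)\<^sup>2) \<partial>lborel)"
            by (intro nn_integral_mono) (auto simp: indicator_def ennreal_mult)
          also have "\<dots> = 2 * (\<integral>\<^sup>+ x. ennreal ((oint (\<lambda>s. G (x, s)) c y)\<^sup>2) \<partial>lborel)"
            by (intro nn_integral_cmult) measurable
          also have "\<dots> \<le> 2 * (ennreal \<bar>y - c\<bar> * N)"
            unfolding N_def by (intro mult_left_mono oint_section_sq_le) auto
          also have "\<dots> \<le> 2 * (ennreal (R + \<bar>c\<bar>) * N)"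
            using True by (intro mult_left_mono mult_right_mono ennreal_leI) auto
          finally show ?thesis using True by simp
        next
          case False
          then have "indicator {-R..R} y = (0::real)" by simp
          then show ?thesis by simp
        qed
      qed
    qed
    also have "\<dots> = ennreal (2 * R) * (2 * (ennreal (R + \<bar>c\<bar>) * N))"
      using R by (simp add: nn_integral_multc)
    also have "2 * ennreal (2 * R) * (\<integral>\<^sup>+x\<in>{-R..R}. ennreal ((g x)\<^sup>2) \<partial>lborel) + \<dots> < \<infinity>"
      using N g by (auto simp: loc_sq_int_def ennreal_mult_less_top)
    finally show ?thesis by (simp add: add_left_mono)
  qed
  have "(\<integral>\<^sup>+z. ennreal (norm (indicator K z *\<^sub>R F z)) \<partial>lborel) \<le> (\<integral>\<^sup>+z. ennreal (?Q z) + ennreal (?Q z * (F z)\<^sup>2) \<partial>lborel)"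
  proof (rule nn_integral_mono)
    fix z
    have "\<bar>F z\<bar> \<le> 1 + (F z)\<^sup>2" by (rule abs_le_1_square)
    then have "?Q z * \<bar>F z\<bar> \<le> ?Q z * (1 + (F z)\<^sup>2)" by (intro mult_left_mono) auto
    moreover have "indicator K z * \<bar>F z\<bar> \<le> ?Q z * \<bar>F z\<bar>" using Q[of z] by (intro mult_right_mono) auto
    ultimately show "ennreal (norm (indicator K z *\<^sub>R F z)) \<le> ennreal (?Q z) + ennreal (?Q z * (F z)\<^sup>2)"
      by (simp add: ennreal_plus[symmetric] ennreal_leI algebra_simps abs_mult del: ennreal_plus)
  qed
  also have "\<dots> = (\<integral>\<^sup>+z. ennreal (?Q z) \<partial>lborel) + (\<integral>\<^sup>+z. ennreal (?Q z * (F z)\<^sup>2) \<partial>lborel)"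
    by (intro nn_integral_add) measurable
  also have "(\<integral>\<^sup>+z. ennreal (?Q z) \<partial>lborel) = ennreal (2 * R) * ennreal (2 * R)"
    using R by (subst nn_integral_plane(1))
      (auto simp: ennreal_mult ennreal_indicator nn_integral_cmult nn_integral_multc)
  finally have "(\<integral>\<^sup>+z. ennreal (norm (indicator K z *\<^sub>R F z)) \<partial>lborel) < \<infinity>"
    using sq by (auto simp: ennreal_mult_less_top order_le_less_trans)
  moreover have [measurable]: "K \<in> sets borel" using K by (simp add: borel_compact)
  ultimately show "set_integrable lborel K F"
    unfolding set_integrable_def integrable_iff_bounded by auto
qed

section \<open>Test functions and integration by parts on vertical lines\<close>

lemma test_fun_support:
  assumes "test_fun \<phi> D"
  obtains R where "R > 0" "\<And>z. norm z \<ge> R \<Longrightarrow> \<phi> z = 0" "\<And>z v. norm z \<ge> R \<Longrightarrow> D z v = 0"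
proof -
  obtain B where B: "B > 0" "\<And>z. \<phi> z \<noteq> 0 \<Longrightarrow> norm z \<le> B"
    using assms unfolding test_fun_def by (auto simp: bounded_pos)
  show thesis
  proof
    \<comment> \<open>\<open>D z\<close> is known to vanish where \<phi> vanishes in a neighbourhood
      of \<open>z\<close>; the margin 1 makes the unit ball around \<open>z\<close> such a
      neighbourhood.\<close>
    show "B + 1 > 0" using B by simp
    show "\<phi> z = 0" if "norm z \<ge> B + 1" for z using B(2)[of z] that by fastforce
    show "D z v = 0" if "norm z \<ge> B + 1" for z v
    proof -
      have "\<phi> w = 0" if "w \<in> ball z 1" for w
      proof -
        have "norm z \<le> norm w + dist z w" by (metis dist_norm norm_triangle_sub add.commute)
        then show ?thesis using that \<open>norm z \<ge> B + 1\<close> B(2)[of w] by fastforce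
      qed
      then have "(\<phi> has_derivative (\<lambda>v. 0)) (at z)"
          by (intro has_derivative_transform_within_open[OF has_derivative_const[of 0], of "ball z 1" z]) auto
      moreover have "(\<phi> has_derivative D z) (at z)" using assms unfolding test_fun_def by blast
      ultimately have "D z = (\<lambda>v. 0)" by (metis has_derivative_unique)
      then show ?thesis by simp
    qed
  qed
qed

lemma continuous_support_bounded:
  fixes f :: "real \<times> real \<Rightarrow> real"
  assumes "continuous_on UNIV f" "\<And>z. norm z \<ge> R \<Longrightarrow> f z = 0"
  obtains C where "C \<ge> 0" "\<And>z. \<bar>f z\<bar> \<le> C * indicator (cball 0 R) z"
proof -
  have "bounded (f ` cball 0 R)"
    by (intro compact_imp_bounded compact_continuous_image continuous_on_subset[OF assms(1)]) auto
  then obtain C where C: "C > 0" "\<And>z. z \<in> cball 0 R \<Longrightarrow> \<bar>f z\<bar> \<le> C" by (auto simp: bounded_pos)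
  show thesis
  proof
    show "C \<ge> 0" using C by simp
    show "\<bar>f z\<bar> \<le> C * indicator (cball 0 R) z" for z
      using C(2)[of z] assms(2)[of z] by (auto simp: indicator_def)
  qed
qed

lemma loc_int_mult_bounded:
  assumes F: "loc_int F" and [measurable]: "F \<in> borel_measurable borel" "h \<in> borel_measurable borel"
    and h: "\<And>z. \<bar>h z\<bar> \<le> C * indicator (cball 0 R) z"
  shows "integrable lborel (\<lambda>z. F z * h z)"
proof (rule Bochner_Integration.integrable_bound)
  show "integrable lborel (\<lambda>z. C * (indicator (cball 0 R) z *\<^sub>R F z))"
    using F compact_cball by (intro integrable_mult_right) (auto simp: loc_int_def set_integrable_def)
  show "AE z in lborel. norm (F z * h z) \<le> norm (C * (indicator (cball 0 R) z *\<^sub>R F z))"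
  proof (intro AE_I2)
    fix z
    have "\<bar>h z\<bar> * \<bar>F z\<bar> \<le> \<bar>C * indicator (cball 0 R) z\<bar> * \<bar>F z\<bar>"
      by (rule mult_right_mono[OF order_trans[OF h abs_ge_self]]) simp
    then show "norm (F z * h z) \<le> norm (C * (indicator (cball 0 R) z *\<^sub>R F z))"
      by (simp add: abs_mult mult_ac)
  qed
qed auto

lemma sq_int_loc_int:
  assumes [measurable]: "G \<in> borel_measurable (borel :: (real \<times> real) measure)" and "sq_int G"
  shows "loc_int G"
  unfolding loc_int_def
proof (intro allI impI)
  fix K :: "(real \<times> real) set" assume K: "compact K"
  have [measurable]: "K \<in> sets borel" using K by (simp add: borel_compact)
  have "(\<integral>\<^sup>+z. ennreal (norm (indicator K z *\<^sub>R G z)) \<partial>lborel) \<le> (\<integral>\<^sup>+z. indicator K z + ennreal ((G z)\<^sup>2) \<partial>lborel)"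
  proof (rule nn_integral_mono)
    fix z
    have "\<bar>G z\<bar> \<le> 1 + (G z)\<^sup>2" by (rule abs_le_1_square)
    then show "ennreal (norm (indicator K z *\<^sub>R G z)) \<le> indicator K z + ennreal ((G z)\<^sup>2)"
      by (auto simp: indicator_def ennreal_leI simp flip: ennreal_plus ennreal_1)
  qed
  also have "\<dots> = emeasure lborel K + (\<integral>\<^sup>+z. ennreal ((G z)\<^sup>2) \<partial>lborel)"
    by (subst nn_integral_add) auto
  also have "\<dots> < \<infinity>"
    using assms emeasure_compact_finite[OF K] by (auto simp: sq_int_def less_top)
  finally show "set_integrable lborel K G"
    unfolding set_integrable_def integrable_iff_bounded by auto
qed

lemma sq_int_AE_section:
  assumes [measurable]: "G \<in> borel_measurable (borel :: (real \<times> real) measure)" and "sq_int G"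
  shows "AE x in lborel. (\<integral>\<^sup>+y. ennreal ((G (x, y))\<^sup>2) \<partial>lborel) < \<infinity>"
    "AE y in lborel. (\<integral>\<^sup>+x. ennreal ((G (x, y))\<^sup>2) \<partial>lborel) < \<infinity>"
proof -
  have "(\<integral>\<^sup>+x. \<integral>\<^sup>+y. ennreal ((G (x, y))\<^sup>2) \<partial>lborel \<partial>lborel) \<noteq> \<infinity>"
    using assms(2) by (simp add: sq_int_def nn_integral_plane(1))
  then have "AE x in lborel. (\<integral>\<^sup>+y. ennreal ((G (x, y))\<^sup>2) \<partial>lborel) \<noteq> \<infinity>"
    by (intro nn_integral_PInf_AE) auto
  then show "AE x in lborel. (\<integral>\<^sup>+y. ennreal ((G (x, y))\<^sup>2) \<partial>lborel) < \<infinity>" by (simp add: less_top)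
  have "(\<integral>\<^sup>+y. \<integral>\<^sup>+x. ennreal ((G (x, y))\<^sup>2) \<partial>lborel \<partial>lborel) \<noteq> \<infinity>"
    using assms(2) by (simp add: sq_int_def nn_integral_plane(2))
  then have "AE y in lborel. (\<integral>\<^sup>+x. ennreal ((G (x, y))\<^sup>2) \<partial>lborel) \<noteq> \<infinity>"
    by (intro nn_integral_PInf_AE) auto
  then show "AE y in lborel. (\<integral>\<^sup>+x. ennreal ((G (x, y))\<^sup>2) \<partial>lborel) < \<infinity>" by (simp add: less_top)
qed

lemma sq_fin_set_integrable:
  fixes g :: "real \<Rightarrow> real"
  assumes [measurable]: "g \<in> borel_measurable borel" and "(\<integral>\<^sup>+y\<in>{a..b}. ennreal ((g y)\<^sup>2) \<partial>lborel) < \<infinity>"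
  shows "set_integrable lborel {a..b} g"
proof -
  have "(\<integral>\<^sup>+z. ennreal (norm (indicator {a..b} z *\<^sub>R g z)) \<partial>lborel) \<le> (\<integral>\<^sup>+z. indicator {a..b} z + ennreal ((g z)\<^sup>2) * indicator {a..b} z \<partial>lborel)"
  proof (rule nn_integral_mono)
    fix z
    have "\<bar>g z\<bar> \<le> 1 + (g z)\<^sup>2" by (rule abs_le_1_square)
    then have "ennreal \<bar>g z\<bar> \<le> 1 + ennreal ((g z)\<^sup>2)"
      by (simp add: ennreal_leI flip: ennreal_plus ennreal_1)
    then show "ennreal (norm (indicator {a..b} z *\<^sub>R g z)) \<le> indicator {a..b} z + ennreal ((g z)\<^sup>2) * indicator {a..b} z"
      by (auto simp: indicator_def)
  qed
  also have "\<dots> = emeasure lborel {a..b} + (\<integral>\<^sup>+y\<in>{a..b}. ennreal ((g y)\<^sup>2) \<partial>lborel)"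
    by (subst nn_integral_add) auto
  also have "\<dots> < \<infinity>" using assms(2) by (cases "a \<le> b") (auto simp: less_top)
  finally show ?thesis unfolding set_integrable_def integrable_iff_bounded by auto
qed

lemma sq_fin_set_integrable':
  fixes g :: "real \<Rightarrow> real"
  assumes [measurable]: "g \<in> borel_measurable borel" and "(\<integral>\<^sup>+y. ennreal ((g y)\<^sup>2) \<partial>lborel) < \<infinity>"
  shows "set_integrable lborel {a..b} g"
proof (rule sq_fin_set_integrable)
  have "(\<integral>\<^sup>+y\<in>{a..b}. ennreal ((g y)\<^sup>2) \<partial>lborel) \<le> (\<integral>\<^sup>+y. ennreal ((g y)\<^sup>2) \<partial>lborel)"
    by (intro nn_integral_mono) (auto simp: indicator_def)
  then show "(\<integral>\<^sup>+y\<in>{a..b}. ennreal ((g y)\<^sup>2) \<partial>lborel) < \<infinity>" using assms(2) by auto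
qed auto

lemma integrable_pair_mult:
  fixes f :: "'a \<Rightarrow> real" and g :: "'b \<Rightarrow> real"
  assumes "sigma_finite_measure M" "sigma_finite_measure N" and f: "integrable M f" and g: "integrable N g"
  shows "integrable (M \<Otimes>\<^sub>M N) (\<lambda>(x, y). f x * g y)"
proof -
  interpret M: sigma_finite_measure M by fact
  interpret N: sigma_finite_measure N by fact
  interpret pair_sigma_finite M N ..
  have [measurable]: "f \<in> borel_measurable M" "g \<in> borel_measurable N" using f g by auto
  show ?thesis
    using f g by (intro Fubini_integrable) (auto simp: abs_mult)
qed

text \<open>For fixed \<open>s\<close> the kernel is, as a function of \<open>y\<close> and up to
  one point, the indicator of the half line above \<open>s\<close> if \<open>c \<le> s\<close>, and
  minus the indicator of the half line below \<open>s\<close> otherwise. As \<open>h\<close>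
  vanishes far out, both cases give \<open>- h s\<close>.\<close>

lemma integral_okern_deriv:
  fixes h h' :: "real \<Rightarrow> real"
  assumes deriv: "\<And>y. (h has_real_derivative h' y) (at y)" and cont: "continuous_on UNIV h'"
    and supp: "\<And>y. \<bar>y\<bar> \<ge> R \<Longrightarrow> h y = 0 \<and> h' y = 0"
  shows "(\<integral>y. okern c y s * h' y \<partial>lborel) = - h s"
proof -
  have [measurable]: "h' \<in> borel_measurable borel" using cont by (rule borel_measurable_continuous_onI)
  have FTC: "(\<integral>x. indicator {a..b} x *\<^sub>R h' x \<partial>lborel) = h b - h a" if "a \<le> b" for a b
    using that deriv cont
    by (intro integral_FTC_Icc) (auto simp: has_real_derivative_iff_has_vector_derivative[symmetric]
      intro: continuous_on_subset has_field_derivative_at_within)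
  show ?thesis
  proof (cases "c \<le> s")
    case True
    have "(\<integral>y. okern c y s * h' y \<partial>lborel) = (\<integral>x. indicator {s..max s \<bar>R\<bar>} x *\<^sub>R h' x \<partial>lborel)"
    proof (rule integral_cong_AE)
      show "AE x in lborel. okern c x s * h' x = indicator {s..max s \<bar>R\<bar>} x *\<^sub>R h' x"
        using AE_lborel_singleton[of s]
      proof eventually_elim
        case (elim x)
        then show ?case using True supp[of x] by (auto simp: okern_def indicator_def)
      qed
    qed measurable
    also have "\<dots> = h (max s \<bar>R\<bar>) - h s" by (rule FTC) simp
    also have "h (max s \<bar>R\<bar>) = 0" using supp[of "max s \<bar>R\<bar>"] by auto
    finally show ?thesis by simp
  next
    case False
    have "(\<integral>y. okern c y s * h' y \<partial>lborel) = (\<integral>x. - (indicator {min s (- \<bar>R\<bar>)..s} x *\<^sub>R h' x) \<partial>lborel)"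
      using False supp by (intro Bochner_Integration.integral_cong) (auto simp: okern_def indicator_def)
    also have "\<dots> = - (h s - h (min s (- \<bar>R\<bar>)))" by (subst Bochner_Integration.integral_minus, subst FTC) auto
    also have "h (min s (- \<bar>R\<bar>)) = 0" using supp[of "min s (- \<bar>R\<bar>)"] by auto
    finally show ?thesis by simp
  qed
qed

text \<open>The primitive of a merely integrable \<open>g\<close> is handled without differentiating
  it: Fubini moves the integral over \<open>y\<close> inside, where
  \<open>integral_okern_deriv\<close> evaluates it. The constant \<open>A\<close> disappears because
  \<open>h'\<close> has integral 0.\<close>

lemma oint_integration_by_parts:
  fixes g h h' :: "real \<Rightarrow> real"
  assumes [measurable]: "g \<in> borel_measurable borel" and gi: "\<And>a b. set_integrable lborel {a..b} g"
    and deriv: "\<And>y. (h has_real_derivative h' y) (at y)" and cont: "continuous_on UNIV h'"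
    and supp: "\<And>y. \<bar>y\<bar> \<ge> R \<Longrightarrow> h y = 0 \<and> h' y = 0"
  shows "(\<integral>y. (A + oint g c y) * h' y \<partial>lborel) = - (\<integral>y. g y * h y \<partial>lborel)"
proof -
  have [measurable]: "h' \<in> borel_measurable borel" using cont by (rule borel_measurable_continuous_onI)
  \<comment> \<open>Where \<open>h' y\<close> is nonzero,
    \<open>\<bar>y\<bar> \<le> \<bar>R\<bar>\<close>, so the kernel sees only \<open>s\<close>
    between \<open>- R'\<close> and \<open>R'\<close>. This provides the dominating product for
    Fubini.\<close>
  define R' where "R' = max \<bar>R\<bar> \<bar>c\<bar>"
  have h'_eq: "h' y = indicator {-\<bar>R\<bar>..\<bar>R\<bar>} y *\<^sub>R h' y" for y
  proof (cases "\<bar>y\<bar> \<le> \<bar>R\<bar>")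
    case False
    then have "\<bar>y\<bar> \<ge> R" by linarith
    then show ?thesis using supp[of y] by simp
  qed (auto simp: indicator_def)
  have "set_integrable lborel {-\<bar>R\<bar>..\<bar>R\<bar>} h'"
    using cont by (intro borel_integrable_atLeastAtMost') (auto intro: continuous_on_subset)
  then have h'i: "integrable lborel h'"
    unfolding set_integrable_def by (simp only: h'_eq[symmetric])
  have gR: "integrable lborel (\<lambda>s. indicator {-R'..R'} s *\<^sub>R g s)"
    using gi[of "-R'" R'] by (simp add: set_integrable_def)
  have int: "integrable (lborel \<Otimes>\<^sub>M lborel) (\<lambda>(y, s). h' y * (okern c y s * g s))"
  proof (rule Bochner_Integration.integrable_bound)
    show "integrable (lborel \<Otimes>\<^sub>M lborel) (\<lambda>(y, s). h' y * (indicator {-R'..R'} s *\<^sub>R g s))"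
      using h'i gR by (intro integrable_pair_mult sigma_finite_lborel)
    show "AE x in lborel \<Otimes>\<^sub>M lborel. norm (case x of (y, s) \<Rightarrow> h' y * (okern c y s * g s))
      \<le> norm (case x of (y, s) \<Rightarrow> h' y * (indicator {-R'..R'} s *\<^sub>R g s))"
    proof (intro AE_I2, clarsimp simp: abs_mult)
      fix y s
      show "\<bar>h' y\<bar> * (\<bar>okern c y s\<bar> * \<bar>g s\<bar>) \<le> \<bar>h' y\<bar> * (indicator {-R'..R'} s * \<bar>g s\<bar>)"
      proof (cases "\<bar>y\<bar> \<ge> R")
        case False
        then have "\<bar>okern c y s\<bar> \<le> indicator {-R'..R'} s"
          by (auto simp: okern_def indicator_def R'_def)
        then show ?thesis by (intro mult_left_mono mult_right_mono) auto
      qed (use supp in auto)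
    qed
  qed measurable
  have h'0: "(\<integral>y. h' y \<partial>lborel) = 0"
  proof -
    have "(\<integral>y. h' y \<partial>lborel) = (\<integral>x. indicator {-\<bar>R\<bar>..\<bar>R\<bar>} x *\<^sub>R h' x \<partial>lborel)"
      by (subst h'_eq) (rule refl)
    also have "\<dots> = h \<bar>R\<bar> - h (- \<bar>R\<bar>)"
      using deriv cont
      by (intro integral_FTC_Icc) (auto simp: has_real_derivative_iff_has_vector_derivative[symmetric]
        intro: continuous_on_subset has_field_derivative_at_within)
    finally show ?thesis using supp[of "\<bar>R\<bar>"] supp[of "- \<bar>R\<bar>"] by simp
  qed
  have "integrable lborel (\<lambda>y. h' y * oint g c y)"
    using lborel_pair.integrable_fst'[OF int] by (simp add: oint_def)
  then have "(\<integral>y. (A + oint g c y) * h' y \<partial>lborel) = A * (\<integral>y. h' y \<partial>lborel) + (\<integral>y. h' y * oint g c y \<partial>lborel)"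
    using h'i by (simp add: algebra_simps)
  also have "\<dots> = (\<integral>y. \<integral>s. h' y * (okern c y s * g s) \<partial>lborel \<partial>lborel)"
    by (simp add: h'0 oint_def)
  also have "\<dots> = (\<integral>s. \<integral>y. h' y * (okern c y s * g s) \<partial>lborel \<partial>lborel)"
    using lborel_pair.Fubini_integral[OF int] by simp
  also have "\<dots> = (\<integral>s. g s * (\<integral>y. okern c y s * h' y \<partial>lborel) \<partial>lborel)"
    by (intro Bochner_Integration.integral_cong refl, subst integral_mult_right_zero[symmetric]) (simp add: ac_simps)
  also have "\<dots> = - (\<integral>y. g y * h y \<partial>lborel)"
    using integral_okern_deriv[OF deriv cont supp] by simp
  finally show ?thesis .
qed

lemma test_fun_vertical_derivative:
  assumes "test_fun \<phi> D"
  shows "((\<lambda>y. \<phi> (x, y)) has_real_derivative D (x, y) (0, 1)) (at y)"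
proof -
  have d: "(\<phi> has_derivative D (x, y)) (at (x, y))" using assms unfolding test_fun_def by blast
  have "((\<lambda>y. \<phi> (x, y)) has_derivative (\<lambda>h. D (x, y) (0, h))) (at y)"
    by (rule has_derivative_compose[where f="\<lambda>y. (x, y)" and g=\<phi>, OF _ d])
       (auto intro!: derivative_eq_intros)
  moreover have "(\<lambda>h. D (x, y) (0, h)) = (*) (D (x, y) (0, 1))"
  proof
    fix h
    interpret bounded_linear "D (x, y)" using d by (rule has_derivative_bounded_linear)
    have "(0, h) = h *\<^sub>R (0::real, 1::real)" by simp
    then show "D (x, y) (0, h) = D (x, y) (0, 1) * h" by (simp only: scaleR) simp
  qed
  ultimately show ?thesis by (simp add: has_field_derivative_def)
qed

text \<open>Integration by parts on each vertical line and Fubini. Almost every section of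
  \<open>G\<close> is square integrable, hence integrable on bounded intervals, which is what the
  one-dimensional lemma requires.\<close>

lemma line_rep_weak_dy:
  assumes [measurable]: "F \<in> borel_measurable borel" "G \<in> borel_measurable (borel :: (real \<times> real) measure)"
    "g \<in> borel_measurable borel"
    and fin: "sq_int G" and g: "loc_sq_int g" and rep: "line_rep F c g G"
  shows "weak_dy F G"
  unfolding weak_dy_def
proof (intro allI impI)
  fix \<phi> D assume T: "test_fun \<phi> D"
  obtain R where R: "R > 0" "\<And>z. norm z \<ge> R \<Longrightarrow> \<phi> z = 0" "\<And>z v. norm z \<ge> R \<Longrightarrow> D z v = 0"
    using test_fun_support[OF T] by blast
  have c1: "continuous_on UNIV (\<lambda>z. D z (0,1))" using T by (simp add: test_fun_def)
  have c2: "continuous_on UNIV \<phi>"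
    using T unfolding test_fun_def by (intro has_derivative_continuous_on[of UNIV \<phi> D]) (auto intro: has_derivative_at_withinI simp del: split_paired_All)
  have [measurable]: "(\<lambda>z. D z (0,1)) \<in> borel_measurable borel" "\<phi> \<in> borel_measurable borel"
    using c1 c2 by (auto intro: borel_measurable_continuous_onI)
  obtain C1 where C1: "\<And>z. \<bar>D z (0,1)\<bar> \<le> C1 * indicator (cball 0 R) z"
    using continuous_support_bounded[OF c1 R(3)] by blast
  obtain C2 where C2: "\<And>z. \<bar>\<phi> z\<bar> \<le> C2 * indicator (cball 0 R) z"
    using continuous_support_bounded[OF c2 R(2)] by blast
  have i1: "integrable lborel (\<lambda>z. F z * D z (0,1))"
    using line_rep_loc_int[OF assms] C1 by (intro loc_int_mult_bounded) auto
  have i2: "integrable lborel (\<lambda>z. G z * \<phi> z)"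
    using sq_int_loc_int[of G] fin C2 by (intro loc_int_mult_bounded) auto
  have "(\<integral>z. F z * D z (0,1) \<partial>lborel) = (\<integral>x. \<integral>y. F (x, y) * D (x, y) (0,1) \<partial>lborel \<partial>lborel)"
    by (rule integral_plane[OF i1])
  also have "\<dots> = (\<integral>x. - (\<integral>y. G (x, y) * \<phi> (x, y) \<partial>lborel) \<partial>lborel)"
  proof (rule integral_cong_AE)
    show "AE x in lborel. (\<integral>y. F (x, y) * D (x, y) (0,1) \<partial>lborel) = - (\<integral>y. G (x, y) * \<phi> (x, y) \<partial>lborel)"
      using AE_planeD(1)[OF rep[unfolded line_rep_def]] sq_int_AE_section(1)[OF assms(2) fin]
    proof eventually_elim
      case (elim x)
      have "(\<integral>y. F (x, y) * D (x, y) (0,1) \<partial>lborel) = (\<integral>y. (g x + oint (\<lambda>s. G (x, s)) c y) * D (x, y) (0,1) \<partial>lborel)"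
        using elim(1) by (intro integral_cong_AE) (auto elim!: eventually_mono)
      also have "\<dots> = - (\<integral>y. G (x, y) * \<phi> (x, y) \<partial>lborel)"
      proof (rule oint_integration_by_parts)
        show "set_integrable lborel {a..b} (\<lambda>s. G (x, s))" for a b
          using elim(2) by (intro sq_fin_set_integrable') auto
        show "((\<lambda>y. \<phi> (x, y)) has_real_derivative D (x, y) (0, 1)) (at y)" for y
          by (rule test_fun_vertical_derivative[OF T])
        show "continuous_on UNIV (\<lambda>y. D (x, y) (0, 1))"
          by (rule continuous_on_compose2[OF c1]) (auto intro!: continuous_intros)
        show "\<phi> (x, y) = 0 \<and> D (x, y) (0, 1) = 0" if "\<bar>y\<bar> \<ge> R" for y
        proof -
          have "norm (x, y) \<ge> R" using that norm_snd_le[of y x] by simp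
          then show ?thesis using R by blast
        qed
      qed measurable
      finally show ?case .
    qed
  qed measurable
  also have "\<dots> = - (\<integral>z. G z * \<phi> z \<partial>lborel)"
    by (simp add: integral_plane[OF i2])
  finally show "(\<integral>z. F z * D z (0,1) \<partial>lborel) = - (\<integral>z. G z * \<phi> z \<partial>lborel)" .
qed

section \<open>The weak derivative determines the function along lines\<close>

lemma DERIV_max0_square: "((\<lambda>t. (max 0 t)\<^sup>2) has_real_derivative 2 * max 0 t) (at (t::real))"
  unfolding DERIV_def
proof (rule LIM_zero_cancel, rule Lim_null_comparison)
  show "\<forall>\<^sub>F h in at 0. norm (((max 0 (t + h))\<^sup>2 - (max 0 t)\<^sup>2) / h - 2 * max 0 t) \<le> \<bar>h\<bar>"
  proof (rule eventually_at_filter[THEN iffD2], intro always_eventually allI impI)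
    fix h :: real assume h: "h \<noteq> 0"
    have "\<bar>(max 0 (t + h))\<^sup>2 - (max 0 t)\<^sup>2 - 2 * max 0 t * h\<bar> \<le> h\<^sup>2"
    proof -
      consider "t \<ge> 0" "t + h \<ge> 0" | "t \<ge> 0" "t + h < 0" | "t < 0" "t + h \<ge> 0" | "t < 0" "t + h < 0" by linarith
      then show ?thesis
      proof cases
        case 1 then show ?thesis by (simp add: power2_sum)
      next
        case 2
        then have "0 \<le> t * (- t - 2 * h)" by (intro mult_nonneg_nonneg) auto
        moreover have "0 \<le> (t + h)\<^sup>2" by simp
        ultimately show ?thesis using 2 by (simp add: power2_sum power2_eq_square algebra_simps abs_le_iff)
      next
        case 3
        then have "(t + h)\<^sup>2 \<le> h\<^sup>2" by (intro power_mono) auto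
        then show ?thesis using 3 by simp
      next
        case 4 then show ?thesis by simp
      qed
    qed
    moreover have "((max 0 (t + h))\<^sup>2 - (max 0 t)\<^sup>2) / h - 2 * max 0 t = ((max 0 (t + h))\<^sup>2 - (max 0 t)\<^sup>2 - 2 * max 0 t * h) / h"
      using h by (simp add: field_simps)
    ultimately show "norm (((max 0 (t + h))\<^sup>2 - (max 0 t)\<^sup>2) / h - 2 * max 0 t) \<le> \<bar>h\<bar>"
      using h by (simp add: abs_divide divide_le_eq power2_eq_square flip: abs_mult)
  qed
  show "((\<lambda>h::real. \<bar>h\<bar>) \<longlongrightarrow> 0) (at 0)" by (intro tendsto_eq_intros) auto
qed

text \<open>\<open>test_fun\<close> asks only for continuous first derivatives, so a rational
  expression in the squared positive part of \<open>(x - a) * (b - x)\<close> suffices. As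
  \<open>n\<close> grows, these functions increase to the indicator of the open interval.\<close>

definition bump :: "real \<Rightarrow> real \<Rightarrow> nat \<Rightarrow> real \<Rightarrow> real" where
  "bump a b n x = 1 - 1 / (1 + real n * (max 0 ((x - a) * (b - x)))\<^sup>2)"

definition bump_deriv :: "real \<Rightarrow> real \<Rightarrow> nat \<Rightarrow> real \<Rightarrow> real" where
  "bump_deriv a b n x = real n * (2 * max 0 ((x - a) * (b - x)) * (a + b - 2 * x)) /
     (1 + real n * (max 0 ((x - a) * (b - x)))\<^sup>2)\<^sup>2"

lemma one_plus_pos: "1 + real n * (x::real)\<^sup>2 > 0" by (simp add: add_pos_nonneg)

lemma bump_has_derivative: "(bump a b n has_real_derivative bump_deriv a b n x) (at x)"
proof -
  have "((\<lambda>x. (max 0 ((x - a) * (b - x)))\<^sup>2) has_real_derivative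
      2 * max 0 ((x - a) * (b - x)) * (a + b - 2 * x)) (at x)"
    by (rule DERIV_chain2[OF DERIV_max0_square]) (auto intro!: derivative_eq_intros simp: algebra_simps)
  moreover have "((\<lambda>x. 1 - 1 / (1 + real n * Q x)) has_real_derivative real n * d / (1 + real n * Q x)\<^sup>2) (at x)"
    if "(Q has_real_derivative d) (at x)" "1 + real n * Q x > 0" for Q d
    using that(2) by (auto intro!: derivative_eq_intros that(1) simp: power2_eq_square)
  ultimately show ?thesis
    unfolding bump_def bump_deriv_def using one_plus_pos[of n "max 0 ((x - a) * (b - x))"] by blast
qed

lemma bump_continuous: "continuous_on A (bump a b n)" "continuous_on A (bump_deriv a b n)"
  unfolding bump_def bump_deriv_def using one_plus_pos
  by (auto intro!: continuous_intros simp: less_imp_neq[symmetric])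

lemma bump_measurable [measurable]: "bump a b n \<in> borel_measurable borel"
  using bump_continuous(1) by (rule borel_measurable_continuous_onI)

lemma bump_range:
  assumes "a < b"
  shows "0 \<le> bump a b n x" "bump a b n x \<le> indicator {a<..<b} x"
proof -
  have *: "1 / (1 + real n * t\<^sup>2) \<le> 1" for t :: real
    using one_plus_pos[of n t] by (subst divide_le_eq_1_pos) auto
  show "0 \<le> bump a b n x" unfolding bump_def using * by simp
  show "bump a b n x \<le> indicator {a<..<b} x"
  proof (cases "x \<in> {a<..<b}")
    case True then show ?thesis unfolding bump_def by simp
  next
    case False
    then have "(x - a) * (b - x) \<le> 0" using assms
      by (auto simp: mult_le_0_iff)
    then show ?thesis unfolding bump_def using False by (simp add: max_absorb1)
  qed
qed

lemma bump_support: "a < b \<Longrightarrow> x \<notin> {a<..<b} \<Longrightarrow> bump a b n x = 0"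
  using bump_range[of a b n x] by auto

lemma bump_limit:
  assumes "a < b"
  shows "(\<lambda>n. bump a b n x) \<longlonglongrightarrow> indicator {a<..<b} x"
proof (cases "x \<in> {a<..<b}")
  case True
  then have "(x - a) * (b - x) > 0" by simp
  then have "(max 0 ((x - a) * (b - x)))\<^sup>2 > 0" by (intro zero_less_power) linarith
  moreover have "(\<lambda>n. 1 - 1 / (1 + real n * c)) \<longlonglongrightarrow> 1" if "c > 0" for c
  proof -
    have "filterlim (\<lambda>n. 1 + real n * c) at_top sequentially"
      by (intro filterlim_tendsto_add_at_top[OF tendsto_const]
        filterlim_at_top_mult_tendsto_pos[OF tendsto_const that filterlim_real_sequentially])
    then have "(\<lambda>n. 1 - 1 / (1 + real n * c)) \<longlonglongrightarrow> 1 - 0"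
      by (intro tendsto_diff tendsto_const tendsto_divide_0[OF tendsto_const filterlim_at_top_imp_at_infinity])
    then show ?thesis by simp
  qed
  ultimately show ?thesis using True by (simp add: bump_def)
qed (simp add: bump_support[OF assms])

lemma test_fun_product:
  assumes a: "\<And>x. (\<alpha> has_real_derivative \<alpha>' x) (at x)" "continuous_on UNIV \<alpha>'" "\<And>x. x \<notin> {a..b} \<Longrightarrow> \<alpha> x = 0"
    and b: "\<And>x. (\<beta> has_real_derivative \<beta>' x) (at x)" "continuous_on UNIV \<beta>'" "\<And>x. x \<notin> {p..q} \<Longrightarrow> \<beta> x = 0"
  shows "test_fun (\<lambda>z. \<alpha> (fst z) * \<beta> (snd z))
    (\<lambda>z v. \<alpha> (fst z) * (\<beta>' (snd z) * snd v) + \<alpha>' (fst z) * fst v * \<beta> (snd z))"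
proof -
  have ca: "continuous_on UNIV \<alpha>" using a(1) by (meson DERIV_isCont continuous_at_imp_continuous_on)
  have cb: "continuous_on UNIV \<beta>" using b(1) by (meson DERIV_isCont continuous_at_imp_continuous_on)
  note c = continuous_on_compose2[OF ca] continuous_on_compose2[OF cb] continuous_on_compose2[OF a(2)] continuous_on_compose2[OF b(2)]
  have "((\<lambda>z. \<alpha> (fst z) * \<beta> (snd z)) has_derivative
    (\<lambda>v. \<alpha> (fst z) * (\<beta>' (snd z) * snd v) + \<alpha>' (fst z) * fst v * \<beta> (snd z))) (at z)" for z :: "real \<times> real"
    by (intro has_derivative_mult has_derivative_compose[where f=fst and g=\<alpha>] has_derivative_compose[where f=snd and g=\<beta>])
       (use a(1) b(1) in \<open>auto simp: has_field_derivative_def intro: has_derivative_fst has_derivative_snd\<close>)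
  moreover have "bounded {z. \<alpha> (fst z) * \<beta> (snd z) \<noteq> 0}"
  proof (rule bounded_subset)
    show "bounded ({a..b} \<times> {p..q})" by (intro bounded_Times) auto
    show "{z. \<alpha> (fst z) * \<beta> (snd z) \<noteq> 0} \<subseteq> {a..b} \<times> {p..q}" using a(3) b(3) by force
  qed
  ultimately show ?thesis unfolding test_fun_def by (auto intro!: continuous_intros c)
qed

section \<open>Functions with vanishing weak derivative in y\<close>

lemma continuous_antiderivative:
  fixes f :: "real \<Rightarrow> real"
  assumes "continuous_on UNIV f"
  obtains F where "\<And>x. (F has_real_derivative f x) (at x)"
proof -
  have "\<exists>F. \<forall>x. -\<infinity> < ereal x \<longrightarrow> ereal x < \<infinity> \<longrightarrow> (F has_vector_derivative f x) (at x)"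
    using assms by (intro einterval_antiderivative) (auto simp: continuous_on_eq_continuous_at)
  then show thesis using that by (auto simp: has_real_derivative_iff_has_vector_derivative)
qed

text \<open>A bump in \<open>y\<close> minus its translate is the derivative of a compactly
  supported function. Multiplied by a bump in \<open>x\<close>, that function is an admissible test
  function, so \<open>K\<close> has equal integrals against both bumps; the limit in
  \<open>n\<close> replaces bumps by indicators.\<close>

lemma weak_dy_zero_translate:
  assumes [measurable]: "K \<in> borel_measurable borel" and K: "loc_int K"
    and weak: "weak_dy K (\<lambda>z. 0)" and ab: "a < b" and pq: "p < q"
  shows "(\<integral>z. K z * (indicator {a<..<b} (fst z) * indicator {p<..<q} (snd z)) \<partial>lborel) =
    (\<integral>z. K z * (indicator {a<..<b} (fst z) * indicator {p<..<q} (snd z - \<tau>)) \<partial>lborel)" (is "?I = ?J")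
proof -
  \<comment> \<open>Large enough for the square \<open>?S\<close> to contain the box and its
    translate by \<tau>, so that one integrable function dominates both limits.\<close>
  define R where "R = \<bar>a\<bar> + \<bar>b\<bar> + \<bar>p\<bar> + \<bar>q\<bar> + \<bar>\<tau>\<bar>"
  let ?S = "{-R..R} \<times> {-R..R} :: (real \<times> real) set"
  have "set_integrable lborel ?S K" using K by (auto simp: loc_int_def intro: compact_Times)
  then have KS: "integrable lborel (\<lambda>z. indicator ?S z * K z)" by (simp add: set_integrable_def)
  have [measurable]: "?S \<in> sets borel" by (intro borel_closed closed_Times) auto
  have bd: "norm (K z * (u * v)) \<le> norm (indicator ?S z * K z)"
    if "0 \<le> u" "u \<le> indicator {a<..<b} (fst z)" "0 \<le> v" "v \<le> indicator {p<..<q} (snd z - t)" "t = 0 \<or> t = \<tau>" for z u v t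
  proof -
    have uv: "u \<le> 1" "v \<le> 1" by (rule order_trans[OF that(2)], simp) (rule order_trans[OF that(4)], simp)
    have "u * v \<le> indicator ?S z"
    proof (cases "fst z \<in> {a<..<b} \<and> snd z - t \<in> {p<..<q}")
      case True
      then have "z \<in> ?S" using that(5) by (cases z) (auto simp: R_def)
      then show ?thesis using uv that(1,3) by (simp add: mult_le_one)
    next
      case False
      then have "u = 0 \<or> v = 0" using that by auto
      then show ?thesis by auto
    qed
    then have "\<bar>u * v\<bar> * \<bar>K z\<bar> \<le> indicator ?S z * \<bar>K z\<bar>" using that by (intro mult_right_mono) auto
    then show ?thesis by (simp add: abs_mult mult_ac)
  qed
  have eq: "(\<integral>z. K z * (bump a b n (fst z) * bump p q n (snd z)) \<partial>lborel) =
    (\<integral>z. K z * (bump a b n (fst z) * bump p q n (snd z - \<tau>)) \<partial>lborel)" for n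
  proof -
    obtain \<Gamma> where \<Gamma>: "\<And>x. (\<Gamma> has_real_derivative bump p q n x) (at x)"
      using continuous_antiderivative[OF bump_continuous(1)] by blast
    have const1: "\<Gamma> x = \<Gamma> y" if "x \<le> y" "y \<le> p \<or> q \<le> x" for x y
    proof -
      have "continuous_on {x..y} \<Gamma>" using \<Gamma> by (meson DERIV_isCont continuous_at_imp_continuous_on)
      moreover have "(\<Gamma> has_real_derivative 0) (at t)" if "x < t" "t < y" for t
        using \<Gamma>[of t] bump_support[OF pq, of t n] that \<open>y \<le> p \<or> q \<le> x\<close> by auto
      ultimately show ?thesis
        using DERIV_isconst_end[of x y \<Gamma>] \<open>x \<le> y\<close> by (cases "x = y") auto
    qed
    \<comment> \<open>\<Gamma> is constant below \<open>p\<close> and above \<open>q\<close>, in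
      general with different constants. Subtracting a translate makes both ends vanish.\<close>
    define \<beta> where "\<beta> y = \<Gamma> y - \<Gamma> (y - \<tau>)" for y
    have "test_fun (\<lambda>z. bump a b n (fst z) * \<beta> (snd z))
      (\<lambda>z v. bump a b n (fst z) * ((bump p q n (snd z) - bump p q n (snd z - \<tau>)) * snd v) + bump_deriv a b n (fst z) * fst v * \<beta> (snd z))"
    proof (rule test_fun_product[where a=a and b=b and p="p - \<bar>\<tau>\<bar>" and q="q + \<bar>\<tau>\<bar>"])
      show "(bump a b n has_real_derivative bump_deriv a b n x) (at x)" for x by (rule bump_has_derivative)
      show "continuous_on UNIV (bump_deriv a b n)" by (rule bump_continuous)
      show "bump a b n x = 0" if "x \<notin> {a..b}" for x using bump_support[OF ab, of x n] that by auto
      have "((\<lambda>y. \<Gamma> (y - \<tau>)) has_real_derivative bump p q n (x - \<tau>) * 1) (at x)" for x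
        by (rule DERIV_chain2[OF \<Gamma>]) (auto intro!: derivative_eq_intros)
      then show "(\<beta> has_real_derivative bump p q n x - bump p q n (x - \<tau>)) (at x)" for x
        unfolding \<beta>_def[abs_def] by (intro DERIV_diff \<Gamma>) simp
      show "continuous_on UNIV (\<lambda>x. bump p q n x - bump p q n (x - \<tau>))"
        by (intro continuous_intros bump_continuous continuous_on_compose2[OF bump_continuous(1)[of UNIV]]) auto
      show "\<beta> x = 0" if "x \<notin> {p - \<bar>\<tau>\<bar>..q + \<bar>\<tau>\<bar>}" for x
        using const1[of x "x - \<tau>"] const1[of "x - \<tau>" x] that
        by (cases "\<tau> \<ge> 0") (auto simp: \<beta>_def)
    qed
    then have "(\<integral>z. K z * (bump a b n (fst z) * (bump p q n (snd z) - bump p q n (snd z - \<tau>))) \<partial>lborel) = 0"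
      using weak unfolding weak_dy_def by fastforce
    moreover have "integrable lborel (\<lambda>z. K z * (bump a b n (fst z) * bump p q n (snd z)))"
      by (rule Bochner_Integration.integrable_bound[OF KS])
         (use bd[where t=0] bump_range[OF ab] bump_range[OF pq] in auto)
    moreover have "integrable lborel (\<lambda>z. K z * (bump a b n (fst z) * bump p q n (snd z - \<tau>)))"
      by (rule Bochner_Integration.integrable_bound[OF KS])
         (use bd[where t=\<tau>] bump_range[OF ab] bump_range[OF pq] in auto)
    ultimately show ?thesis by (simp add: algebra_simps)
  qed
  have 1: "(\<lambda>n. \<integral>z. K z * (bump a b n (fst z) * bump p q n (snd z)) \<partial>lborel) \<longlonglongrightarrow> ?I"
  proof (rule integral_dominated_convergence[OF _ _ integrable_norm[OF KS]])
    show "AE z in lborel. (\<lambda>n. K z * (bump a b n (fst z) * bump p q n (snd z))) \<longlonglongrightarrow>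
      K z * (indicator {a<..<b} (fst z) * indicator {p<..<q} (snd z))"
      by (intro AE_I2 tendsto_intros bump_limit ab pq)
    show "AE z in lborel. norm (K z * (bump a b n (fst z) * bump p q n (snd z))) \<le> norm (indicator ?S z * K z)" for n
      using bd[where t=0] bump_range[OF ab] bump_range[OF pq] by simp
  qed measurable
  have 2: "(\<lambda>n. \<integral>z. K z * (bump a b n (fst z) * bump p q n (snd z - \<tau>)) \<partial>lborel) \<longlonglongrightarrow> ?J"
  proof (rule integral_dominated_convergence[OF _ _ integrable_norm[OF KS]])
    show "AE z in lborel. (\<lambda>n. K z * (bump a b n (fst z) * bump p q n (snd z - \<tau>))) \<longlonglongrightarrow>
      K z * (indicator {a<..<b} (fst z) * indicator {p<..<q} (snd z - \<tau>))"
      by (intro AE_I2 tendsto_intros bump_limit ab pq)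
    show "AE z in lborel. norm (K z * (bump a b n (fst z) * bump p q n (snd z - \<tau>))) \<le> norm (indicator ?S z * K z)" for n
      using bd[where t=\<tau>] bump_range[OF ab] bump_range[OF pq] by simp
  qed measurable
  show ?thesis using LIMSEQ_unique[OF 1] 2 by (simp add: eq)
qed


lemma box_plane: "box (a, p) (b, q) = {a<..<b} \<times> {p<..<(q::real)}" for a b :: real
  by (auto simp: mem_box Basis_prod_def)

text \<open>Boxes form a generator of the Borel sets closed under intersection, and the sets with
  vanishing integral form a Dynkin system once \<open>L\<close> is made integrable by cutting it off
  to a large box \<open>?B\<close>; cutting a box by \<open>?B\<close> leaves a box.\<close>

lemma AE_zero_if_box_integrals_zero:
  assumes [measurable]: "L \<in> borel_measurable borel" and L: "loc_int L"
    and zero: "\<And>a b p q. a < b \<Longrightarrow> p < q \<Longrightarrow>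
      (\<integral>z. L z * (indicator {a<..<b} (fst z) * indicator {p<..<q} (snd z)) \<partial>lborel) = 0"
  shows "AE z in lborel. L z = (0::real)"
proof -
  have box0: "(\<integral>z. indicator (box u v) z * L z \<partial>lborel) = 0" for u v
  proof -
    obtain a p b q where uv: "u = (a, p)" "v = (b, q)" by (cases u, cases v) 
    have "(\<lambda>z. indicator (box u v) z * L z) = (\<lambda>z. L z * (indicator {a<..<b} (fst z) * indicator {p<..<q} (snd z)))"
      by (auto simp: uv box_plane indicator_def fun_eq_iff)
    then have eq: "(\<integral>z. indicator (box u v) z * L z \<partial>lborel) =
      (\<integral>z. L z * (indicator {a<..<b} (fst z) * indicator {p<..<q} (snd z)) \<partial>lborel)" by simp
    show ?thesis
      unfolding eq using zero[of a b p q] by (cases "a < b \<and> p < q") auto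
  qed
  have "AE z in lborel. indicator (box (-(real m), -(real m)) (real m, real m)) z * L z = 0" for m
  proof (rule sigma_finite_measure.density_zero[OF sigma_finite_lborel])
    let ?B = "box (-(real m), -(real m)) (real m, real m)"
    have c: "compact (cbox (-(real m), -(real m)) (real m, real m))" by (rule compact_cbox)
    have "set_integrable lborel (cbox (-(real m), -(real m)) (real m, real m)) L"
      using L c unfolding loc_int_def by blast
    then have "set_integrable lborel ?B L" by (rule set_integrable_subset) (auto simp: box_subset_cbox)
    then show int: "integrable lborel (\<lambda>z. indicator ?B z * L z)" by (simp add: set_integrable_def)
    have si: "set_integrable lborel A (\<lambda>z. indicator ?B z * L z)" if "A \<in> sets borel" for A
      using int that unfolding set_integrable_def by (intro integrable_mult_indicator) auto
    fix A :: "(real \<times> real) set" assume "A \<in> sets lborel"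
    then have sig: "A \<in> sigma_sets UNIV (range (\<lambda>(a, b). box a b :: (real \<times> real) set))"
      by (simp add: borel_eq_box)
    have stable: "Int_stable (range (\<lambda>(a, b). box a b :: (real \<times> real) set))"
      by (auto simp: Int_stable_def box_Int_box)
    have "range (\<lambda>(a, b). box a b :: (real \<times> real) set) \<subseteq> Pow UNIV" by simp
    from stable this sig show "set_lebesgue_integral lborel A (\<lambda>z. indicator ?B z * L z) = 0"
    proof (induct rule: sigma_sets_induct_disjoint)
      case (basic A)
      then obtain u v where A: "A = box u v" by auto
      obtain u' v' where "A \<inter> ?B = box u' v'" unfolding A box_Int_box by blast
      then have "(\<lambda>z. indicator A z *\<^sub>R (indicator ?B z * L z)) = (\<lambda>z. indicator (box u' v') z * L z)"
        by (auto simp: indicator_def fun_eq_iff)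
      then show ?case using box0[of u' v'] by (simp only: set_lebesgue_integral_def)
    next
      case empty show ?case by (simp add: set_lebesgue_integral_def)
    next
      case (compl A)
      then have A: "A \<in> sets borel" by (simp add: borel_eq_box)
      have "set_lebesgue_integral lborel (UNIV - A) (\<lambda>z. indicator ?B z * L z) =
        (\<integral>z. indicator ?B z * L z - indicator A z *\<^sub>R (indicator ?B z * L z) \<partial>lborel)"
        unfolding set_lebesgue_integral_def by (intro Bochner_Integration.integral_cong) (auto simp: indicator_def)
      also have "\<dots> = 0"
        using int si[OF A] compl(2) box0 by (simp add: set_integrable_def set_lebesgue_integral_def)
      finally show ?case .
    next
      case (union A)
      then have A: "A i \<in> sets borel" for i by (auto simp: borel_eq_box)
      have "set_lebesgue_integral lborel (\<Union>i. A i) (\<lambda>z. indicator ?B z * L z) =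
        (\<Sum>i. set_lebesgue_integral lborel (A i) (\<lambda>z. indicator ?B z * L z))"
        using A union(1) by (intro lebesgue_integral_countable_add si) (auto simp: disjoint_family_on_def)
      then show ?case using union(3) by simp
    qed
  qed
  then have "AE z in lborel. \<forall>m. indicator (box (-(real m), -(real m)) (real m, real m)) z * L z = 0"
    by (subst AE_all_countable) simp
  then show ?thesis
  proof eventually_elim
    case (elim z)
    obtain m :: nat where "real m > \<bar>fst z\<bar> + \<bar>snd z\<bar>" using reals_Archimedean2 by blast
    then have "z \<in> box (-(real m), -(real m)) (real m, real m)" by (cases z) (auto simp: box_plane)
    then show ?case using elim[rule_format, of m] by simp
  qed
qed

lemma integrable_translate:
  fixes f :: "'a::euclidean_space \<Rightarrow> real"
  assumes "integrable lborel f"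
  shows "integrable lborel (\<lambda>z. f (w + z))"
  using assms integrable_distr_eq[of "(+) w" lborel borel f] 
  by (simp add: lborel_distr_plus borel_measurable_integrable)

lemma integral_translate:
  fixes f :: "'a::euclidean_space \<Rightarrow> real"
  assumes "f \<in> borel_measurable borel"
  shows "(\<integral>z. f (w + z) \<partial>lborel) = (\<integral>z. f z \<partial>lborel)"
  using assms integral_distr[of "(+) w" lborel borel f] 
  by (simp add: lborel_distr_plus)

lemma loc_int_translate:
  assumes "loc_int K"
  shows "loc_int (\<lambda>z. K (w + z))"
  unfolding loc_int_def
proof (intro allI impI)
  fix S :: "(real \<times> real) set" assume "compact S"
  then have "compact ((+) w ` S)" by (rule compact_translation)
  then have "integrable lborel (\<lambda>z. indicator ((+) w ` S) z * K z)"
    using assms by (auto simp: loc_int_def set_integrable_def)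
  from integrable_translate[OF this, of w]
  have "integrable lborel (\<lambda>z. indicator ((+) w ` S) (w + z) * K (w + z))" .
  moreover have "indicator ((+) w ` S) (w + z) = (indicator S z :: real)" for z
    by (auto simp: indicator_def)
  ultimately show "set_integrable lborel S (\<lambda>z. K (w + z))" by (simp add: set_integrable_def)
qed

lemma loc_int_diff: "loc_int F \<Longrightarrow> loc_int G \<Longrightarrow> loc_int (\<lambda>z. F z - G z)"
  by (auto simp: loc_int_def intro: set_integral_diff)

lemma AE_lborel_ex: "AE x in (lborel :: real measure). P x \<Longrightarrow> \<exists>x. P x"
  using ae_filter_eq_bot_iff[of "lborel :: real measure"] by (auto intro: eventually_happens')

lemma AE_lborel_small_ex:
  assumes "AE t in lborel. \<bar>t\<bar> < \<eta> \<longrightarrow> P t" "\<eta> > (0::real)"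
  shows "\<exists>t. \<bar>t\<bar> < \<eta> \<and> P t"
proof (rule ccontr)
  assume "\<not> ?thesis"
  then have "AE t in lborel. t \<notin> {-\<eta><..<\<eta>}" using assms(1) by (auto elim!: eventually_mono)
  then have "emeasure lborel {-\<eta><..<\<eta>} = 0"
    by (subst (asm) AE_iff_measurable[of "{-\<eta><..<\<eta>}"]) auto
  then show False using assms(2) by simp
qed

text \<open>For each \<tau>, \<open>K\<close> agrees almost everywhere with its vertical translate
  by \<tau>, since their box integrals agree. The null set depends on \<tau>, so Fubini is applied
  to \<open>(z, \<tau>)\<close>: some height \<open>y\<close> is good for almost every
  \<open>x\<close> and \<tau>, and the slice at this height serves as \<open>k\<close>.\<close>

lemma weak_dy_zero_const:
  assumes [measurable]: "K \<in> borel_measurable borel" and K: "loc_int K"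
    and weak: "weak_dy K (\<lambda>z. 0)"
  obtains k where "k \<in> borel_measurable borel" "AE z in lborel. K z = k (fst z)"
proof -
  have tr: "AE z in lborel. K z = K (fst z, \<tau> + snd z)" for \<tau>
  proof -
    have 1: "(0, \<tau>) + z = (fst z, \<tau> + snd z)" for z :: "real \<times> real" by (cases z) simp
    have "AE z in lborel. K z - K ((0, \<tau>) + z) = 0"
    proof (rule AE_zero_if_box_integrals_zero)
      show "(\<lambda>z. K z - K ((0, \<tau>) + z)) \<in> borel_measurable borel" unfolding 1 by measurable
      show "loc_int (\<lambda>z. K z - K ((0, \<tau>) + z))"
        by (intro loc_int_diff loc_int_translate K)
      fix a b p q :: real assume ab: "a < b" "p < q"
      let ?i = "\<lambda>z. indicator {a<..<b} (fst z) * indicator {p<..<q} (snd z) :: real"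
      have int: "integrable lborel (\<lambda>z. H z * ?i z)" if H: "loc_int H" for H
      proof -
        have "compact (cbox (a, p) (b, q))" by (rule compact_cbox)
        then have "set_integrable lborel (cbox (a, p) (b, q)) H" using H unfolding loc_int_def by blast
        then have "set_integrable lborel (box (a, p) (b, q)) H" by (rule set_integrable_subset) (auto simp: box_subset_cbox)
        moreover have "indicator (box (a, p) (b, q)) z * H z = H z * ?i z" for z
          by (cases z) (auto simp: box_plane indicator_def)
        ultimately show ?thesis by (simp add: set_integrable_def)
      qed
      have "(\<integral>z. (K z - K ((0, \<tau>) + z)) * ?i z \<partial>lborel) = (\<integral>z. K z * ?i z \<partial>lborel) - (\<integral>z. K ((0, \<tau>) + z) * ?i z \<partial>lborel)"
        unfolding left_diff_distrib
        by (rule Bochner_Integration.integral_diff[OF int[OF K] int[OF loc_int_translate[OF K]]])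
      also have "(\<integral>z. K ((0, \<tau>) + z) * ?i z \<partial>lborel) =
        (\<integral>z. (\<lambda>z. K z * (indicator {a<..<b} (fst z) * indicator {p<..<q} (snd z - \<tau>))) ((0, \<tau>) + z) \<partial>lborel)"
        by simp
      also have "\<dots> = (\<integral>z. K z * (indicator {a<..<b} (fst z) * indicator {p<..<q} (snd z - \<tau>)) \<partial>lborel)"
        by (rule integral_translate) measurable
      finally show "(\<integral>z. (K z - K ((0, \<tau>) + z)) * ?i z \<partial>lborel) = 0"
        using weak_dy_zero_translate[OF assms(1) K weak ab, of \<tau>] by simp
    qed
    then show ?thesis unfolding 1 by simp
  qed
  have "AE z in lborel. AE \<tau> in lborel. K z = K (fst z, \<tau> + snd z)"
  proof (subst lborel_pair.AE_commute)
    have "Measurable.pred (lborel \<Otimes>\<^sub>M lborel) (\<lambda>w :: (real \<times> real) \<times> real. K (fst w) = K (fst (fst w), snd w + snd (fst w)))"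
      by measurable
    then show "{w \<in> space (lborel \<Otimes>\<^sub>M lborel). K (fst w) = K (fst (fst w), snd w + snd (fst w))} \<in> sets (lborel \<Otimes>\<^sub>M lborel)"
      by (simp only: pred_def)
  qed (use tr in simp)
  from AE_planeD(2)[OF this] obtain y where y: "AE x in lborel. AE \<tau> in lborel. K (x, y) = K (x, \<tau> + y)"
    using AE_lborel_ex by fastforce
  have "AE x in lborel. AE t in lborel. K (x, t) = K (x, y)"
    using y
  proof eventually_elim
    case (elim x)
    from AE_affine[of 1 "\<lambda>\<tau>. K (x, y) = K (x, \<tau> + y)" "-y", OF _ this] show ?case by (simp add: eq_commute[of _ "K (x, y)"])
  qed
  then have "AE z in lborel. K z = K (fst z, y)"
    by (subst AE_plane(1)) auto
  then show thesis by (intro that[of "\<lambda>x. K (x, y)"]) auto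
qed

text \<open>Both candidates are compared with one slice of \<open>F\<close> at a height
  \<open>t\<close> admissible for both limits. Such a \<open>t\<close> exists because the small
  heights form a set of positive measure.\<close>

lemma slice_limit_unique:
  assumes [measurable]: "F \<in> borel_measurable borel" "g \<in> borel_measurable borel" "k \<in> borel_measurable borel"
    and g: "slice_limit F c g" and k: "slice_limit F c k"
  shows "AE x in lborel. g x = k x"
proof -
  have "AE x in lborel. x \<in> {-real m..real m} \<longrightarrow> g x = k x" for m
  proof -
    let ?I = "\<lambda>f. (\<integral>\<^sup>+x\<in>{-real m..real m}. ennreal ((f x)\<^sup>2) \<partial>lborel)"
    have "?I (\<lambda>x. g x - k x) \<le> 0 + ennreal e" if e: "e > 0" for e
    proof -
      obtain \<eta>1 where \<eta>1: "\<eta>1 > 0" "AE t in lborel. \<bar>t\<bar> < \<eta>1 \<longrightarrow> ?I (\<lambda>x. F (x, c + t) - g x) < ennreal (e / 4)"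
        \<comment> \<open>\<open>power2_sum_le\<close> doubles each of the two errors, so
          \<open>e / 4\<close> for each adds up to \<open>e\<close>.\<close>
        using g[unfolded slice_limit_def, rule_format, of "e / 4" "-real m" "real m"] e by auto
      obtain \<eta>2 where \<eta>2: "\<eta>2 > 0" "AE t in lborel. \<bar>t\<bar> < \<eta>2 \<longrightarrow> ?I (\<lambda>x. F (x, c + t) - k x) < ennreal (e / 4)"
        using k[unfolded slice_limit_def, rule_format, of "e / 4" "-real m" "real m"] e by auto
      have "AE t in lborel. \<bar>t\<bar> < min \<eta>1 \<eta>2 \<longrightarrow> ?I (\<lambda>x. F (x, c + t) - g x) < ennreal (e / 4) \<and> ?I (\<lambda>x. F (x, c + t) - k x) < ennreal (e / 4)"
        using \<eta>1(2) \<eta>2(2) by eventually_elim auto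
      from AE_lborel_small_ex[OF this]
      obtain t where t: "?I (\<lambda>x. F (x, c + t) - g x) < ennreal (e / 4)" "?I (\<lambda>x. F (x, c + t) - k x) < ennreal (e / 4)"
        using \<eta>1(1) \<eta>2(1) by auto
      have "?I (\<lambda>x. g x - k x) \<le> (\<integral>\<^sup>+x\<in>{-real m..real m}. 2 * ennreal ((F (x, c + t) - g x)\<^sup>2) + 2 * ennreal ((F (x, c + t) - k x)\<^sup>2) \<partial>lborel)"
      proof (intro nn_integral_mono mult_right_mono)
        fix x
        have "(g x - k x)\<^sup>2 \<le> 2 * (F (x, c + t) - g x)\<^sup>2 + 2 * (F (x, c + t) - k x)\<^sup>2"
          using power2_sum_le[of "g x - F (x, c + t)" "F (x, c + t) - k x"] by (simp add: power2_commute)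
        then have "ennreal ((g x - k x)\<^sup>2) \<le> ennreal (2 * (F (x, c + t) - g x)\<^sup>2 + 2 * (F (x, c + t) - k x)\<^sup>2)"
          by (rule ennreal_leI)
        then show "ennreal ((g x - k x)\<^sup>2) \<le> 2 * ennreal ((F (x, c + t) - g x)\<^sup>2) + 2 * ennreal ((F (x, c + t) - k x)\<^sup>2)"
          by (simp add: ennreal_mult)
      qed auto
      also have "\<dots> = 2 * ?I (\<lambda>x. F (x, c + t) - g x) + 2 * ?I (\<lambda>x. F (x, c + t) - k x)"
        by (simp add: distrib_right nn_integral_add nn_integral_cmult mult.assoc)
      also have "\<dots> \<le> 2 * ennreal (e / 4) + 2 * ennreal (e / 4)"
        using t by (intro add_mono mult_left_mono) auto
      also have "\<dots> = ennreal e" using e by (simp add: ennreal_mult[symmetric] ennreal_plus[symmetric] flip: ennreal_numeral del: ennreal_plus)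
      finally show ?thesis by simp
    qed
    then have "?I (\<lambda>x. g x - k x) \<le> 0" by (rule ennreal_le_epsilon) 
    then have "AE x in lborel. ennreal ((g x - k x)\<^sup>2) * indicator {-real m..real m} x = 0"
      by (subst (asm) le_zero_eq, subst (asm) nn_integral_0_iff_AE) auto
    then show ?thesis by eventually_elim (auto simp: indicator_def)
  qed
  then have "AE x in lborel. \<forall>m. x \<in> {-real m..real m} \<longrightarrow> g x = k x" by (subst AE_all_countable) simp
  then show ?thesis
  proof eventually_elim
    case (elim x)
    obtain m :: nat where "real m > \<bar>x\<bar>" using reals_Archimedean2 by blast
    then have "x \<in> {-real m..real m}" by auto
    then show ?case using elim by blast
  qed
qed

lemma loc_int_test_integrable:
  assumes [measurable]: "F \<in> borel_measurable borel" and F: "loc_int F" and T: "test_fun \<phi> D"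
  shows "integrable lborel (\<lambda>z. F z * D z (0,1))"
proof -
  obtain R where "R > 0" "\<And>z. norm z \<ge> R \<Longrightarrow> \<phi> z = 0" and R: "\<And>z v. norm z \<ge> R \<Longrightarrow> D z v = 0"
    using test_fun_support[OF T] by blast
  have c1: "continuous_on UNIV (\<lambda>z. D z (0,1))" using T by (simp add: test_fun_def)
  then have [measurable]: "(\<lambda>z. D z (0,1)) \<in> borel_measurable borel"
    by (rule borel_measurable_continuous_onI)
  obtain C1 where C1: "\<And>z. \<bar>D z (0,1)\<bar> \<le> C1 * indicator (cball 0 R) z"
    using continuous_support_bounded[OF c1 R] by blast
  show ?thesis using F C1 by (intro loc_int_mult_bounded) auto
qed

text \<open>Subtract the primitive \<open>J\<close> of \<open>G\<close> that starts on the line. The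
  difference has vanishing weak derivative in \<open>y\<close>, hence is a function \<open>k\<close>
  of \<open>x\<close> alone. Then \<open>k\<close> is itself a trace of \<open>F\<close>, and
  uniqueness of the trace identifies it with \<open>g\<close>.\<close>

theorem weak_dy_line_rep:
  assumes [measurable]: "F \<in> borel_measurable borel" "G \<in> borel_measurable (borel :: (real \<times> real) measure)"
    "g \<in> borel_measurable borel"
    and F: "loc_int F" and fin: "sq_int G" and weak: "weak_dy F G" and tr: "slice_limit F c g"
  shows "line_rep F c g G"
proof -
  define J where "J z = oint (\<lambda>s. G (fst z, s)) c (snd z)" for z
  have [measurable]: "J \<in> borel_measurable borel" unfolding J_def by measurable
  have "line_rep J c (\<lambda>x. 0) G" by (simp add: line_rep_def J_def)
  moreover have "loc_sq_int (\<lambda>x. 0)" by (simp add: loc_sq_int_def)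
  ultimately have J: "weak_dy J G" "loc_int J"
    using line_rep_weak_dy[of J G "\<lambda>x. 0" c] line_rep_loc_int[of J G "\<lambda>x. 0" c] fin by auto
  have "weak_dy (\<lambda>z. F z - J z) (\<lambda>z. 0)"
    unfolding weak_dy_def
  proof (intro allI impI)
    fix \<phi> D assume T: "test_fun \<phi> D"
    have "(\<integral>z. (F z - J z) * D z (0, 1) \<partial>lborel) = (\<integral>z. F z * D z (0, 1) \<partial>lborel) - (\<integral>z. J z * D z (0, 1) \<partial>lborel)"
      using loc_int_test_integrable[OF _ F T] loc_int_test_integrable[OF _ J(2) T] by (simp add: left_diff_distrib)
    then show "(\<integral>z. (F z - J z) * D z (0, 1) \<partial>lborel) = - (\<integral>z. 0 * \<phi> z \<partial>lborel)"
      using weak J(1) T by (simp add: weak_dy_def)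
  qed
  then obtain k where k[measurable]: "k \<in> borel_measurable borel" and "AE z in lborel. F z - J z = k (fst z)"
    using weak_dy_zero_const[of "\<lambda>z. F z - J z"] loc_int_diff[OF F J(2)] by auto
  then have rep: "line_rep F c k G"
    unfolding line_rep_def J_def by (auto elim!: eventually_mono)
  have "AE x in lborel. k x = g x"
    using line_rep_slice_limit[OF _ fin rep] tr by (intro slice_limit_unique[of F]) auto
  then have "AE x in lborel. AE y in lborel. k x = g x" by (auto elim!: eventually_mono)
  then have "AE z :: real \<times> real in lborel. k (fst z) = g (fst z)" using AE_plane(1)[of "\<lambda>z. k (fst z) = g (fst z)"] by simp
  with rep show ?thesis unfolding line_rep_def by eventually_elim simp
qed

section \<open>Borel representatives and the trace on the grid\<close>

lemma distr_swap_plane: "distr lborel borel prod.swap = (lborel :: (real \<times> real) measure)"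
proof -
  have "(lborel :: (real \<times> real) measure) = distr (lborel \<Otimes>\<^sub>M lborel) (lborel \<Otimes>\<^sub>M lborel) (\<lambda>(x, y). (y, x))"
    using lborel_pair.distr_pair_swap unfolding lborel_prod by blast
  also have "\<dots> = distr lborel lborel prod.swap"
    unfolding lborel_prod prod.swap_def by (simp add: case_prod_unfold)
  also have "\<dots> = distr lborel borel prod.swap" by (intro distr_cong) auto
  finally show ?thesis by simp
qed

lemma swap_measurable [measurable]: "prod.swap \<in> borel \<rightarrow>\<^sub>M (borel :: (real \<times> real) measure)"
  unfolding prod.swap_def by measurable

lemma nn_integral_swap:
  assumes "f \<in> borel_measurable borel"
  shows "(\<integral>\<^sup>+z. f (prod.swap z) \<partial>lborel) = (\<integral>\<^sup>+z. f z \<partial>(lborel :: (real \<times> real) measure))"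
  using nn_integral_distr[of prod.swap lborel borel f] assms by (simp add: distr_swap_plane)

lemma integral_swap:
  fixes f :: "real \<times> real \<Rightarrow> real"
  assumes "f \<in> borel_measurable borel"
  shows "(\<integral>z. f (prod.swap z) \<partial>lborel) = (\<integral>z. f z \<partial>lborel)"
  using integral_distr[of prod.swap lborel borel f] assms by (simp add: distr_swap_plane)

lemma AE_swap:
  assumes "AE z in (lborel :: (real \<times> real) measure). P z"
  shows "AE z in lborel. P (prod.swap z)"
proof -
  have "AE z in distr lborel borel prod.swap. P z" using assms unfolding distr_swap_plane .
  then show ?thesis by (rule AE_distrD[rotated]) simp
qed

lemma sq_int_swap:
  assumes [measurable]: "G \<in> borel_measurable borel" and "sq_int G"
  shows "sq_int (\<lambda>z. G (prod.swap z))"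
  using assms nn_integral_swap[of "\<lambda>z. ennreal ((G z)\<^sup>2)"] by (simp add: sq_int_def)

lemma loc_int_swap:
  assumes [measurable]: "F \<in> borel_measurable borel" and F: "loc_int F"
  shows "loc_int (\<lambda>z. F (prod.swap z))"
  unfolding loc_int_def
proof (intro allI impI)
  fix K :: "(real \<times> real) set" assume K: "compact K"
  have "continuous_on K prod.swap" unfolding prod.swap_def by (intro continuous_intros)
  then have cK: "compact (prod.swap ` K)" using K by (rule compact_continuous_image)
  then have "integrable lborel (\<lambda>z. indicator (prod.swap ` K) z *\<^sub>R F z)"
    using F by (auto simp: loc_int_def set_integrable_def)
  moreover have [measurable]: "prod.swap ` K \<in> sets borel" using cK by (rule borel_compact)
  ultimately have "integrable lborel (\<lambda>z. indicator (prod.swap ` K) (prod.swap z) *\<^sub>R F (prod.swap z))"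
    using integrable_distr_eq[of prod.swap lborel borel "\<lambda>z. indicator (prod.swap ` K) z *\<^sub>R F z"]
    by (simp add: distr_swap_plane)
  moreover have "indicator (prod.swap ` K) (prod.swap z) = (indicator K z :: real)" for z
    by (cases z) (force simp: indicator_def)
  ultimately show "set_integrable lborel K (\<lambda>z. F (prod.swap z))" by (simp add: set_integrable_def)
qed

lemma test_fun_swap:
  assumes T: "test_fun \<phi> D"
  shows "test_fun (\<lambda>z. \<phi> (prod.swap z)) (\<lambda>z v. D (prod.swap z) (prod.swap v))"
proof -
  have d: "(\<phi> has_derivative D z) (at z)" for z using T unfolding test_fun_def by blast
  have s: "(prod.swap has_derivative prod.swap) (at z)" for z :: "real \<times> real"
  proof -
    have "bounded_linear (prod.swap :: real \<times> real \<Rightarrow> _)"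
      unfolding prod.swap_def by (intro bounded_linear_intros)
    then show ?thesis by (rule bounded_linear_imp_has_derivative)
  qed
  have cs: "continuous_on UNIV (prod.swap :: real \<times> real \<Rightarrow> _)" unfolding prod.swap_def by (intro continuous_intros)
  have "((\<lambda>z. \<phi> (prod.swap z)) has_derivative (\<lambda>v. D (prod.swap z) (prod.swap v))) (at z)" for z
    using has_derivative_compose[OF s d] .
  moreover have "continuous_on UNIV (\<lambda>z. D (prod.swap z) (0, 1))" "continuous_on UNIV (\<lambda>z. D (prod.swap z) (1, 0))"
    using T unfolding test_fun_def by (auto intro: continuous_on_compose2[OF _ cs])
  moreover have "bounded {z. \<phi> (prod.swap z) \<noteq> 0}"
  proof -
    have "bounded {z. \<phi> z \<noteq> 0}" using T by (simp add: test_fun_def)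
    then have "bounded (prod.swap ` {z. \<phi> z \<noteq> 0})"
      by (rule bounded_linear_image) (unfold prod.swap_def, intro bounded_linear_intros)
    moreover have "{z. \<phi> (prod.swap z) \<noteq> 0} \<subseteq> prod.swap ` {z. \<phi> z \<noteq> 0}" by force
    ultimately show ?thesis by (rule bounded_subset)
  qed
  ultimately show ?thesis by (simp add: test_fun_def del: split_paired_All)
qed

lemma test_fun_measurable:
  assumes T: "test_fun \<phi> D"
  shows "(\<lambda>z. D z (0,1)) \<in> borel_measurable borel" "(\<lambda>z. D z (1,0)) \<in> borel_measurable borel" "\<phi> \<in> borel_measurable borel"
proof -
  show "(\<lambda>z. D z (0,1)) \<in> borel_measurable borel" "(\<lambda>z. D z (1,0)) \<in> borel_measurable borel"
    using T by (auto simp: test_fun_def intro: borel_measurable_continuous_onI)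
  have "continuous_on UNIV \<phi>"
    using T unfolding test_fun_def by (intro has_derivative_continuous_on[of UNIV \<phi> D]) (auto intro: has_derivative_at_withinI simp del: split_paired_All)
  then show "\<phi> \<in> borel_measurable borel" by (rule borel_measurable_continuous_onI)
qed

text \<open>The class of test functions is invariant under the exchange of coordinates, so the
  condition on the derivative in \<open>x\<close> becomes \<open>weak_dy\<close> for the exchanged
  function. Results about vertical lines then cover both components.\<close>

lemma weak_gradient_iff:
  assumes [measurable]: "F \<in> borel_measurable borel" "G1 \<in> borel_measurable borel" "G2 \<in> borel_measurable borel"
  shows "weak_gradient F G1 G2 \<longleftrightarrow> weak_dy F G2 \<and> weak_dy (\<lambda>z. F (prod.swap z)) (\<lambda>z. G1 (prod.swap z))"
proof -
  have leb: "integral\<^sup>L lebesgue h = integral\<^sup>L lborel h" if "h \<in> borel_measurable borel" for h :: "real \<times> real \<Rightarrow> real"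
    using that by (intro integral_completion) simp
  have 1: "weak_gradient F G1 G2 \<longleftrightarrow> (\<forall>\<phi> D. test_fun \<phi> D \<longrightarrow>
      (\<integral>z. F z * D z (1,0) \<partial>lborel) = - (\<integral>z. G1 z * \<phi> z \<partial>lborel) \<and>
      (\<integral>z. F z * D z (0,1) \<partial>lborel) = - (\<integral>z. G2 z * \<phi> z \<partial>lborel))"
    unfolding weak_gradient_def
    by (intro arg_cong[where f=All] ext imp_cong refl) (use test_fun_measurable leb in auto)
  have sw: "(\<integral>z. F z * D z (1,0) \<partial>lborel) = (\<integral>z. F (prod.swap z) * D (prod.swap z) (1, 0) \<partial>lborel)"
    "(\<integral>z. G1 z * \<phi> z \<partial>lborel) = (\<integral>z. G1 (prod.swap z) * \<phi> (prod.swap z) \<partial>lborel)"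
    if T: "test_fun \<phi> D" for \<phi> D
    using test_fun_measurable[OF T] integral_swap[of "\<lambda>z. F z * D z (1,0)"] integral_swap[of "\<lambda>z. G1 z * \<phi> z"] by auto
  show ?thesis
  proof
    assume L: "weak_gradient F G1 G2"
    show "weak_dy F G2 \<and> weak_dy (\<lambda>z. F (prod.swap z)) (\<lambda>z. G1 (prod.swap z))"
      unfolding weak_dy_def
    proof (intro conjI allI impI)
      fix \<phi> D assume T: "test_fun \<phi> D"
      show "(\<integral>z. F z * D z (0,1) \<partial>lborel) = - (\<integral>z. G2 z * \<phi> z \<partial>lborel)" using L T unfolding 1 by blast
      from test_fun_swap[OF T] L
      have "(\<integral>z. F z * D (prod.swap z) (prod.swap (1,0)) \<partial>lborel) = - (\<integral>z. G1 z * \<phi> (prod.swap z) \<partial>lborel)"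
        unfolding 1 by blast
      then show "(\<integral>z. F (prod.swap z) * D z (0,1) \<partial>lborel) = - (\<integral>z. G1 (prod.swap z) * \<phi> z \<partial>lborel)"
        using sw[OF test_fun_swap[OF T]] by simp
    qed
  next
    assume R: "weak_dy F G2 \<and> weak_dy (\<lambda>z. F (prod.swap z)) (\<lambda>z. G1 (prod.swap z))"
    show "weak_gradient F G1 G2"
      unfolding 1
    proof (intro allI impI conjI)
      fix \<phi> D assume T: "test_fun \<phi> D"
      show "(\<integral>z. F z * D z (0,1) \<partial>lborel) = - (\<integral>z. G2 z * \<phi> z \<partial>lborel)" using R T by (simp add: weak_dy_def)
      have "weak_dy (\<lambda>z. F (prod.swap z)) (\<lambda>z. G1 (prod.swap z))" using R by blast
      from this[unfolded weak_dy_def, rule_format, OF test_fun_swap[OF T]]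
      show "(\<integral>z. F z * D z (1,0) \<partial>lborel) = - (\<integral>z. G1 z * \<phi> z \<partial>lborel)"
        using sw[OF T] by simp
    qed
  qed
qed

section \<open>Passage to Borel representatives\<close>

lemma weak_gradient_cong_AE:
  assumes "AE z in lborel. F z = F' z" "AE z in lborel. G1 z = G1' z" "AE z in lborel. G2 z = G2' z"
    and [measurable]: "F \<in> borel_measurable lebesgue" "G1 \<in> borel_measurable lebesgue" "G2 \<in> borel_measurable lebesgue"
    "F' \<in> borel_measurable borel" "G1' \<in> borel_measurable borel" "G2' \<in> borel_measurable borel"
    and W: "weak_gradient F G1 G2"
  shows "weak_gradient F' G1' G2'"
  unfolding weak_gradient_def
proof (intro allI impI)
  fix \<phi> D assume T: "test_fun \<phi> D"
  have m: "h \<in> borel_measurable lebesgue" if "h \<in> borel_measurable borel" for h :: "real \<times> real \<Rightarrow> real"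
    using that by (intro measurable_completion) simp
  note [measurable] = test_fun_measurable[OF T, THEN m]
  have [measurable]: "F' \<in> borel_measurable lebesgue" "G1' \<in> borel_measurable lebesgue" "G2' \<in> borel_measurable lebesgue"
    by (auto intro!: m)
  have eq: "(\<integral>z. F z * h z \<partial>lebesgue) = (\<integral>z. F' z * h z \<partial>lebesgue)"
    "(\<integral>z. G1 z * h z \<partial>lebesgue) = (\<integral>z. G1' z * h z \<partial>lebesgue)"
    "(\<integral>z. G2 z * h z \<partial>lebesgue) = (\<integral>z. G2' z * h z \<partial>lebesgue)"
    if [measurable]: "h \<in> borel_measurable lebesgue" for h
    subgoal using assms(1)[THEN AE_completion] by (auto intro!: integral_cong_AE elim!: eventually_mono)
    subgoal using assms(2)[THEN AE_completion] by (auto intro!: integral_cong_AE elim!: eventually_mono)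
    subgoal using assms(3)[THEN AE_completion] by (auto intro!: integral_cong_AE elim!: eventually_mono)
    done
  show "(\<integral>z. F' z * D z (1,0) \<partial>lebesgue) = - (\<integral>z. G1' z * \<phi> z \<partial>lebesgue) \<and>
        (\<integral>z. F' z * D z (0,1) \<partial>lebesgue) = - (\<integral>z. G2' z * \<phi> z \<partial>lebesgue)"
    using W T eq[of "\<lambda>z. D z (1,0)"] eq[of "\<lambda>z. D z (0,1)"] eq[of \<phi>] unfolding weak_gradient_def by simp
qed

text \<open>Measurability of \<open>F\<close> is implicit in \<open>H1\<close>: integrability on a
  ball includes measurability of the restriction, and the restrictions to growing balls are
  eventually equal to \<open>F\<close> at each point.\<close>

lemma loc_int_lebesgue_measurable:
  fixes F :: "real \<times> real \<Rightarrow> real"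
  assumes "\<forall>K. compact K \<longrightarrow> set_integrable lebesgue K F"
  shows "F \<in> borel_measurable lebesgue"
proof (rule borel_measurable_LIMSEQ_real)
  show "(\<lambda>n. indicator (cball 0 (real n)) z * F z) \<longlonglongrightarrow> F z" for z
  proof (rule tendsto_eventually)
    obtain m :: nat where m: "norm z < real m" using reals_Archimedean2 by blast
    show "\<forall>\<^sub>F n in sequentially. indicator (cball 0 (real n)) z * F z = F z"
      using eventually_ge_at_top[of m] by eventually_elim (use m in \<open>auto simp: indicator_def\<close>)
  qed
  show "(\<lambda>z. indicator (cball 0 (real n)) z * F z) \<in> borel_measurable lebesgue" for n
    using assms[rule_format, OF compact_cball, of 0 "real n"]
    by (auto simp: set_integrable_def dest: borel_measurable_integrable)
qed

lemma H1_borel: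
  assumes "H1 F"
  obtains F' G1 G2 where "F' \<in> borel_measurable borel" "G1 \<in> borel_measurable borel" "G2 \<in> borel_measurable borel"
    "AE z in lborel. F z = F' z" "loc_int F'" "sq_int G1" "sq_int G2"
    "weak_dy F' G2" "weak_dy (\<lambda>z. F' (prod.swap z)) (\<lambda>z. G1 (prod.swap z))"
proof -
  from assms obtain g1 g2 where F: "\<forall>K. compact K \<longrightarrow> set_integrable lebesgue K F"
    and g[measurable]: "g1 \<in> borel_measurable lebesgue" "g2 \<in> borel_measurable lebesgue"
    and gi: "integrable lebesgue (\<lambda>z. (g1 z)\<^sup>2)" "integrable lebesgue (\<lambda>z. (g2 z)\<^sup>2)"
    and w: "weak_gradient F g1 g2"
    unfolding H1_def by blast
  have Fm: "F \<in> borel_measurable lebesgue" by (rule loc_int_lebesgue_measurable[OF F])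
  obtain F' where F': "F' \<in> borel_measurable borel" "AE z in lborel. F z = F' z"
    using completion_ex_borel_measurable_real[OF Fm] by auto
  obtain G1 where G1: "G1 \<in> borel_measurable borel" "AE z in lborel. g1 z = G1 z"
    using completion_ex_borel_measurable_real[OF g(1)] by auto
  obtain G2 where G2: "G2 \<in> borel_measurable borel" "AE z in lborel. g2 z = G2 z"
    using completion_ex_borel_measurable_real[OF g(2)] by auto
  have sq: "sq_int G" if "integrable lebesgue (\<lambda>z. (g z)\<^sup>2)" "AE z in lborel. g z = G z" for g G
  proof -
    have "(\<integral>\<^sup>+z. ennreal ((G z)\<^sup>2) \<partial>lborel) = (\<integral>\<^sup>+z. ennreal ((g z)\<^sup>2) \<partial>lborel)"
      using that(2) by (intro nn_integral_cong_AE) (auto elim!: eventually_mono)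
    also have "\<dots> = (\<integral>\<^sup>+z. ennreal ((g z)\<^sup>2) \<partial>lebesgue)" by (simp add: nn_integral_completion)
    also have "\<dots> < \<infinity>" using that(1) by (auto simp: integrable_iff_bounded)
    finally show ?thesis by (simp add: sq_int_def)
  qed
  have loc: "loc_int F'"
    unfolding loc_int_def
  proof (intro allI impI)
    fix K :: "(real \<times> real) set" assume K: "compact K"
    have [measurable]: "K \<in> sets borel" using K by (rule borel_compact)
    have "integrable lebesgue (\<lambda>z. indicator K z *\<^sub>R F z)" using F K by (simp add: set_integrable_def)
    then have "(\<integral>\<^sup>+z. ennreal (norm (indicator K z *\<^sub>R F z)) \<partial>lebesgue) < \<infinity>"
      unfolding integrable_iff_bounded by blast
    also have "(\<integral>\<^sup>+z. ennreal (norm (indicator K z *\<^sub>R F z)) \<partial>lebesgue) = (\<integral>\<^sup>+z. ennreal (norm (indicator K z *\<^sub>R F' z)) \<partial>lborel)"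
      unfolding nn_integral_completion using F'(2) by (intro nn_integral_cong_AE) (auto elim!: eventually_mono)
    finally show "set_integrable lborel K F'"
      unfolding set_integrable_def integrable_iff_bounded using F'(1) by auto
  qed
  have "weak_gradient F' G1 G2"
    using weak_gradient_cong_AE[OF F'(2) G1(2) G2(2) Fm g F'(1) G1(1) G2(1) w] .
  then show thesis
    using that[OF F'(1) G1(1) G2(1) F'(2) loc sq[OF gi(1) G1(2)] sq[OF gi(2) G2(2)]]
    by (simp add: weak_gradient_iff F' G1 G2)
qed

text \<open>Changing \<open>F\<close> on a null set affects the integrals over only a null set of
  slices, and the trace condition inspects only almost every \<open>t\<close>.\<close>

lemma htrace_cong_AE:
  assumes F: "AE z in lborel. F z = F' z" and g: "AE x in lborel. g x = g' x"
  shows "(\<forall>a b. \<forall>e>0. \<exists>\<eta>>0. AE t in lebesgue. \<bar>t\<bar> < \<eta> \<longrightarrow>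
        (\<integral>\<^sup>+ x \<in> {a..b}. ennreal ((F (x, c + t) - g x)\<^sup>2) \<partial>lebesgue) < ennreal e) \<longleftrightarrow> slice_limit F' c g'"
proof -
  have "AE y in lborel. AE x in lborel. F (x, y) = F' (x, y)" by (rule AE_planeD(2)[OF F])
  from AE_affine[of 1 _ c, OF _ this]
  have sl: "AE t in lborel. AE x in lborel. F (x, c + t) = F' (x, c + t)" by simp
  have eq: "AE t in lborel. (\<integral>\<^sup>+ x \<in> {a..b}. ennreal ((F (x, c + t) - g x)\<^sup>2) \<partial>lebesgue) =
     (\<integral>\<^sup>+ x \<in> {a..b}. ennreal ((F' (x, c + t) - g' x)\<^sup>2) \<partial>lborel)" for a b
    using sl
  proof eventually_elim
    case (elim t)
    show ?case
      unfolding nn_integral_completion using elim g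
      by (intro nn_integral_cong_AE) (elim eventually_elim2, auto)
  qed
  have "(AE t in lebesgue. \<bar>t\<bar> < \<eta> \<longrightarrow> (\<integral>\<^sup>+ x \<in> {a..b}. ennreal ((F (x, c + t) - g x)\<^sup>2) \<partial>lebesgue) < ennreal e) \<longleftrightarrow>
    (AE t in lborel. \<bar>t\<bar> < \<eta> \<longrightarrow> (\<integral>\<^sup>+ x \<in> {a..b}. ennreal ((F' (x, c + t) - g' x)\<^sup>2) \<partial>lborel) < ennreal e)" for a b e \<eta>
    unfolding AE_completion_iff using eq[of a b] by (intro eventually_subst) (auto elim!: eventually_mono)
  then show ?thesis unfolding slice_limit_def by simp
qed

lemma loc_sq_int_cong_AE:
  assumes g: "AE x in lborel. g x = g' x"
  shows "(\<forall>a b. (\<integral>\<^sup>+ x \<in> {a..b}. ennreal ((g x)\<^sup>2) \<partial>lebesgue) < \<infinity>) \<longleftrightarrow> loc_sq_int g'"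
proof -
  have "(\<integral>\<^sup>+ x \<in> {a..b}. ennreal ((g x)\<^sup>2) \<partial>lebesgue) = (\<integral>\<^sup>+ x \<in> {a..b}. ennreal ((g' x)\<^sup>2) \<partial>lborel)" for a b
    unfolding nn_integral_completion using g by (intro nn_integral_cong_AE) (auto elim!: eventually_mono)
  then show ?thesis by (simp add: loc_sq_int_def)
qed

text \<open>\<open>u k\<close> and \<open>v j\<close> represent \<open>f\<close> on the horizontal
  and vertical grid lines. Nothing links them at the vertices, since single values are invisible to
  them.\<close>

definition line_data :: "real \<Rightarrow> (real \<times> real \<Rightarrow> real) \<Rightarrow> (int \<Rightarrow> real \<Rightarrow> real) \<Rightarrow> (int \<Rightarrow> real \<Rightarrow> real) \<Rightarrow> bool" where
  "line_data \<delta> f u v \<longleftrightarrow>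
    (\<forall>k. u k \<in> borel_measurable borel \<and> loc_sq_int (u k) \<and> (AE x in lborel. f (x, of_int k * \<delta>) = u k x)) \<and>
    (\<forall>j. v j \<in> borel_measurable borel \<and> loc_sq_int (v j) \<and> (AE y in lborel. f (of_int j * \<delta>, y) = v j y))"

lemma locL2_borel:
  assumes "locL2 g"
  shows "\<exists>g'. g' \<in> borel_measurable borel \<and> loc_sq_int g' \<and> (AE x in lborel. g x = g' x)"
proof -
  have "g \<in> borel_measurable lebesgue" using assms by (simp add: locL2_def)
  from completion_ex_borel_measurable_real[OF this]
  obtain g' where "g' \<in> borel_measurable borel" "AE x in lborel. g x = g' x" by auto
  then show ?thesis using assms loc_sq_int_cong_AE[of g g'] by (auto simp: locL2_def)
qed

lemma gp_locL2_line_data: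
  assumes "gp_locL2 \<delta> f"
  obtains u v where "line_data \<delta> f u v"
proof -
  have "\<forall>k::int. \<exists>u. u \<in> borel_measurable borel \<and> loc_sq_int u \<and> (AE x in lborel. f (x, of_int k * \<delta>) = u x)"
    using assms locL2_borel unfolding gp_locL2_def by blast
  from choice[OF this] obtain u
    where u: "\<forall>k::int. u k \<in> borel_measurable borel \<and> loc_sq_int (u k) \<and> (AE x in lborel. f (x, of_int k * \<delta>) = u k x)" ..
  have "\<forall>k::int. \<exists>u. u \<in> borel_measurable borel \<and> loc_sq_int u \<and> (AE x in lborel. f (of_int k * \<delta>, x) = u x)"
    using assms locL2_borel unfolding gp_locL2_def by blast
  from choice[OF this] obtain v
    where v: "\<forall>k::int. v k \<in> borel_measurable borel \<and> loc_sq_int (v k) \<and> (AE x in lborel. f (of_int k * \<delta>, x) = v k x)" ..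
  show thesis by (rule that[of u v]) (simp only: line_data_def u v simp_thms)
qed

lemma trace_line_rep:
  assumes H: "H1 F" and tr: "gp_trace \<delta> F f" and ld: "line_data \<delta> f u v"
  obtains F' G1 G2 where "F' \<in> borel_measurable borel" "G1 \<in> borel_measurable borel" "G2 \<in> borel_measurable borel"
    "sq_int G1" "sq_int G2" "\<And>k. line_rep F' (of_int k * \<delta>) (u k) G2"
    "\<And>j. line_rep (\<lambda>z. F' (prod.swap z)) (of_int j * \<delta>) (v j) (\<lambda>z. G1 (prod.swap z))"
proof -
  from H1_borel[OF H] obtain F' G1 G2 where m[measurable]: "F' \<in> borel_measurable borel" "G1 \<in> borel_measurable borel" "G2 \<in> borel_measurable borel"
    and ae: "AE z in lborel. F z = F' z" and F': "loc_int F'" and sq: "sq_int G1" "sq_int G2"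
    and w: "weak_dy F' G2" "weak_dy (\<lambda>z. F' (prod.swap z)) (\<lambda>z. G1 (prod.swap z))" by blast
  have h: "line_rep F' (of_int k * \<delta>) (u k) G2" for k
  proof (rule weak_dy_line_rep[OF m(1) m(3) _ F' sq(2) w(1)])
    show "u k \<in> borel_measurable borel" using ld by (simp add: line_data_def)
    show "slice_limit F' (of_int k * \<delta>) (u k)"
      using tr ld htrace_cong_AE[OF ae, of "\<lambda>x. f (x, of_int k * \<delta>)" "u k"]
      unfolding gp_trace_def htrace_def line_data_def by blast
  qed
  have v: "line_rep (\<lambda>z. F' (prod.swap z)) (of_int j * \<delta>) (v j) (\<lambda>z. G1 (prod.swap z))" for j
  proof (rule weak_dy_line_rep[OF _ _ _ loc_int_swap[OF m(1) F'] sq_int_swap[OF m(2) sq(1)] w(2)])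
    show "v j \<in> borel_measurable borel" using ld by (simp add: line_data_def)
    have "AE z in lborel. (\<lambda>(x, y). F (y, x)) z = F' (prod.swap z)"
      using AE_swap[OF ae] by (auto elim!: eventually_mono)
    note cong = htrace_cong_AE[OF this, of "\<lambda>x. f (of_int j * \<delta>, x)" "v j" "of_int j * \<delta>"]
    have "AE y in lborel. f (of_int j * \<delta>, y) = v j y" using ld by (simp add: line_data_def)
    moreover have "vtrace F (of_int j * \<delta>) (\<lambda>y. f (of_int j * \<delta>, y))" using tr by (simp add: gp_trace_def)
    ultimately show "slice_limit (\<lambda>z. F' (prod.swap z)) (of_int j * \<delta>) (v j)"
      using cong unfolding vtrace_def htrace_def by blast
  qed measurable
  show thesis using that[OF m sq h v] .
qed

lemma line_rep_trace:
  assumes ld: "line_data \<delta> f u v" and lf: "gp_locL2 \<delta> f"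
    and m[measurable]: "F \<in> borel_measurable borel" "G1 \<in> borel_measurable borel" "G2 \<in> borel_measurable borel"
    and sq: "sq_int G1" "sq_int G2" and h: "\<And>k. line_rep F (of_int k * \<delta>) (u k) G2"
    and v: "\<And>j. line_rep (\<lambda>z. F (prod.swap z)) (of_int j * \<delta>) (v j) (\<lambda>z. G1 (prod.swap z))"
  shows "H1 F \<and> gp_trace \<delta> F f"
proof
  have ub [measurable]: "u k \<in> borel_measurable borel" "v k \<in> borel_measurable borel" for k
    using ld by (auto simp: line_data_def)
  have uv: "loc_sq_int (u k)" "loc_sq_int (v k)" for k using ld by (auto simp: line_data_def)
  note sq1 = sq_int_swap[OF m(2) sq(1)]
  have lf': "loc_int F" by (rule line_rep_loc_int[OF m(1) m(3) ub(1) sq(2) uv(1) h])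
  have w1: "weak_dy F G2" by (rule line_rep_weak_dy[OF m(1) m(3) ub(1) sq(2) uv(1) h])
  have w2: "weak_dy (\<lambda>z. F (prod.swap z)) (\<lambda>z. G1 (prod.swap z))"
    by (rule line_rep_weak_dy[OF _ _ ub(2) sq1 uv(2) v]) measurable
  have "weak_gradient F G1 G2" using w1 w2 by (simp add: weak_gradient_iff)
  moreover have "set_integrable lebesgue K F" if "compact K" for K
    using lf' that integrable_completion[of "\<lambda>z. indicator K z *\<^sub>R F z" lborel] borel_compact[OF that]
    by (auto simp: loc_int_def set_integrable_def)
  moreover have "integrable lebesgue (\<lambda>z. (G z)\<^sup>2)" if [measurable]: "G \<in> borel_measurable borel" and "sq_int G" for G :: "real \<times> real \<Rightarrow> real"
    using that(2) by (subst integrable_completion) (auto simp: sq_int_def integrable_iff_bounded)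
  ultimately show "H1 F"
    unfolding H1_def using sq by (intro conjI allI impI exI[of _ G1] exI[of _ G2]) (auto intro: measurable_completion)
  show "gp_trace \<delta> F f"
    unfolding gp_trace_def vtrace_def htrace_def
  proof (intro conjI allI)
    fix k :: int
    show "locL2 (\<lambda>x. f (x, of_int k * \<delta>))" "locL2 (\<lambda>y. f (of_int k * \<delta>, y))" using lf by (auto simp: gp_locL2_def)
  next
    have *: "AE z in lborel. F z = F z" "AE z in lborel. (\<lambda>(x, y). F (y, x)) z = F (prod.swap z)" by auto
    fix k :: int
    have "slice_limit F (of_int k * \<delta>) (u k)" by (rule line_rep_slice_limit[OF m(3) sq(2) h])
    with htrace_cong_AE[OF *(1), of "\<lambda>x. f (x, of_int k * \<delta>)" "u k"] ld
    show "e > 0 \<longrightarrow> (\<exists>\<eta>>0. AE t in lebesgue. \<bar>t\<bar> < \<eta> \<longrightarrow>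
        (\<integral>\<^sup>+ x \<in> {a..b}. ennreal ((F (x, of_int k * \<delta> + t) - f (x, of_int k * \<delta>))\<^sup>2) \<partial>lebesgue) < ennreal e)" for a b e
      unfolding line_data_def by blast
    have "slice_limit (\<lambda>z. F (prod.swap z)) (of_int k * \<delta>) (v k)"
      by (rule line_rep_slice_limit[OF _ sq1 v]) measurable
    with htrace_cong_AE[OF *(2), of "\<lambda>x. f (of_int k * \<delta>, x)" "v k"] ld
    show "e > 0 \<longrightarrow> (\<exists>\<eta>>0. AE t in lebesgue. \<bar>t\<bar> < \<eta> \<longrightarrow>
        (\<integral>\<^sup>+ x \<in> {a..b}. ennreal (((\<lambda>(x, y). F (y, x)) (x, of_int k * \<delta> + t) - f (of_int k * \<delta>, x))\<^sup>2) \<partial>lebesgue) < ennreal e)" for a b e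
      unfolding line_data_def by blast
  qed
qed

section \<open>Traces have finite norm\<close>

lemma nn_integral_ennreal_cmult:
  assumes "0 \<le> c" "f \<in> borel_measurable M"
  shows "(\<integral>\<^sup>+x. ennreal (c * f x) \<partial>M) = ennreal c * (\<integral>\<^sup>+x. ennreal (f x) \<partial>M)"
  using assms by (simp add: ennreal_mult' nn_integral_cmult)

lemma nn_integral_inverse_sqrt: "0 \<le> h \<Longrightarrow> (\<integral>\<^sup>+s. ennreal (indicator {0..h} s * s powr (-1/2)) \<partial>lborel) = ennreal (2 * sqrt h)"
  using nn_integral_has_integral_lebesgue[OF _ has_integral_powr_from_0[of "-1/2" h]]
  by (simp add: powr_half_sqrt)

lemma nn_integral_powr_tail: "0 < a \<Longrightarrow> (\<integral>\<^sup>+s. ennreal (indicator {a..} s * s powr (-3/2)) \<partial>lborel) = ennreal (2 * a powr (-1/2))"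
  using nn_integral_has_integral_lebesgue[OF _ has_integral_powr_to_inf[of "-3/2" a]]
  by simp

text \<open>Cauchy--Schwarz with the weights \<open>s powr (-1/2)\<close> and \<open>s powr (1/2)\<close> reduces Hardy's inequality
  to an exchange of integrals.\<close>
lemma hardy:
  fixes g :: "real \<Rightarrow> real"
  assumes [measurable]: "g \<in> borel_measurable borel"
  shows "(\<integral>\<^sup>+h. ennreal (indicator {0<..d} h * ((oint g 0 h)\<^sup>2 / h\<^sup>2)) \<partial>lborel) \<le>
    4 * (\<integral>\<^sup>+s. ennreal (indicator {0..d} s * (g s)\<^sup>2) \<partial>lborel)"
proof -
  have pt: "ennreal (indicator {0<..d} h * ((oint g 0 h)\<^sup>2 / h\<^sup>2)) \<le>
     (\<integral>\<^sup>+s. ennreal (indicator {0<..d} h * (2 * h powr (-3/2)) * (indicator {0<..h} s * (s powr (1/2) * (g s)\<^sup>2))) \<partial>lborel)" for h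
  proof (cases "h \<in> {0<..d}")
    case True
    then have h: "h > 0" by simp
    have "oint g 0 h = (\<integral>s. (indicator {0<..h} s * s powr (-1/2)) * (s powr (1/2) * g s) \<partial>lborel)"
      unfolding oint_def
    proof (rule integral_cong_AE)
      show "AE s in lborel. okern 0 h s * g s = (indicator {0<..h} s * s powr (-1/2)) * (s powr (1/2) * g s)"
        using AE_lborel_singleton[of 0] AE_lborel_singleton[of h]
      proof eventually_elim
        case (elim s)
        have "s powr (-1/2) * (s powr (1/2) * g s) = g s" if "s > 0"
          using that by (simp add: mult.assoc[symmetric] powr_add[symmetric])
        then show ?case using elim h by (auto simp: okern_def indicator_def)
      qed
    qed measurable
    then have "ennreal ((oint g 0 h)\<^sup>2) \<le> (\<integral>\<^sup>+s. ennreal \<bar>indicator {0<..h} s * s powr (-1/2)\<bar> \<partial>lborel) *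
      (\<integral>\<^sup>+s. ennreal (\<bar>indicator {0<..h} s * s powr (-1/2)\<bar> * (s powr (1/2) * g s)\<^sup>2) \<partial>lborel)"
      using integral_square_weighted_le[of "\<lambda>s. indicator {0<..h} s * s powr (-1/2)" lborel "\<lambda>s. s powr (1/2) * g s"] by simp
    also have "(\<integral>\<^sup>+s. ennreal \<bar>indicator {0<..h} s * s powr (-1/2)\<bar> \<partial>lborel) \<le> (\<integral>\<^sup>+s. ennreal (indicator {0..h} s * s powr (-1/2)) \<partial>lborel)"
      by (intro nn_integral_mono ennreal_leI) (auto simp: indicator_def)
    also have "\<dots> = ennreal (2 * sqrt h)" using h by (intro nn_integral_inverse_sqrt) simp
    also have "(\<integral>\<^sup>+s. ennreal (\<bar>indicator {0<..h} s * s powr (-1/2)\<bar> * (s powr (1/2) * g s)\<^sup>2) \<partial>lborel) =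
      (\<integral>\<^sup>+s. ennreal (indicator {0<..h} s * (s powr (1/2) * (g s)\<^sup>2)) \<partial>lborel)"
    proof (intro nn_integral_cong arg_cong[where f=ennreal])
      fix s
      have "s powr (-1/2) * (s powr (1/2) * g s)\<^sup>2 = (s powr (-1/2) * s powr (1/2)) * s powr (1/2) * (g s)\<^sup>2"
        by (simp add: power2_eq_square mult_ac)
      also have "\<dots> = s powr (1/2) * (g s)\<^sup>2" if "s > 0"
        using that by (simp add: powr_add[symmetric])
      finally show "\<bar>indicator {0<..h} s * s powr (-1/2)\<bar> * (s powr (1/2) * g s)\<^sup>2 = indicator {0<..h} s * (s powr (1/2) * (g s)\<^sup>2)"
        by (auto simp: indicator_def)
    qed
    finally have le: "ennreal ((oint g 0 h)\<^sup>2) \<le> ennreal (2 * sqrt h) * (\<integral>\<^sup>+s. ennreal (indicator {0<..h} s * (s powr (1/2) * (g s)\<^sup>2)) \<partial>lborel)"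
      by (simp add: mult_right_mono)
    have "ennreal (indicator {0<..d} h * ((oint g 0 h)\<^sup>2 / h\<^sup>2)) = ennreal (1 / h\<^sup>2) * ennreal ((oint g 0 h)\<^sup>2)"
      using True by (simp add: ennreal_mult[symmetric])
    also have "\<dots> \<le> ennreal (1 / h\<^sup>2) * (ennreal (2 * sqrt h) * (\<integral>\<^sup>+s. ennreal (indicator {0<..h} s * (s powr (1/2) * (g s)\<^sup>2)) \<partial>lborel))"
      by (intro mult_left_mono le) auto
    also have "\<dots> = ennreal (2 * h powr (-3/2)) * (\<integral>\<^sup>+s. ennreal (indicator {0<..h} s * (s powr (1/2) * (g s)\<^sup>2)) \<partial>lborel)"
    proof -
      have "1 / h\<^sup>2 * (2 * sqrt h) = 2 * (h powr (-2) * h powr (1/2))"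
        using h by (simp add: powr_minus powr_half_sqrt field_simps)
      also have "\<dots> = 2 * h powr (-3/2)" by (simp add: powr_add[symmetric])
      finally show ?thesis using h by (simp add: mult.assoc[symmetric] ennreal_mult[symmetric])
    qed
    also have "\<dots> = (\<integral>\<^sup>+s. ennreal (indicator {0<..d} h * (2 * h powr (-3/2)) * (indicator {0<..h} s * (s powr (1/2) * (g s)\<^sup>2))) \<partial>lborel)"
      using True by (subst nn_integral_ennreal_cmult) auto
    finally show ?thesis .
  qed simp
  have "(\<integral>\<^sup>+h. ennreal (indicator {0<..d} h * ((oint g 0 h)\<^sup>2 / h\<^sup>2)) \<partial>lborel) \<le>
    (\<integral>\<^sup>+h. \<integral>\<^sup>+s. ennreal (indicator {0<..d} h * (2 * h powr (-3/2)) * (indicator {0<..h} s * (s powr (1/2) * (g s)\<^sup>2))) \<partial>lborel \<partial>lborel)"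
    by (intro nn_integral_mono pt)
  also have "\<dots> = (\<integral>\<^sup>+s. \<integral>\<^sup>+h. ennreal (indicator {0<..d} h * (2 * h powr (-3/2)) * (indicator {0<..h} s * (s powr (1/2) * (g s)\<^sup>2))) \<partial>lborel \<partial>lborel)"
    by (rule lborel_pair.Fubini') (simp add: indicator_def, measurable)
  \<comment> \<open>For fixed \<open>s\<close> the variable \<open>h\<close> runs above
    \<open>s\<close>; the resulting \<open>2 * s powr (-1/2)\<close> cancels the weight
    \<open>s powr (1/2)\<close>, and the two factors 2 give 4.\<close>
  also have "\<dots> \<le> (\<integral>\<^sup>+s. 4 * ennreal (indicator {0..d} s * (g s)\<^sup>2) \<partial>lborel)"
  proof (rule nn_integral_mono)
    fix s
    show "(\<integral>\<^sup>+h. ennreal (indicator {0<..d} h * (2 * h powr (-3/2)) * (indicator {0<..h} s * (s powr (1/2) * (g s)\<^sup>2))) \<partial>lborel) \<le> 4 * ennreal (indicator {0..d} s * (g s)\<^sup>2)"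
    proof (cases "0 < s \<and> s \<le> d")
      case True
      have "(\<integral>\<^sup>+h. ennreal (indicator {0<..d} h * (2 * h powr (-3/2)) * (indicator {0<..h} s * (s powr (1/2) * (g s)\<^sup>2))) \<partial>lborel) \<le>
        (\<integral>\<^sup>+h. ennreal ((2 * (s powr (1/2) * (g s)\<^sup>2)) * (indicator {s..} h * h powr (-3/2))) \<partial>lborel)"
        using True by (intro nn_integral_mono ennreal_leI) (auto simp: indicator_def)
      also have "\<dots> = ennreal (2 * (s powr (1/2) * (g s)\<^sup>2)) * ennreal (2 * s powr (-1/2))"
        using True nn_integral_powr_tail[of s] by (subst nn_integral_ennreal_cmult) auto
      also have "\<dots> = ennreal (4 * (s powr (1/2) * s powr (-1/2)) * (g s)\<^sup>2)"
        by (subst ennreal_mult[symmetric]) (auto simp: mult_ac)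
      also have "\<dots> = 4 * ennreal (indicator {0..d} s * (g s)\<^sup>2)"
        using True by (simp add: powr_add[symmetric] ennreal_mult)
      finally show ?thesis .
    next
      case False
      then have z: "indicator {0<..d} h * (2 * h powr (-3/2)) * (indicator {0<..h} s * (s powr (1/2) * (g s)\<^sup>2)) = 0" for h
        by (auto simp: indicator_def)
      show ?thesis unfolding z by simp
    qed
  qed
  also have "\<dots> = 4 * (\<integral>\<^sup>+s. ennreal (indicator {0..d} s * (g s)\<^sup>2) \<partial>lborel)"
    by (rule nn_integral_cmult) measurable
  finally show ?thesis .
qed

text \<open>The squared Gagliardo seminorm of order 1/2 on \<open>{0..d}\<close>. On the diagonal
  the quotient is 0 by the convention for division.\<close>

definition gag :: "real \<Rightarrow> (real \<Rightarrow> real) \<Rightarrow> ennreal" where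
  "gag d U = (\<integral>\<^sup>+x. \<integral>\<^sup>+y. ennreal (indicator {0..d} x * indicator {0..d} y * ((U x - U y)\<^sup>2 / (x - y)\<^sup>2)) \<partial>lborel \<partial>lborel)"

text \<open>The mismatch of two edges as functions of the distance to their common vertex. It is
  symmetric and satisfies a triangle inequality, which permits passing from one edge to another
  through a third.\<close>

definition corner :: "real \<Rightarrow> (real \<Rightarrow> real) \<Rightarrow> (real \<Rightarrow> real) \<Rightarrow> ennreal" where
  "corner d U V = (\<integral>\<^sup>+x. ennreal (indicator {0..d} x * ((U x - V x)\<^sup>2 / x)) \<partial>lborel)"

definition energy :: "real \<Rightarrow> (real \<times> real \<Rightarrow> real) \<Rightarrow> ennreal" where
  "energy d P = (\<integral>\<^sup>+z. ennreal (indicator ({0..d} \<times> {0..d}) z * (P z)\<^sup>2) \<partial>lborel)"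

section \<open>Edge and vertex integrals bounded by the energy of one quadrant\<close>

lemma nn_integral_translate:
  fixes f :: "real \<Rightarrow> ennreal"
  assumes "f \<in> borel_measurable borel"
  shows "(\<integral>\<^sup>+x. f (a + x) \<partial>lborel) = (\<integral>\<^sup>+x. f x \<partial>lborel)"
  using nn_integral_real_affine[OF assms, of 1 a] by simp

lemma nn_integral_reflect:
  fixes f :: "real \<Rightarrow> ennreal"
  assumes "f \<in> borel_measurable borel"
  shows "(\<integral>\<^sup>+x. f (a - x) \<partial>lborel) = (\<integral>\<^sup>+x. f x \<partial>lborel)"
  using nn_integral_real_affine[OF assms, of "-1" a] by simp

text \<open>With \<open>y = x + h\<close>, the symmetry of \<open>f\<close> and a translation in
  \<open>x\<close> show that \<open>h\<close> and \<open>- h\<close> contribute equally. The point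
  of this form is that the difference \<open>h\<close> becomes available as a height in
  \<open>gag_le_energy\<close>.\<close>

lemma nn_integral_symmetric_plane:
  fixes f :: "real \<Rightarrow> real \<Rightarrow> ennreal"
  assumes [measurable]: "(\<lambda>(x, y). f x y) \<in> borel_measurable (borel \<Otimes>\<^sub>M borel)"
    and sym: "\<And>x y. f x y = f y x"
  shows "(\<integral>\<^sup>+x. \<integral>\<^sup>+y. f x y \<partial>lborel \<partial>lborel) = 2 * (\<integral>\<^sup>+h. \<integral>\<^sup>+x. indicator {0<..} h * f x (x + h) \<partial>lborel \<partial>lborel)"
proof -
  have m: "(\<lambda>(x, y). f x y) \<in> borel_measurable (lborel \<Otimes>\<^sub>M lborel)"
    using assms(1) by (simp cong: measurable_cong_sets)
  note [measurable] = m
  let ?J = "\<lambda>h. \<integral>\<^sup>+x. f x (x + h) \<partial>lborel"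
  have [measurable]: "?J \<in> borel_measurable borel" by measurable
  have J: "?J (- h) = ?J h" for h
  proof -
    have "?J (- h) = (\<integral>\<^sup>+x. f (h + x) (h + x + - h) \<partial>lborel)"
      by (subst nn_integral_translate[where a=h, symmetric]) auto
    also have "\<dots> = ?J h"
    proof (rule nn_integral_cong)
      show "f (h + x) (h + x + - h) = f x (x + h)" for x using sym[of "h + x" x] by (simp add: add.commute)
    qed
    finally show ?thesis .
  qed
  have "(\<integral>\<^sup>+x. \<integral>\<^sup>+y. f x y \<partial>lborel \<partial>lborel) = (\<integral>\<^sup>+x. \<integral>\<^sup>+h. f x (x + h) \<partial>lborel \<partial>lborel)"
    by (intro nn_integral_cong nn_integral_translate[symmetric]) measurable
  also have "\<dots> = (\<integral>\<^sup>+h. ?J h \<partial>lborel)"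
    by (rule lborel_pair.Fubini'[symmetric]) measurable
  also have "\<dots> = (\<integral>\<^sup>+h. indicator {0<..} h * ?J h + indicator {0<..} (- h) * ?J h \<partial>lborel)"
    using AE_lborel_singleton[of 0] by (intro nn_integral_cong_AE) (auto elim!: eventually_mono simp: indicator_def)
  also have "\<dots> = (\<integral>\<^sup>+h. indicator {0<..} h * ?J h \<partial>lborel) + (\<integral>\<^sup>+h. indicator {0<..} (- h) * ?J h \<partial>lborel)"
    by (rule nn_integral_add) measurable
  also have "(\<integral>\<^sup>+h. indicator {0<..} (- h) * ?J h \<partial>lborel) = (\<integral>\<^sup>+h. indicator {0<..} h * ?J h \<partial>lborel)"
    using nn_integral_reflect[of "\<lambda>h. indicator {0<..} h * ?J h" 0] by (simp add: J[simplified])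
  finally show ?thesis by (simp add: mult_2 nn_integral_cmult)
qed

lemma power2_sum3_le: "(a + b + c)\<^sup>2 \<le> 3 * a\<^sup>2 + 3 * b\<^sup>2 + 3 * (c::real)\<^sup>2"
proof -
  have "0 \<le> (a - b)\<^sup>2 + (b - c)\<^sup>2 + (a - c)\<^sup>2" by simp
  then show ?thesis by (simp add: power2_eq_square algebra_simps)
qed

lemma energy_iterated:
  assumes [measurable]: "P \<in> borel_measurable borel"
  shows "energy d P = (\<integral>\<^sup>+x. \<integral>\<^sup>+y. ennreal (indicator {0..d} x * indicator {0..d} y * (P (x, y))\<^sup>2) \<partial>lborel \<partial>lborel)"
    "energy d P = (\<integral>\<^sup>+y. \<integral>\<^sup>+x. ennreal (indicator {0..d} x * indicator {0..d} y * (P (x, y))\<^sup>2) \<partial>lborel \<partial>lborel)"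
proof -
  have [measurable]: "{0..d} \<times> {0..d} \<in> sets (borel :: (real \<times> real) measure)" by (intro borel_closed closed_Times) auto
  show "energy d P = (\<integral>\<^sup>+x. \<integral>\<^sup>+y. ennreal (indicator {0..d} x * indicator {0..d} y * (P (x, y))\<^sup>2) \<partial>lborel \<partial>lborel)"
    "energy d P = (\<integral>\<^sup>+y. \<integral>\<^sup>+x. ennreal (indicator {0..d} x * indicator {0..d} y * (P (x, y))\<^sup>2) \<partial>lborel \<partial>lborel)"
    unfolding energy_def
    by (subst nn_integral_plane(1) nn_integral_plane(2), simp_all add: indicator_times)+
qed

lemma nn_integral_okern_start:
  assumes "0 \<le> h"
  shows "(\<integral>\<^sup>+x. ennreal \<bar>okern x (x + h) s\<bar> \<partial>lborel) = ennreal h"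
proof -
  have "(\<integral>\<^sup>+x. ennreal \<bar>okern x (x + h) s\<bar> \<partial>lborel) = (\<integral>\<^sup>+x. indicator {s - h<..s} x \<partial>lborel)"
    using assms by (intro nn_integral_cong) (auto simp: okern_def indicator_def)
  then show ?thesis using assms by simp
qed

lemma ennreal_3_sum:
  "0 \<le> a \<Longrightarrow> 0 \<le> b \<Longrightarrow> 0 \<le> c \<Longrightarrow> ennreal (3 * a + 3 * b + 3 * c) = 3 * ennreal a + 3 * ennreal b + 3 * ennreal c"
  by (simp add: ennreal_mult)

text \<open>The two vertical pieces are Hardy integrals of \<open>Q\<close>. The horizontal piece
  costs a length \<open>h\<close> by Cauchy-Schwarz, which reduces the weight to
  \<open>1 / h\<close>; each \<open>s\<close> lies in \<open>{x..x + h}\<close> for \<open>x\<close>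
  in a set of length \<open>h\<close>, which removes the rest. The constant 48 comes from 2 for the
  symmetry, 3 for the three-term square, two vertical pieces, and Hardy's 4.\<close>

lemma gag_le_energy:
  assumes [measurable]: "U \<in> borel_measurable borel" "V \<in> borel_measurable borel"
    "P \<in> borel_measurable borel" "Q \<in> borel_measurable (borel :: (real \<times> real) measure)"
    and P: "sq_int P"
    and id: "AE z in lborel. U (fst z) + oint (\<lambda>s. Q (fst z, s)) 0 (snd z) = V (snd z) + oint (\<lambda>s. P (s, snd z)) 0 (fst z)"
  shows "gag d U \<le> 48 * (energy d P + energy d Q)"
proof -
  define f where "f x y = ennreal (indicator {0..d} x * indicator {0..d} y * ((U x - U y)\<^sup>2 / (x - y)\<^sup>2))" for x y
  define k1 where "k1 h x = ennreal (indicator {0<..d} h * indicator {0..d} x * ((oint (\<lambda>s. Q (x, s)) 0 h)\<^sup>2 / h\<^sup>2))" for h x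
  define k3 where "k3 h x = ennreal (indicator {0<..d} h * indicator {0..d} x * indicator {0..d} (x + h) * ((oint (\<lambda>s. P (s, h)) x (x + h))\<^sup>2 / h\<^sup>2))" for h x
  have fm: "(\<lambda>(x, y). f x y) \<in> borel_measurable (borel \<Otimes>\<^sub>M borel)" unfolding f_def by measurable
  have k1m [measurable]: "(\<lambda>(h, x). k1 h x) \<in> borel_measurable (borel \<Otimes>\<^sub>M borel)" unfolding k1_def by measurable
  have k1m' [measurable]: "k1 h \<in> borel_measurable borel" for h unfolding k1_def by measurable
  have k3m [measurable]: "k3 h \<in> borel_measurable borel" for h unfolding k3_def by measurable
  have k3i [measurable]: "(\<lambda>h. \<integral>\<^sup>+x. k3 h x \<partial>lborel) \<in> borel_measurable borel" unfolding k3_def by measurable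
  have k1i [measurable]: "(\<lambda>h. \<integral>\<^sup>+x. k1 h x \<partial>lborel) \<in> borel_measurable borel" unfolding k1_def by measurable
  have A1: "AE h in lborel. AE x in lborel. U x + oint (\<lambda>s. Q (x, s)) 0 h = V h + oint (\<lambda>s. P (s, h)) 0 x"
    using AE_planeD(2)[OF id] by simp
  have A2: "AE h in lborel. AE x in lborel. U (h + x) + oint (\<lambda>s. Q (h + x, s)) 0 h = V h + oint (\<lambda>s. P (s, h)) 0 (h + x)"
    using A1
  proof eventually_elim
    case (elim h)
    from AE_affine[of 1 _ h, OF _ elim] show ?case by simp
  qed
  \<comment> \<open>Finite energy on almost every horizontal line makes \<open>P\<close> integrable
    on bounded parts of it, as the additivity of \<open>oint\<close> in \<open>tr\<close>
    requires.\<close>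
  have A3: "AE h in lborel. (\<integral>\<^sup>+x. ennreal ((P (x, h))\<^sup>2) \<partial>lborel) < \<infinity>"
    by (rule sq_int_AE_section(2)[OF _ P]) measurable
  have "gag d U = (\<integral>\<^sup>+x. \<integral>\<^sup>+y. f x y \<partial>lborel \<partial>lborel)" by (simp add: gag_def f_def)
  also have "\<dots> = 2 * (\<integral>\<^sup>+h. \<integral>\<^sup>+x. indicator {0<..} h * f x (x + h) \<partial>lborel \<partial>lborel)"
    by (rule nn_integral_symmetric_plane[OF fm]) (simp add: f_def power2_commute mult_ac)
  also have "(\<integral>\<^sup>+h. \<integral>\<^sup>+x. indicator {0<..} h * f x (x + h) \<partial>lborel \<partial>lborel) \<le>
    (\<integral>\<^sup>+h. 3 * (\<integral>\<^sup>+x. k1 h x \<partial>lborel) + 3 * (\<integral>\<^sup>+x. k1 h (h + x) \<partial>lborel) + 3 * (\<integral>\<^sup>+x. k3 h x \<partial>lborel) \<partial>lborel)"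
    using A1 A2 A3
  proof (intro nn_integral_mono_AE, eventually_elim)
    case (elim h)
    have "(\<integral>\<^sup>+x. indicator {0<..} h * f x (x + h) \<partial>lborel) \<le>
      (\<integral>\<^sup>+x. 3 * k1 h x + 3 * k1 h (h + x) + 3 * k3 h x \<partial>lborel)"
      using elim(4,5)
    proof (intro nn_integral_mono_AE, eventually_elim)
      case (elim x)
      show ?case
      proof (cases "0 < h \<and> 0 \<le> x \<and> x + h \<le> d")
        case True
        define I where "I = {min 0 (min x (x+h))..max 0 (max x (x+h))}"
        have si: "set_integrable lborel I (\<lambda>s. P (s, h))"
          unfolding I_def using \<open>(\<integral>\<^sup>+x. ennreal ((P (x, h))\<^sup>2) \<partial>lborel) < \<infinity>\<close> by (intro sq_fin_set_integrable') auto
        have tr: "oint (\<lambda>s. P (s, h)) 0 x + oint (\<lambda>s. P (s, h)) x (x + h) = oint (\<lambda>s. P (s, h)) 0 (x + h)"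
          using si unfolding I_def by (intro oint_trans integrable_okern[where a="min 0 (min x (x+h))" and b="max 0 (max x (x+h))"]) auto
        define q1 where "q1 = oint (\<lambda>s. Q (x, s)) 0 h"
        define q2 where "q2 = oint (\<lambda>s. Q (h + x, s)) 0 h"
        define p where "p = oint (\<lambda>s. P (s, h)) x (x + h)"
        \<comment> \<open>Up from \<open>x\<close>, across at height \<open>h\<close>, down to
          \<open>x + h\<close>; the common value \<open>V h\<close> cancels.\<close>
        have "U x - U (x + h) = - q1 + q2 + (- p)"
          using elim tr unfolding q1_def q2_def p_def by (simp add: add.commute)
        then have "(U x - U (x + h))\<^sup>2 \<le> 3 * q1\<^sup>2 + 3 * q2\<^sup>2 + 3 * p\<^sup>2"
          using power2_sum3_le[of "-q1" q2 "-p"] by simp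
        then have "(U x - U (x + h))\<^sup>2 / h\<^sup>2 \<le> (3 * q1\<^sup>2 + 3 * q2\<^sup>2 + 3 * p\<^sup>2) / h\<^sup>2"
          by (intro divide_right_mono) auto
        then have "ennreal ((U x - U (x + h))\<^sup>2 / h\<^sup>2) \<le> ennreal (3 * (q1\<^sup>2 / h\<^sup>2) + 3 * (q2\<^sup>2 / h\<^sup>2) + 3 * (p\<^sup>2 / h\<^sup>2))"
          by (intro ennreal_leI) (simp add: add_divide_distrib)
        also have "\<dots> = 3 * k1 h x + 3 * k1 h (h + x) + 3 * k3 h x"
          using True unfolding k1_def k3_def q1_def[symmetric] q2_def[symmetric] p_def[symmetric]
          by (subst ennreal_3_sum) (simp_all add: add.commute[of h x])
        also have "ennreal ((U x - U (x + h))\<^sup>2 / h\<^sup>2) = indicator {0<..} h * f x (x + h)"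
          using True by (simp add: f_def)
        finally show ?thesis .
      next
        case False
        then have z: "indicator {0<..} h * f x (x + h) = 0" by (auto simp: f_def indicator_def)
        show ?thesis unfolding z by simp
      qed
    qed
    also have "\<dots> = 3 * (\<integral>\<^sup>+x. k1 h x \<partial>lborel) + 3 * (\<integral>\<^sup>+x. k1 h (h + x) \<partial>lborel) + 3 * (\<integral>\<^sup>+x. k3 h x \<partial>lborel)"
      by (simp add: nn_integral_add nn_integral_cmult)
    finally show ?case .
  qed
  \<comment> \<open>The vertical terms at \<open>x\<close> and at \<open>x + h\<close> are
    translates of each other, so their integrals over \<open>x\<close> agree.\<close>
  also have "\<dots> = (\<integral>\<^sup>+h. 6 * (\<integral>\<^sup>+x. k1 h x \<partial>lborel) + 3 * (\<integral>\<^sup>+x. k3 h x \<partial>lborel) \<partial>lborel)"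
    by (simp add: nn_integral_translate distrib_right[symmetric])
  also have "\<dots> = 6 * (\<integral>\<^sup>+h. \<integral>\<^sup>+x. k1 h x \<partial>lborel \<partial>lborel) + 3 * (\<integral>\<^sup>+h. \<integral>\<^sup>+x. k3 h x \<partial>lborel \<partial>lborel)"
    by (simp add: nn_integral_add nn_integral_cmult)
  also have "(\<integral>\<^sup>+h. \<integral>\<^sup>+x. k1 h x \<partial>lborel \<partial>lborel) = (\<integral>\<^sup>+x. \<integral>\<^sup>+h. k1 h x \<partial>lborel \<partial>lborel)"
    using k1m by (intro lborel_pair.Fubini'[symmetric]) (simp add: k1_def, measurable)
  also have "\<dots> \<le> (\<integral>\<^sup>+x. 4 * (\<integral>\<^sup>+s. ennreal (indicator {0..d} x * indicator {0..d} s * (Q (x, s))\<^sup>2) \<partial>lborel) \<partial>lborel)"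
  proof (rule nn_integral_mono)
    fix x
    show "(\<integral>\<^sup>+h. k1 h x \<partial>lborel) \<le> 4 * (\<integral>\<^sup>+s. ennreal (indicator {0..d} x * indicator {0..d} s * (Q (x, s))\<^sup>2) \<partial>lborel)"
      using hardy[of "\<lambda>s. Q (x, s)" d] by (cases "x \<in> {0..d}") (simp_all add: k1_def)
  qed
  also have "\<dots> = 4 * energy d Q"
    by (subst nn_integral_cmult) (simp_all add: energy_iterated(1))
  also have "(\<integral>\<^sup>+h. \<integral>\<^sup>+x. k3 h x \<partial>lborel \<partial>lborel) \<le>
    (\<integral>\<^sup>+h. \<integral>\<^sup>+s. ennreal (indicator {0..d} s * indicator {0..d} h * (P (s, h))\<^sup>2) \<partial>lborel \<partial>lborel)"
  proof (rule nn_integral_mono)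
    fix h
    show "(\<integral>\<^sup>+x. k3 h x \<partial>lborel) \<le> (\<integral>\<^sup>+s. ennreal (indicator {0..d} s * indicator {0..d} h * (P (s, h))\<^sup>2) \<partial>lborel)"
    proof (cases "h \<in> {0<..d}")
      case True
      have "(\<integral>\<^sup>+x. k3 h x \<partial>lborel) \<le> (\<integral>\<^sup>+x. \<integral>\<^sup>+s. ennreal (1 / h * (\<bar>okern x (x + h) s\<bar> * (indicator {0..d} s * (P (s, h))\<^sup>2))) \<partial>lborel \<partial>lborel)"
      proof (rule nn_integral_mono)
        fix x
        show "k3 h x \<le> (\<integral>\<^sup>+s. ennreal (1 / h * (\<bar>okern x (x + h) s\<bar> * (indicator {0..d} s * (P (s, h))\<^sup>2))) \<partial>lborel)"
        proof (cases "0 \<le> x \<and> x + h \<le> d")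
          case x: True
          have "k3 h x = ennreal (1 / h\<^sup>2) * ennreal ((oint (\<lambda>s. P (s, h)) x (x + h))\<^sup>2)"
            using True x by (simp add: k3_def ennreal_mult[symmetric])
          also have "\<dots> \<le> ennreal (1 / h\<^sup>2) * (ennreal \<bar>x + h - x\<bar> * (\<integral>\<^sup>+s. ennreal (\<bar>okern x (x + h) s\<bar> * (P (s, h))\<^sup>2) \<partial>lborel))"
            by (intro mult_left_mono oint_square_le) auto
          also have "\<dots> = ennreal (1 / h) * (\<integral>\<^sup>+s. ennreal (\<bar>okern x (x + h) s\<bar> * (P (s, h))\<^sup>2) \<partial>lborel)"
            using True by (simp add: mult.assoc[symmetric] ennreal_mult[symmetric] power2_eq_square)
          also have "(\<integral>\<^sup>+s. ennreal (\<bar>okern x (x + h) s\<bar> * (P (s, h))\<^sup>2) \<partial>lborel) =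
            (\<integral>\<^sup>+s. ennreal (\<bar>okern x (x + h) s\<bar> * (indicator {0..d} s * (P (s, h))\<^sup>2)) \<partial>lborel)"
            using x True by (intro nn_integral_cong) (auto simp: okern_def indicator_def)
          also have "ennreal (1 / h) * \<dots> = (\<integral>\<^sup>+s. ennreal (1 / h * (\<bar>okern x (x + h) s\<bar> * (indicator {0..d} s * (P (s, h))\<^sup>2))) \<partial>lborel)"
            using True by (intro nn_integral_ennreal_cmult[symmetric]) auto
          finally show ?thesis .
        qed (auto simp: k3_def indicator_def)
      qed
      also have "\<dots> = (\<integral>\<^sup>+s. \<integral>\<^sup>+x. ennreal (1 / h * (\<bar>okern x (x + h) s\<bar> * (indicator {0..d} s * (P (s, h))\<^sup>2))) \<partial>lborel \<partial>lborel)"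
        by (rule lborel_pair.Fubini'[symmetric]) measurable
      also have "\<dots> = (\<integral>\<^sup>+s. ennreal (indicator {0..d} s * indicator {0..d} h * (P (s, h))\<^sup>2) \<partial>lborel)"
      proof (rule nn_integral_cong)
        fix s
        have "(\<integral>\<^sup>+x. ennreal (1 / h * (\<bar>okern x (x + h) s\<bar> * (indicator {0..d} s * (P (s, h))\<^sup>2))) \<partial>lborel) =
          (\<integral>\<^sup>+x. ennreal ((1 / h * (indicator {0..d} s * (P (s, h))\<^sup>2)) * \<bar>okern x (x + h) s\<bar>) \<partial>lborel)"
          by (simp add: mult_ac)
        also have "\<dots> = ennreal (1 / h * (indicator {0..d} s * (P (s, h))\<^sup>2)) * ennreal h"
          using True by (subst nn_integral_ennreal_cmult) (auto simp: nn_integral_okern_start)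
        also have "\<dots> = ennreal (indicator {0..d} s * indicator {0..d} h * (P (s, h))\<^sup>2)"
          using True by (simp add: ennreal_mult[symmetric])
        finally show "(\<integral>\<^sup>+x. ennreal (1 / h * (\<bar>okern x (x + h) s\<bar> * (indicator {0..d} s * (P (s, h))\<^sup>2))) \<partial>lborel) =
          ennreal (indicator {0..d} s * indicator {0..d} h * (P (s, h))\<^sup>2)" .
      qed
      finally show ?thesis .
    qed (auto simp: k3_def indicator_def)
  qed
  also have "\<dots> = energy d P" by (simp add: energy_iterated(2))
  finally have "gag d U \<le> 2 * (6 * (4 * energy d Q) + 3 * energy d P)"
    by (simp add: add_mono mult_left_mono)
  also have "\<dots> = 6 * energy d P + 48 * energy d Q" by (simp add: distrib_left add.commute mult.assoc[symmetric])
  also have "\<dots> \<le> 48 * energy d P + 48 * energy d Q" by (intro add_mono mult_right_mono) auto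
  finally show ?thesis by (simp add: distrib_left)
qed

lemma ennreal_8_sum:
  "0 \<le> a \<Longrightarrow> 0 \<le> b \<Longrightarrow> 0 \<le> c \<Longrightarrow> ennreal (a + 8 * b + 8 * c) = ennreal a + 8 * ennreal b + 8 * ennreal c"
  by (simp add: ennreal_mult)

text \<open>An indicator whose end points may vary too: as a conditional it is visibly measurable in
  all three arguments together.\<close>

definition ind_cc :: "real \<Rightarrow> real \<Rightarrow> real \<Rightarrow> real" where
  "ind_cc a b x = (if a \<le> x \<and> x \<le> b then 1 else 0)"

lemma ind_cc_measurable [measurable (raw)]:
  assumes [measurable]: "a \<in> borel_measurable M" "b \<in> borel_measurable M" "x \<in> borel_measurable M"
  shows "(\<lambda>z. ind_cc (a z) (b z) (x z)) \<in> borel_measurable M"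
  unfolding ind_cc_def by measurable

lemma nn_integral_ind_cc: "a \<le> b \<Longrightarrow> (\<integral>\<^sup>+x. ennreal (ind_cc a b x) \<partial>lborel) = ennreal (b - a)"
proof -
  have "ind_cc a b x = indicator {a..b} x" for x by (auto simp: ind_cc_def indicator_def)
  then show "a \<le> b \<Longrightarrow> ?thesis" by (simp add: ennreal_indicator)
qed

text \<open>Insert \<open>V y\<close> between \<open>U x\<close> and \<open>V x\<close>. The part
  \<open>V y - V x\<close> is a Gagliardo difference, since
  \<open>\<bar>x - y\<bar> \<le> x / 2\<close>; the part \<open>U x - V y\<close> is given by
  \<open>id\<close> as a difference of integrals of \<open>P\<close> and \<open>Q\<close> over
  segments of length at most \<open>x\<close>.\<close>

lemma corner_le_energy:
  assumes [measurable]: "U \<in> borel_measurable borel" "V \<in> borel_measurable borel"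
    "P \<in> borel_measurable borel" "Q \<in> borel_measurable (borel :: (real \<times> real) measure)"
    and id: "AE z in lborel. U (fst z) + oint (\<lambda>s. Q (fst z, s)) 0 (snd z) = V (snd z) + oint (\<lambda>s. P (s, snd z)) 0 (fst z)"
  shows "corner d U V \<le> gag d V + 8 * (energy d P + energy d Q)"
proof -
  let ?A = "\<lambda>x y. indicator {0<..d} x * ind_cc (x/2) x y :: real"
  define M1 where "M1 y = (\<integral>\<^sup>+s. ennreal (indicator {0..d} s * (P (s, y))\<^sup>2) \<partial>lborel)" for y
  define M2 where "M2 x = (\<integral>\<^sup>+s. ennreal (indicator {0..d} s * (Q (x, s))\<^sup>2) \<partial>lborel)" for x
  have [measurable]: "M1 \<in> borel_measurable borel" "M2 \<in> borel_measurable borel" unfolding M1_def M2_def by measurable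
  let ?gV = "\<lambda>x y. ennreal (indicator {0..d} x * indicator {0..d} y * ((V x - V y)\<^sup>2 / (x - y)\<^sup>2))"
  \<comment> \<open>The range of \<open>y\<close> is read as the range of \<open>x\<close> between
    \<open>y\<close> and \<open>2 * y\<close>, and \<open>1 / x\<close> is bounded by
    \<open>1 / y\<close>. After the exchange of integrals the inner integral over \<open>x\<close>
    is then at most 1.\<close>
  let ?k1 = "\<lambda>x y. ennreal (indicator {0..d} y * ind_cc y (2*y) x / y) * M1 y"
  let ?k2 = "\<lambda>x y. ennreal (indicator {0<..d} x * ind_cc (x/2) x y / x) * M2 x"
  have P2: "ennreal ((oint (\<lambda>s. P (s, y)) 0 x)\<^sup>2) \<le> ennreal x * M1 y" if "0 < x" "x \<le> d" for x y
  proof -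
    have "ennreal ((oint (\<lambda>s. P (s, y)) 0 x)\<^sup>2) \<le> ennreal \<bar>x - 0\<bar> * (\<integral>\<^sup>+s. ennreal (\<bar>okern 0 x s\<bar> * (P (s, y))\<^sup>2) \<partial>lborel)"
      by (rule oint_square_le) measurable
    also have "\<dots> \<le> ennreal x * M1 y"
      unfolding M1_def using that by (intro mult_mono nn_integral_mono ennreal_leI mult_right_mono) (auto simp: okern_def indicator_def)
    finally show ?thesis .
  qed
  have Q2: "ennreal ((oint (\<lambda>s. Q (x, s)) 0 y)\<^sup>2) \<le> ennreal y * M2 x" if "0 < y" "y \<le> d" for x y
  proof -
    have "ennreal ((oint (\<lambda>s. Q (x, s)) 0 y)\<^sup>2) \<le> ennreal \<bar>y - 0\<bar> * (\<integral>\<^sup>+s. ennreal (\<bar>okern 0 y s\<bar> * (Q (x, s))\<^sup>2) \<partial>lborel)"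
      by (rule oint_square_le) measurable
    also have "\<dots> \<le> ennreal y * M2 x"
      unfolding M2_def using that by (intro mult_mono nn_integral_mono ennreal_leI mult_right_mono) (auto simp: okern_def indicator_def)
    finally show ?thesis .
  qed
  \<comment> \<open>The factor \<open>2 / x\<close> normalises the mean over an interval of length
    \<open>x / 2\<close>; the other \<open>1 / x\<close> is the weight of
    \<open>corner\<close>.\<close>
  have "corner d U V \<le> (\<integral>\<^sup>+x. \<integral>\<^sup>+y. ennreal (?A x y * (2 * (U x - V x)\<^sup>2 / x\<^sup>2)) \<partial>lborel \<partial>lborel)"
    unfolding corner_def
  proof (rule nn_integral_mono)
    fix x
    show "ennreal (indicator {0..d} x * ((U x - V x)\<^sup>2 / x)) \<le> (\<integral>\<^sup>+y. ennreal (?A x y * (2 * (U x - V x)\<^sup>2 / x\<^sup>2)) \<partial>lborel)"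
    proof (cases "x \<in> {0<..d}")
      case True
      have "(\<integral>\<^sup>+y. ennreal (?A x y * (2 * (U x - V x)\<^sup>2 / x\<^sup>2)) \<partial>lborel) =
        (\<integral>\<^sup>+y. ennreal (2 * (U x - V x)\<^sup>2 / x\<^sup>2 * ind_cc (x/2) x y) \<partial>lborel)"
        using True by (simp add: mult_ac)
      also have "\<dots> = ennreal (2 * (U x - V x)\<^sup>2 / x\<^sup>2) * ennreal (x / 2)"
        using True by (subst nn_integral_ennreal_cmult) (auto simp: nn_integral_ind_cc)
      also have "\<dots> = ennreal (2 * (U x - V x)\<^sup>2 / x\<^sup>2 * (x / 2))"
        using True by (subst ennreal_mult[symmetric]) auto
      also have "2 * (U x - V x)\<^sup>2 / x\<^sup>2 * (x / 2) = indicator {0..d} x * ((U x - V x)\<^sup>2 / x)"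
        using True by (simp add: power2_eq_square field_simps)
      finally show ?thesis by simp
    next
      case False
      then have z: "indicator {0..d} x * ((U x - V x)\<^sup>2 / x) = 0" by (auto simp: indicator_def)
      show ?thesis unfolding z by simp
    qed
  qed
  also have "\<dots> \<le> (\<integral>\<^sup>+x. \<integral>\<^sup>+y. ?gV x y + 8 * ?k1 x y + 8 * ?k2 x y \<partial>lborel \<partial>lborel)"
    using AE_planeD(1)[OF id]
  proof (intro nn_integral_mono_AE, eventually_elim)
    case (elim x)
    then show ?case
    proof (intro nn_integral_mono_AE, eventually_elim)
      case (elim y)
      show ?case
      proof (cases "0 < x \<and> x \<le> d \<and> x / 2 \<le> y \<and> y \<le> x")
        case True
        define p where "p = oint (\<lambda>s. P (s, y)) 0 x"
        define q where "q = oint (\<lambda>s. Q (x, s)) 0 y"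
        have y: "0 < y" "y \<le> d" "0 < x" using True by auto
        have UV: "U x - V y = p + - q" using elim by (simp add: p_def q_def)
        have "(U x - V x)\<^sup>2 \<le> 2 * (V y - V x)\<^sup>2 + 2 * (U x - V y)\<^sup>2"
          using power2_sum_le[of "V y - V x" "U x - V y"] by (simp add: algebra_simps)
        also have "(U x - V y)\<^sup>2 \<le> 2 * p\<^sup>2 + 2 * q\<^sup>2" unfolding UV using power2_sum_le[of p "-q"] by simp
        finally have "(U x - V x)\<^sup>2 \<le> 2 * (V x - V y)\<^sup>2 + 4 * p\<^sup>2 + 4 * q\<^sup>2" by (simp add: power2_commute)
        then have "2 * (U x - V x)\<^sup>2 / x\<^sup>2 \<le> (4 * (V x - V y)\<^sup>2 + 8 * p\<^sup>2 + 8 * q\<^sup>2) / x\<^sup>2"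
          by (intro divide_right_mono) auto
        also have "\<dots> = 4 * (V x - V y)\<^sup>2 / x\<^sup>2 + 8 * (p\<^sup>2 / x\<^sup>2) + 8 * (q\<^sup>2 / x\<^sup>2)"
          by (simp add: add_divide_distrib)
        also have "4 * (V x - V y)\<^sup>2 / x\<^sup>2 \<le> (V x - V y)\<^sup>2 / (x - y)\<^sup>2"
        proof (cases "x = y")
          case False
          have "(2 * (x - y))\<^sup>2 \<le> x\<^sup>2" using True by (intro power_mono) auto
          then have "4 * (x - y)\<^sup>2 \<le> x\<^sup>2" unfolding power_mult_distrib by simp
          then have "(V x - V y)\<^sup>2 * (4 * (x - y)\<^sup>2) \<le> (V x - V y)\<^sup>2 * x\<^sup>2" by (intro mult_left_mono) auto
          moreover have "0 < x\<^sup>2" "0 < (x - y)\<^sup>2" using y False by auto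
          ultimately show ?thesis by (simp add: field_simps)
        qed simp
        finally have "2 * (U x - V x)\<^sup>2 / x\<^sup>2 \<le> (V x - V y)\<^sup>2 / (x - y)\<^sup>2 + 8 * (p\<^sup>2 / x\<^sup>2) + 8 * (q\<^sup>2 / x\<^sup>2)"
          by simp
        then have "ennreal (2 * (U x - V x)\<^sup>2 / x\<^sup>2) \<le> ennreal ((V x - V y)\<^sup>2 / (x - y)\<^sup>2 + 8 * (p\<^sup>2 / x\<^sup>2) + 8 * (q\<^sup>2 / x\<^sup>2))"
          by (rule ennreal_leI)
        also have "\<dots> = ennreal ((V x - V y)\<^sup>2 / (x - y)\<^sup>2) + 8 * (ennreal (1 / x\<^sup>2) * ennreal (p\<^sup>2)) + 8 * (ennreal (1 / x\<^sup>2) * ennreal (q\<^sup>2))"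
          by (subst ennreal_8_sum) (simp_all add: ennreal_mult[symmetric])
        also have "\<dots> \<le> ?gV x y + 8 * ?k1 x y + 8 * ?k2 x y"
        proof (intro add_mono mult_left_mono)
          show "ennreal ((V x - V y)\<^sup>2 / (x - y)\<^sup>2) \<le> ?gV x y" using True y by simp
          have "ennreal (1 / x\<^sup>2) * ennreal (p\<^sup>2) \<le> ennreal (1 / x\<^sup>2) * (ennreal x * M1 y)"
            unfolding p_def using True by (intro mult_left_mono P2) auto
          also have "\<dots> = ennreal (1 / x) * M1 y"
            using y by (simp add: mult.assoc[symmetric] ennreal_mult[symmetric] power2_eq_square)
          also have "\<dots> \<le> ?k1 x y"
            using True y by (intro mult_right_mono ennreal_leI) (auto simp: field_simps ind_cc_def)
          finally show "ennreal (1 / x\<^sup>2) * ennreal (p\<^sup>2) \<le> ?k1 x y" .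
          have "ennreal (1 / x\<^sup>2) * ennreal (q\<^sup>2) \<le> ennreal (1 / x\<^sup>2) * (ennreal y * M2 x)"
            unfolding q_def using y by (intro mult_left_mono Q2) auto
          also have "\<dots> \<le> ennreal (1 / x\<^sup>2) * (ennreal x * M2 x)"
            using True by (intro mult_left_mono mult_right_mono ennreal_leI) auto
          also have "\<dots> = ?k2 x y"
            using True y by (simp add: mult.assoc[symmetric] ennreal_mult[symmetric] power2_eq_square ind_cc_def)
          finally show "ennreal (1 / x\<^sup>2) * ennreal (q\<^sup>2) \<le> ?k2 x y" .
        qed auto
        finally show ?thesis using True by (simp add: ind_cc_def)
      next
        case False
        then have z: "?A x y = 0" by (auto simp: indicator_def ind_cc_def)
        show ?thesis unfolding z by simp
      qed
    qed
  qed
  also have "\<dots> = gag d V + 8 * (\<integral>\<^sup>+x. \<integral>\<^sup>+y. ?k1 x y \<partial>lborel \<partial>lborel) + 8 * (\<integral>\<^sup>+x. \<integral>\<^sup>+y. ?k2 x y \<partial>lborel \<partial>lborel)"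
    by (simp add: nn_integral_add nn_integral_cmult gag_def)
  also have "(\<integral>\<^sup>+x. \<integral>\<^sup>+y. ?k1 x y \<partial>lborel \<partial>lborel) = (\<integral>\<^sup>+y. \<integral>\<^sup>+x. ?k1 x y \<partial>lborel \<partial>lborel)"
    by (rule lborel_pair.Fubini'[symmetric]) measurable
  also have "\<dots> \<le> (\<integral>\<^sup>+y. indicator {0..d} y * M1 y \<partial>lborel)"
  proof (rule nn_integral_mono)
    fix y
    show "(\<integral>\<^sup>+x. ?k1 x y \<partial>lborel) \<le> indicator {0..d} y * M1 y"
    proof (cases "y \<in> {0..d}")
      case True
      have "(\<integral>\<^sup>+x. ennreal (indicator {0..d} y * ind_cc y (2*y) x / y) \<partial>lborel) =
        (\<integral>\<^sup>+x. ennreal (1 / y * ind_cc y (2*y) x) \<partial>lborel)" using True by simp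
      also have "\<dots> = ennreal (1 / y) * ennreal y"
        using True by (subst nn_integral_ennreal_cmult) (auto simp: nn_integral_ind_cc)
      also have "\<dots> \<le> 1" using True by (subst ennreal_mult[symmetric]) (auto simp: divide_le_eq_1)
      finally have "(\<integral>\<^sup>+x. ennreal (indicator {0..d} y * ind_cc y (2*y) x / y) \<partial>lborel) \<le> 1" .
      then have "(\<integral>\<^sup>+x. ennreal (indicator {0..d} y * ind_cc y (2*y) x / y) \<partial>lborel) * M1 y \<le> 1 * M1 y"
        by (rule mult_right_mono) simp
      then show ?thesis using True by (subst nn_integral_multc) auto
    qed simp
  qed
  also have "\<dots> = energy d P"
    unfolding energy_iterated(2)[OF assms(3)] M1_def
    by (intro nn_integral_cong, subst nn_integral_cmult[symmetric]) (auto intro!: nn_integral_cong simp: indicator_def)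
  also have "(\<integral>\<^sup>+x. \<integral>\<^sup>+y. ?k2 x y \<partial>lborel \<partial>lborel) \<le> (\<integral>\<^sup>+x. indicator {0..d} x * M2 x \<partial>lborel)"
  proof (rule nn_integral_mono)
    fix x
    show "(\<integral>\<^sup>+y. ?k2 x y \<partial>lborel) \<le> indicator {0..d} x * M2 x"
    proof (cases "x \<in> {0<..d}")
      case True
      have "(\<integral>\<^sup>+y. ennreal (indicator {0<..d} x * ind_cc (x/2) x y / x) \<partial>lborel) =
        (\<integral>\<^sup>+y. ennreal (1 / x * ind_cc (x/2) x y) \<partial>lborel)" using True by simp
      also have "\<dots> = ennreal (1 / x) * ennreal (x / 2)"
        using True by (subst nn_integral_ennreal_cmult) (auto simp: nn_integral_ind_cc)
      also have "\<dots> = ennreal (1 / x * (x / 2))" using True by (subst ennreal_mult[symmetric]) auto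
      also have "\<dots> \<le> ennreal 1" using True by (intro ennreal_leI) auto
      also have "ennreal 1 = 1" by simp
      finally have "(\<integral>\<^sup>+y. ennreal (indicator {0<..d} x * ind_cc (x/2) x y / x) \<partial>lborel) \<le> 1" .
      then have "(\<integral>\<^sup>+y. ennreal (indicator {0<..d} x * ind_cc (x/2) x y / x) \<partial>lborel) * M2 x \<le> 1 * M2 x"
        by (rule mult_right_mono) simp
      then show ?thesis using True by (subst nn_integral_multc) auto
    qed simp
  qed
  also have "\<dots> = energy d Q"
    unfolding energy_iterated(1)[OF assms(4)] M2_def
    by (intro nn_integral_cong, subst nn_integral_cmult[symmetric]) (auto intro!: nn_integral_cong simp: indicator_def)
  finally show ?thesis by (simp add: distrib_left add_mono mult_left_mono add.assoc)
qed

lemma corner_triangle: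
  assumes [measurable]: "U \<in> borel_measurable borel" "V \<in> borel_measurable borel" "W \<in> borel_measurable borel"
  shows "corner d U W \<le> 2 * corner d U V + 2 * corner d V W"
proof -
  have "corner d U W \<le> (\<integral>\<^sup>+x. 2 * ennreal (indicator {0..d} x * ((U x - V x)\<^sup>2 / x)) + 2 * ennreal (indicator {0..d} x * ((V x - W x)\<^sup>2 / x)) \<partial>lborel)"
    unfolding corner_def
  proof (rule nn_integral_mono)
    fix x
    show "ennreal (indicator {0..d} x * ((U x - W x)\<^sup>2 / x)) \<le> 2 * ennreal (indicator {0..d} x * ((U x - V x)\<^sup>2 / x)) + 2 * ennreal (indicator {0..d} x * ((V x - W x)\<^sup>2 / x))"
    proof (cases "x \<in> {0..d}")
      case True
      have "(U x - W x)\<^sup>2 / x \<le> (2 * (U x - V x)\<^sup>2 + 2 * (V x - W x)\<^sup>2) / x"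
        using True power2_sum_le[of "U x - V x" "V x - W x"] by (intro divide_right_mono) auto
      also have "\<dots> = 2 * ((U x - V x)\<^sup>2 / x) + 2 * ((V x - W x)\<^sup>2 / x)" by (simp add: add_divide_distrib)
      finally have "ennreal ((U x - W x)\<^sup>2 / x) \<le> ennreal (2 * ((U x - V x)\<^sup>2 / x) + 2 * ((V x - W x)\<^sup>2 / x))" by (rule ennreal_leI)
      also have "\<dots> = ennreal (2 * ((U x - V x)\<^sup>2 / x)) + ennreal (2 * ((V x - W x)\<^sup>2 / x))"
        using True by (intro ennreal_plus) auto
      also have "\<dots> = 2 * ennreal ((U x - V x)\<^sup>2 / x) + 2 * ennreal ((V x - W x)\<^sup>2 / x)"
        using True by (subst (1 2) ennreal_mult) auto
      finally show ?thesis using True by simp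
    qed simp
  qed
  also have "\<dots> = 2 * corner d U V + 2 * corner d V W"
    unfolding corner_def by (simp add: nn_integral_add nn_integral_cmult)
  finally show ?thesis .
qed

lemma corner_commute: "corner d U V = corner d V U"
  by (simp add: corner_def power2_commute)

section \<open>The four quadrants at a vertex\<close>

lemma oint_affine:
  assumes [measurable]: "g \<in> borel_measurable borel" and "\<sigma>\<^sup>2 = 1"
  shows "oint g b (b + \<sigma> * y) = oint (\<lambda>s. \<sigma> * g (b + \<sigma> * s)) 0 y"
proof -
  have s: "\<sigma> = 1 \<or> \<sigma> = -1" using assms(2) by (simp add: power2_eq_1_iff)
  then have "\<sigma> \<noteq> 0" by auto
  from lborel_integral_real_affine[OF this, of "\<lambda>s. okern b (b + \<sigma> * y) s * g s" b]
  have "oint g b (b + \<sigma> * y) = (\<integral>s. okern b (b + \<sigma> * y) (b + \<sigma> * s) * g (b + \<sigma> * s) \<partial>lborel)"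
    using s by (auto simp: oint_def)
  also have "\<dots> = oint (\<lambda>s. \<sigma> * g (b + \<sigma> * s)) 0 y"
    unfolding oint_def
  proof (rule integral_cong_AE)
    show "AE s in lborel. okern b (b + \<sigma> * y) (b + \<sigma> * s) * g (b + \<sigma> * s) = okern 0 y s * (\<sigma> * g (b + \<sigma> * s))"
      using AE_lborel_singleton[of 0] AE_lborel_singleton[of y]
    proof eventually_elim
      case (elim s) then show ?case using s by (auto simp: okern_def)
    qed
  qed measurable
  finally show ?thesis .
qed


lemma sq_int_affine:
  assumes [measurable]: "G \<in> borel_measurable borel" and "sq_int G" and "\<sigma>\<^sup>2 = 1" "\<tau>\<^sup>2 = 1" and "\<rho>\<^sup>2 = 1"
  shows "sq_int (\<lambda>z. \<rho> * G (a + \<sigma> * fst z, b + \<tau> * snd z))"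
    and "energy d (\<lambda>z. \<rho> * G (a + \<sigma> * fst z, b + \<tau> * snd z)) \<le>
      (\<integral>\<^sup>+z. ennreal (indicator {a-d..a+d} (fst z) * indicator {b-d..b+d} (snd z) * (G z)\<^sup>2) \<partial>lborel)"
proof -
  have st: "\<sigma> = 1 \<or> \<sigma> = -1" "\<tau> = 1 \<or> \<tau> = -1" using assms by (auto simp: power2_eq_1_iff)
  then have nz: "\<sigma> \<noteq> 0" "\<tau> \<noteq> 0" "\<bar>\<sigma>\<bar> = 1" "\<bar>\<tau>\<bar> = 1" by auto
  have sub: "(\<integral>\<^sup>+z. f (a + \<sigma> * fst z, b + \<tau> * snd z) \<partial>lborel) = (\<integral>\<^sup>+z. f z \<partial>lborel)"
    if [measurable]: "f \<in> borel_measurable (borel :: (real \<times> real) measure)" for f :: "real \<times> real \<Rightarrow> ennreal"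
  proof -
    have "(\<integral>\<^sup>+z. f (a + \<sigma> * fst z, b + \<tau> * snd z) \<partial>lborel) = (\<integral>\<^sup>+x. \<integral>\<^sup>+y. f (a + \<sigma> * x, b + \<tau> * y) \<partial>lborel \<partial>lborel)"
      by (subst nn_integral_plane(1)) auto
    also have "\<dots> = (\<integral>\<^sup>+x. \<integral>\<^sup>+y. f (a + \<sigma> * x, y) \<partial>lborel \<partial>lborel)"
    proof (rule nn_integral_cong)
      fix x
      show "(\<integral>\<^sup>+y. f (a + \<sigma> * x, b + \<tau> * y) \<partial>lborel) = (\<integral>\<^sup>+y. f (a + \<sigma> * x, y) \<partial>lborel)"
        using nn_integral_real_affine[of "\<lambda>y. f (a + \<sigma> * x, y)" \<tau> b] nz by simp
    qed
    also have "\<dots> = (\<integral>\<^sup>+x. \<integral>\<^sup>+y. f (x, y) \<partial>lborel \<partial>lborel)"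
      using nn_integral_real_affine[of "\<lambda>x. \<integral>\<^sup>+y. f (x, y) \<partial>lborel" \<sigma> a] nz by simp
    finally show ?thesis by (simp add: nn_integral_plane(1))
  qed
  show "sq_int (\<lambda>z. \<rho> * G (a + \<sigma> * fst z, b + \<tau> * snd z))"
    using sub[of "\<lambda>z. ennreal ((G z)\<^sup>2)"] assms(2,5) by (simp add: sq_int_def power_mult_distrib)
  have "energy d (\<lambda>z. \<rho> * G (a + \<sigma> * fst z, b + \<tau> * snd z)) \<le>
    (\<integral>\<^sup>+z. (\<lambda>z. ennreal (indicator {a-d..a+d} (fst z) * indicator {b-d..b+d} (snd z) * (G z)\<^sup>2)) (a + \<sigma> * fst z, b + \<tau> * snd z) \<partial>lborel)"
    unfolding energy_def using st assms(5)
    by (intro nn_integral_mono ennreal_leI) (auto simp: indicator_def power_mult_distrib)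
  also have "\<dots> = (\<integral>\<^sup>+z. ennreal (indicator {a-d..a+d} (fst z) * indicator {b-d..b+d} (snd z) * (G z)\<^sup>2) \<partial>lborel)"
    by (rule sub) measurable
  finally show "energy d (\<lambda>z. \<rho> * G (a + \<sigma> * fst z, b + \<tau> * snd z)) \<le>
    (\<integral>\<^sup>+z. ennreal (indicator {a-d..a+d} (fst z) * indicator {b-d..b+d} (snd z) * (G z)\<^sup>2) \<partial>lborel)" .
qed

text \<open>The signs \<sigma> and \<tau> select a quadrant at the vertex \<open>(a, b)\<close> and
  reflect it to the first one; by the chain rule the derivatives acquire the same signs. The bound
  for \<open>v\<close> is the one for \<open>u\<close> with exchanged coordinates, and 56 is 48 +
  8.\<close>

lemma quadrant_bounds:
  fixes a b d :: real
  assumes [measurable]: "u \<in> borel_measurable borel" "v \<in> borel_measurable borel"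
    "G1 \<in> borel_measurable (borel :: (real \<times> real) measure)" "G2 \<in> borel_measurable (borel :: (real \<times> real) measure)"
    and sq: "sq_int G1" "sq_int G2"
    and id: "AE z in lborel. u (fst z) + oint (\<lambda>s. G2 (fst z, s)) b (snd z) = v (snd z) + oint (\<lambda>s. G1 (s, snd z)) a (fst z)"
    and s: "\<sigma>\<^sup>2 = 1" "\<tau>\<^sup>2 = 1"
  defines "N \<equiv> (\<integral>\<^sup>+z. ennreal (indicator {a-d..a+d} (fst z) * indicator {b-d..b+d} (snd z) * ((G1 z)\<^sup>2 + (G2 z)\<^sup>2)) \<partial>lborel)"
  shows "gag d (\<lambda>x. u (a + \<sigma> * x)) \<le> 48 * N" "gag d (\<lambda>y. v (b + \<tau> * y)) \<le> 48 * N"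
    "corner d (\<lambda>x. u (a + \<sigma> * x)) (\<lambda>y. v (b + \<tau> * y)) \<le> 56 * N"
proof -
  define P where "P z = \<sigma> * G1 (a + \<sigma> * fst z, b + \<tau> * snd z)" for z
  define Q where "Q z = \<tau> * G2 (a + \<sigma> * fst z, b + \<tau> * snd z)" for z
  have [measurable]: "P \<in> borel_measurable borel" "Q \<in> borel_measurable borel" unfolding P_def Q_def by measurable
  have nz: "\<sigma> \<noteq> 0" "\<tau> \<noteq> 0" using s by auto
  have sqP: "sq_int P" "sq_int Q" unfolding P_def[abs_def] Q_def[abs_def] using sq s by (auto intro: sq_int_affine)
  have "energy d P + energy d Q \<le>
    (\<integral>\<^sup>+z. ennreal (indicator {a-d..a+d} (fst z) * indicator {b-d..b+d} (snd z) * (G1 z)\<^sup>2) \<partial>lborel) +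
    (\<integral>\<^sup>+z. ennreal (indicator {a-d..a+d} (fst z) * indicator {b-d..b+d} (snd z) * (G2 z)\<^sup>2) \<partial>lborel)"
    unfolding P_def[abs_def] Q_def[abs_def] using sq s by (intro add_mono sq_int_affine) auto
  also have "\<dots> = N"
    unfolding N_def by (subst nn_integral_add[symmetric])
      (auto intro!: nn_integral_cong simp: distrib_left simp flip: ennreal_plus)
  finally have N: "energy d P + energy d Q \<le> N" .
  have "AE x in lborel. AE y in lborel. u (a + \<sigma> * x) + oint (\<lambda>s. G2 (a + \<sigma> * x, s)) b (b + \<tau> * y) =
    v (b + \<tau> * y) + oint (\<lambda>s. G1 (s, b + \<tau> * y)) a (a + \<sigma> * x)"
    using AE_affine[OF nz(1) AE_planeD(1)[OF id], of a]
  proof eventually_elim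
    case (elim x)
    from AE_affine[OF nz(2) elim, of b] show ?case by simp
  qed
  then have "AE x in lborel. AE y in lborel. u (a + \<sigma> * x) + oint (\<lambda>s. Q (x, s)) 0 y = v (b + \<tau> * y) + oint (\<lambda>s. P (s, y)) 0 x"
    by (simp add: oint_affine[OF _ s(1)] oint_affine[OF _ s(2)] P_def Q_def)
  then have id': "AE z in lborel. u (a + \<sigma> * fst z) + oint (\<lambda>s. Q (fst z, s)) 0 (snd z) = v (b + \<tau> * snd z) + oint (\<lambda>s. P (s, snd z)) 0 (fst z)"
    using AE_plane(1)[of "\<lambda>z. u (a + \<sigma> * fst z) + oint (\<lambda>s. Q (fst z, s)) 0 (snd z) = v (b + \<tau> * snd z) + oint (\<lambda>s. P (s, snd z)) 0 (fst z)"]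
    by simp
  have "gag d (\<lambda>x. u (a + \<sigma> * x)) \<le> 48 * (energy d P + energy d Q)"
    by (rule gag_le_energy[OF _ _ _ _ sqP(1) id']) measurable
  also have "\<dots> \<le> 48 * N" by (intro mult_left_mono N) simp
  finally show "gag d (\<lambda>x. u (a + \<sigma> * x)) \<le> 48 * N" .
  have esw: "energy d (\<lambda>z. H (prod.swap z)) = energy d H" if [measurable]: "H \<in> borel_measurable borel" for H
    unfolding energy_iterated(1)[of "\<lambda>z. H (prod.swap z)", simplified] energy_iterated(2)[OF that]
    by (simp add: mult_ac)
  have "gag d (\<lambda>y. v (b + \<tau> * y)) \<le> 48 * (energy d (\<lambda>z. Q (prod.swap z)) + energy d (\<lambda>z. P (prod.swap z)))"
  proof (rule gag_le_energy)
    show "AE z in lborel. v (b + \<tau> * fst z) + oint (\<lambda>s. P (prod.swap (fst z, s))) 0 (snd z) =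
      u (a + \<sigma> * snd z) + oint (\<lambda>s. Q (prod.swap (s, snd z))) 0 (fst z)"
      using AE_swap[OF id'] by (auto elim!: eventually_mono)
    show "sq_int (\<lambda>z. Q (prod.swap z))" by (rule sq_int_swap[OF _ sqP(2)]) measurable
  qed measurable
  also have "\<dots> = 48 * (energy d P + energy d Q)" by (simp add: esw add.commute)
  also have "\<dots> \<le> 48 * N" by (intro mult_left_mono N) simp
  finally show gv: "gag d (\<lambda>y. v (b + \<tau> * y)) \<le> 48 * N" .
  have "corner d (\<lambda>x. u (a + \<sigma> * x)) (\<lambda>y. v (b + \<tau> * y)) \<le> gag d (\<lambda>y. v (b + \<tau> * y)) + 8 * (energy d P + energy d Q)"
    by (rule corner_le_energy[OF _ _ _ _ id']) measurable
  also have "\<dots> \<le> 48 * N + 8 * N" by (intro add_mono gv mult_left_mono N) simp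
  also have "\<dots> = 56 * N" by (simp add: distrib_right[symmetric])
  finally show "corner d (\<lambda>x. u (a + \<sigma> * x)) (\<lambda>y. v (b + \<tau> * y)) \<le> 56 * N" .
qed

text \<open>The five terms of \<open>gp_terms\<close> for the representatives. The integral over
  \<open>{-d..d}\<close> is split at 0 into the two corners in which both edges point the same
  way.\<close>

definition vertex_terms :: "real \<Rightarrow> (real \<Rightarrow> real) \<Rightarrow> (real \<Rightarrow> real) \<Rightarrow> real \<Rightarrow> real \<Rightarrow> ennreal" where
  "vertex_terms d u v a b =
     gag d (\<lambda>x. u (a + x)) + gag d (\<lambda>y. v (b + y)) +
     (corner d (\<lambda>x. u (a + x)) (\<lambda>y. v (b + y)) + corner d (\<lambda>x. u (a - x)) (\<lambda>y. v (b - y))) +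
     corner d (\<lambda>x. u (a + x)) (\<lambda>x. u (a - x)) + corner d (\<lambda>y. v (b + y)) (\<lambda>y. v (b - y))"

text \<open>The last two terms compare opposite edges, which lie in no common quadrant; each is
  routed through a perpendicular edge by \<open>corner_triangle\<close>. The constant is 48 + 48 +
  56 + 56 + 224 + 224.\<close>

lemma vertex_terms_le:
  fixes a b d :: real
  assumes [measurable]: "u \<in> borel_measurable borel" "v \<in> borel_measurable borel"
    "G1 \<in> borel_measurable (borel :: (real \<times> real) measure)" "G2 \<in> borel_measurable (borel :: (real \<times> real) measure)"
    and sq: "sq_int G1" "sq_int G2"
    and id: "AE z in lborel. u (fst z) + oint (\<lambda>s. G2 (fst z, s)) b (snd z) = v (snd z) + oint (\<lambda>s. G1 (s, snd z)) a (fst z)"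
  defines "N \<equiv> (\<integral>\<^sup>+z. ennreal (indicator {a-d..a+d} (fst z) * indicator {b-d..b+d} (snd z) * ((G1 z)\<^sup>2 + (G2 z)\<^sup>2)) \<partial>lborel)"
  shows "vertex_terms d u v a b \<le> 656 * N"
proof -
  note q = quadrant_bounds[OF assms(1-7), where d=d, folded N_def]
  have pp: "gag d (\<lambda>x. u (a + x)) \<le> 48 * N" "gag d (\<lambda>y. v (b + y)) \<le> 48 * N"
    "corner d (\<lambda>x. u (a + x)) (\<lambda>y. v (b + y)) \<le> 56 * N"
    using q[of 1 1] by simp_all
  have mm: "corner d (\<lambda>x. u (a - x)) (\<lambda>y. v (b - y)) \<le> 56 * N" using q(3)[of "-1" "-1"] by simp
  have pm: "corner d (\<lambda>x. u (a + x)) (\<lambda>y. v (b - y)) \<le> 56 * N" using q(3)[of 1 "-1"] by simp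
  have mp: "corner d (\<lambda>x. u (a - x)) (\<lambda>y. v (b + y)) \<le> 56 * N" using q(3)[of "-1" 1] by simp
  have "corner d (\<lambda>x. u (a + x)) (\<lambda>x. u (a - x)) \<le> 2 * corner d (\<lambda>x. u (a + x)) (\<lambda>y. v (b + y)) + 2 * corner d (\<lambda>y. v (b + y)) (\<lambda>x. u (a - x))"
    by (rule corner_triangle) measurable
  also have "\<dots> \<le> 2 * (56 * N) + 2 * (56 * N)"
    using pp mp by (intro add_mono mult_left_mono) (auto simp: corner_commute)
  finally have t4: "corner d (\<lambda>x. u (a + x)) (\<lambda>x. u (a - x)) \<le> 2 * (56 * N) + 2 * (56 * N)" .
  have "corner d (\<lambda>y. v (b + y)) (\<lambda>y. v (b - y)) \<le> 2 * corner d (\<lambda>y. v (b + y)) (\<lambda>x. u (a + x)) + 2 * corner d (\<lambda>x. u (a + x)) (\<lambda>y. v (b - y))"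
    by (rule corner_triangle) measurable
  also have "\<dots> \<le> 2 * (56 * N) + 2 * (56 * N)"
    using pp pm by (intro add_mono mult_left_mono) (auto simp: corner_commute)
  finally have t5: "corner d (\<lambda>y. v (b + y)) (\<lambda>y. v (b - y)) \<le> 2 * (56 * N) + 2 * (56 * N)" .
  have "vertex_terms d u v a b \<le> 48 * N + 48 * N + (56 * N + 56 * N) + (2 * (56 * N) + 2 * (56 * N)) + (2 * (56 * N) + 2 * (56 * N))"
    unfolding vertex_terms_def by (intro add_mono pp mm t4 t5)
  also have "\<dots> = 656 * N" by (simp add: mult.assoc[symmetric] distrib_right[symmetric])
  finally show ?thesis .
qed

section \<open>Identification with the given norm and summation over the vertices\<close>

lemma gag_lebesgue:
  assumes [measurable]: "U \<in> borel_measurable borel" and ae: "AE x in lborel. g x = U x"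
  shows "(\<integral>\<^sup>+ x \<in> {0..d}. (\<integral>\<^sup>+ y \<in> {0..d}. ennreal ((g x - g y)\<^sup>2 / (x - y)\<^sup>2) \<partial>lebesgue) \<partial>lebesgue) = gag d U"
  unfolding nn_integral_completion gag_def
proof (rule nn_integral_cong_AE)
  show "AE x in lborel. (\<integral>\<^sup>+ y \<in> {0..d}. ennreal ((g x - g y)\<^sup>2 / (x - y)\<^sup>2) \<partial>lborel) * indicator {0..d} x =
    (\<integral>\<^sup>+ y. ennreal (indicator {0..d} x * indicator {0..d} y * ((U x - U y)\<^sup>2 / (x - y)\<^sup>2)) \<partial>lborel)"
    using ae
  proof eventually_elim
    case (elim x)
    have "(\<integral>\<^sup>+ y \<in> {0..d}. ennreal ((g x - g y)\<^sup>2 / (x - y)\<^sup>2) \<partial>lborel) = (\<integral>\<^sup>+ y. ennreal (indicator {0..d} y * ((U x - U y)\<^sup>2 / (x - y)\<^sup>2)) \<partial>lborel)"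
      using ae elim by (intro nn_integral_cong_AE) (auto elim!: eventually_mono simp: indicator_def)
    then show ?case by (cases "x \<in> {0..d}") auto
  qed
qed

lemma corner_lebesgue:
  assumes "AE x in lborel. g x = U x" "AE x in lborel. h x = V x"
  shows "(\<integral>\<^sup>+ x \<in> {0..d}. ennreal ((g x - h x)\<^sup>2 / x) \<partial>lebesgue) = corner d U V"
  unfolding nn_integral_completion corner_def
  using assms by (intro nn_integral_cong_AE, elim eventually_elim2) (auto simp: indicator_def)

lemma corner_two_sided_lebesgue:
  assumes [measurable]: "U \<in> borel_measurable borel" "V \<in> borel_measurable borel"
    and "AE x in lborel. g x = U x" "AE x in lborel. h x = V x"
  shows "(\<integral>\<^sup>+ x \<in> {-d..d}. ennreal ((g x - h x)\<^sup>2 / \<bar>x\<bar>) \<partial>lebesgue) =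
    corner d U V + corner d (\<lambda>x. U (- x)) (\<lambda>x. V (- x))"
proof -
  let ?c = "\<lambda>x. ennreal (indicator {0..d} x * ((U x - V x)\<^sup>2 / x))"
  let ?c' = "\<lambda>x. ennreal (indicator {0..d} x * ((U (- x) - V (- x))\<^sup>2 / x))"
  have "(\<integral>\<^sup>+ x \<in> {-d..d}. ennreal ((g x - h x)\<^sup>2 / \<bar>x\<bar>) \<partial>lebesgue) = (\<integral>\<^sup>+x. ?c x + ?c' (- x) \<partial>lborel)"
    unfolding nn_integral_completion
    using assms(3,4) AE_lborel_singleton[of "0::real"]
  proof (intro nn_integral_cong_AE, eventually_elim)
    case (elim x)
    then show ?case by (cases "x > 0") (auto simp: indicator_def)
  qed
  also have "\<dots> = (\<integral>\<^sup>+x. ?c x \<partial>lborel) + (\<integral>\<^sup>+x. ?c' (- x) \<partial>lborel)"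
    by (rule nn_integral_add) measurable
  also have "(\<integral>\<^sup>+x. ?c' (- x) \<partial>lborel) = (\<integral>\<^sup>+x. ?c' x \<partial>lborel)"
    using nn_integral_reflect[of ?c' 0] by simp
  finally show ?thesis by (simp add: corner_def)
qed

lemma gp_terms_eq:
  assumes ld: "line_data \<delta> f u v"
  shows "gp_terms \<delta> f j k = vertex_terms \<delta> (u k) (v j) (of_int j * \<delta>) (of_int k * \<delta>)"
proof -
  have [measurable]: "u k \<in> borel_measurable borel" "v j \<in> borel_measurable borel"
    and ae: "AE x in lborel. f (x, of_int k * \<delta>) = u k x" "AE y in lborel. f (of_int j * \<delta>, y) = v j y"
    using ld by (auto simp: line_data_def)
  define a where "a = of_int j * \<delta>"
  define b where "b = of_int k * \<delta>"
  have up: "AE x in lborel. f (a + x, b) = u k (a + x)" using AE_affine[OF _ ae(1), of 1 a] by (simp add: b_def)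
  have um: "AE x in lborel. f (a - x, b) = u k (a - x)" using AE_affine[OF _ ae(1), of "-1" a] by (simp add: b_def)
  have vp: "AE x in lborel. f (a, b + x) = v j (b + x)" using AE_affine[OF _ ae(2), of 1 b] by (simp add: a_def)
  have vm: "AE x in lborel. f (a, b - x) = v j (b - x)" using AE_affine[OF _ ae(2), of "-1" b] by (simp add: a_def)
  show ?thesis
    unfolding gp_terms_def vertex_terms_def Let_def a_def[symmetric] b_def[symmetric]
    using gag_lebesgue[OF _ up, of \<delta>] gag_lebesgue[OF _ vp, of \<delta>] corner_lebesgue[OF up um, of \<delta>]
      corner_lebesgue[OF vp vm, of \<delta>] corner_two_sided_lebesgue[OF _ _ up vp, of \<delta>]
    by simp
qed

lemma nn_integral_count_space_swap:
  fixes F :: "'a::countable \<Rightarrow> 'b \<Rightarrow> ennreal"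
  assumes "sigma_finite_measure M" and [measurable]: "\<And>i. F i \<in> borel_measurable M"
  shows "(\<integral>\<^sup>+i. (\<integral>\<^sup>+z. F i z \<partial>M) \<partial>count_space UNIV) = (\<integral>\<^sup>+z. (\<integral>\<^sup>+i. F i z \<partial>count_space UNIV) \<partial>M)"
proof -
  interpret M: sigma_finite_measure M by fact
  interpret C: sigma_finite_measure "count_space (UNIV :: 'a set)"
    by (rule sigma_finite_measure_count_space_countable) simp
  interpret pair_sigma_finite "count_space (UNIV :: 'a set)" M ..
  have "case_prod F \<in> borel_measurable (count_space UNIV \<Otimes>\<^sub>M M)"
    by (rule measurable_pair_measure_countable1) auto
  from Fubini'[OF this] show ?thesis by simp
qed

text \<open>A general point lies in two windows; as the windows are closed, a multiple of \<delta>
  lies in three.\<close>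

lemma int_window_card:
  fixes \<delta> x :: real
  assumes "\<delta> > 0"
  shows "finite {j::int. \<bar>x - of_int j * \<delta>\<bar> \<le> \<delta>}" "card {j::int. \<bar>x - of_int j * \<delta>\<bar> \<le> \<delta>} \<le> 3"
proof -
  have sub: "{j::int. \<bar>x - of_int j * \<delta>\<bar> \<le> \<delta>} \<subseteq> {\<lfloor>x / \<delta>\<rfloor> - 1..\<lfloor>x / \<delta>\<rfloor> + 1}"
  proof
    fix j :: int assume "j \<in> {j. \<bar>x - of_int j * \<delta>\<bar> \<le> \<delta>}"
    then have "x \<le> (of_int j + 1) * \<delta>" "(of_int j - 1) * \<delta> \<le> x" by (auto simp: algebra_simps)
    then have "x / \<delta> \<le> of_int j + 1" "of_int j - 1 \<le> x / \<delta>" using assms by (auto simp: field_simps)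
    then show "j \<in> {\<lfloor>x / \<delta>\<rfloor> - 1..\<lfloor>x / \<delta>\<rfloor> + 1}" by (simp add: floor_le_iff le_floor_iff) linarith
  qed
  show "finite {j::int. \<bar>x - of_int j * \<delta>\<bar> \<le> \<delta>}" by (rule finite_subset[OF sub]) simp
  have "card {j::int. \<bar>x - of_int j * \<delta>\<bar> \<le> \<delta>} \<le> card {\<lfloor>x / \<delta>\<rfloor> - 1..\<lfloor>x / \<delta>\<rfloor> + 1}" by (rule card_mono[OF _ sub]) simp
  then show "card {j::int. \<bar>x - of_int j * \<delta>\<bar> \<le> \<delta>} \<le> 3" by simp
qed

lemma trace_norm_finite:
  assumes d: "\<delta> > 0" and H: "H1 F" and tr: "gp_trace \<delta> F f" and ld: "line_data \<delta> f u v"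
  shows "gp_half_norm_sq \<delta> f < \<infinity>"
proof -
  from trace_line_rep[OF H tr ld] obtain F' G1 G2 where m[measurable]: "F' \<in> borel_measurable borel" "G1 \<in> borel_measurable borel" "G2 \<in> borel_measurable borel"
    and sq: "sq_int G1" "sq_int G2" and h: "\<And>k. line_rep F' (of_int k * \<delta>) (u k) G2"
    and v: "\<And>j. line_rep (\<lambda>z. F' (prod.swap z)) (of_int j * \<delta>) (v j) (\<lambda>z. G1 (prod.swap z))" by blast
  have [measurable]: "u k \<in> borel_measurable borel" "v k \<in> borel_measurable borel" for k
    using ld by (auto simp: line_data_def)
  define g where "g z = (G1 z)\<^sup>2 + (G2 z)\<^sup>2" for z
  have [measurable]: "g \<in> borel_measurable borel" unfolding g_def by measurable
  have g0: "0 \<le> g z" for z by (simp add: g_def)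
  let ?i = "\<lambda>jk z. indicator {of_int (fst jk) * \<delta> - \<delta>..of_int (fst jk) * \<delta> + \<delta>} (fst z) *
      indicator {of_int (snd jk) * \<delta> - \<delta>..of_int (snd jk) * \<delta> + \<delta>} (snd z) :: real"
  have le: "gp_terms \<delta> f j k \<le> 656 * (\<integral>\<^sup>+z. ennreal (?i (j, k) z * g z) \<partial>lborel)" for j k
  proof -
    have "AE z in lborel. F' z = v j (snd z) + oint (\<lambda>s. G1 (s, snd z)) (of_int j * \<delta>) (fst z)"
      using AE_swap[OF v[of j, unfolded line_rep_def]] by (auto elim!: eventually_mono)
    with h[of k, unfolded line_rep_def]
    have "AE z in lborel. u k (fst z) + oint (\<lambda>s. G2 (fst z, s)) (of_int k * \<delta>) (snd z) = v j (snd z) + oint (\<lambda>s. G1 (s, snd z)) (of_int j * \<delta>) (fst z)"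
      by eventually_elim simp
    from vertex_terms_le[OF _ _ m(2,3) sq this, of \<delta>] show ?thesis
      by (simp add: gp_terms_eq[OF ld] g_def)
  qed
  have "gp_half_norm_sq \<delta> f \<le> (\<integral>\<^sup>+jk. 656 * (\<integral>\<^sup>+z. ennreal (?i jk z * g z) \<partial>lborel) \<partial>count_space UNIV)"
    unfolding gp_half_norm_sq_def
  proof (rule nn_integral_mono)
    fix jk :: "int \<times> int"
    show "gp_terms \<delta> f (fst jk) (snd jk) \<le> 656 * (\<integral>\<^sup>+z. ennreal (?i jk z * g z) \<partial>lborel)"
      using le[of "fst jk" "snd jk"] by simp
  qed
  also have "\<dots> = 656 * (\<integral>\<^sup>+jk. (\<integral>\<^sup>+z. ennreal (?i jk z * g z) \<partial>lborel) \<partial>count_space UNIV)"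
    by (rule nn_integral_cmult) simp
  also have "(\<integral>\<^sup>+jk. (\<integral>\<^sup>+z. ennreal (?i jk z * g z) \<partial>lborel) \<partial>count_space UNIV) =
    (\<integral>\<^sup>+z. (\<integral>\<^sup>+jk. ennreal (?i jk z * g z) \<partial>count_space UNIV) \<partial>lborel)"
    by (intro nn_integral_count_space_swap sigma_finite_lborel) measurable
  \<comment> \<open>At most three windows in each direction contain a given point, hence at most 9
    neighbourhoods of vertices.\<close>
  also have "\<dots> \<le> (\<integral>\<^sup>+z. 9 * ennreal (g z) \<partial>lborel)"
  proof (rule nn_integral_mono)
    fix z :: "real \<times> real"
    let ?A = "{j::int. \<bar>fst z - of_int j * \<delta>\<bar> \<le> \<delta>}" and ?B = "{j::int. \<bar>snd z - of_int j * \<delta>\<bar> \<le> \<delta>}"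
    have "(\<integral>\<^sup>+jk. ennreal (?i jk z * g z) \<partial>count_space UNIV) = (\<integral>\<^sup>+jk. ennreal (g z) * indicator (?A \<times> ?B) jk \<partial>count_space UNIV)"
      by (intro nn_integral_cong) (auto simp: indicator_def abs_le_iff)
    also have "\<dots> = ennreal (g z) * emeasure (count_space UNIV) (?A \<times> ?B)"
      by (rule nn_integral_cmult_indicator) simp
    also have "emeasure (count_space UNIV) (?A \<times> ?B) = of_nat (card ?A * card ?B)"
      using int_window_card[OF d] by (subst emeasure_count_space_finite) (auto simp: card_cartesian_product)
    also have "\<dots> \<le> of_nat (3 * 3)"
      by (intro of_nat_mono mult_mono int_window_card[OF d]) auto
    finally have "(\<integral>\<^sup>+jk. ennreal (?i jk z * g z) \<partial>count_space UNIV) \<le> ennreal (g z) * of_nat (3 * 3)"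
      by (meson mult_left_mono zero_le)
    then show "(\<integral>\<^sup>+jk. ennreal (?i jk z * g z) \<partial>count_space UNIV) \<le> 9 * ennreal (g z)"
      unfolding mult.commute[of 9] by simp
  qed
  also have "\<dots> = 9 * ((\<integral>\<^sup>+z. ennreal ((G1 z)\<^sup>2) \<partial>lborel) + (\<integral>\<^sup>+z. ennreal ((G2 z)\<^sup>2) \<partial>lborel))"
    by (simp add: nn_integral_cmult nn_integral_add g_def)
  finally have "gp_half_norm_sq \<delta> f \<le> 656 * (9 * ((\<integral>\<^sup>+z. ennreal ((G1 z)\<^sup>2) \<partial>lborel) + (\<integral>\<^sup>+z. ennreal ((G2 z)\<^sup>2) \<partial>lborel)))"
    by (simp add: mult_left_mono)
  also have "\<dots> < \<infinity>" using sq by (auto simp: sq_int_def ennreal_mult_less_top)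
  finally show ?thesis .
qed

section \<open>Absolutely continuous functions of one variable\<close>

text \<open>\<open>F\<close> is absolutely continuous on the closed interval with density
  \<open>g\<close>. The identity is required at every point, so that pieces can be joined by their
  values at the end points.\<close>

definition ac_on :: "real \<Rightarrow> real \<Rightarrow> (real \<Rightarrow> real) \<Rightarrow> (real \<Rightarrow> real) \<Rightarrow> bool" where
  "ac_on a b F g \<longleftrightarrow> set_integrable lborel {a..b} g \<and> (\<forall>y\<in>{a..b}. F y = F a + oint g a y)"

lemma ac_on_int: "ac_on a b F g \<Longrightarrow> set_integrable lborel {a..b} g"
  and ac_on_D: "ac_on a b F g \<Longrightarrow> y \<in> {a..b} \<Longrightarrow> F y = F a + oint g a y"
  unfolding ac_on_def by blast+

lemma ac_on_diff:
  assumes "ac_on a b F g" "p \<in> {a..b}" "q \<in> {a..b}"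
  shows "F q = F p + oint g p q"
proof -
  have i: "set_integrable lborel {a..b} g" using assms(1) by (rule ac_on_int)
  have ab: "a \<in> {a..b}" using assms by auto
  have "oint g a p + oint g p q = oint g a q"
    using assms ab by (intro oint_trans integrable_okern[OF i])
  then show ?thesis using ac_on_D[OF assms(1,2)] ac_on_D[OF assms(1,3)] by simp
qed

lemma ac_on_concat:
  assumes "ac_on a b F g" "ac_on b c F g" "a \<le> b" "b \<le> c"
  shows "ac_on a c F g"
proof -
  have i: "set_integrable lborel {a..c} g"
  proof -
    have "set_integrable lborel ({a..b} \<union> {b..c}) g"
      using ac_on_int[OF assms(1)] ac_on_int[OF assms(2)] by (intro set_integrable_Un) auto
    moreover have "{a..b} \<union> {b..c} = {a..c}" using assms by auto
    ultimately show ?thesis by simp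
  qed
  moreover have "F y = F a + oint g a y" if y: "y \<in> {a..c}" for y
  proof (cases "y \<le> b")
    case True then show ?thesis using ac_on_D[OF assms(1), of y] y by simp
  next
    case False
    have "oint g a b + oint g b y = oint g a y" using y False assms by (intro oint_trans integrable_okern[OF i]) auto
    moreover have "F y = F b + oint g b y" using ac_on_D[OF assms(2), of y] y False by simp
    moreover have "F b = F a + oint g a b" using ac_on_D[OF assms(1), of b] assms(3) by simp
    ultimately show ?thesis by simp
  qed
  ultimately show ?thesis unfolding ac_on_def by blast
qed

lemma oint_cong_AE:
  assumes [measurable]: "g \<in> borel_measurable borel" "g' \<in> borel_measurable borel"
    and "AE s in lborel. s \<in> {a..b} \<longrightarrow> g s = g' s" and "p \<in> {a..b}" "q \<in> {a..b}"
  shows "oint g p q = oint g' p q"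
  unfolding oint_def
proof (rule integral_cong_AE)
  show "AE s in lborel. okern p q s * g s = okern p q s * g' s"
    using assms(3)
  proof eventually_elim
    case (elim s) then show ?case using assms(4,5) by (cases "s \<in> {a..b}") (auto simp: okern_def)
  qed
qed measurable

lemma ac_on_cong:
  assumes ac: "ac_on a b F g" and F: "\<And>y. y \<in> {a..b} \<Longrightarrow> F y = F' y"
    and g: "AE s in lborel. s \<in> {a..b} \<longrightarrow> g s = g' s"
    and [measurable]: "g \<in> borel_measurable borel" "g' \<in> borel_measurable borel"
  shows "ac_on a b F' g'"
proof -
  have "set_integrable lborel {a..b} g'"
    unfolding set_integrable_def
    using ac_on_int[OF ac] g by (subst integrable_cong_AE[where g="\<lambda>s. indicator {a..b} s *\<^sub>R g s"])
      (auto simp: set_integrable_def indicator_def elim!: eventually_mono)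
  moreover have "F' y = F' a + oint g' a y" if y: "y \<in> {a..b}" for y
    using ac_on_D[OF ac y] y F[OF y] F[of a] oint_cong_AE[OF _ _ g, of a y] by simp
  ultimately show ?thesis unfolding ac_on_def by blast
qed

lemma ac_on_add:
  assumes "ac_on a b F g" "ac_on a b F' g'"
  shows "ac_on a b (\<lambda>y. F y + F' y) (\<lambda>y. g y + g' y)"
proof -
  have i: "set_integrable lborel {a..b} g" "set_integrable lborel {a..b} g'" using assms ac_on_int by blast+
  have "oint (\<lambda>y. g y + g' y) a y = oint g a y + oint g' a y" if y: "y \<in> {a..b}" for y
  proof -
    have "a \<in> {a..b}" using y by auto
    then show ?thesis
      using integrable_okern[OF i(1) _ y] integrable_okern[OF i(2) _ y] by (simp add: oint_def distrib_left)
  qed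
  then have "F y + F' y = F a + F' a + oint (\<lambda>y. g y + g' y) a y" if "y \<in> {a..b}" for y
    using ac_on_D[OF assms(1) that] ac_on_D[OF assms(2) that] that by simp
  then show ?thesis using set_integral_add(1)[OF i] unfolding ac_on_def by blast
qed

lemma ac_on_reflect:
  assumes [measurable]: "g \<in> borel_measurable borel" and ac: "ac_on 0 d F g"
  shows "ac_on 0 d (\<lambda>y. F (d - y)) (\<lambda>y. - g (d - y))"
proof -
  have i: "set_integrable lborel {0..d} g" using ac by (rule ac_on_int)
  then have "integrable lborel (\<lambda>s. indicator {0..d} (d + (-1) * s) *\<^sub>R g (d + (-1) * s))"
    unfolding set_integrable_def by (rule lborel_integrable_real_affine) simp
  moreover have "indicator {0..d} (d + (-1) * s) = (indicator {0..d} s :: real)" for s :: real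
    by (auto simp: indicator_def)
  ultimately have "set_integrable lborel {0..d} (\<lambda>y. - g (d - y))"
    by (simp add: set_integrable_def)
  moreover have "F (d - y) = F (d - 0) + oint (\<lambda>y. - g (d - y)) 0 y" if y: "y \<in> {0..d}" for y
    using ac_on_diff[OF ac, of d "d - y"] y oint_affine[of g "-1" d y] by simp
  ultimately show ?thesis unfolding ac_on_def by blast
qed

lemma ac_on_shift:
  assumes [measurable]: "g \<in> borel_measurable borel" and ac: "ac_on 0 d F g"
  shows "ac_on c (c + d) (\<lambda>y. F (y - c)) (\<lambda>y. g (y - c))"
proof -
  have "integrable lborel (\<lambda>s. indicator {0..d} (- c + 1 * s) *\<^sub>R g (- c + 1 * s))"
    using ac_on_int[OF ac] unfolding set_integrable_def by (intro lborel_integrable_real_affine) auto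
  moreover have "indicator {0..d} (- c + 1 * s) = (indicator {c..c + d} s :: real)" for s :: real
    by (auto simp: indicator_def)
  ultimately have "set_integrable lborel {c..c + d} (\<lambda>y. g (y - c))"
    by (simp add: set_integrable_def)
  moreover have "F (y - c) = F (c - c) + oint (\<lambda>y. g (y - c)) c y" if y: "y \<in> {c..c + d}" for y
    using ac_on_D[OF ac, of "y - c"] y oint_affine[of "\<lambda>y. g (y - c)" 1 c "y - c"] by simp
  ultimately show ?thesis unfolding ac_on_def by blast
qed

section \<open>Products with linear functions and running means\<close>

lemma integrable_indicator_Icc: "integrable lborel (indicator {a..b::real} :: real \<Rightarrow> real)"
  by (intro integrable_real_indicator) (auto simp: emeasure_lborel_Icc_eq)

text \<open>Cauchy's formula for repeated integration; it supplies the product rule in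
  \<open>ac_on_linear_mult\<close>.\<close>

lemma oint_oint:
  assumes [measurable]: "g \<in> borel_measurable borel" and i: "set_integrable lborel {0..d} g" and y: "0 \<le> y" "y \<le> d"
  shows "oint (oint g 0) 0 y = oint (\<lambda>t. (y - t) * g t) 0 y"
proof -
  have int: "integrable (lborel \<Otimes>\<^sub>M lborel) (\<lambda>(s, t). okern 0 y s * (okern 0 s t * g t))"
  proof (rule Bochner_Integration.integrable_bound)
    show "integrable (lborel \<Otimes>\<^sub>M lborel) (\<lambda>(s, t). indicator {0..d} s * (indicator {0..d} t *\<^sub>R g t))"
      using i integrable_indicator_Icc by (intro integrable_pair_mult sigma_finite_lborel) (simp_all add: set_integrable_def)
    show "AE x in lborel \<Otimes>\<^sub>M lborel. norm (case x of (s, t) \<Rightarrow> okern 0 y s * (okern 0 s t * g t)) \<le> norm (case x of (s, t) \<Rightarrow> indicator {0..d} s * (indicator {0..d} t *\<^sub>R g t))"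
      using y by (intro AE_I2) (auto simp: okern_def indicator_def)
  qed measurable
  have "oint (oint g 0) 0 y = (\<integral>s. \<integral>t. okern 0 y s * (okern 0 s t * g t) \<partial>lborel \<partial>lborel)"
    by (simp add: oint_def)
  also have "\<dots> = (\<integral>t. \<integral>s. okern 0 y s * (okern 0 s t * g t) \<partial>lborel \<partial>lborel)"
    using lborel_pair.Fubini_integral[OF int] by simp
  also have "\<dots> = oint (\<lambda>t. (y - t) * g t) 0 y"
    unfolding oint_def
  proof (rule Bochner_Integration.integral_cong[OF refl])
    fix t
    show "(\<integral>s. okern 0 y s * (okern 0 s t * g t) \<partial>lborel) = okern 0 y t * ((y - t) * g t)"
    proof (cases "0 \<le> t \<and> t < y")
      case True
      have "(\<integral>s. okern 0 y s * (okern 0 s t * g t) \<partial>lborel) = (\<integral>s. g t * indicator {t<..<y} s \<partial>lborel)"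
        using True by (intro Bochner_Integration.integral_cong) (auto simp: okern_def indicator_def)
      then show ?thesis using True by (simp add: okern_def)
    next
      case False
      then have "okern 0 y s * (okern 0 s t * g t) = 0" for s using y by (auto simp: okern_def)
      then have "(\<integral>s. okern 0 y s * (okern 0 s t * g t) \<partial>lborel) = (\<integral>s. 0 \<partial>(lborel :: real measure))" by (simp only:)
      moreover have "okern 0 y t = 0" using False y by (auto simp: okern_def)
      ultimately show ?thesis by simp
    qed
  qed
  finally show ?thesis .
qed

lemma oint_const: "oint (\<lambda>s. c) a y = c * (y - a)"
proof -
  have "(\<integral>s. okern a y s \<partial>lborel) = y - a"
  proof (cases "a \<le> y")
    case True
    then have "(\<integral>s. okern a y s \<partial>lborel) = (\<integral>s. indicator {a..<y} s \<partial>lborel)"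
      by (intro Bochner_Integration.integral_cong) (auto simp: okern_def indicator_def)
    then show ?thesis using True by simp
  next
    case False
    then have "(\<integral>s. okern a y s \<partial>lborel) = (\<integral>s. - indicator {y..<a} s \<partial>lborel)"
      by (intro Bochner_Integration.integral_cong) (auto simp: okern_def indicator_def)
    then show ?thesis using False by simp
  qed
  then show ?thesis by (simp add: oint_def mult.commute)
qed

text \<open>The product rule for the only weights that occur, linear functions of \<open>y\<close>.
  With \<open>F\<close> written as a primitive, the integral of \<open>F\<close> becomes an integral
  of \<open>(y - s) * g s\<close>, and the claim reduces to an identity between integrands.\<close>

lemma ac_on_linear_mult:
  assumes [measurable]: "g \<in> borel_measurable borel" "F \<in> borel_measurable borel" and ac: "ac_on 0 d F g"
  shows "ac_on 0 d (\<lambda>y. (\<alpha> + \<beta> * y) * F y) (\<lambda>y. (\<alpha> + \<beta> * y) * g y + \<beta> * F y)"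
proof -
  have i: "set_integrable lborel {0..d} g" and F: "\<And>y. y \<in> {0..d} \<Longrightarrow> F y = F 0 + oint g 0 y"
    using ac_on_int[OF ac] ac_on_D[OF ac] by blast+
  define L where "L = (\<integral>s. \<bar>indicator {0..d} s * g s\<bar> \<partial>lborel)"
  have bF: "\<bar>oint g 0 y\<bar> \<le> L" if "y \<in> {0..d}" for y
  proof -
    have "\<bar>oint g 0 y\<bar> \<le> (\<integral>s. \<bar>okern 0 y s * g s\<bar> \<partial>lborel)" unfolding oint_def by (rule integral_abs_bound)
    also have "\<dots> \<le> L"
      unfolding L_def using i that integrable_okern[OF i, of 0 y]
      by (intro integral_mono integrable_abs) (auto simp: set_integrable_def okern_def indicator_def)
    finally show ?thesis .
  qed
  have iF: "set_integrable lborel {0..d} F"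
    unfolding set_integrable_def
  proof (rule Bochner_Integration.integrable_bound)
    show "integrable lborel (\<lambda>s. (\<bar>F 0\<bar> + L) * indicator {0..d} s)" using integrable_indicator_Icc by (intro integrable_mult_right)
    have "\<bar>F s\<bar> \<le> \<bar>F 0\<bar> + L" if "s \<in> {0..d}" for s
      using F[OF that] bF[OF that] by linarith
    then show "AE s in lborel. norm (indicator {0..d} s *\<^sub>R F s) \<le> norm ((\<bar>F 0\<bar> + L) * indicator {0..d} s)"
      by (intro AE_I2) (auto simp: indicator_def intro: order_trans[OF _ abs_ge_self])
  qed measurable
  have ig: "set_integrable lborel {0..d} (\<lambda>y. (\<alpha> + \<beta> * y) * g y)"
    unfolding set_integrable_def
  proof (rule Bochner_Integration.integrable_bound)
    show "integrable lborel (\<lambda>s. (\<bar>\<alpha>\<bar> + \<bar>\<beta>\<bar> * \<bar>d\<bar>) * (indicator {0..d} s *\<^sub>R g s))" using i by (simp add: set_integrable_def)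
    have "\<bar>(\<alpha> + \<beta> * s) * g s\<bar> \<le> \<bar>(\<bar>\<alpha>\<bar> + \<bar>\<beta>\<bar> * \<bar>d\<bar>) * g s\<bar>" if "s \<in> {0..d}" for s
    proof -
      have "\<bar>\<beta> * s\<bar> \<le> \<bar>\<beta>\<bar> * \<bar>d\<bar>" using that by (auto simp: abs_mult intro: mult_left_mono)
      then have "\<bar>\<alpha> + \<beta> * s\<bar> \<le> \<bar>\<bar>\<alpha>\<bar> + \<bar>\<beta>\<bar> * \<bar>d\<bar>\<bar>" by linarith
      then show ?thesis unfolding abs_mult by (intro mult_right_mono) auto
    qed
    then show "AE s in lborel. norm (indicator {0..d} s *\<^sub>R ((\<alpha> + \<beta> * s) * g s)) \<le> norm ((\<bar>\<alpha>\<bar> + \<bar>\<beta>\<bar> * \<bar>d\<bar>) * (indicator {0..d} s *\<^sub>R g s))"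
      by (intro AE_I2) (auto simp: indicator_def)
  qed measurable
  have "set_integrable lborel {0..d} (\<lambda>y. \<beta> * F y)" using iF by simp
  from set_integral_add(1)[OF ig this] have I: "set_integrable lborel {0..d} (\<lambda>y. (\<alpha> + \<beta> * y) * g y + \<beta> * F y)" .
  have "(\<alpha> + \<beta> * y) * F y = (\<alpha> + \<beta> * 0) * F 0 + oint (\<lambda>y. (\<alpha> + \<beta> * y) * g y + \<beta> * F y) 0 y" if y: "y \<in> {0..d}" for y
  proof -
    have 0: "0 \<in> {0..d}" using y by auto
    note k = integrable_okern[OF _ 0 y]
    have isc: "integrable lborel (\<lambda>s. okern 0 y s * ((y - s) * g s))"
    proof -
      have "(\<lambda>s. okern 0 y s * ((y - s) * g s)) = (\<lambda>s. (y + \<alpha>) * (okern 0 y s * g s) - (okern 0 y s * ((\<alpha> + 1 * s) * g s)))" by (auto simp: algebra_simps)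
      have *: "set_integrable lborel {0..d} (\<lambda>s. (y - s) * g s)"
        unfolding set_integrable_def
      proof (rule Bochner_Integration.integrable_bound)
        show "integrable lborel (\<lambda>s. d * (indicator {0..d} s *\<^sub>R g s))" using i by (simp add: set_integrable_def)
        have "\<bar>(y - s) * g s\<bar> \<le> \<bar>d * g s\<bar>" if "s \<in> {0..d}" for s
          unfolding abs_mult using that y by (intro mult_right_mono) auto
        then show "AE s in lborel. norm (indicator {0..d} s *\<^sub>R ((y - s) * g s)) \<le> norm (d * (indicator {0..d} s *\<^sub>R g s))"
          by (intro AE_I2) (auto simp: indicator_def)
      qed measurable
      show ?thesis by (rule k[OF *])
    qed
    have oF: "oint F 0 y = F 0 * y + oint (oint g 0) 0 y"
    proof -
      have "oint F 0 y = oint (\<lambda>s. F 0 + oint g 0 s) 0 y"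
      proof -
        have "okern 0 y s * F s = okern 0 y s * (F 0 + oint g 0 s)" for s
        proof (cases "s \<in> {0..d}")
          case True
          show ?thesis by (rule arg_cong[OF F[OF True]])
        next
          case False
          then have "okern 0 y s = 0" using y by (auto simp: okern_def)
          then show ?thesis by simp
        qed
        then show ?thesis unfolding oint_def[of F] oint_def[of "\<lambda>s. F 0 + oint g 0 s"] by (simp only:)
      qed
      also have "\<dots> = oint (\<lambda>s. F 0) 0 y + oint (oint g 0) 0 y"
      proof -
        have "integrable lborel (\<lambda>s. okern 0 y s * F 0)"
          using integrable_indicator_Icc by (intro k) (simp add: set_integrable_def)
        moreover have "integrable lborel (\<lambda>s. okern 0 y s * oint g 0 s)"
        proof -
          have "okern 0 y s * oint g 0 s = okern 0 y s * F s - okern 0 y s * F 0" for s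
            using y F[of s] by (cases "s \<in> {0..d}") (auto simp: okern_def)
          then show ?thesis using k[OF iF] calculation by simp
        qed
        ultimately show ?thesis unfolding oint_def[of "\<lambda>s. F 0 + oint g 0 s"] oint_def[of "\<lambda>s. F 0"] oint_def[of "oint g 0"]
          by (simp add: distrib_left)
      qed
      finally show ?thesis by (simp add: oint_const)
    qed
    have "oint (\<lambda>y. (\<alpha> + \<beta> * y) * g y + \<beta> * F y) 0 y = oint (\<lambda>y. (\<alpha> + \<beta> * y) * g y) 0 y + \<beta> * oint F 0 y"
      using k[OF ig] k[OF iF] unfolding oint_def by (simp add: distrib_left mult.left_commute[of _ \<beta>])
    also have "\<dots> = oint (\<lambda>y. (\<alpha> + \<beta> * y) * g y) 0 y + \<beta> * oint (\<lambda>t. (y - t) * g t) 0 y + \<beta> * (F 0 * y)"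
      using y by (simp add: oF oint_oint[OF _ i] distrib_left)
    \<comment> \<open>The linear factors add up to \<open>(\<alpha> + \<beta> * s) + \<beta> * (y -
      s) = \<alpha> + \<beta> * y\<close>, which no longer depends on \<open>s\<close>.\<close>
    also have "oint (\<lambda>y. (\<alpha> + \<beta> * y) * g y) 0 y + \<beta> * oint (\<lambda>t. (y - t) * g t) 0 y = (\<alpha> + \<beta> * y) * oint g 0 y"
    proof -
      have "oint (\<lambda>y. (\<alpha> + \<beta> * y) * g y) 0 y + \<beta> * oint (\<lambda>t. (y - t) * g t) 0 y =
        (\<integral>s. okern 0 y s * ((\<alpha> + \<beta> * s) * g s) + \<beta> * (okern 0 y s * ((y - s) * g s)) \<partial>lborel)"
        unfolding oint_def using k[OF ig] isc by simp
      also have "\<dots> = (\<integral>s. (\<alpha> + \<beta> * y) * (okern 0 y s * g s) \<partial>lborel)"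
        by (intro Bochner_Integration.integral_cong) (auto simp: algebra_simps)
      finally show ?thesis by (simp add: oint_def)
    qed
    finally show ?thesis using F[OF y] by (simp add: algebra_simps)
  qed
  with I show ?thesis unfolding ac_on_def by blast
qed

text \<open>By Fubini, \<open>\<integral>\<^sub>0\<^sup>y t\<^sup>-\<^sup>2 \<integral>\<^sub>0\<^sup>t h = \<integral>\<^sub>0\<^sup>y h(\<sigma>) (1/\<sigma> - 1/y) d\<sigma>\<close>. This gives both the derivative of the running
  mean of \<open>h\<close> and its limit \<open>0\<close> at the origin, without Lebesgue's differentiation theorem.\<close>
lemma ac_on_running_mean:
  fixes h :: "real \<Rightarrow> real"
  assumes [measurable]: "h \<in> borel_measurable borel" and A: "0 \<le> A" and i: "set_integrable lborel {0..A} (\<lambda>t. h t / t)"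
  shows "ac_on 0 A (\<lambda>y. oint h 0 y / y) (\<lambda>t. (h t - oint h 0 t / t) / t)"
proof -
  define k where "k t = indicator {0..A} t *\<^sub>R (h t / t)" for t
  have ki: "integrable lborel k" using i unfolding set_integrable_def k_def[abs_def] .
  have [measurable]: "k \<in> borel_measurable borel" unfolding k_def by measurable
  define f where "f y t \<sigma> = okern 0 y t * (okern 0 t \<sigma> * h \<sigma>) / t\<^sup>2" for y t \<sigma>
  have FTC: "(\<integral>\<^sup>+t. ennreal (indicator {\<sigma><..<y} t / t\<^sup>2) \<partial>lborel) = ennreal (1 / \<sigma> - 1 / y)" if "0 < \<sigma>" "\<sigma> < y" for \<sigma> y
  proof -
    have "(\<integral>\<^sup>+t. ennreal (indicator {\<sigma><..<y} t / t\<^sup>2) \<partial>lborel) = (\<integral>\<^sup>+t. ennreal (1 / t\<^sup>2) * indicator {\<sigma>..y} t \<partial>lborel)"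
      using AE_lborel_singleton[of \<sigma>] AE_lborel_singleton[of y]
      by (intro nn_integral_cong_AE, eventually_elim) (auto simp: indicator_def)
    also have "\<dots> = ennreal (- (1 / y) - - (1 / \<sigma>))"
      using that by (intro nn_integral_FTC_Icc) (auto intro!: derivative_eq_intros simp: power2_eq_square)
    finally show ?thesis by simp
  qed
  \<comment> \<open>After the exchange the inner integral is at most \<open>1 / \<sigma>\<close>, so
    the integrability of \<open>h t / t\<close> is the condition for Fubini.\<close>
  have fi: "(\<integral>\<^sup>+t. \<integral>\<^sup>+\<sigma>. ennreal \<bar>f y t \<sigma>\<bar> \<partial>lborel \<partial>lborel) < \<infinity>" if y: "0 < y" "y \<le> A" for y
  proof -
    have "(\<integral>\<^sup>+t. \<integral>\<^sup>+\<sigma>. ennreal \<bar>f y t \<sigma>\<bar> \<partial>lborel \<partial>lborel) = (\<integral>\<^sup>+\<sigma>. \<integral>\<^sup>+t. ennreal \<bar>f y t \<sigma>\<bar> \<partial>lborel \<partial>lborel)"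
      unfolding f_def by (rule lborel_pair.Fubini'[symmetric]) measurable
    also have "\<dots> \<le> (\<integral>\<^sup>+\<sigma>. ennreal \<bar>k \<sigma>\<bar> \<partial>lborel)"
      using AE_lborel_singleton[of "0::real"]
    proof (intro nn_integral_mono_AE, eventually_elim)
      case (elim \<sigma>)
      show ?case
      proof (cases "0 < \<sigma> \<and> \<sigma> < y")
        case True
        have "(\<integral>\<^sup>+t. ennreal \<bar>f y t \<sigma>\<bar> \<partial>lborel) = (\<integral>\<^sup>+t. ennreal (\<bar>h \<sigma>\<bar> * (indicator {\<sigma><..<y} t / t\<^sup>2)) \<partial>lborel)"
          using True by (intro nn_integral_cong) (auto simp: f_def okern_def indicator_def abs_mult)
        also have "\<dots> = ennreal \<bar>h \<sigma>\<bar> * ennreal (1 / \<sigma> - 1 / y)"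
          using True by (subst nn_integral_ennreal_cmult) (auto simp: FTC)
        also have "\<dots> \<le> ennreal \<bar>h \<sigma>\<bar> * ennreal (1 / \<sigma>)"
          using True by (intro mult_left_mono ennreal_leI) auto
        also have "\<dots> = ennreal \<bar>k \<sigma>\<bar>"
          using True y by (simp add: k_def ennreal_mult[symmetric])
        finally show ?thesis .
      next
        case False
        then have "f y t \<sigma> = 0" for t using elim y by (auto simp: f_def okern_def)
        then show ?thesis by simp
      qed
    qed
    also have "\<dots> < \<infinity>" using ki by (simp add: integrable_iff_bounded)
    finally show ?thesis .
  qed
  have int: "integrable (lborel \<Otimes>\<^sub>M lborel) (\<lambda>(t, \<sigma>). f y t \<sigma>)" if y: "0 < y" "y \<le> A" for y
  proof (rule integrableI_bounded)
    show m: "(\<lambda>(t, \<sigma>). f y t \<sigma>) \<in> borel_measurable (lborel \<Otimes>\<^sub>M lborel)" unfolding f_def by measurable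
    have "(\<integral>\<^sup>+p. ennreal (norm (case p of (t, \<sigma>) \<Rightarrow> f y t \<sigma>)) \<partial>(lborel \<Otimes>\<^sub>M lborel)) = (\<integral>\<^sup>+t. \<integral>\<^sup>+\<sigma>. ennreal \<bar>f y t \<sigma>\<bar> \<partial>lborel \<partial>lborel)"
      using m by (subst lborel.nn_integral_fst[symmetric]) auto
    then show "(\<integral>\<^sup>+p. ennreal (norm (case p of (t, \<sigma>) \<Rightarrow> f y t \<sigma>)) \<partial>(lborel \<Otimes>\<^sub>M lborel)) < \<infinity>" using fi[OF y] by simp
  qed
  have inner: "(\<integral>\<sigma>. f y t \<sigma> \<partial>lborel) = okern 0 y t * (oint h 0 t / t\<^sup>2)" for y t
    by (simp add: f_def oint_def)
  have outer: "(\<integral>t. f y t \<sigma> \<partial>lborel) = okern 0 y \<sigma> * (h \<sigma> / \<sigma> - h \<sigma> / y)" if y: "0 < y" "y \<le> A" and \<sigma>: "\<sigma> \<noteq> 0" for y \<sigma>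
  proof (cases "0 < \<sigma> \<and> \<sigma> < y")
    case True
    have "(\<integral>t. f y t \<sigma> \<partial>lborel) = (\<integral>t. h \<sigma> * (indicator {\<sigma><..<y} t / t\<^sup>2) \<partial>lborel)"
      using True by (intro Bochner_Integration.integral_cong) (auto simp: f_def okern_def indicator_def)
    also have "\<dots> = h \<sigma> * (1 / \<sigma> - 1 / y)"
      using FTC[of \<sigma> y] True by (subst integral_mult_right_zero, subst integral_eq_nn_integral) (auto simp: frac_le)
    finally show ?thesis using True by (simp add: okern_def right_diff_distrib)
  next
    case False
    then have "f y t \<sigma> = 0" for t using \<sigma> y by (auto simp: f_def okern_def)
    then have "(\<integral>t. f y t \<sigma> \<partial>lborel) = (\<integral>t. 0 \<partial>(lborel :: real measure))" by (simp only:)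
    moreover have "okern 0 y \<sigma> = 0" using False \<sigma> y by (auto simp: okern_def)
    ultimately show ?thesis by simp
  qed
  have i2: "set_integrable lborel {0..A} (\<lambda>t. oint h 0 t / t\<^sup>2)"
  proof (cases "A = 0")
    case True
    have "AE t in lborel. indicator {0..A} t *\<^sub>R (oint h 0 t / t\<^sup>2) = 0"
      using AE_lborel_singleton[of "0::real"] by eventually_elim (auto simp: True)
    then show ?thesis unfolding set_integrable_def by (subst integrable_cong_AE[where g="\<lambda>t. 0"]) auto
  next
    case False
    then have "integrable lborel (\<lambda>t. okern 0 A t * (oint h 0 t / t\<^sup>2))"
      using lborel_pair.integrable_fst'[OF int[of A]] A by (simp add: inner)
    moreover have "AE t in lborel. okern 0 A t * (oint h 0 t / t\<^sup>2) = indicator {0..A} t *\<^sub>R (oint h 0 t / t\<^sup>2)"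
      using AE_lborel_singleton[of A] by eventually_elim (use A in \<open>auto simp: okern_def indicator_def\<close>)
    ultimately show ?thesis unfolding set_integrable_def
      by (subst integrable_cong_AE[where g="\<lambda>t. okern 0 A t * (oint h 0 t / t\<^sup>2)"]) (auto elim!: eventually_mono)
  qed
  have eq: "(h t - oint h 0 t / t) / t = h t / t - oint h 0 t / t\<^sup>2" for t
    by (simp add: diff_divide_distrib power2_eq_square)
  \<comment> \<open>The quotient at 0 is 0 by convention. This is also the limit of the running mean
    there, so the formula extends to the closed interval.\<close>
  have "oint h 0 y / y = oint h 0 0 / 0 + oint (\<lambda>t. (h t - oint h 0 t / t) / t) 0 y" if y: "y \<in> {0..A}" for y
  proof (cases "y = 0")
    case False
    then have y': "0 < y" "y \<le> A" using y by auto
    have 0: "0 \<in> {0..A}" using A by simp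
    note k1 = integrable_okern[OF i 0 y] and k2 = integrable_okern[OF i2 0 y]
    have ih: "integrable lborel (\<lambda>t. okern 0 y t * h t)"
    proof (rule Bochner_Integration.integrable_bound)
      show "integrable lborel (\<lambda>t. A * (okern 0 y t * (h t / t)))" using k1 by (rule integrable_mult_right)
      show "AE t in lborel. norm (okern 0 y t * h t) \<le> norm (A * (okern 0 y t * (h t / t)))"
        using AE_lborel_singleton[of "0::real"]
      proof eventually_elim
        case (elim t)
        then show ?case
        proof (cases "0 < t \<and> t < y")
          case True
          then have "\<bar>h t\<bar> * t \<le> \<bar>h t\<bar> * A" using y' by (intro mult_left_mono) auto
          then show ?thesis using True A by (simp add: okern_def abs_mult field_simps)
        qed (use elim y' in \<open>auto simp: okern_def\<close>)
      qed
    qed measurable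
    have "oint (\<lambda>t. oint h 0 t / t\<^sup>2) 0 y = (\<integral>t. \<integral>\<sigma>. f y t \<sigma> \<partial>lborel \<partial>lborel)"
      unfolding inner by (simp add: oint_def)
    also have "\<dots> = (\<integral>\<sigma>. \<integral>t. f y t \<sigma> \<partial>lborel \<partial>lborel)"
      using lborel_pair.Fubini_integral[OF int[OF y']] by simp
    also have "\<dots> = (\<integral>\<sigma>. okern 0 y \<sigma> * (h \<sigma> / \<sigma>) - okern 0 y \<sigma> * h \<sigma> / y \<partial>lborel)"
    proof (rule integral_cong_AE)
      show "AE \<sigma> in lborel. (\<integral>t. f y t \<sigma> \<partial>lborel) = okern 0 y \<sigma> * (h \<sigma> / \<sigma>) - okern 0 y \<sigma> * h \<sigma> / y"
        using AE_lborel_singleton[of "0::real"] by eventually_elim (simp add: outer[OF y'] right_diff_distrib)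
      show "(\<lambda>\<sigma>. \<integral>t. f y t \<sigma> \<partial>lborel) \<in> borel_measurable lborel" unfolding f_def by measurable
    qed measurable
    also have "\<dots> = oint (\<lambda>t. h t / t) 0 y - oint h 0 y / y"
      using k1 ih by (simp add: oint_def)
    finally have "oint h 0 y / y = oint (\<lambda>t. h t / t) 0 y - oint (\<lambda>t. oint h 0 t / t\<^sup>2) 0 y" by simp
    also have "\<dots> = oint (\<lambda>t. h t / t - oint h 0 t / t\<^sup>2) 0 y"
      using k1 k2 unfolding oint_def[of "\<lambda>t. h t / t"] oint_def[of "\<lambda>t. oint h 0 t / t\<^sup>2"] oint_def[of "\<lambda>t. h t / t - oint h 0 t / t\<^sup>2"]
      by (simp add: right_diff_distrib)
    finally show ?thesis by (simp add: eq)
  qed simp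
  moreover have "set_integrable lborel {0..A} (\<lambda>t. (h t - oint h 0 t / t) / t)"
    unfolding eq using i i2 by (rule set_integral_diff(1))
  ultimately show ?thesis unfolding ac_on_def by blast
qed

section \<open>Extension from a corner\<close>

text \<open>The two sides of a corner are unfolded to one interval, \<open>u\<close> on the right and \<open>v\<close> on the left.
  The half plane is mapped to the quadrant by a piecewise linear map under which the boundary point \<open>s\<close> goes to
  \<open>(s, 0)\<close> or \<open>(0, -s)\<close>; the extension \<open>corner_ext w x y\<close> averages \<open>w\<close> over the interval with centre \<open>x - y\<close> and radius
  \<open>min x y\<close>, and \<open>corner_ext_dy\<close> is its derivative in \<open>y\<close>.\<close>
definition corner_data :: "real \<Rightarrow> (real \<Rightarrow> real) \<Rightarrow> (real \<Rightarrow> real) \<Rightarrow> real \<Rightarrow> real" where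
  "corner_data d u v s = (if 0 < s \<and> s \<le> d then u s else if - d \<le> s \<and> s < 0 then v (- s) else 0)"

definition corner_ext :: "(real \<Rightarrow> real) \<Rightarrow> real \<Rightarrow> real \<Rightarrow> real" where
  "corner_ext w x y = (\<integral>\<theta>. indicator {0..1} \<theta> * w (if y \<le> x then x - 2 * y * \<theta> else 2 * x * \<theta> - y) \<partial>lborel)"

definition corner_ext_dy :: "(real \<Rightarrow> real) \<Rightarrow> real \<Rightarrow> real \<Rightarrow> real" where
  "corner_ext_dy w x y = (if y \<le> x then (w (x - 2 * y) - corner_ext w x y) / y else (w (- y) - w (2 * x - y)) / (2 * x))"

definition gag_sym :: "real \<Rightarrow> (real \<Rightarrow> real) \<Rightarrow> ennreal" where
  "gag_sym d w = (\<integral>\<^sup>+p. \<integral>\<^sup>+s. ennreal (indicator {-d..d} p * indicator {-d..d} s * ((w p - w s)\<^sup>2 / (p - s)\<^sup>2)) \<partial>lborel \<partial>lborel)"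

section \<open>Absolute continuity of the corner extension in y\<close>

lemma corner_data_measurable [measurable]:
  assumes [measurable]: "u \<in> borel_measurable borel" "v \<in> borel_measurable borel"
  shows "corner_data d u v \<in> borel_measurable borel"
  unfolding corner_data_def[abs_def] by measurable

lemma corner_data_uminus: "corner_data d u v (- s) = corner_data d v u s"
  by (auto simp: corner_data_def)

lemma corner_ext_measurable [measurable (raw)]:
  assumes [measurable]: "w \<in> borel_measurable borel" "f \<in> borel_measurable M" "g \<in> borel_measurable M"
  shows "(\<lambda>z. corner_ext w (f z) (g z)) \<in> borel_measurable M"
proof -
  have "(\<lambda>(z, \<theta>). indicator {0..1} \<theta> * w (if g z \<le> f z then f z - 2 * g z * \<theta> else 2 * f z * \<theta> - g z)) \<in> borel_measurable (M \<Otimes>\<^sub>M lborel)"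
    by measurable
  then show ?thesis unfolding corner_ext_def by (rule lborel.borel_measurable_lebesgue_integral)
qed

lemma corner_ext_dy_measurable [measurable (raw)]:
  assumes [measurable]: "w \<in> borel_measurable borel" "f \<in> borel_measurable M" "g \<in> borel_measurable M"
  shows "(\<lambda>z. corner_ext_dy w (f z) (g z)) \<in> borel_measurable M"
  unfolding corner_ext_dy_def by measurable

text \<open>Off the diagonal the exchange of coordinates interchanges the two branches literally; on
  it both sides use the first branch and traverse the interval in opposite directions.\<close>

lemma corner_ext_swap: "x \<noteq> y \<Longrightarrow> corner_ext w x y = corner_ext (\<lambda>s. w (- s)) y x"
  by (cases "x < y") (simp_all add: corner_ext_def)

lemma oint_reflect:
  assumes [measurable]: "w \<in> borel_measurable borel"
  shows "oint (\<lambda>s. w (c - s)) x y = oint w (c - y) (c - x)"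
proof -
  have "oint w (c - y) (c - x) = (\<integral>s. okern (c - y) (c - x) (c + (-1) * s) * w (c + (-1) * s) \<partial>lborel)"
    unfolding oint_def by (subst lborel_integral_real_affine[of "-1" _ c]) auto
  also have "\<dots> = oint (\<lambda>s. w (c - s)) x y"
    unfolding oint_def
  proof (rule integral_cong_AE)
    show "AE s in lborel. okern (c - y) (c - x) (c + (-1) * s) * w (c + (-1) * s) = okern x y s * w (c - s)"
      using AE_lborel_singleton[of x] AE_lborel_singleton[of y]
      by eventually_elim (auto simp: okern_def)
  qed measurable
  finally show ?thesis by simp
qed

lemma ac_on_const_add:
  assumes "ac_on a b F g"
  shows "ac_on a b (\<lambda>y. c + F y) g"
proof -
  have "c + F y = c + F a + oint g a y" if "y \<in> {a..b}" for y using ac_on_D[OF assms that] by simp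
  with ac_on_int[OF assms] show ?thesis unfolding ac_on_def by blast
qed

lemma set_integrable_affine:
  fixes w :: "real \<Rightarrow> real"
  assumes i: "set_integrable lborel {p..q} w" and c: "c \<noteq> 0" and sub: "\<And>s. s \<in> {a..b} \<Longrightarrow> t + c * s \<in> {p..q}"
  shows "set_integrable lborel {a..b} (\<lambda>s. w (t + c * s))"
proof -
  have "integrable lborel (\<lambda>s. indicator {p..q} (t + c * s) *\<^sub>R w (t + c * s))"
    using i unfolding set_integrable_def by (rule lborel_integrable_real_affine) (rule c)
  then have "integrable lborel (\<lambda>s. indicator {a..b} s *\<^sub>R (indicator {p..q} (t + c * s) *\<^sub>R w (t + c * s)))"
    by (intro integrable_mult_indicator) auto
  also have "(\<lambda>s. indicator {a..b} s *\<^sub>R (indicator {p..q} (t + c * s) *\<^sub>R w (t + c * s))) = (\<lambda>s. indicator {a..b} s *\<^sub>R w (t + c * s))"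
    using sub by (force simp: indicator_def fun_eq_iff)
  finally show ?thesis by (simp only: set_integrable_def)
qed

text \<open>For \<open>y \<le> x\<close> the interval of averaging has the fixed end point
  \<open>x\<close>. Subtracting the boundary value \<open>w x\<close> leaves a running mean to which
  \<open>ac_on_running_mean\<close> applies; at \<open>y = 0\<close> both sides are
  \<open>w x\<close>.\<close>

lemma corner_ext_lower:
  assumes [measurable]: "w \<in> borel_measurable borel" and i: "set_integrable lborel {-d..d} w"
    and x: "0 < x" "x \<le> d" and y: "0 \<le> y" "y \<le> x"
  shows "corner_ext w x y = w x + oint (\<lambda>\<sigma>. w (x - 2 * \<sigma>) - w x) 0 y / y"
proof (cases "y = 0")
  case True then show ?thesis using x by (simp add: corner_ext_def)
next
  case False
  then have y0: "y > 0" using y by simp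
  have "set_integrable lborel {0..1} (\<lambda>\<theta>. w (x + (- (2 * y)) * \<theta>))"
  proof (rule set_integrable_affine[OF i])
    fix s :: real assume "s \<in> {0..1}"
    then have "y * s \<le> y * 1" "0 \<le> y * s" using y0 by (auto intro: mult_left_mono simp del: mult_1_right)
    then show "x + (- (2 * y)) * s \<in> {-d..d}" using x y by auto
  qed (use y0 in simp)
  then have I: "integrable lborel (\<lambda>\<theta>. indicator {0..1} \<theta> * w (x - 2 * y * \<theta>))" by (simp add: set_integrable_def)
  have I2: "integrable lborel (\<lambda>\<theta>::real. indicator {0..1} \<theta> * w x)"
    using integrable_indicator_Icc[of 0 1] by simp
  have "oint (\<lambda>\<sigma>. w (x - 2 * \<sigma>) - w x) 0 y = y * (\<integral>\<theta>. okern 0 y (0 + y * \<theta>) * (w (x - 2 * (0 + y * \<theta>)) - w x) \<partial>lborel)"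
    unfolding oint_def using y0 by (subst lborel_integral_real_affine[of y _ 0]) auto
  also have "(\<integral>\<theta>. okern 0 y (0 + y * \<theta>) * (w (x - 2 * (0 + y * \<theta>)) - w x) \<partial>lborel) =
    (\<integral>\<theta>. indicator {0..1} \<theta> * w (x - 2 * y * \<theta>) - indicator {0..1} \<theta> * w x \<partial>lborel)"
  proof (rule integral_cong_AE)
    show "AE \<theta> in lborel. okern 0 y (0 + y * \<theta>) * (w (x - 2 * (0 + y * \<theta>)) - w x) = indicator {0..1} \<theta> * w (x - 2 * y * \<theta>) - indicator {0..1} \<theta> * w x"
      using AE_lborel_singleton[of "1::real"]
    proof eventually_elim
      case (elim \<theta>)
      have "okern 0 y (y * \<theta>) = indicator {0..1} \<theta>" using y0 elim by (auto simp: okern_def indicator_def zero_le_mult_iff mult_less_0_iff)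
      then show ?case by (simp add: right_diff_distrib mult.assoc)
    qed
  qed measurable
  also have "\<dots> = corner_ext w x y - w x"
    using y I I2 by (simp add: corner_ext_def)
  finally show ?thesis using y0 by simp
qed

text \<open>For \<open>x \<le> y\<close> the interval has the fixed length \<open>2 * x\<close> and
  only moves with \<open>y\<close>. On the diagonal \<open>corner_ext\<close> is given by its first
  branch, which parametrises the interval backwards.\<close>

lemma corner_ext_upper:
  assumes [measurable]: "w \<in> borel_measurable borel" and x: "0 < x" and y: "x \<le> y"
  shows "corner_ext w x y = oint w (- y) (2 * x - y) / (2 * x)"
proof (cases "x = y")
  case True
  have "oint w (- x) x = 2 * x * (\<integral>\<theta>. okern (- x) x (x + (- (2 * x)) * \<theta>) * w (x + (- (2 * x)) * \<theta>) \<partial>lborel)"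
    unfolding oint_def using x by (subst lborel_integral_real_affine[of "- (2 * x)" _ x]) auto
  also have "(\<integral>\<theta>. okern (- x) x (x + (- (2 * x)) * \<theta>) * w (x + (- (2 * x)) * \<theta>) \<partial>lborel) = corner_ext w x x"
    unfolding corner_ext_def
  proof (rule integral_cong_AE)
    show "AE \<theta> in lborel. okern (- x) x (x + (- (2 * x)) * \<theta>) * w (x + (- (2 * x)) * \<theta>) =
      indicator {0..1} \<theta> * w (if x \<le> x then x - 2 * x * \<theta> else 2 * x * \<theta> - x)"
      using AE_lborel_singleton[of "0::real"]
    proof eventually_elim
      case (elim \<theta>)
      have a: "- x \<le> x + (- (2 * x)) * \<theta> \<longleftrightarrow> 2 * x * \<theta> \<le> 2 * x * 1" "x + (- (2 * x)) * \<theta> < x \<longleftrightarrow> 0 < 2 * x * \<theta>" by auto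
      have "- x \<le> x + (- (2 * x)) * \<theta> \<longleftrightarrow> \<theta> \<le> 1" "x + (- (2 * x)) * \<theta> < x \<longleftrightarrow> 0 < \<theta>"
        unfolding a using x by (simp_all add: zero_less_mult_iff)
      then have "okern (- x) x (x + (- (2 * x)) * \<theta>) = indicator {0..1} \<theta>"
        using x elim unfolding okern_def indicator_def by force
      then show ?case by simp
    qed
  qed measurable
  finally show ?thesis using x True by simp
next
  case False
  have "oint w (- y) (2 * x - y) = 2 * x * (\<integral>\<theta>. okern (- y) (2 * x - y) (- y + 2 * x * \<theta>) * w (- y + 2 * x * \<theta>) \<partial>lborel)"
    unfolding oint_def using x by (subst lborel_integral_real_affine[of "2 * x" _ "- y"]) auto
  also have "(\<integral>\<theta>. okern (- y) (2 * x - y) (- y + 2 * x * \<theta>) * w (- y + 2 * x * \<theta>) \<partial>lborel) = corner_ext w x y"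
    unfolding corner_ext_def
  proof (rule integral_cong_AE)
    show "AE \<theta> in lborel. okern (- y) (2 * x - y) (- y + 2 * x * \<theta>) * w (- y + 2 * x * \<theta>) =
      indicator {0..1} \<theta> * w (if y \<le> x then x - 2 * y * \<theta> else 2 * x * \<theta> - y)"
      using AE_lborel_singleton[of "1::real"]
    proof eventually_elim
      case (elim \<theta>)
      have a: "- y \<le> - y + 2 * x * \<theta> \<longleftrightarrow> 0 \<le> 2 * x * \<theta>" "- y + 2 * x * \<theta> < 2 * x - y \<longleftrightarrow> 2 * x * \<theta> < 2 * x * 1" by auto
      have "- y \<le> - y + 2 * x * \<theta> \<longleftrightarrow> 0 \<le> \<theta>" "- y + 2 * x * \<theta> < 2 * x - y \<longleftrightarrow> \<theta> < 1"
        unfolding a using x by (simp_all add: zero_le_mult_iff)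
      then have "okern (- y) (2 * x - y) (- y + 2 * x * \<theta>) = indicator {0..1} \<theta>"
        using x elim unfolding okern_def indicator_def by force
      then show ?case using y False by simp
    qed
  qed measurable
  finally show ?thesis using x by simp
qed

text \<open>The two branches are joined at \<open>y = x\<close>. Below, \<open>fin\<close> makes the
  difference quotient of \<open>w\<close> at \<open>x\<close> square integrable, as the running mean
  needs; above, the derivative comes from the two moving end points.\<close>

lemma corner_ext_ac_on:
  assumes [measurable]: "w \<in> borel_measurable borel" and i: "set_integrable lborel {-d..d} w"
    and x: "0 < x" "x \<le> d"
    and fin: "(\<integral>\<^sup>+s. ennreal (indicator {-d..d} s * ((w x - w s)\<^sup>2 / (x - s)\<^sup>2)) \<partial>lborel) < \<infinity>"
  shows "ac_on 0 d (corner_ext w x) (corner_ext_dy w x)"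
proof (rule ac_on_concat)
  show "ac_on 0 x (corner_ext w x) (corner_ext_dy w x)"
  proof -
    define h where "h \<sigma> = w (x - 2 * \<sigma>) - w x" for \<sigma>
    have [measurable]: "h \<in> borel_measurable borel" unfolding h_def by measurable
    have E: "corner_ext w x y = w x + oint h 0 y / y" if "y \<in> {0..x}" for y
      unfolding h_def[abs_def] using corner_ext_lower[OF assms(1) i x] that by simp
    have "(\<integral>\<^sup>+t\<in>{0..x}. ennreal ((h t / t)\<^sup>2) \<partial>lborel) \<le>
      (\<integral>\<^sup>+t. ennreal (4 * (indicator {-d..d} (x + (-2) * t) * ((w x - w (x + (-2) * t))\<^sup>2 / (x - (x + (-2) * t))\<^sup>2))) \<partial>lborel)"
    proof (rule nn_integral_mono)
      fix t
      have "4 * ((w x - w (x - 2 * t))\<^sup>2 / (2 * t)\<^sup>2) = (h t / t)\<^sup>2"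
        by (simp add: h_def power_divide power_mult_distrib power2_commute)
      then show "ennreal ((h t / t)\<^sup>2) * indicator {0..x} t \<le> ennreal (4 * (indicator {-d..d} (x + (-2) * t) * ((w x - w (x + (-2) * t))\<^sup>2 / (x - (x + (-2) * t))\<^sup>2)))"
        using x by (auto simp: indicator_def)
    qed
    also have "\<dots> = 4 * (\<integral>\<^sup>+t. ennreal (indicator {-d..d} (x + (-2) * t) * ((w x - w (x + (-2) * t))\<^sup>2 / (x - (x + (-2) * t))\<^sup>2)) \<partial>lborel)"
      by (subst nn_integral_ennreal_cmult) auto
    \<comment> \<open>The substitution \<open>s = x - 2 * t\<close> halves the constant 4.\<close>
    also have "\<dots> = 2 * (\<integral>\<^sup>+s. ennreal (indicator {-d..d} s * ((w x - w s)\<^sup>2 / (x - s)\<^sup>2)) \<partial>lborel)"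
      by (subst (2) nn_integral_real_affine[where c="-2" and t=x]) (auto simp: mult.assoc[symmetric])
    also have "\<dots> < \<infinity>" using fin by (simp add: ennreal_mult_less_top)
    finally have "set_integrable lborel {0..x} (\<lambda>t. h t / t)"
      by (intro sq_fin_set_integrable) auto
    then have "ac_on 0 x (\<lambda>y. oint h 0 y / y) (\<lambda>t. (h t - oint h 0 t / t) / t)"
      using x by (intro ac_on_running_mean) auto
    then have "ac_on 0 x (\<lambda>y. w x + oint h 0 y / y) (\<lambda>t. (h t - oint h 0 t / t) / t)"
      by (rule ac_on_const_add)
    then show ?thesis
    proof (rule ac_on_cong)
      show "w x + oint h 0 y / y = corner_ext w x y" if "y \<in> {0..x}" for y using E[OF that] by simp
      show "AE s in lborel. s \<in> {0..x} \<longrightarrow> (h s - oint h 0 s / s) / s = corner_ext_dy w x s"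
        by (intro AE_I2) (auto simp: corner_ext_dy_def E h_def)
    qed measurable
  qed
  show "ac_on x d (corner_ext w x) (corner_ext_dy w x)"
  proof -
    define \<gamma> where "\<gamma> s = (w (- s) - w (2 * x - s)) / (2 * x)" for s
    have [measurable]: "\<gamma> \<in> borel_measurable borel" unfolding \<gamma>_def by measurable
    have i1: "set_integrable lborel {x..d} (\<lambda>s. w (0 - s))"
      using set_integrable_affine[OF i, of "-1" x d 0] x by simp
    have i2: "set_integrable lborel {x..d} (\<lambda>s. w (2 * x - s))"
      using set_integrable_affine[OF i, of "-1" x d "2 * x"] x by simp
    have ig: "set_integrable lborel {x..d} \<gamma>"
      unfolding \<gamma>_def[abs_def] using set_integral_diff(1)[OF i1 i2] by simp
    have "corner_ext w x y = corner_ext w x x + oint \<gamma> x y" if y: "y \<in> {x..d}" for y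
    proof -
      have xx: "x \<in> {x..d}" using x by simp
      have "oint \<gamma> x y = (\<integral>s. (okern x y s * w (0 - s) - okern x y s * w (2 * x - s)) / (2 * x) \<partial>lborel)"
        unfolding oint_def \<gamma>_def by (intro Bochner_Integration.integral_cong) (auto simp: field_simps)
      also have "\<dots> = (oint (\<lambda>s. w (0 - s)) x y - oint (\<lambda>s. w (2 * x - s)) x y) / (2 * x)"
        using integrable_okern[OF i1 xx y] integrable_okern[OF i2 xx y] unfolding oint_def by simp
      also have "\<dots> = (oint w (- y) (- x) - oint w (2 * x - y) x) / (2 * x)"
        using oint_reflect[of w 0 x y] oint_reflect[of w "2 * x" x y] by simp
      finally have g: "oint \<gamma> x y = (oint w (- y) (- x) - oint w (2 * x - y) x) / (2 * x)" .
      have m: "- y \<in> {-d..d}" "- x \<in> {-d..d}" "x \<in> {-d..d}" "2 * x - y \<in> {-d..d}" using x y by auto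
      note k = integrable_okern[OF i]
      have "oint w (- y) (- x) + oint w (- x) x = oint w (- y) x" by (intro oint_trans k m)
      moreover have "oint w (- y) (2 * x - y) + oint w (2 * x - y) x = oint w (- y) x" by (intro oint_trans k m)
      ultimately have "oint w (- y) (2 * x - y) = oint w (- x) x + (oint w (- y) (- x) - oint w (2 * x - y) x)" by simp
      then show ?thesis
        using corner_ext_upper[OF assms(1) x(1), of y] corner_ext_upper[OF assms(1) x(1), of x] y g by (simp add: add_divide_distrib)
    qed
    with ig have "ac_on x d (corner_ext w x) \<gamma>" unfolding ac_on_def by blast
    then show ?thesis
    proof (rule ac_on_cong)
      show "AE s in lborel. s \<in> {x..d} \<longrightarrow> \<gamma> s = corner_ext_dy w x s"
        using AE_lborel_singleton[of x] by eventually_elim (auto simp: corner_ext_dy_def \<gamma>_def)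
    qed auto
  qed
qed (use x in auto)

section \<open>Boundary values and energy of the corner extension\<close>

lemma corner_ext_zero: "0 \<le> x \<Longrightarrow> corner_ext w x 0 = w x"
  by (simp add: corner_ext_def)

text \<open>The linear change of variables \<open>p = x - \<alpha> * y\<close>,
  \<open>s = x - \<beta> * y\<close>, of determinant \<open>\<alpha> - \<beta>\<close> up to sign,
  carried out as a translation in \<open>x\<close> followed by a scaling in
  \<open>y\<close>.\<close>

lemma nn_integral_shear:
  fixes K :: "real \<Rightarrow> real \<Rightarrow> ennreal"
  assumes [measurable]: "(\<lambda>(p, s). K p s) \<in> borel_measurable (borel \<Otimes>\<^sub>M borel)" and ab: "\<alpha> \<noteq> \<beta>"
  shows "ennreal \<bar>\<alpha> - \<beta>\<bar> * (\<integral>\<^sup>+y. \<integral>\<^sup>+x. K (x - \<alpha> * y) (x - \<beta> * y) \<partial>lborel \<partial>lborel) = (\<integral>\<^sup>+p. \<integral>\<^sup>+s. K p s \<partial>lborel \<partial>lborel)"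
proof -
  have [measurable]: "(\<lambda>(p, s). K p s) \<in> borel_measurable (lborel \<Otimes>\<^sub>M lborel)"
    using assms(1) by (simp cong: measurable_cong_sets)
  have "(\<integral>\<^sup>+y. \<integral>\<^sup>+x. K (x - \<alpha> * y) (x - \<beta> * y) \<partial>lborel \<partial>lborel) = (\<integral>\<^sup>+y. \<integral>\<^sup>+x. K x (x + (\<alpha> - \<beta>) * y) \<partial>lborel \<partial>lborel)"
  proof (rule nn_integral_cong)
    fix y
    have "(\<integral>\<^sup>+x. K (x - \<alpha> * y) (x - \<beta> * y) \<partial>lborel) = (\<integral>\<^sup>+x. K (\<alpha> * y + x - \<alpha> * y) (\<alpha> * y + x - \<beta> * y) \<partial>lborel)"
      by (rule nn_integral_translate[symmetric]) measurable
    then show "(\<integral>\<^sup>+x. K (x - \<alpha> * y) (x - \<beta> * y) \<partial>lborel) = (\<integral>\<^sup>+x. K x (x + (\<alpha> - \<beta>) * y) \<partial>lborel)"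
      by (simp add: algebra_simps)
  qed
  also have "\<dots> = (\<integral>\<^sup>+x. \<integral>\<^sup>+y. K x (x + (\<alpha> - \<beta>) * y) \<partial>lborel \<partial>lborel)"
    by (rule lborel_pair.Fubini') measurable
  finally have "ennreal \<bar>\<alpha> - \<beta>\<bar> * (\<integral>\<^sup>+y. \<integral>\<^sup>+x. K (x - \<alpha> * y) (x - \<beta> * y) \<partial>lborel \<partial>lborel) =
    (\<integral>\<^sup>+x. ennreal \<bar>\<alpha> - \<beta>\<bar> * (\<integral>\<^sup>+y. K x (x + (\<alpha> - \<beta>) * y) \<partial>lborel) \<partial>lborel)"
    by (simp add: nn_integral_cmult)
  also have "\<dots> = (\<integral>\<^sup>+p. \<integral>\<^sup>+s. K p s \<partial>lborel \<partial>lborel)"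
  proof (rule nn_integral_cong)
    fix x
    show "ennreal \<bar>\<alpha> - \<beta>\<bar> * (\<integral>\<^sup>+y. K x (x + (\<alpha> - \<beta>) * y) \<partial>lborel) = (\<integral>\<^sup>+s. K x s \<partial>lborel)"
      by (rule nn_integral_real_affine[symmetric]) (use ab in auto)
  qed
  finally show ?thesis .
qed

lemma le_ennreal_mult_self: "1 \<le> c \<Longrightarrow> X \<le> ennreal c * X"
  using mult_right_mono[of 1 "ennreal c" X] by simp

lemma corner_ext_arg_range:
  assumes "0 \<le> x" "x \<le> d" "0 \<le> y" "y \<le> d" "0 \<le> \<theta>" "\<theta> \<le> (1::real)"
  shows "(if y \<le> x then x - 2 * y * \<theta> else 2 * x * \<theta> - y) \<in> {-d..d}"
proof -
  have "y * \<theta> \<le> y * 1" "0 \<le> y * \<theta>" "x * \<theta> \<le> x * 1" "0 \<le> x * \<theta>"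
    using assms by (auto intro: mult_left_mono simp del: mult_1_right)
  moreover have "2 * y * \<theta> = 2 * (y * \<theta>)" "2 * x * \<theta> = 2 * (x * \<theta>)" by simp_all
  ultimately show ?thesis using assms unfolding atLeastAtMost_iff by (cases "y \<le> x") (simp only: if_True if_False, linarith)+
qed

text \<open>Jensen's inequality for the uniform measure on \<open>{0..1}\<close>; the integrability
  of \<open>w\<close> is needed to subtract \<open>m\<close> under the integral.\<close>

lemma corner_ext_diff_sq:
  assumes [measurable]: "w \<in> borel_measurable borel" and i: "set_integrable lborel {-d..d} w"
    and xy: "0 \<le> x" "x \<le> d" "0 \<le> y" "y \<le> d"
  shows "ennreal ((corner_ext w x y - m)\<^sup>2) \<le>
    (\<integral>\<^sup>+\<theta>. ennreal (indicator {0..1} \<theta> * (w (if y \<le> x then x - 2 * y * \<theta> else 2 * x * \<theta> - y) - m)\<^sup>2) \<partial>lborel)"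
proof -
  let ?a = "\<lambda>\<theta>. if y \<le> x then x - 2 * y * \<theta> else 2 * x * \<theta> - y"
  have "set_integrable lborel {0..1} (\<lambda>\<theta>. w (?a \<theta>))"
  proof (cases "y \<le> x")
    case True
    show ?thesis
    proof (cases "y = 0")
      case True
      then show ?thesis using xy integrable_indicator_Icc[of 0 1] by (auto simp: set_integrable_def)
    next
      case False
      then show ?thesis
        using set_integrable_affine[OF i, of "- (2 * y)" 0 1 x] corner_ext_arg_range[OF xy] True by simp
    qed
  next
    case False
    show ?thesis
    proof (cases "x = 0")
      case True
      then show ?thesis using False integrable_indicator_Icc[of 0 1] by (auto simp: set_integrable_def)
    next
      case nz: False
      then show ?thesis
        using set_integrable_affine[OF i, of "2 * x" 0 1 "- y"] corner_ext_arg_range[OF xy] False by simp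
    qed
  qed
  then have I: "integrable lborel (\<lambda>\<theta>. indicator {0..1} \<theta> * w (?a \<theta>))" by (simp add: set_integrable_def)
  have I2: "integrable lborel (\<lambda>\<theta>::real. indicator {0..1} \<theta> * m)" using integrable_indicator_Icc[of 0 1] by simp
  have "corner_ext w x y - m = (\<integral>\<theta>. indicator {0..1} \<theta> * (w (?a \<theta>) - m) \<partial>lborel)"
    using I I2 by (simp add: corner_ext_def right_diff_distrib)
  moreover have "ennreal ((\<integral>\<theta>. indicator {0..1::real} \<theta> * (w (?a \<theta>) - m) \<partial>lborel)\<^sup>2) \<le> (\<integral>\<^sup>+\<theta>. ennreal \<bar>indicator {0..1::real} \<theta>\<bar> \<partial>lborel) *
    (\<integral>\<^sup>+\<theta>. ennreal (\<bar>indicator {0..1} \<theta>\<bar> * (w (?a \<theta>) - m)\<^sup>2) \<partial>lborel)"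
    by (rule integral_square_weighted_le) measurable
  ultimately have "ennreal ((corner_ext w x y - m)\<^sup>2) \<le> (\<integral>\<^sup>+\<theta>. ennreal \<bar>indicator {0..1::real} \<theta>\<bar> \<partial>lborel) *
    (\<integral>\<^sup>+\<theta>. ennreal (\<bar>indicator {0..1} \<theta>\<bar> * (w (?a \<theta>) - m)\<^sup>2) \<partial>lborel)"
    by (simp only:)
  also have "(\<integral>\<^sup>+\<theta>. ennreal \<bar>indicator {0..1::real} \<theta>\<bar> \<partial>lborel) = (\<integral>\<^sup>+\<theta>. indicator {0..1::real} \<theta> \<partial>lborel)"
    by (intro nn_integral_cong) (auto simp: indicator_def)
  also have "\<dots> = 1" by simp
  finally show ?thesis by simp
qed

text \<open>For fixed \<theta> the argument of \<open>w\<close> is a translate of \<open>x\<close>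
  in one branch and a reflection of \<open>y\<close> in the other. Integrating over that variable
  first gives the full integral; the other variable contributes \<open>d\<close>, and the two
  branches contribute 2.\<close>

lemma corner_ext_mean_sq:
  assumes [measurable]: "w \<in> borel_measurable borel" and i: "set_integrable lborel {-d..d} w" and d: "0 \<le> d"
  shows "(\<integral>\<^sup>+x. \<integral>\<^sup>+y. ennreal (indicator {0..d} x * indicator {0..d} y * (corner_ext w x y - m)\<^sup>2) \<partial>lborel \<partial>lborel) \<le>
    2 * ennreal d * (\<integral>\<^sup>+s. ennreal (indicator {-d..d} s * (w s - m)\<^sup>2) \<partial>lborel)"
proof -
  define q where "q s = ennreal (indicator {-d..d} s * (w s - m)\<^sup>2)" for s
  have [measurable]: "q \<in> borel_measurable borel" unfolding q_def by measurable
  let ?q1 = "\<lambda>x y \<theta>. indicator {0..1} \<theta> * (indicator {0..d} y * q (x - 2 * y * \<theta>)) :: ennreal"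
  let ?q2 = "\<lambda>x y \<theta>. indicator {0..1} \<theta> * (indicator {0..d} x * q (2 * x * \<theta> - y)) :: ennreal"
  have "(\<integral>\<^sup>+x. \<integral>\<^sup>+y. ennreal (indicator {0..d} x * indicator {0..d} y * (corner_ext w x y - m)\<^sup>2) \<partial>lborel \<partial>lborel) \<le>
    (\<integral>\<^sup>+x. \<integral>\<^sup>+y. (\<integral>\<^sup>+\<theta>. ?q1 x y \<theta> \<partial>lborel) + (\<integral>\<^sup>+\<theta>. ?q2 x y \<theta> \<partial>lborel) \<partial>lborel \<partial>lborel)"
  proof (intro nn_integral_mono)
    fix x y
    show "ennreal (indicator {0..d} x * indicator {0..d} y * (corner_ext w x y - m)\<^sup>2) \<le> (\<integral>\<^sup>+\<theta>. ?q1 x y \<theta> \<partial>lborel) + (\<integral>\<^sup>+\<theta>. ?q2 x y \<theta> \<partial>lborel)"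
    proof (cases "x \<in> {0..d} \<and> y \<in> {0..d}")
      case True
      then have "ennreal ((corner_ext w x y - m)\<^sup>2) \<le>
        (\<integral>\<^sup>+\<theta>. ennreal (indicator {0..1} \<theta> * (w (if y \<le> x then x - 2 * y * \<theta> else 2 * x * \<theta> - y) - m)\<^sup>2) \<partial>lborel)"
        by (intro corner_ext_diff_sq[OF assms(1) i]) auto
      also have "\<dots> \<le> (\<integral>\<^sup>+\<theta>. ?q1 x y \<theta> + ?q2 x y \<theta> \<partial>lborel)"
      proof (rule nn_integral_mono)
        fix \<theta> :: real
        show "ennreal (indicator {0..1} \<theta> * (w (if y \<le> x then x - 2 * y * \<theta> else 2 * x * \<theta> - y) - m)\<^sup>2) \<le> ?q1 x y \<theta> + ?q2 x y \<theta>"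
          using corner_ext_arg_range[of x d y \<theta>] True
          by (cases "\<theta> \<in> {0..1}"; cases "y \<le> x") (auto simp: q_def)
      qed
      also have "\<dots> = (\<integral>\<^sup>+\<theta>. ?q1 x y \<theta> \<partial>lborel) + (\<integral>\<^sup>+\<theta>. ?q2 x y \<theta> \<partial>lborel)"
        by (rule nn_integral_add) measurable
      finally show ?thesis using True by simp
    next
      case False
      then have z: "indicator {0..d} x * indicator {0..d} y * (corner_ext w x y - m)\<^sup>2 = 0" by auto
      show ?thesis unfolding z by simp
    qed
  qed
  also have "\<dots> = (\<integral>\<^sup>+x. \<integral>\<^sup>+y. (\<integral>\<^sup>+\<theta>. ?q1 x y \<theta> \<partial>lborel) \<partial>lborel \<partial>lborel) + (\<integral>\<^sup>+x. \<integral>\<^sup>+y. (\<integral>\<^sup>+\<theta>. ?q2 x y \<theta> \<partial>lborel) \<partial>lborel \<partial>lborel)"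
    by (simp add: nn_integral_add)
  also have "(\<integral>\<^sup>+x. \<integral>\<^sup>+y. (\<integral>\<^sup>+\<theta>. ?q1 x y \<theta> \<partial>lborel) \<partial>lborel \<partial>lborel) = (\<integral>\<^sup>+y. \<integral>\<^sup>+x. (\<integral>\<^sup>+\<theta>. ?q1 x y \<theta> \<partial>lborel) \<partial>lborel \<partial>lborel)"
    by (rule lborel_pair.Fubini'[symmetric]) measurable
  also have "\<dots> = (\<integral>\<^sup>+y. indicator {0..d} y * (\<integral>\<^sup>+s. q s \<partial>lborel) \<partial>lborel)"
  proof (rule nn_integral_cong)
    fix y
    have "(\<integral>\<^sup>+x. (\<integral>\<^sup>+\<theta>. ?q1 x y \<theta> \<partial>lborel) \<partial>lborel) = (\<integral>\<^sup>+\<theta>. (\<integral>\<^sup>+x. ?q1 x y \<theta> \<partial>lborel) \<partial>lborel)"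
      by (rule lborel_pair.Fubini'[symmetric]) measurable
    also have "\<dots> = (\<integral>\<^sup>+\<theta>. indicator {0..1::real} \<theta> * (indicator {0..d} y * (\<integral>\<^sup>+s. q s \<partial>lborel)) \<partial>lborel)"
    proof (rule nn_integral_cong)
      fix \<theta> :: real
      have "(\<integral>\<^sup>+x. q (x - 2 * y * \<theta>) \<partial>lborel) = (\<integral>\<^sup>+s. q s \<partial>lborel)"
        using nn_integral_translate[of q "- (2 * y * \<theta>)"] by simp
      then show "(\<integral>\<^sup>+x. ?q1 x y \<theta> \<partial>lborel) = indicator {0..1} \<theta> * (indicator {0..d} y * (\<integral>\<^sup>+s. q s \<partial>lborel))"
        by (simp add: nn_integral_cmult)
    qed
    also have "\<dots> = indicator {0..d} y * (\<integral>\<^sup>+s. q s \<partial>lborel)" by (simp add: nn_integral_multc)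
    finally show "(\<integral>\<^sup>+x. (\<integral>\<^sup>+\<theta>. ?q1 x y \<theta> \<partial>lborel) \<partial>lborel) = indicator {0..d} y * (\<integral>\<^sup>+s. q s \<partial>lborel)" .
  qed
  also have "(\<integral>\<^sup>+x. \<integral>\<^sup>+y. (\<integral>\<^sup>+\<theta>. ?q2 x y \<theta> \<partial>lborel) \<partial>lborel \<partial>lborel) = (\<integral>\<^sup>+x. indicator {0..d} x * (\<integral>\<^sup>+s. q s \<partial>lborel) \<partial>lborel)"
  proof (rule nn_integral_cong)
    fix x
    have "(\<integral>\<^sup>+y. (\<integral>\<^sup>+\<theta>. ?q2 x y \<theta> \<partial>lborel) \<partial>lborel) = (\<integral>\<^sup>+\<theta>. (\<integral>\<^sup>+y. ?q2 x y \<theta> \<partial>lborel) \<partial>lborel)"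
      by (rule lborel_pair.Fubini'[symmetric]) measurable
    also have "\<dots> = (\<integral>\<^sup>+\<theta>. indicator {0..1::real} \<theta> * (indicator {0..d} x * (\<integral>\<^sup>+s. q s \<partial>lborel)) \<partial>lborel)"
    proof (rule nn_integral_cong)
      fix \<theta> :: real
      have "(\<integral>\<^sup>+y. q (2 * x * \<theta> - y) \<partial>lborel) = (\<integral>\<^sup>+s. q s \<partial>lborel)"
        by (rule nn_integral_reflect) measurable
      then show "(\<integral>\<^sup>+y. ?q2 x y \<theta> \<partial>lborel) = indicator {0..1} \<theta> * (indicator {0..d} x * (\<integral>\<^sup>+s. q s \<partial>lborel))"
        by (simp add: nn_integral_cmult)
    qed
    also have "\<dots> = indicator {0..d} x * (\<integral>\<^sup>+s. q s \<partial>lborel)" by (simp add: nn_integral_multc)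
    finally show "(\<integral>\<^sup>+y. (\<integral>\<^sup>+\<theta>. ?q2 x y \<theta> \<partial>lborel) \<partial>lborel) = indicator {0..d} x * (\<integral>\<^sup>+s. q s \<partial>lborel)" .
  qed
  also have "(\<integral>\<^sup>+y. indicator {0..d} y * (\<integral>\<^sup>+s. q s \<partial>lborel) \<partial>lborel) = ennreal d * (\<integral>\<^sup>+s. q s \<partial>lborel)"
    using d by (simp add: nn_integral_multc)
  finally show ?thesis by (simp add: q_def mult_2 distrib_right)
qed

text \<open>In the branch \<open>y \<le> x\<close> the derivative is a mean over \<theta> of
  differences of \<open>w\<close> at \<open>x - 2 * y\<close> and
  \<open>x - 2 * \<theta> * y\<close>. The square of their distance brings in
  \<open>4 * (1 - \<theta>)\<^sup>2\<close>, while the determinant of the change of variables is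
  only \<open>2 * (1 - \<theta>)\<close>; hence the degeneration at \<open>\<theta> = 1\<close> is
  harmless and the branch costs at most 2. The other branch is a single difference quotient and
  costs at most 1.\<close>

lemma corner_ext_dy_sq:
  assumes [measurable]: "w \<in> borel_measurable borel" and i: "set_integrable lborel {-d..d} w"
  shows "(\<integral>\<^sup>+x. \<integral>\<^sup>+y. ennreal (indicator {0..d} x * indicator {0..d} y * (corner_ext_dy w x y)\<^sup>2) \<partial>lborel \<partial>lborel) \<le> 3 * gag_sym d w"
proof -
  define K where "K p s = ennreal (indicator {-d..d} p * indicator {-d..d} s * ((w p - w s)\<^sup>2 / (p - s)\<^sup>2))" for p s
  have Km: "(\<lambda>(p, s). K p s) \<in> borel_measurable (borel \<Otimes>\<^sub>M borel)" unfolding K_def by measurable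
  have [measurable]: "(\<lambda>(p, s). K p s) \<in> borel_measurable (lborel \<Otimes>\<^sub>M lborel)"
    using Km by (simp cong: measurable_cong_sets)
  note [measurable] = Km
  have gwK: "gag_sym d w = (\<integral>\<^sup>+p. \<integral>\<^sup>+s. K p s \<partial>lborel \<partial>lborel)" by (simp add: gag_sym_def K_def)
  let ?k1 = "\<lambda>x y \<theta>. ennreal (indicator {0..1} \<theta> * (4 * (1 - \<theta>)\<^sup>2)) * K (x - 2 * y) (x - 2 * \<theta> * y)"
  have "(\<integral>\<^sup>+x. \<integral>\<^sup>+y. ennreal (indicator {0..d} x * indicator {0..d} y * (corner_ext_dy w x y)\<^sup>2) \<partial>lborel \<partial>lborel) \<le>
    (\<integral>\<^sup>+x. \<integral>\<^sup>+y. (\<integral>\<^sup>+\<theta>. ?k1 x y \<theta> \<partial>lborel) + K (- y) (2 * x - y) \<partial>lborel \<partial>lborel)"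
  proof (intro nn_integral_mono)
    fix x y
    show "ennreal (indicator {0..d} x * indicator {0..d} y * (corner_ext_dy w x y)\<^sup>2) \<le> (\<integral>\<^sup>+\<theta>. ?k1 x y \<theta> \<partial>lborel) + K (- y) (2 * x - y)"
    proof (cases "x \<in> {0..d} \<and> y \<in> {0..d}")
      case xy: True
      show ?thesis
      proof (cases "y \<le> x")
        case True
        have "ennreal ((corner_ext_dy w x y)\<^sup>2) = ennreal (1 / y\<^sup>2) * ennreal ((corner_ext w x y - w (x - 2 * y))\<^sup>2)"
          using True by (simp add: corner_ext_dy_def power_divide ennreal_mult[symmetric] power2_commute)
        also have "\<dots> \<le> ennreal (1 / y\<^sup>2) * (\<integral>\<^sup>+\<theta>. ennreal (indicator {0..1} \<theta> * (w (if y \<le> x then x - 2 * y * \<theta> else 2 * x * \<theta> - y) - w (x - 2 * y))\<^sup>2) \<partial>lborel)"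
          using xy by (intro mult_left_mono corner_ext_diff_sq[OF assms(1) i]) auto
        also have "\<dots> = (\<integral>\<^sup>+\<theta>. ennreal (1 / y\<^sup>2 * (indicator {0..1} \<theta> * (w (x - 2 * y * \<theta>) - w (x - 2 * y))\<^sup>2)) \<partial>lborel)"
          using True by (subst nn_integral_ennreal_cmult) auto
        also have "\<dots> \<le> (\<integral>\<^sup>+\<theta>. ?k1 x y \<theta> \<partial>lborel)"
        proof (rule nn_integral_mono)
          fix \<theta> :: real
          show "ennreal (1 / y\<^sup>2 * (indicator {0..1} \<theta> * (w (x - 2 * y * \<theta>) - w (x - 2 * y))\<^sup>2)) \<le> ?k1 x y \<theta>"
          proof (cases "\<theta> \<in> {0..1} \<and> y \<noteq> 0 \<and> \<theta> \<noteq> 1")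
            case t: True
            have r: "x - 2 * y \<in> {-d..d}" "x - 2 * \<theta> * y \<in> {-d..d}"
              using corner_ext_arg_range[of x d y \<theta>] corner_ext_arg_range[of x d y 1] xy True t by (auto simp: mult_ac)
            have "(x - 2 * y - (x - 2 * \<theta> * y))\<^sup>2 = 4 * (1 - \<theta>)\<^sup>2 * y\<^sup>2" by (simp add: power2_eq_square algebra_simps)
            then have "1 / y\<^sup>2 * (w (x - 2 * y * \<theta>) - w (x - 2 * y))\<^sup>2 =
              4 * (1 - \<theta>)\<^sup>2 * ((w (x - 2 * y) - w (x - 2 * \<theta> * y))\<^sup>2 / (x - 2 * y - (x - 2 * \<theta> * y))\<^sup>2)"
              using t by (simp add: power2_commute[of "w (x - 2 * y)"] mult.commute[of \<theta>] mult.assoc)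
            then show ?thesis using t r by (simp add: K_def ennreal_mult[symmetric])
          next
            case False
            then have z: "1 / y\<^sup>2 * (indicator {0..1} \<theta> * (w (x - 2 * y * \<theta>) - w (x - 2 * y))\<^sup>2) = 0" by auto
            show ?thesis unfolding z by simp
          qed
        qed
        finally show ?thesis using xy by (simp add: add_increasing2)
      next
        case False
        have "(corner_ext_dy w x y)\<^sup>2 = (w (- y) - w (2 * x - y))\<^sup>2 / (- y - (2 * x - y))\<^sup>2"
          using False by (simp add: corner_ext_dy_def power_divide)
        then have "ennreal (indicator {0..d} x * indicator {0..d} y * (corner_ext_dy w x y)\<^sup>2) = K (- y) (2 * x - y)"
          using xy False by (simp add: K_def)
        then show ?thesis by simp
      qed
    next
      case False
      then have z: "indicator {0..d} x * indicator {0..d} y * (corner_ext_dy w x y)\<^sup>2 = 0" by auto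
      show ?thesis unfolding z by simp
    qed
  qed
  also have "\<dots> = (\<integral>\<^sup>+x. \<integral>\<^sup>+y. (\<integral>\<^sup>+\<theta>. ?k1 x y \<theta> \<partial>lborel) \<partial>lborel \<partial>lborel) + (\<integral>\<^sup>+x. \<integral>\<^sup>+y. K (- y) (2 * x - y) \<partial>lborel \<partial>lborel)"
    by (simp add: nn_integral_add)
  also have "(\<integral>\<^sup>+x. \<integral>\<^sup>+y. (\<integral>\<^sup>+\<theta>. ?k1 x y \<theta> \<partial>lborel) \<partial>lborel \<partial>lborel) = (\<integral>\<^sup>+x. \<integral>\<^sup>+\<theta>. (\<integral>\<^sup>+y. ?k1 x y \<theta> \<partial>lborel) \<partial>lborel \<partial>lborel)"
    by (intro nn_integral_cong lborel_pair.Fubini'[symmetric]) measurable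
  also have "\<dots> = (\<integral>\<^sup>+\<theta>. \<integral>\<^sup>+x. (\<integral>\<^sup>+y. ?k1 x y \<theta> \<partial>lborel) \<partial>lborel \<partial>lborel)"
    by (rule lborel_pair.Fubini'[symmetric]) measurable
  also have "\<dots> \<le> (\<integral>\<^sup>+\<theta>. indicator {0..1::real} \<theta> * (2 * gag_sym d w) \<partial>lborel)"
    using AE_lborel_singleton[of "1::real"]
  proof (intro nn_integral_mono_AE, eventually_elim)
    case (elim \<theta>)
    show ?case
    proof (cases "\<theta> \<in> {0..1}")
      case True
      have "(\<integral>\<^sup>+x. (\<integral>\<^sup>+y. ?k1 x y \<theta> \<partial>lborel) \<partial>lborel) = ennreal (4 * (1 - \<theta>)\<^sup>2) * (\<integral>\<^sup>+x. \<integral>\<^sup>+y. K (x - 2 * y) (x - 2 * \<theta> * y) \<partial>lborel \<partial>lborel)"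
        using True by (simp add: nn_integral_cmult)
      also have "(\<integral>\<^sup>+x. \<integral>\<^sup>+y. K (x - 2 * y) (x - 2 * \<theta> * y) \<partial>lborel \<partial>lborel) = (\<integral>\<^sup>+y. \<integral>\<^sup>+x. K (x - 2 * y) (x - 2 * \<theta> * y) \<partial>lborel \<partial>lborel)"
        by (rule lborel_pair.Fubini'[symmetric]) measurable
      also have "ennreal (4 * (1 - \<theta>)\<^sup>2) * \<dots> = ennreal (2 * (1 - \<theta>)) * (ennreal \<bar>2 - 2 * \<theta>\<bar> * \<dots>)"
      proof -
        have "4 * (1 - \<theta>)\<^sup>2 = 2 * (1 - \<theta>) * \<bar>2 - 2 * \<theta>\<bar>" using True by (simp add: power2_eq_square algebra_simps)
        then have "ennreal (4 * (1 - \<theta>)\<^sup>2) = ennreal (2 * (1 - \<theta>)) * ennreal \<bar>2 - 2 * \<theta>\<bar>"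
          using True by (simp only:) (rule ennreal_mult, auto)
        then show ?thesis by (simp only: mult.assoc)
      qed
      also have "ennreal \<bar>2 - 2 * \<theta>\<bar> * (\<integral>\<^sup>+y. \<integral>\<^sup>+x. K (x - 2 * y) (x - 2 * \<theta> * y) \<partial>lborel \<partial>lborel) = gag_sym d w"
        unfolding gwK using elim by (intro nn_integral_shear[OF Km]) simp
      also have "ennreal (2 * (1 - \<theta>)) * gag_sym d w \<le> ennreal 2 * gag_sym d w"
        using True by (intro mult_right_mono ennreal_leI) auto
      finally show ?thesis using True by simp
    qed simp
  qed
  also have "\<dots> = 2 * gag_sym d w" by (simp add: nn_integral_multc)
  also have "(\<integral>\<^sup>+x. \<integral>\<^sup>+y. K (- y) (2 * x - y) \<partial>lborel \<partial>lborel) \<le> gag_sym d w"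
  proof -
    have "(\<integral>\<^sup>+x. \<integral>\<^sup>+y. K (- y) (2 * x - y) \<partial>lborel \<partial>lborel) = (\<integral>\<^sup>+x. \<integral>\<^sup>+y. K (y - 0 * x) (y - (-2) * x) \<partial>lborel \<partial>lborel)"
    proof (rule nn_integral_cong)
      fix x
      show "(\<integral>\<^sup>+y. K (- y) (2 * x - y) \<partial>lborel) = (\<integral>\<^sup>+y. K (y - 0 * x) (y - (-2) * x) \<partial>lborel)"
        using nn_integral_reflect[of "\<lambda>y. K y (2 * x + y)" 0] by (simp add: add.commute)
    qed
    also have "\<dots> \<le> ennreal \<bar>0 - (-2)\<bar> * \<dots>"
      by (rule le_ennreal_mult_self) simp
    also have "\<dots> = gag_sym d w" unfolding gwK by (rule nn_integral_shear[OF Km]) simp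
    finally show ?thesis .
  qed
  finally have "(\<integral>\<^sup>+x. \<integral>\<^sup>+y. ennreal (indicator {0..d} x * indicator {0..d} y * (corner_ext_dy w x y)\<^sup>2) \<partial>lborel \<partial>lborel) \<le> 2 * gag_sym d w + gag_sym d w"
    by (simp add: add_mono)
  also have "\<dots> = (2 + 1) * gag_sym d w" by (simp only: distrib_right mult_1)
  finally show ?thesis by simp
qed

text \<open>A Poincare inequality: distances in \<open>{-d..d}\<close> are at most
  \<open>2 * d\<close>, so averaging over a length \<open>d\<close> costs
  \<open>(2 * d)\<^sup>2 / d\<close>. The mean is taken over \<open>v\<close> alone, so that the two
  corners on the same vertical side of a square can share it in
  \<open>cell_ext_dy_energy\<close>.\<close>

lemma corner_data_mean_sq:
  assumes [measurable]: "u \<in> borel_measurable borel" "v \<in> borel_measurable borel" and d: "0 < d"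
    and v: "set_integrable lborel {0..d} v"
  defines "m \<equiv> (\<integral>t. indicator {0..d} t * v t \<partial>lborel) / d"
  shows "(\<integral>\<^sup>+s. ennreal (indicator {-d..d} s * (corner_data d u v s - m)\<^sup>2) \<partial>lborel) \<le> ennreal (4 * d) * gag_sym d (corner_data d u v)"
proof -
  let ?w = "corner_data d u v"
  let ?K = "\<lambda>p s. ennreal (indicator {-d..d} p * indicator {-d..d} s * ((?w p - ?w s)\<^sup>2 / (p - s)\<^sup>2))"
  have "(\<integral>\<^sup>+s. ennreal (indicator {-d..d} s * (?w s - m)\<^sup>2) \<partial>lborel) \<le> (\<integral>\<^sup>+s. ennreal (4 * d) * (\<integral>\<^sup>+t. ?K s t \<partial>lborel) \<partial>lborel)"
  proof (rule nn_integral_mono)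
    fix s
    show "ennreal (indicator {-d..d} s * (?w s - m)\<^sup>2) \<le> ennreal (4 * d) * (\<integral>\<^sup>+t. ?K s t \<partial>lborel)"
    proof (cases "s \<in> {-d..d}")
      case True
      have I: "integrable lborel (\<lambda>t. indicator {0..d} t * v t)" using v by (simp add: set_integrable_def)
      have I2: "integrable lborel (\<lambda>t::real. indicator {0..d} t * ?w s)" using integrable_indicator_Icc[of 0 d] by simp
      have "(\<integral>t. (indicator {0..d} t / d) * (?w s - v t) \<partial>lborel) = (\<integral>t. (indicator {0..d} t * ?w s - indicator {0..d} t * v t) / d \<partial>lborel)"
        by (intro Bochner_Integration.integral_cong) (auto simp: field_simps)
      also have "\<dots> = ?w s - m"
        using I I2 d by (simp add: m_def diff_divide_distrib)
      finally have "ennreal ((?w s - m)\<^sup>2) \<le> (\<integral>\<^sup>+t. ennreal \<bar>indicator {0..d} t / d\<bar> \<partial>lborel) *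
        (\<integral>\<^sup>+t. ennreal (\<bar>indicator {0..d} t / d\<bar> * (?w s - v t)\<^sup>2) \<partial>lborel)"
        using integral_square_weighted_le[of "\<lambda>t. indicator {0..d} t / d" lborel "\<lambda>t. ?w s - v t"] by simp
      also have "(\<integral>\<^sup>+t. ennreal \<bar>indicator {0..d} t / d\<bar> \<partial>lborel) = (\<integral>\<^sup>+t. ennreal (1 / d * indicator {0..d} t) \<partial>lborel)"
        using d by (intro nn_integral_cong) (auto simp: indicator_def)
      also have "\<dots> = 1" using d by (subst nn_integral_ennreal_cmult) (auto simp: ennreal_indicator ennreal_mult[symmetric])
      \<comment> \<open>\<open>corner_data\<close> carries \<open>v\<close> on the negative half, so
        \<open>v t\<close> is its value at \<open>- t\<close>.\<close>
      also have "(\<integral>\<^sup>+t. ennreal (\<bar>indicator {0..d} t / d\<bar> * (?w s - v t)\<^sup>2) \<partial>lborel) \<le> (\<integral>\<^sup>+t. ennreal (4 * d) * ?K s (- t) \<partial>lborel)"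
        using AE_lborel_singleton[of "0::real"]
      proof (intro nn_integral_mono_AE, eventually_elim)
        case (elim t)
        show ?case
        proof (cases "t \<in> {0..d} \<and> s \<noteq> - t")
          case t: True
          have wt: "?w (- t) = v t" using t elim by (auto simp: corner_data_def)
          have "(s + t)\<^sup>2 \<le> (2 * d)\<^sup>2" using True t by (intro power2_le_iff_abs_le[THEN iffD2]) auto
          then have "(?w s - v t)\<^sup>2 * (s + t)\<^sup>2 \<le> (?w s - v t)\<^sup>2 * (4 * d\<^sup>2)" by (intro mult_left_mono) (auto simp: power_mult_distrib)
          moreover have "(s + t)\<^sup>2 > 0" using t by (simp add: add_eq_0_iff2)
          ultimately have "1 / d * (?w s - v t)\<^sup>2 \<le> 4 * d * ((?w s - v t)\<^sup>2 / (s + t)\<^sup>2)"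
            using d by (simp add: field_simps power2_eq_square)
          then show ?thesis using t True d wt by (simp add: ennreal_mult[symmetric] ennreal_leI)
        next
          case False
          then have z: "\<bar>indicator {0..d} t / d\<bar> * (?w s - v t)\<^sup>2 = 0"
            using elim by (auto simp: corner_data_def)
          show ?thesis unfolding z by simp
        qed
      qed
      also have "\<dots> = ennreal (4 * d) * (\<integral>\<^sup>+t. ?K s (- t) \<partial>lborel)" by (rule nn_integral_cmult) measurable
      also have "(\<integral>\<^sup>+t. ?K s (- t) \<partial>lborel) = (\<integral>\<^sup>+t. ?K s t \<partial>lborel)"
        using nn_integral_reflect[of "?K s" 0] by simp
      finally show ?thesis using True by simp
    qed simp
  qed
  also have "\<dots> = ennreal (4 * d) * gag_sym d ?w" unfolding gag_sym_def by (rule nn_integral_cmult) measurable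
  finally show ?thesis .
qed

lemma le_sum4:
  fixes a b c e :: ennreal
  shows "a \<le> a + b + c + e" "b \<le> a + b + c + e" "c \<le> a + b + c + e" "e \<le> a + b + c + e"
  by (simp_all add: add_increasing add_increasing2 add.assoc)

text \<open>Pairs of equal sign give \<open>gag\<close>. For pairs of opposite sign insert
  \<open>u t\<close> between \<open>u p\<close> and \<open>v t\<close>: since
  \<open>\<bar>p - t\<bar> \<le> p + t\<close>, the first difference is again controlled by
  \<open>gag d u\<close>, and in the second the integral of \<open>1 / (p + t)\<^sup>2\<close> over
  \<open>p\<close> is at most \<open>1 / t\<close>, the weight of \<open>corner\<close>. The mixed
  term occurs twice, whence 5 = 1 + 2 + 2 and 4 = 2 + 2.\<close>

lemma gag_sym_corner_data:
  assumes [measurable]: "u \<in> borel_measurable borel" "v \<in> borel_measurable borel" and d: "0 < d"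
  shows "gag_sym d (corner_data d u v) \<le> 5 * gag d u + gag d v + 4 * corner d u v"
proof -
  let ?A = "\<lambda>u p s. ennreal (indicator {0..d} p * indicator {0..d} s * ((u p - u s)\<^sup>2 / (p - s)\<^sup>2))"
  let ?B = "\<lambda>p t. ennreal (indicator {0..d} p * indicator {0..d} t * ((u p - v t)\<^sup>2 / (p + t)\<^sup>2))"
  let ?K = "\<lambda>p s. ennreal (indicator {-d..d} p * indicator {-d..d} s * ((corner_data d u v p - corner_data d u v s)\<^sup>2 / (p - s)\<^sup>2))"
  have pt: "?K p s \<le> ?A u p s + ?A v (- p) (- s) + ?B p (- s) + ?B s (- p)" if nz: "p \<noteq> 0" "s \<noteq> 0" for p s
  proof (cases "p \<in> {-d..d} \<and> s \<in> {-d..d}")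
    case True
    consider "p > 0" "s > 0" | "p > 0" "s < 0" | "p < 0" "s > 0" | "p < 0" "s < 0" using nz by linarith
    then show ?thesis
    proof cases
      case 1
      then have "?K p s = ?A u p s" using True by (simp add: corner_data_def)
      then show ?thesis by (rule order_trans[OF eq_refl le_sum4(1)])
    next
      case 2
      then have "?K p s = ?B p (- s)" using True by (simp add: corner_data_def)
      then show ?thesis by (rule order_trans[OF eq_refl le_sum4(3)])
    next
      case 3
      have "(v (- p) - u s)\<^sup>2 / (p - s)\<^sup>2 = (u s - v (- p))\<^sup>2 / (s + - p)\<^sup>2" by (simp add: power2_commute)
      then have "?K p s = ?B s (- p)" using True 3 by (simp add: corner_data_def)
      then show ?thesis by (rule order_trans[OF eq_refl le_sum4(4)])
    next
      case 4
      have "(v (- p) - v (- s))\<^sup>2 / (p - s)\<^sup>2 = (v (- p) - v (- s))\<^sup>2 / (- p - - s)\<^sup>2" by (simp add: power2_commute)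
      then have "?K p s = ?A v (- p) (- s)" using True 4 by (simp add: corner_data_def)
      then show ?thesis by (rule order_trans[OF eq_refl le_sum4(2)])
    qed
  next
    case False
    then have z: "indicator {-d..d} p * indicator {-d..d} s * ((corner_data d u v p - corner_data d u v s)\<^sup>2 / (p - s)\<^sup>2) = 0" by auto
    show ?thesis unfolding z by simp
  qed
  have ref: "(\<integral>\<^sup>+x. f (- x) \<partial>lborel) = (\<integral>\<^sup>+x. f x \<partial>lborel)" if "f \<in> borel_measurable borel" for f :: "real \<Rightarrow> ennreal"
    using nn_integral_reflect[OF that, of 0] by simp
  have "gag_sym d (corner_data d u v) \<le> (\<integral>\<^sup>+p. \<integral>\<^sup>+s. ?A u p s + ?A v (- p) (- s) + ?B p (- s) + ?B s (- p) \<partial>lborel \<partial>lborel)"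
    unfolding gag_sym_def using AE_lborel_singleton[of "0::real"]
  proof (intro nn_integral_mono_AE, eventually_elim)
    case (elim p)
    have p0: "p \<noteq> 0" by (rule elim(2))
    show ?case
      using AE_lborel_singleton[of "0::real"]
      by (intro nn_integral_mono_AE, eventually_elim) (rule pt[OF p0], assumption)
  qed
  also have "\<dots> = (\<integral>\<^sup>+p. \<integral>\<^sup>+s. ?A u p s \<partial>lborel \<partial>lborel) + (\<integral>\<^sup>+p. \<integral>\<^sup>+s. ?A v (- p) (- s) \<partial>lborel \<partial>lborel) +
      (\<integral>\<^sup>+p. \<integral>\<^sup>+s. ?B p (- s) \<partial>lborel \<partial>lborel) + (\<integral>\<^sup>+p. \<integral>\<^sup>+s. ?B s (- p) \<partial>lborel \<partial>lborel)"
    by (simp add: nn_integral_add)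
  also have "(\<integral>\<^sup>+p. \<integral>\<^sup>+s. ?A u p s \<partial>lborel \<partial>lborel) = gag d u" by (simp add: gag_def)
  also have "(\<integral>\<^sup>+p. \<integral>\<^sup>+s. ?A v (- p) (- s) \<partial>lborel \<partial>lborel) = (\<integral>\<^sup>+p. \<integral>\<^sup>+s. ?A v (- p) s \<partial>lborel \<partial>lborel)"
    by (intro nn_integral_cong ref) measurable
  also have "\<dots> = gag d v" unfolding gag_def by (rule ref) measurable
  also have "(\<integral>\<^sup>+p. \<integral>\<^sup>+s. ?B p (- s) \<partial>lborel \<partial>lborel) = (\<integral>\<^sup>+p. \<integral>\<^sup>+s. ?B p s \<partial>lborel \<partial>lborel)"
    by (intro nn_integral_cong ref) measurable
  also have "(\<integral>\<^sup>+p. \<integral>\<^sup>+s. ?B s (- p) \<partial>lborel \<partial>lborel) = (\<integral>\<^sup>+p. \<integral>\<^sup>+s. ?B s p \<partial>lborel \<partial>lborel)"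
    by (rule ref) measurable
  also have "\<dots> = (\<integral>\<^sup>+p. \<integral>\<^sup>+s. ?B p s \<partial>lborel \<partial>lborel)"
    by (rule lborel_pair.Fubini') measurable
  finally have 1: "gag_sym d (corner_data d u v) \<le> gag d u + gag d v + (\<integral>\<^sup>+p. \<integral>\<^sup>+s. ?B p s \<partial>lborel \<partial>lborel) + (\<integral>\<^sup>+p. \<integral>\<^sup>+s. ?B p s \<partial>lborel \<partial>lborel)" .
  let ?C = "\<lambda>p t. ennreal (indicator {0..d} t * (u t - v t)\<^sup>2) * ennreal (indicator {0..d} p / (p + t)\<^sup>2)"
  have "(\<integral>\<^sup>+p. \<integral>\<^sup>+s. ?B p s \<partial>lborel \<partial>lborel) \<le> (\<integral>\<^sup>+p. \<integral>\<^sup>+t. 2 * ?A u p t + 2 * ?C p t \<partial>lborel \<partial>lborel)"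
    using AE_lborel_singleton[of "0::real"]
  proof (intro nn_integral_mono_AE, eventually_elim, intro nn_integral_mono)
    fix p t :: real assume "p \<noteq> 0"
    show "?B p t \<le> 2 * ?A u p t + 2 * ?C p t"
    proof (cases "p \<in> {0..d} \<and> t \<in> {0..d}")
      case True
      then have pos: "(p + t)\<^sup>2 > 0" using \<open>p \<noteq> 0\<close> by auto
      have "(u p - v t)\<^sup>2 / (p + t)\<^sup>2 \<le> (2 * (u p - u t)\<^sup>2 + 2 * (u t - v t)\<^sup>2) / (p + t)\<^sup>2"
        using power2_sum_le[of "u p - u t" "u t - v t"] by (intro divide_right_mono) auto
      also have "\<dots> = 2 * ((u p - u t)\<^sup>2 / (p + t)\<^sup>2) + 2 * ((u t - v t)\<^sup>2 / (p + t)\<^sup>2)" by (simp add: add_divide_distrib)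
      also have "(u p - u t)\<^sup>2 / (p + t)\<^sup>2 \<le> (u p - u t)\<^sup>2 / (p - t)\<^sup>2"
      proof (cases "p = t")
        case False
        have "(p - t)\<^sup>2 \<le> (p + t)\<^sup>2" using True by (intro power2_le_iff_abs_le[THEN iffD2]) auto
        then show ?thesis using False pos by (intro divide_left_mono) auto
      qed simp
      finally have "(u p - v t)\<^sup>2 / (p + t)\<^sup>2 \<le> 2 * ((u p - u t)\<^sup>2 / (p - t)\<^sup>2) + 2 * ((u t - v t)\<^sup>2 / (p + t)\<^sup>2)" by simp
      then have "ennreal ((u p - v t)\<^sup>2 / (p + t)\<^sup>2) \<le> ennreal (2 * ((u p - u t)\<^sup>2 / (p - t)\<^sup>2) + 2 * ((u t - v t)\<^sup>2 / (p + t)\<^sup>2))" by (rule ennreal_leI)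
      also have "\<dots> = ennreal (2 * ((u p - u t)\<^sup>2 / (p - t)\<^sup>2)) + ennreal (2 * ((u t - v t)\<^sup>2 / (p + t)\<^sup>2))"
        by (rule ennreal_plus) auto
      also have "ennreal (2 * ((u p - u t)\<^sup>2 / (p - t)\<^sup>2)) = 2 * ennreal ((u p - u t)\<^sup>2 / (p - t)\<^sup>2)"
        by (subst ennreal_mult) auto
      also have "ennreal (2 * ((u t - v t)\<^sup>2 / (p + t)\<^sup>2)) = 2 * (ennreal ((u t - v t)\<^sup>2) * ennreal (1 / (p + t)\<^sup>2))"
        by (subst ennreal_mult) (auto simp: ennreal_mult[symmetric])
      finally show ?thesis using True by simp
    next
      case False
      then have z: "indicator {0..d} p * indicator {0..d} t * ((u p - v t)\<^sup>2 / (p + t)\<^sup>2) = 0" by auto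
      show ?thesis unfolding z by simp
    qed
  qed
  also have "\<dots> = 2 * gag d u + 2 * (\<integral>\<^sup>+p. \<integral>\<^sup>+t. ?C p t \<partial>lborel \<partial>lborel)"
    by (simp add: nn_integral_add nn_integral_cmult gag_def)
  also have "(\<integral>\<^sup>+p. \<integral>\<^sup>+t. ?C p t \<partial>lborel \<partial>lborel) = (\<integral>\<^sup>+t. \<integral>\<^sup>+p. ?C p t \<partial>lborel \<partial>lborel)"
    by (rule lborel_pair.Fubini'[symmetric]) measurable
  also have "\<dots> \<le> corner d u v"
    unfolding corner_def using AE_lborel_singleton[of "0::real"]
  proof (intro nn_integral_mono_AE, eventually_elim)
    case (elim t)
    show ?case
    proof (cases "t \<in> {0..d}")
      case True
      then have t: "t > 0" using elim by auto
      have "(\<integral>\<^sup>+p. ennreal (indicator {0..d} p / (p + t)\<^sup>2) \<partial>lborel) = (\<integral>\<^sup>+p. ennreal (1 / (p + t)\<^sup>2) * indicator {0..d} p \<partial>lborel)"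
        by (intro nn_integral_cong) (auto simp: indicator_def)
      also have "\<dots> = ennreal (- (1 / (d + t)) - - (1 / (0 + t)))"
        using t d by (intro nn_integral_FTC_Icc) (auto intro!: derivative_eq_intros simp: power2_eq_square)
      also have "\<dots> \<le> ennreal (1 / t)" using t d by (intro ennreal_leI) auto
      finally have "(\<integral>\<^sup>+p. ennreal (indicator {0..d} p / (p + t)\<^sup>2) \<partial>lborel) \<le> ennreal (1 / t)" .
      then have "ennreal (indicator {0..d} t * (u t - v t)\<^sup>2) * (\<integral>\<^sup>+p. ennreal (indicator {0..d} p / (p + t)\<^sup>2) \<partial>lborel) \<le>
        ennreal (indicator {0..d} t * (u t - v t)\<^sup>2) * ennreal (1 / t)"
        by (rule mult_left_mono) simp
      also have "\<dots> = ennreal (indicator {0..d} t * ((u t - v t)\<^sup>2 / t))"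
        using t by (simp add: ennreal_mult[symmetric])
      finally show ?thesis by (subst nn_integral_cmult) auto
    qed simp
  qed
  finally have 2: "(\<integral>\<^sup>+p. \<integral>\<^sup>+s. ?B p s \<partial>lborel \<partial>lborel) \<le> 2 * gag d u + 2 * corner d u v"
    by (simp add: add_mono mult_left_mono)
  have "gag_sym d (corner_data d u v) \<le> gag d u + gag d v + (2 * gag d u + 2 * corner d u v) + (2 * gag d u + 2 * corner d u v)"
    using 1 2 by (meson add_mono order_refl order_trans)
  also have "\<dots> = 5 * gag d u + gag d v + 4 * corner d u v"
  proof -
    have "(1 + 2 + 2) * a = a + 2 * a + 2 * a" "(2 + 2) * a = 2 * a + 2 * a" for a :: ennreal
      by (simp_all only: distrib_right mult_1)
    then have e: "5 * a = a + 2 * a + 2 * a" "4 * a = 2 * a + 2 * a" for a :: ennreal by simp_all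
    show ?thesis unfolding e by (simp only: add.assoc add.commute add.left_commute)
  qed
  finally show ?thesis .
qed

section \<open>Extension to a square\<close>

text \<open>Each corner of the square is reflected to the origin. The bilinear weights in
  \<open>x / d\<close> and \<open>y / d\<close> are expanded as
  \<open>\<alpha> + \<beta> * y\<close> to fit \<open>ac_on_linear_mult\<close>.\<close>

definition cell_ext :: "real \<Rightarrow> (real \<Rightarrow> real) \<Rightarrow> (real \<Rightarrow> real) \<Rightarrow> (real \<Rightarrow> real) \<Rightarrow> (real \<Rightarrow> real) \<Rightarrow> real \<Rightarrow> real \<Rightarrow> real" where
  "cell_ext d u0 u1 v0 v1 x y =
     ((1 - x / d) + (- ((1 - x / d) / d)) * y) * corner_ext (corner_data d u0 v0) x y +
     (x / d + (- (x / d / d)) * y) * corner_ext (corner_data d (\<lambda>s. u0 (d - s)) v1) (d - x) y +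
     (0 + (1 - x / d) / d * y) * corner_ext (corner_data d u1 (\<lambda>s. v0 (d - s))) x (d - y) +
     (0 + x / d / d * y) * corner_ext (corner_data d (\<lambda>s. u1 (d - s)) (\<lambda>s. v1 (d - s))) (d - x) (d - y)"

text \<open>The exact shape which \<open>ac_on_add\<close>, \<open>ac_on_linear_mult\<close> and
  \<open>ac_on_reflect\<close> produce from \<open>cell_ext\<close>; the minus signs at the upper
  corners come from reflecting \<open>y\<close>.\<close>

definition cell_ext_dy :: "real \<Rightarrow> (real \<Rightarrow> real) \<Rightarrow> (real \<Rightarrow> real) \<Rightarrow> (real \<Rightarrow> real) \<Rightarrow> (real \<Rightarrow> real) \<Rightarrow> real \<Rightarrow> real \<Rightarrow> real" where
  "cell_ext_dy d u0 u1 v0 v1 x y =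
     ((1 - x / d) + (- ((1 - x / d) / d)) * y) * corner_ext_dy (corner_data d u0 v0) x y + (- ((1 - x / d) / d)) * corner_ext (corner_data d u0 v0) x y +
     ((x / d + (- (x / d / d)) * y) * corner_ext_dy (corner_data d (\<lambda>s. u0 (d - s)) v1) (d - x) y + (- (x / d / d)) * corner_ext (corner_data d (\<lambda>s. u0 (d - s)) v1) (d - x) y) +
     ((0 + (1 - x / d) / d * y) * (- corner_ext_dy (corner_data d u1 (\<lambda>s. v0 (d - s))) x (d - y)) + (1 - x / d) / d * corner_ext (corner_data d u1 (\<lambda>s. v0 (d - s))) x (d - y)) +
     ((0 + x / d / d * y) * (- corner_ext_dy (corner_data d (\<lambda>s. u1 (d - s)) (\<lambda>s. v1 (d - s))) (d - x) (d - y)) + x / d / d * corner_ext (corner_data d (\<lambda>s. u1 (d - s)) (\<lambda>s. v1 (d - s))) (d - x) (d - y))"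

lemma cell_measurable [measurable (raw)]:
  assumes [measurable]: "u0 \<in> borel_measurable borel" "u1 \<in> borel_measurable borel" "v0 \<in> borel_measurable borel" "v1 \<in> borel_measurable borel"
    "f \<in> borel_measurable M" "g \<in> borel_measurable M"
  shows "(\<lambda>z. cell_ext d u0 u1 v0 v1 (f z) (g z)) \<in> borel_measurable M" "(\<lambda>z. cell_ext_dy d u0 u1 v0 v1 (f z) (g z)) \<in> borel_measurable M"
  unfolding cell_ext_def cell_ext_dy_def by measurable

lemma corner_data_set_integrable:
  assumes [measurable]: "u \<in> borel_measurable borel" "v \<in> borel_measurable borel"
    and u: "set_integrable lborel {0..d} u" and v: "set_integrable lborel {0..d} v"
  shows "set_integrable lborel {-d..d} (corner_data d u v)"
proof -
  have "integrable lborel (\<lambda>s. indicator {0..d} (0 + (-1) * s) *\<^sub>R v (0 + (-1) * s))"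
    using v unfolding set_integrable_def by (rule lborel_integrable_real_affine) simp
  then have "integrable lborel (\<lambda>s. indicator {0..d} s *\<^sub>R u s + indicator {0..d} (0 + (-1) * s) *\<^sub>R v (0 + (-1) * s))"
    using u unfolding set_integrable_def by (rule Bochner_Integration.integrable_add[rotated])
  moreover have "AE s in lborel. indicator {0..d} s *\<^sub>R u s + indicator {0..d} (0 + (-1) * s) *\<^sub>R v (0 + (-1) * s) = indicator {-d..d} s *\<^sub>R corner_data d u v s"
    using AE_lborel_singleton[of "0::real"] by eventually_elim (auto simp: corner_data_def indicator_def)
  ultimately show ?thesis
    unfolding set_integrable_def by (subst (asm) integrable_cong_AE) auto
qed

lemma set_integrable_reflect:
  fixes v :: "real \<Rightarrow> real"
  assumes "set_integrable lborel {0..d} v"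
  shows "set_integrable lborel {0..d} (\<lambda>s. v (d - s))"
  using set_integrable_affine[OF assms, of "-1" 0 d d] by simp

lemma gag_sym_AE_finite:
  assumes [measurable]: "w \<in> borel_measurable borel" and fin: "gag_sym d w < \<infinity>"
  shows "AE x in lborel. x \<in> {0<..<d} \<longrightarrow> (\<integral>\<^sup>+s. ennreal (indicator {-d..d} s * ((w x - w s)\<^sup>2 / (x - s)\<^sup>2)) \<partial>lborel) < \<infinity>"
proof -
  have "AE x in lborel. (\<integral>\<^sup>+s. ennreal (indicator {-d..d} x * indicator {-d..d} s * ((w x - w s)\<^sup>2 / (x - s)\<^sup>2)) \<partial>lborel) \<noteq> \<infinity>"
    using fin unfolding gag_sym_def by (intro nn_integral_PInf_AE) auto
  then show ?thesis by eventually_elim (auto simp: less_top)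
qed

lemma cell_ac_on:
  assumes m[measurable]: "u0 \<in> borel_measurable borel" "u1 \<in> borel_measurable borel" "v0 \<in> borel_measurable borel" "v1 \<in> borel_measurable borel"
    and si: "set_integrable lborel {0..d} u0" "set_integrable lborel {0..d} u1" "set_integrable lborel {0..d} v0" "set_integrable lborel {0..d} v1"
    and fin: "gag_sym d (corner_data d u0 v0) < \<infinity>" "gag_sym d (corner_data d (\<lambda>s. u0 (d - s)) v1) < \<infinity>"
      "gag_sym d (corner_data d u1 (\<lambda>s. v0 (d - s))) < \<infinity>" "gag_sym d (corner_data d (\<lambda>s. u1 (d - s)) (\<lambda>s. v1 (d - s))) < \<infinity>"
    and d: "0 < d"
  shows "AE x in lborel. x \<in> {0<..<d} \<longrightarrow> ac_on 0 d (cell_ext d u0 u1 v0 v1 x) (cell_ext_dy d u0 u1 v0 v1 x) \<and>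
    cell_ext d u0 u1 v0 v1 x 0 = u0 x \<and> cell_ext d u0 u1 v0 v1 x d = u1 x"
proof -
  define w00 where "w00 = corner_data d u0 v0"
  define w10 where "w10 = corner_data d (\<lambda>s. u0 (d - s)) v1"
  define w01 where "w01 = corner_data d u1 (\<lambda>s. v0 (d - s))"
  define w11 where "w11 = corner_data d (\<lambda>s. u1 (d - s)) (\<lambda>s. v1 (d - s))"
  note w_defs = w00_def w10_def w01_def w11_def
  have wm[measurable]: "w00 \<in> borel_measurable borel" "w10 \<in> borel_measurable borel" "w01 \<in> borel_measurable borel" "w11 \<in> borel_measurable borel"
    unfolding w_defs by measurable
  note sir = si[THEN set_integrable_reflect]
  have wi: "set_integrable lborel {-d..d} w00" "set_integrable lborel {-d..d} w10" "set_integrable lborel {-d..d} w01" "set_integrable lborel {-d..d} w11"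
    unfolding w_defs using si sir by (auto intro!: corner_data_set_integrable)
  note fin' = fin[folded w_defs]
  note r = AE_affine[of "-1" _ d, simplified]
  have "AE x in lborel. x \<in> {0<..<d} \<longrightarrow> ac_on 0 d (corner_ext w x) (corner_ext_dy w x)"
    if "w \<in> borel_measurable borel" "set_integrable lborel {-d..d} w" "gag_sym d w < \<infinity>" for w
    using gag_sym_AE_finite[OF that(1,3)]
    by eventually_elim (auto intro!: corner_ext_ac_on[OF that(1,2)])
  note ac = this
  note ac4 = ac[OF wm(1) wi(1) fin'(1)] r[OF ac[OF wm(2) wi(2) fin'(2)]] ac[OF wm(3) wi(3) fin'(3)] r[OF ac[OF wm(4) wi(4) fin'(4)]]
  show ?thesis
    using ac4
  proof (eventually_elim, intro impI conjI)
    fix x assume x: "x \<in> {0<..<d}"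
      and a: "x \<in> {0<..<d} \<longrightarrow> ac_on 0 d (corner_ext w00 x) (corner_ext_dy w00 x)"
        "d - x \<in> {0<..<d} \<longrightarrow> ac_on 0 d (corner_ext w10 (d - x)) (corner_ext_dy w10 (d - x))"
        "x \<in> {0<..<d} \<longrightarrow> ac_on 0 d (corner_ext w01 x) (corner_ext_dy w01 x)"
        "d - x \<in> {0<..<d} \<longrightarrow> ac_on 0 d (corner_ext w11 (d - x)) (corner_ext_dy w11 (d - x))"
    have x': "d - x \<in> {0<..<d}" using x by auto
    have a1: "ac_on 0 d (corner_ext w00 x) (corner_ext_dy w00 x)" using a(1) x by blast
    have a2: "ac_on 0 d (corner_ext w10 (d - x)) (corner_ext_dy w10 (d - x))" using a(2) x' by blast
    have a3: "ac_on 0 d (\<lambda>y. corner_ext w01 x (d - y)) (\<lambda>y. - corner_ext_dy w01 x (d - y))" using a(3) x by (intro ac_on_reflect) auto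
    have a4: "ac_on 0 d (\<lambda>y. corner_ext w11 (d - x) (d - y)) (\<lambda>y. - corner_ext_dy w11 (d - x) (d - y))" using a(4) x' by (intro ac_on_reflect) auto
    show "ac_on 0 d (cell_ext d u0 u1 v0 v1 x) (cell_ext_dy d u0 u1 v0 v1 x)"
      unfolding cell_ext_def[abs_def] cell_ext_dy_def[abs_def] w_defs[symmetric]
      by (intro ac_on_add ac_on_linear_mult a1 a2 a3 a4) measurable
    \<comment> \<open>At \<open>y = 0\<close> only the two lower corners have nonzero weight. Both
      extensions equal \<open>u0 x\<close> there, and the weights \<open>1 - x / d\<close> and
      \<open>x / d\<close> add up to 1.\<close>
    show "cell_ext d u0 u1 v0 v1 x 0 = u0 x"
      using x d by (simp add: cell_ext_def corner_ext_zero corner_data_def) (simp add: field_simps)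
    show "cell_ext d u0 u1 v0 v1 x d = u1 x"
      using x d by (simp add: cell_ext_def corner_ext_zero corner_data_def) (simp add: field_simps)
  qed
qed

section \<open>Energy of the extension to a square\<close>

lemma sum8_square_le:
  fixes a1 a2 a3 a4 a5 a6 a7 a8 :: real
  shows "(a1 + a2 + a3 + a4 + (a5 + a6 + a7 + a8))\<^sup>2 \<le>
    8 * (a1\<^sup>2 + a2\<^sup>2 + a3\<^sup>2 + a4\<^sup>2) + 8 * (a5\<^sup>2 + a6\<^sup>2 + a7\<^sup>2 + a8\<^sup>2)"
proof -
  have 4: "(a + b + c + e)\<^sup>2 \<le> 4 * (a\<^sup>2 + b\<^sup>2 + c\<^sup>2 + e\<^sup>2)" for a b c e :: real
    using power2_sum_le[of "a + b" "c + e"] power2_sum_le[of a b] power2_sum_le[of c e] by (simp add: add.assoc)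
  show ?thesis
    using power2_sum_le[of "a1 + a2 + a3 + a4" "a5 + a6 + a7 + a8"] 4[of a1 a2 a3 a4] 4[of a5 a6 a7 a8] by linarith
qed

lemma mult_sq_le: "\<bar>a\<bar> \<le> c \<Longrightarrow> (a * b)\<^sup>2 \<le> c\<^sup>2 * (b::real)\<^sup>2"
  unfolding power_mult_distrib by (intro mult_right_mono) (auto simp: abs_le_square_iff[symmetric])

text \<open>The derivatives of the weights at the two left corners are opposite, and so are those at
  the two right corners. Hence arbitrary constants \<open>m0\<close> and \<open>m1\<close> may be
  subtracted, one for each vertical side, before the eight terms are squared.\<close>

lemma cell_ext_dy_pointwise:
  fixes d :: real
  assumes d: "0 < d" and x: "x \<in> {0..d}" and y: "y \<in> {0..d}"
  shows "(cell_ext_dy d u0 u1 v0 v1 x y)\<^sup>2 \<le>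
     8 * ((corner_ext_dy (corner_data d u0 v0) x y)\<^sup>2 + (corner_ext_dy (corner_data d (\<lambda>s. u0 (d - s)) v1) (d - x) y)\<^sup>2 +
       (corner_ext_dy (corner_data d u1 (\<lambda>s. v0 (d - s))) x (d - y))\<^sup>2 + (corner_ext_dy (corner_data d (\<lambda>s. u1 (d - s)) (\<lambda>s. v1 (d - s))) (d - x) (d - y))\<^sup>2) +
     8 / d\<^sup>2 * ((corner_ext (corner_data d u0 v0) x y - m0)\<^sup>2 + (corner_ext (corner_data d (\<lambda>s. u0 (d - s)) v1) (d - x) y - m1)\<^sup>2 +
       (corner_ext (corner_data d u1 (\<lambda>s. v0 (d - s))) x (d - y) - m0)\<^sup>2 + (corner_ext (corner_data d (\<lambda>s. u1 (d - s)) (\<lambda>s. v1 (d - s))) (d - x) (d - y) - m1)\<^sup>2)"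
proof -
  let ?X = "x / d" and ?Y = "y / d"
  have X: "0 \<le> ?X" "?X \<le> 1" and Y: "0 \<le> ?Y" "?Y \<le> 1" using assms by auto
  define e1 where "e1 = corner_ext (corner_data d u0 v0) x y"
  define e2 where "e2 = corner_ext (corner_data d (\<lambda>s. u0 (d - s)) v1) (d - x) y"
  define e3 where "e3 = corner_ext (corner_data d u1 (\<lambda>s. v0 (d - s))) x (d - y)"
  define e4 where "e4 = corner_ext (corner_data d (\<lambda>s. u1 (d - s)) (\<lambda>s. v1 (d - s))) (d - x) (d - y)"
  define g1 where "g1 = corner_ext_dy (corner_data d u0 v0) x y"
  define g2 where "g2 = corner_ext_dy (corner_data d (\<lambda>s. u0 (d - s)) v1) (d - x) y"
  define g3 where "g3 = corner_ext_dy (corner_data d u1 (\<lambda>s. v0 (d - s))) x (d - y)"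
  define g4 where "g4 = corner_ext_dy (corner_data d (\<lambda>s. u1 (d - s)) (\<lambda>s. v1 (d - s))) (d - x) (d - y)"
  have eq: "cell_ext_dy d u0 u1 v0 v1 x y =
    (1 - ?X) * (1 - ?Y) * g1 + ?X * (1 - ?Y) * g2 + (- ((1 - ?X) * ?Y)) * g3 + (- (?X * ?Y)) * g4 +
    ((- ((1 - ?X) / d)) * (e1 - m0) + (- (?X / d)) * (e2 - m1) + (1 - ?X) / d * (e3 - m0) + ?X / d * (e4 - m1))"
    unfolding cell_ext_dy_def e1_def[symmetric] e2_def[symmetric] e3_def[symmetric] e4_def[symmetric]
      g1_def[symmetric] g2_def[symmetric] g3_def[symmetric] g4_def[symmetric]
    using d by (simp add: field_simps)
  have c: "\<bar>(1 - ?X) * (1 - ?Y)\<bar> \<le> 1" "\<bar>?X * (1 - ?Y)\<bar> \<le> 1" "\<bar>- ((1 - ?X) * ?Y)\<bar> \<le> 1" "\<bar>- (?X * ?Y)\<bar> \<le> 1"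
  proof -
    have p: "\<bar>a * b\<bar> \<le> 1" if "0 \<le> a" "a \<le> 1" "0 \<le> b" "b \<le> 1" for a b :: real
      using that by (simp add: abs_mult mult_le_one)
    show "\<bar>(1 - ?X) * (1 - ?Y)\<bar> \<le> 1" "\<bar>?X * (1 - ?Y)\<bar> \<le> 1" "\<bar>- ((1 - ?X) * ?Y)\<bar> \<le> 1" "\<bar>- (?X * ?Y)\<bar> \<le> 1"
      unfolding abs_minus_cancel by (intro p; use X Y in simp)+
  qed
  have c': "\<bar>- ((1 - ?X) / d)\<bar> \<le> 1 / d" "\<bar>- (?X / d)\<bar> \<le> 1 / d" "\<bar>(1 - ?X) / d\<bar> \<le> 1 / d" "\<bar>?X / d\<bar> \<le> 1 / d"
  proof -
    have q: "\<bar>t / d\<bar> \<le> 1 / d" if "0 \<le> t" "t \<le> 1" for t using that d by (simp add: abs_divide divide_right_mono)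
    show "\<bar>- ((1 - ?X) / d)\<bar> \<le> 1 / d" "\<bar>- (?X / d)\<bar> \<le> 1 / d" "\<bar>(1 - ?X) / d\<bar> \<le> 1 / d" "\<bar>?X / d\<bar> \<le> 1 / d"
      unfolding abs_minus_cancel using q[of ?X] q[of "1 - ?X"] X by (auto simp del: abs_divide)
  qed
  have "(cell_ext_dy d u0 u1 v0 v1 x y)\<^sup>2 \<le>
    8 * (((1 - ?X) * (1 - ?Y) * g1)\<^sup>2 + (?X * (1 - ?Y) * g2)\<^sup>2 + ((- ((1 - ?X) * ?Y)) * g3)\<^sup>2 + ((- (?X * ?Y)) * g4)\<^sup>2) +
    8 * (((- ((1 - ?X) / d)) * (e1 - m0))\<^sup>2 + ((- (?X / d)) * (e2 - m1))\<^sup>2 + ((1 - ?X) / d * (e3 - m0))\<^sup>2 + (?X / d * (e4 - m1))\<^sup>2)"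
    unfolding eq by (rule sum8_square_le)
  also have "\<dots> \<le> 8 * (1\<^sup>2 * g1\<^sup>2 + 1\<^sup>2 * g2\<^sup>2 + 1\<^sup>2 * g3\<^sup>2 + 1\<^sup>2 * g4\<^sup>2) +
    8 * ((1 / d)\<^sup>2 * (e1 - m0)\<^sup>2 + (1 / d)\<^sup>2 * (e2 - m1)\<^sup>2 + (1 / d)\<^sup>2 * (e3 - m0)\<^sup>2 + (1 / d)\<^sup>2 * (e4 - m1)\<^sup>2)"
    by (intro add_mono mult_left_mono mult_sq_le c c') simp_all
  also have "\<dots> = 8 * (g1\<^sup>2 + g2\<^sup>2 + g3\<^sup>2 + g4\<^sup>2) + 8 / d\<^sup>2 * ((e1 - m0)\<^sup>2 + (e2 - m1)\<^sup>2 + (e3 - m0)\<^sup>2 + (e4 - m1)\<^sup>2)"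
    by (simp add: power_divide distrib_left)
  finally show ?thesis unfolding e1_def e2_def e3_def e4_def g1_def g2_def g3_def g4_def .
qed

lemma nn_integral_reflect_square:
  fixes f :: "real \<Rightarrow> real \<Rightarrow> ennreal"
  assumes [measurable]: "(\<lambda>(p, s). f p s) \<in> borel_measurable (borel \<Otimes>\<^sub>M borel)"
  shows "(\<integral>\<^sup>+x. \<integral>\<^sup>+y. f (d - x) y \<partial>lborel \<partial>lborel) = (\<integral>\<^sup>+x. \<integral>\<^sup>+y. f x y \<partial>lborel \<partial>lborel)"
    and "(\<integral>\<^sup>+x. \<integral>\<^sup>+y. f x (d - y) \<partial>lborel \<partial>lborel) = (\<integral>\<^sup>+x. \<integral>\<^sup>+y. f x y \<partial>lborel \<partial>lborel)"
    and "(\<integral>\<^sup>+x. \<integral>\<^sup>+y. f (d - x) (d - y) \<partial>lborel \<partial>lborel) = (\<integral>\<^sup>+x. \<integral>\<^sup>+y. f x y \<partial>lborel \<partial>lborel)"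
proof -
  have [measurable]: "(\<lambda>(p, s). f p s) \<in> borel_measurable (lborel \<Otimes>\<^sub>M lborel)"
    using assms(1) by (simp cong: measurable_cong_sets)
  have in1: "(\<integral>\<^sup>+y. f x (d - y) \<partial>lborel) = (\<integral>\<^sup>+y. f x y \<partial>lborel)" for x
    by (rule nn_integral_reflect) measurable
  show 1: "(\<integral>\<^sup>+x. \<integral>\<^sup>+y. f (d - x) y \<partial>lborel \<partial>lborel) = (\<integral>\<^sup>+x. \<integral>\<^sup>+y. f x y \<partial>lborel \<partial>lborel)"
    by (rule nn_integral_reflect) measurable
  show "(\<integral>\<^sup>+x. \<integral>\<^sup>+y. f x (d - y) \<partial>lborel \<partial>lborel) = (\<integral>\<^sup>+x. \<integral>\<^sup>+y. f x y \<partial>lborel \<partial>lborel)"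
    unfolding in1 by (rule refl)
  show "(\<integral>\<^sup>+x. \<integral>\<^sup>+y. f (d - x) (d - y) \<partial>lborel \<partial>lborel) = (\<integral>\<^sup>+x. \<integral>\<^sup>+y. f x y \<partial>lborel \<partial>lborel)"
    unfolding in1 by (rule 1)
qed

lemma integral_reflect_Icc:
  fixes v :: "real \<Rightarrow> real"
  shows "(\<integral>t. indicator {0..d} t * v (d - t) \<partial>lborel) = (\<integral>t. indicator {0..d} t * v t \<partial>lborel)"
proof -
  have "(\<integral>t. indicator {0..d} t * v t \<partial>lborel) = (\<integral>t. indicator {0..d} (d + (-1) * t) * v (d + (-1) * t) \<partial>lborel)"
    by (subst lborel_integral_real_affine[of "-1" _ d]) auto
  also have "\<dots> = (\<integral>t. indicator {0..d} t * v (d - t) \<partial>lborel)"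
    by (intro Bochner_Integration.integral_cong) (auto simp: indicator_def)
  finally show ?thesis by simp
qed

lemma corner_ext_mean_gag_sym:
  assumes [measurable]: "u \<in> borel_measurable borel" "v \<in> borel_measurable borel" and d: "0 < d"
    and si: "set_integrable lborel {0..d} u" "set_integrable lborel {0..d} v"
    and m: "m = (\<integral>t. indicator {0..d} t * v t \<partial>lborel) / d"
  shows "(\<integral>\<^sup>+x. \<integral>\<^sup>+y. ennreal (indicator {0..d} x * indicator {0..d} y * (corner_ext (corner_data d u v) x y - m)\<^sup>2) \<partial>lborel \<partial>lborel) \<le>
    ennreal (8 * d\<^sup>2) * gag_sym d (corner_data d u v)"
proof -
  have "(\<integral>\<^sup>+x. \<integral>\<^sup>+y. ennreal (indicator {0..d} x * indicator {0..d} y * (corner_ext (corner_data d u v) x y - m)\<^sup>2) \<partial>lborel \<partial>lborel) \<le>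
    2 * ennreal d * (\<integral>\<^sup>+s. ennreal (indicator {-d..d} s * (corner_data d u v s - m)\<^sup>2) \<partial>lborel)"
    using d by (intro corner_ext_mean_sq corner_data_set_integrable si) auto
  also have "\<dots> \<le> 2 * ennreal d * (ennreal (4 * d) * gag_sym d (corner_data d u v))"
    unfolding m by (intro mult_left_mono corner_data_mean_sq si d) auto
  also have "\<dots> = (2 * ennreal d * ennreal (4 * d)) * gag_sym d (corner_data d u v)" by (simp only: mult.assoc)
  also have "2 * ennreal d * ennreal (4 * d) = ennreal (2 * d * (4 * d))"
  proof -
    have "2 * ennreal d = ennreal (2 * d)" using d by (subst ennreal_mult) auto
    then show ?thesis using d by (simp only:) (rule ennreal_mult[symmetric], auto)
  qed
  also have "2 * d * (4 * d) = 8 * d\<^sup>2" by (simp add: power2_eq_square)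
  finally show ?thesis .
qed

lemma ennreal_weighted_sum:
  assumes "0 \<le> a" "0 \<le> b" "0 \<le> c" "0 \<le> e" "0 \<le> A" "0 \<le> B" "0 \<le> C" "0 \<le> E" "0 \<le> k"
  shows "ennreal (8 * (a + b + c + e) + k * (A + B + C + E)) =
    8 * (ennreal a + ennreal b + ennreal c + ennreal e) + ennreal k * (ennreal A + ennreal B + ennreal C + ennreal E)"
proof -
  have "ennreal (8 * (a + b + c + e) + k * (A + B + C + E)) = ennreal 8 * ennreal (a + b + c + e) + ennreal k * ennreal (A + B + C + E)"
    using assms ennreal_mult[of 8 "a + b + c + e"] ennreal_mult[of k "A + B + C + E"]
    by (subst ennreal_plus) (auto simp del: ennreal_plus)
  then show ?thesis using assms by simp
qed

text \<open>The constants subtracted are the means over the vertical sides, which do not change when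
  a side is reflected for its upper corner. The factor \<open>8 / d\<^sup>2\<close> from the weights
  meets \<open>8 * d\<^sup>2\<close> from the Poincare inequality, so \<open>d\<close> disappears:
  88 = 8 * 3 + 8 * 8.\<close>

lemma cell_ext_dy_energy:
  assumes m[measurable]: "u0 \<in> borel_measurable borel" "u1 \<in> borel_measurable borel" "v0 \<in> borel_measurable borel" "v1 \<in> borel_measurable borel"
    and si: "set_integrable lborel {0..d} u0" "set_integrable lborel {0..d} u1" "set_integrable lborel {0..d} v0" "set_integrable lborel {0..d} v1"
    and d: "0 < d"
  shows "(\<integral>\<^sup>+x. \<integral>\<^sup>+y. ennreal (indicator {0..d} x * indicator {0..d} y * (cell_ext_dy d u0 u1 v0 v1 x y)\<^sup>2) \<partial>lborel \<partial>lborel) \<le>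
    88 * (gag_sym d (corner_data d u0 v0) + gag_sym d (corner_data d (\<lambda>s. u0 (d - s)) v1) + gag_sym d (corner_data d u1 (\<lambda>s. v0 (d - s))) + gag_sym d (corner_data d (\<lambda>s. u1 (d - s)) (\<lambda>s. v1 (d - s))))"
proof -
  define w00 where "w00 = corner_data d u0 v0"
  define w10 where "w10 = corner_data d (\<lambda>s. u0 (d - s)) v1"
  define w01 where "w01 = corner_data d u1 (\<lambda>s. v0 (d - s))"
  define w11 where "w11 = corner_data d (\<lambda>s. u1 (d - s)) (\<lambda>s. v1 (d - s))"
  note w_defs = w00_def w10_def w01_def w11_def
  have wm[measurable]: "w00 \<in> borel_measurable borel" "w10 \<in> borel_measurable borel" "w01 \<in> borel_measurable borel" "w11 \<in> borel_measurable borel"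
    unfolding w_defs by measurable
  note sir = si[THEN set_integrable_reflect]
  have wi: "set_integrable lborel {-d..d} w00" "set_integrable lborel {-d..d} w10" "set_integrable lborel {-d..d} w01" "set_integrable lborel {-d..d} w11"
    unfolding w_defs using si sir by (auto intro!: corner_data_set_integrable)
  define m0 where "m0 = (\<integral>t. indicator {0..d} t * v0 t \<partial>lborel) / d"
  define m1 where "m1 = (\<integral>t. indicator {0..d} t * v1 t \<partial>lborel) / d"
  define T where "T w x y = ennreal (indicator {0..d} x * indicator {0..d} y * (corner_ext_dy w x y)\<^sup>2)" for w and x y :: real
  define M where "M w c x y = ennreal (indicator {0..d} x * indicator {0..d} y * (corner_ext w x y - c)\<^sup>2)" for w c and x y :: real
  have Tm [measurable]: "(\<lambda>z. T w (f z) (g z)) \<in> borel_measurable N" if [measurable]: "w \<in> borel_measurable borel" "f \<in> borel_measurable N" "g \<in> borel_measurable N" for w f g and N :: "'z measure"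
    unfolding T_def by measurable
  have Mm [measurable]: "(\<lambda>z. M w c (f z) (g z)) \<in> borel_measurable N" if [measurable]: "w \<in> borel_measurable borel" "f \<in> borel_measurable N" "g \<in> borel_measurable N" for w c f g and N :: "'z measure"
    unfolding M_def by measurable
  let ?I = "\<lambda>f. \<integral>\<^sup>+x. \<integral>\<^sup>+y. f x y \<partial>lborel \<partial>(lborel :: real measure)"
  have "?I (\<lambda>x y. ennreal (indicator {0..d} x * indicator {0..d} y * (cell_ext_dy d u0 u1 v0 v1 x y)\<^sup>2)) \<le>
    ?I (\<lambda>x y. 8 * (T w00 x y + T w10 (d - x) y + T w01 x (d - y) + T w11 (d - x) (d - y)) +
      ennreal (8 / d\<^sup>2) * (M w00 m0 x y + M w10 m1 (d - x) y + M w01 m0 x (d - y) + M w11 m1 (d - x) (d - y)))"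
  proof (intro nn_integral_mono)
    fix x y
    show "ennreal (indicator {0..d} x * indicator {0..d} y * (cell_ext_dy d u0 u1 v0 v1 x y)\<^sup>2) \<le>
      8 * (T w00 x y + T w10 (d - x) y + T w01 x (d - y) + T w11 (d - x) (d - y)) +
      ennreal (8 / d\<^sup>2) * (M w00 m0 x y + M w10 m1 (d - x) y + M w01 m0 x (d - y) + M w11 m1 (d - x) (d - y))"
    proof (cases "x \<in> {0..d} \<and> y \<in> {0..d}")
      case True
      then have "ennreal ((cell_ext_dy d u0 u1 v0 v1 x y)\<^sup>2) \<le> ennreal (
         8 * ((corner_ext_dy w00 x y)\<^sup>2 + (corner_ext_dy w10 (d - x) y)\<^sup>2 + (corner_ext_dy w01 x (d - y))\<^sup>2 + (corner_ext_dy w11 (d - x) (d - y))\<^sup>2) +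
         8 / d\<^sup>2 * ((corner_ext w00 x y - m0)\<^sup>2 + (corner_ext w10 (d - x) y - m1)\<^sup>2 + (corner_ext w01 x (d - y) - m0)\<^sup>2 + (corner_ext w11 (d - x) (d - y) - m1)\<^sup>2))"
        unfolding w_defs using d by (intro ennreal_leI cell_ext_dy_pointwise) auto
      also have "\<dots> = 8 * (T w00 x y + T w10 (d - x) y + T w01 x (d - y) + T w11 (d - x) (d - y)) +
        ennreal (8 / d\<^sup>2) * (M w00 m0 x y + M w10 m1 (d - x) y + M w01 m0 x (d - y) + M w11 m1 (d - x) (d - y))"
      proof -
        have i: "d - x \<in> {0..d}" "d - y \<in> {0..d}" using True by auto
        have "0 \<le> 8 / d\<^sup>2" by simp
        then show ?thesis
          unfolding T_def M_def using True i by (subst ennreal_weighted_sum) simp_all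
      qed
      finally show ?thesis using True by simp
    next
      case False
      then have z: "indicator {0..d} x * indicator {0..d} y * (cell_ext_dy d u0 u1 v0 v1 x y)\<^sup>2 = 0" by auto
      show ?thesis unfolding z by simp
    qed
  qed
  also have "\<dots> = 8 * (?I (T w00) + ?I (\<lambda>x. T w10 (d - x)) + ?I (\<lambda>x y. T w01 x (d - y)) + ?I (\<lambda>x y. T w11 (d - x) (d - y))) +
      ennreal (8 / d\<^sup>2) * (?I (M w00 m0) + ?I (\<lambda>x. M w10 m1 (d - x)) + ?I (\<lambda>x y. M w01 m0 x (d - y)) + ?I (\<lambda>x y. M w11 m1 (d - x) (d - y)))"
    by (simp add: nn_integral_add nn_integral_cmult)
  also have "?I (\<lambda>x. T w10 (d - x)) = ?I (T w10)" by (rule nn_integral_reflect_square) (unfold T_def, measurable)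
  also have "?I (\<lambda>x y. T w01 x (d - y)) = ?I (T w01)" by (rule nn_integral_reflect_square) (unfold T_def, measurable)
  also have "?I (\<lambda>x y. T w11 (d - x) (d - y)) = ?I (T w11)" by (rule nn_integral_reflect_square) (unfold T_def, measurable)
  also have "?I (\<lambda>x. M w10 m1 (d - x)) = ?I (M w10 m1)" by (rule nn_integral_reflect_square) (unfold M_def, measurable)
  also have "?I (\<lambda>x y. M w01 m0 x (d - y)) = ?I (M w01 m0)" by (rule nn_integral_reflect_square) (unfold M_def, measurable)
  also have "?I (\<lambda>x y. M w11 m1 (d - x) (d - y)) = ?I (M w11 m1)" by (rule nn_integral_reflect_square) (unfold M_def, measurable)
  also have "8 * (?I (T w00) + ?I (T w10) + ?I (T w01) + ?I (T w11)) +
      ennreal (8 / d\<^sup>2) * (?I (M w00 m0) + ?I (M w10 m1) + ?I (M w01 m0) + ?I (M w11 m1)) \<le>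
    8 * (3 * gag_sym d w00 + 3 * gag_sym d w10 + 3 * gag_sym d w01 + 3 * gag_sym d w11) +
      ennreal (8 / d\<^sup>2) * (ennreal (8 * d\<^sup>2) * gag_sym d w00 + ennreal (8 * d\<^sup>2) * gag_sym d w10 + ennreal (8 * d\<^sup>2) * gag_sym d w01 + ennreal (8 * d\<^sup>2) * gag_sym d w11)"
  proof (intro add_mono mult_left_mono)
    show "?I (T w00) \<le> 3 * gag_sym d w00" "?I (T w10) \<le> 3 * gag_sym d w10" "?I (T w01) \<le> 3 * gag_sym d w01" "?I (T w11) \<le> 3 * gag_sym d w11"
      unfolding T_def using wi by (auto intro!: corner_ext_dy_sq)
    show "?I (M w00 m0) \<le> ennreal (8 * d\<^sup>2) * gag_sym d w00"
      unfolding M_def w_defs by (rule corner_ext_mean_gag_sym[OF m(1) m(3) d si(1) si(3) m0_def])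
    show "?I (M w10 m1) \<le> ennreal (8 * d\<^sup>2) * gag_sym d w10"
      unfolding M_def w_defs by (rule corner_ext_mean_gag_sym[OF _ m(4) d sir(1) si(4) m1_def]) measurable
    show "?I (M w01 m0) \<le> ennreal (8 * d\<^sup>2) * gag_sym d w01"
      unfolding M_def w_defs by (rule corner_ext_mean_gag_sym[OF m(2) _ d si(2) sir(3)]) (auto simp: m0_def integral_reflect_Icc)
    show "?I (M w11 m1) \<le> ennreal (8 * d\<^sup>2) * gag_sym d w11"
      unfolding M_def w_defs by (rule corner_ext_mean_gag_sym[OF _ _ d sir(2) sir(4)]) (auto simp: m1_def integral_reflect_Icc)
  qed auto
  also have "\<dots> = 24 * (gag_sym d w00 + gag_sym d w10 + gag_sym d w01 + gag_sym d w11) + 64 * (gag_sym d w00 + gag_sym d w10 + gag_sym d w01 + gag_sym d w11)"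
  proof -
    have "ennreal (8 / d\<^sup>2) * (ennreal (8 * d\<^sup>2) * X) = 64 * X" for X
      using d by (simp add: mult.assoc[symmetric] ennreal_mult[symmetric])
    moreover have "8 * (3 * X) = 24 * (X :: ennreal)" for X by (simp add: mult.assoc[symmetric])
    ultimately show ?thesis by (simp only: distrib_left)
  qed
  also have "\<dots> = (24 + 64) * (gag_sym d w00 + gag_sym d w10 + gag_sym d w01 + gag_sym d w11)"
    by (rule distrib_right[symmetric])
  also have "(24 + 64 :: ennreal) = 88" by simp
  finally show ?thesis unfolding w_defs .
qed

section \<open>Extension to the plane\<close>

definition square_fun :: "real \<Rightarrow> (int \<Rightarrow> real \<Rightarrow> real) \<Rightarrow> (int \<Rightarrow> real \<Rightarrow> real) \<Rightarrow> int \<Rightarrow> int \<Rightarrow> real \<Rightarrow> real \<Rightarrow> real" where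
  "square_fun d u v j k = cell_ext d (\<lambda>s. u k (of_int j * d + s)) (\<lambda>s. u (k + 1) (of_int j * d + s))
     (\<lambda>s. v j (of_int k * d + s)) (\<lambda>s. v (j + 1) (of_int k * d + s))"

definition square_dy :: "real \<Rightarrow> (int \<Rightarrow> real \<Rightarrow> real) \<Rightarrow> (int \<Rightarrow> real \<Rightarrow> real) \<Rightarrow> int \<Rightarrow> int \<Rightarrow> real \<Rightarrow> real \<Rightarrow> real" where
  "square_dy d u v j k = cell_ext_dy d (\<lambda>s. u k (of_int j * d + s)) (\<lambda>s. u (k + 1) (of_int j * d + s))
     (\<lambda>s. v j (of_int k * d + s)) (\<lambda>s. v (j + 1) (of_int k * d + s))"

definition grid_ext :: "real \<Rightarrow> (int \<Rightarrow> real \<Rightarrow> real) \<Rightarrow> (int \<Rightarrow> real \<Rightarrow> real) \<Rightarrow> real \<times> real \<Rightarrow> real" where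
  "grid_ext d u v z = square_fun d u v \<lfloor>fst z / d\<rfloor> \<lfloor>snd z / d\<rfloor> (fst z - of_int \<lfloor>fst z / d\<rfloor> * d) (snd z - of_int \<lfloor>snd z / d\<rfloor> * d)"

definition grid_ext_dy :: "real \<Rightarrow> (int \<Rightarrow> real \<Rightarrow> real) \<Rightarrow> (int \<Rightarrow> real \<Rightarrow> real) \<Rightarrow> real \<times> real \<Rightarrow> real" where
  "grid_ext_dy d u v z = square_dy d u v \<lfloor>fst z / d\<rfloor> \<lfloor>snd z / d\<rfloor> (fst z - of_int \<lfloor>fst z / d\<rfloor> * d) (snd z - of_int \<lfloor>snd z / d\<rfloor> * d)"

definition vertex_sum :: "real \<Rightarrow> (int \<Rightarrow> real \<Rightarrow> real) \<Rightarrow> (int \<Rightarrow> real \<Rightarrow> real) \<Rightarrow> int \<times> int \<Rightarrow> ennreal" where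
  "vertex_sum d u v jk = vertex_terms d (u (snd jk)) (v (fst jk)) (of_int (fst jk) * d) (of_int (snd jk) * d)"

text \<open>The assumptions are symmetric in \<open>u\<close> and \<open>v\<close>, so the locale
  can be interpreted a second time with both exchanged; this yields the derivative in
  \<open>x\<close>.\<close>

locale grid_data =
  fixes d :: real and u v :: "int \<Rightarrow> real \<Rightarrow> real"
  assumes d: "0 < d"
    and um [measurable]: "\<And>k. u k \<in> borel_measurable borel"
    and vm [measurable]: "\<And>k. v k \<in> borel_measurable borel"
    and ul: "\<And>k. loc_sq_int (u k)"
    and vl: "\<And>k. loc_sq_int (v k)"
    and fin: "(\<integral>\<^sup>+jk. vertex_sum d u v jk \<partial>count_space UNIV) < \<infinity>"
begin

lemma square_fun_measurable [measurable (raw)]: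
  assumes [measurable]: "f \<in> borel_measurable M" "g \<in> borel_measurable M"
  shows "(\<lambda>z. square_fun d u v j k (f z) (g z)) \<in> borel_measurable M" "(\<lambda>z. square_dy d u v j k (f z) (g z)) \<in> borel_measurable M"
  unfolding square_fun_def square_dy_def by measurable

lemma grid_ext_measurable [measurable]:
  shows "grid_ext d u v \<in> borel_measurable borel" "grid_ext_dy d u v \<in> borel_measurable borel"
proof -
  have [measurable]: "(\<lambda>z. \<lfloor>fst z / d\<rfloor>) \<in> measurable (borel :: (real \<times> real) measure) (count_space UNIV)"
    "(\<lambda>z. \<lfloor>snd z / d\<rfloor>) \<in> measurable (borel :: (real \<times> real) measure) (count_space UNIV)"
    by measurable
  \<comment> \<open>The floors take countably many values, so measurability needs checking only for
    fixed indices of the square.\<close>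
  have step: "(\<lambda>z. h \<lfloor>fst z / d\<rfloor> \<lfloor>snd z / d\<rfloor> z) \<in> borel_measurable borel"
    if h: "\<And>j k. h j k \<in> borel_measurable borel" for h :: "int \<Rightarrow> int \<Rightarrow> real \<times> real \<Rightarrow> real"
  proof -
    have "(\<lambda>z. h j \<lfloor>snd z / d\<rfloor> z) \<in> borel_measurable borel" for j
      by (rule measurable_compose_countable[where f="h j", OF h]) measurable
    then show ?thesis
      by (rule measurable_compose_countable[where f="\<lambda>j z. h j \<lfloor>snd z / d\<rfloor> z"]) measurable
  qed
  have "(\<lambda>z. square_fun d u v j k (fst z - of_int j * d) (snd z - of_int k * d)) \<in> borel_measurable borel"
    "(\<lambda>z. square_dy d u v j k (fst z - of_int j * d) (snd z - of_int k * d)) \<in> borel_measurable borel" for j k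
    by measurable
  then show "grid_ext d u v \<in> borel_measurable borel" "grid_ext_dy d u v \<in> borel_measurable borel"
    unfolding grid_ext_def[abs_def] grid_ext_dy_def[abs_def]
    using step[of "\<lambda>j k z. square_fun d u v j k (fst z - of_int j * d) (snd z - of_int k * d)"]
      step[of "\<lambda>j k z. square_dy d u v j k (fst z - of_int j * d) (snd z - of_int k * d)"] by blast+
qed

lemma vertex_sum_finite: "vertex_sum d u v jk < \<infinity>"
  using nn_integral_ge_point[of jk UNIV "vertex_sum d u v"] fin by (auto intro: le_less_trans)

definition square_sum :: "int \<Rightarrow> int \<Rightarrow> ennreal" where
  "square_sum j k = vertex_sum d u v (j, k) + vertex_sum d u v (j + 1, k) + vertex_sum d u v (j, k + 1) + vertex_sum d u v (j + 1, k + 1)"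

lemma data_integrable:
  "set_integrable lborel {0..d} (\<lambda>s. u k (of_int j * d + s))" "set_integrable lborel {0..d} (\<lambda>s. v k (of_int j * d + s))"
proof -
  have "set_integrable lborel {of_int j * d..of_int j * d + d} (u k)" "set_integrable lborel {of_int j * d..of_int j * d + d} (v k)"
    using ul[of k] vl[of k] by (auto simp: loc_sq_int_def intro!: sq_fin_set_integrable)
  then show "set_integrable lborel {0..d} (\<lambda>s. u k (of_int j * d + s))" "set_integrable lborel {0..d} (\<lambda>s. v k (of_int j * d + s))"
    using set_integrable_affine[of "of_int j * d" "of_int j * d + d" _ 1 0 d "of_int j * d"] by simp_all
qed

lemma vertex_parts:
  defines "a j \<equiv> of_int j * d"
  shows "gag d (\<lambda>x. u k (a j + x)) \<le> vertex_sum d u v (j, k)" "gag d (\<lambda>y. v j (a k + y)) \<le> vertex_sum d u v (j, k)"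
    "corner d (\<lambda>x. u k (a j + x)) (\<lambda>y. v j (a k + y)) \<le> vertex_sum d u v (j, k)"
    "corner d (\<lambda>x. u k (a j - x)) (\<lambda>y. v j (a k - y)) \<le> vertex_sum d u v (j, k)"
    "corner d (\<lambda>x. u k (a j + x)) (\<lambda>x. u k (a j - x)) \<le> vertex_sum d u v (j, k)"
    "corner d (\<lambda>y. v j (a k + y)) (\<lambda>y. v j (a k - y)) \<le> vertex_sum d u v (j, k)"
proof -
  have *: "A1 \<le> A1 + A2 + (A3 + A4) + A5 + A6" "A2 \<le> A1 + A2 + (A3 + A4) + A5 + A6" "A3 \<le> A1 + A2 + (A3 + A4) + A5 + A6"
    "A4 \<le> A1 + A2 + (A3 + A4) + A5 + A6" "A5 \<le> A1 + A2 + (A3 + A4) + A5 + A6" "A6 \<le> A1 + A2 + (A3 + A4) + A5 + A6" for A1 A2 A3 A4 A5 A6 :: ennreal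
    by (simp_all add: add_increasing add_increasing2 add.assoc)
  show "gag d (\<lambda>x. u k (a j + x)) \<le> vertex_sum d u v (j, k)" "gag d (\<lambda>y. v j (a k + y)) \<le> vertex_sum d u v (j, k)"
    "corner d (\<lambda>x. u k (a j + x)) (\<lambda>y. v j (a k + y)) \<le> vertex_sum d u v (j, k)"
    "corner d (\<lambda>x. u k (a j - x)) (\<lambda>y. v j (a k - y)) \<le> vertex_sum d u v (j, k)"
    "corner d (\<lambda>x. u k (a j + x)) (\<lambda>x. u k (a j - x)) \<le> vertex_sum d u v (j, k)"
    "corner d (\<lambda>y. v j (a k + y)) (\<lambda>y. v j (a k - y)) \<le> vertex_sum d u v (j, k)"
    unfolding vertex_sum_def vertex_terms_def a_def fst_conv snd_conv by (rule *)+
qed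

lemma gag_reflect:
  assumes [measurable]: "f \<in> borel_measurable borel"
  shows "gag e (\<lambda>s. f (e - s)) = gag e f"
proof -
  let ?K = "\<lambda>x y. ennreal (indicator {0..e} x * indicator {0..e} y * ((f x - f y)\<^sup>2 / (x - y)\<^sup>2))"
  have "gag e (\<lambda>s. f (e - s)) = (\<integral>\<^sup>+x. \<integral>\<^sup>+y. ?K (e - x) (e - y) \<partial>lborel \<partial>lborel)"
    unfolding gag_def by (intro nn_integral_cong) (auto simp: indicator_def power2_commute)
  also have "\<dots> = gag e f" unfolding gag_def by (rule nn_integral_reflect_square) measurable
  finally show ?thesis .
qed

text \<open>The norm compares perpendicular edges directly only when both point in the positive or
  both in the negative direction, which settles the lower left and the upper right corner. At the
  other two corners one edge is first replaced by the opposite edge at the same vertex, by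
  \<open>corner_triangle\<close>. This costs up to 2 + 2, whence 22 = 5 + 1 + 4 * (2 + 2).\<close>

lemma gag_sym_le_square_sum:
  "gag_sym d (corner_data d (\<lambda>s. u k (of_int j * d + s)) (\<lambda>s. v j (of_int k * d + s))) \<le> 22 * square_sum j k"
  "gag_sym d (corner_data d (\<lambda>s. u k (of_int j * d + (d - s))) (\<lambda>s. v (j + 1) (of_int k * d + s))) \<le> 22 * square_sum j k"
  "gag_sym d (corner_data d (\<lambda>s. u (k + 1) (of_int j * d + s)) (\<lambda>s. v j (of_int k * d + (d - s)))) \<le> 22 * square_sum j k"
  "gag_sym d (corner_data d (\<lambda>s. u (k + 1) (of_int j * d + (d - s))) (\<lambda>s. v (j + 1) (of_int k * d + (d - s)))) \<le> 22 * square_sum j k"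
proof -
  have S: "vertex_sum d u v (j, k) \<le> square_sum j k" "vertex_sum d u v (j + 1, k) \<le> square_sum j k" "vertex_sum d u v (j, k + 1) \<le> square_sum j k" "vertex_sum d u v (j + 1, k + 1) \<le> square_sum j k"
    unfolding square_sum_def by (rule le_sum4)+
  have sh: "of_int j * d + (d - s) = of_int (j + 1) * d - s" for j :: int and s by (simp add: algebra_simps)
  have 22: "gag_sym d (corner_data d f g) \<le> 22 * square_sum j k"
    if [measurable]: "f \<in> borel_measurable borel" "g \<in> borel_measurable borel"
      and le: "gag d f \<le> square_sum j k" "gag d g \<le> square_sum j k" "corner d f g \<le> 2 * square_sum j k + 2 * square_sum j k" for f g
  proof -
    have "gag_sym d (corner_data d f g) \<le> 5 * gag d f + gag d g + 4 * corner d f g" by (rule gag_sym_corner_data[OF _ _ d]) measurable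
    also have "\<dots> \<le> 5 * square_sum j k + square_sum j k + 4 * (2 * square_sum j k + 2 * square_sum j k)"
      by (intro add_mono mult_left_mono le) auto
    also have "\<dots> = 5 * square_sum j k + 1 * square_sum j k + 4 * ((2 + 2) * square_sum j k)" by (simp only: distrib_right mult_1)
    also have "\<dots> = (5 + 1 + 4 * (2 + 2)) * square_sum j k" by (simp only: distrib_right mult.assoc)
    finally show ?thesis by simp
  qed
  have dbl: "X \<le> 2 * square_sum j k + 2 * square_sum j k" if "X \<le> square_sum j k" for X
    using that by (simp add: add_increasing2 mult_2)
  note p = vertex_parts
  show "gag_sym d (corner_data d (\<lambda>s. u k (of_int j * d + s)) (\<lambda>s. v j (of_int k * d + s))) \<le> 22 * square_sum j k"
    by (intro 22 dbl order_trans[OF p(1) S(1)] order_trans[OF p(2) S(1)] order_trans[OF p(3) S(1)]) measurable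
  show "gag_sym d (corner_data d (\<lambda>s. u k (of_int j * d + (d - s))) (\<lambda>s. v (j + 1) (of_int k * d + s))) \<le> 22 * square_sum j k"
  proof (rule 22)
    show "gag d (\<lambda>s. u k (of_int j * d + (d - s))) \<le> square_sum j k"
      using order_trans[OF p(1) S(1)] gag_reflect[of "\<lambda>s. u k (of_int j * d + s)" d] by simp
    show "gag d (\<lambda>s. v (j + 1) (of_int k * d + s)) \<le> square_sum j k" by (rule order_trans[OF p(2) S(2)])
    have "corner d (\<lambda>s. u k (of_int (j + 1) * d - s)) (\<lambda>s. v (j + 1) (of_int k * d + s)) \<le>
      2 * corner d (\<lambda>s. u k (of_int (j + 1) * d - s)) (\<lambda>s. u k (of_int (j + 1) * d + s)) +
      2 * corner d (\<lambda>s. u k (of_int (j + 1) * d + s)) (\<lambda>s. v (j + 1) (of_int k * d + s))"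
      by (rule corner_triangle) measurable
    also have "\<dots> \<le> 2 * square_sum j k + 2 * square_sum j k"
      unfolding corner_commute[of d "\<lambda>s. u k (of_int (j + 1) * d - s)"]
      by (intro add_mono mult_left_mono order_trans[OF p(5) S(2)] order_trans[OF p(3) S(2)]) auto
    finally show "corner d (\<lambda>s. u k (of_int j * d + (d - s))) (\<lambda>s. v (j + 1) (of_int k * d + s)) \<le> 2 * square_sum j k + 2 * square_sum j k"
      unfolding sh .
  qed measurable
  show "gag_sym d (corner_data d (\<lambda>s. u (k + 1) (of_int j * d + s)) (\<lambda>s. v j (of_int k * d + (d - s)))) \<le> 22 * square_sum j k"
  proof (rule 22)
    show "gag d (\<lambda>s. u (k + 1) (of_int j * d + s)) \<le> square_sum j k" by (rule order_trans[OF p(1) S(3)])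
    show "gag d (\<lambda>s. v j (of_int k * d + (d - s))) \<le> square_sum j k"
      using order_trans[OF p(2) S(1)] gag_reflect[of "\<lambda>s. v j (of_int k * d + s)" d] by simp
    have "corner d (\<lambda>s. u (k + 1) (of_int j * d + s)) (\<lambda>s. v j (of_int (k + 1) * d - s)) \<le>
      2 * corner d (\<lambda>s. u (k + 1) (of_int j * d + s)) (\<lambda>s. v j (of_int (k + 1) * d + s)) +
      2 * corner d (\<lambda>s. v j (of_int (k + 1) * d + s)) (\<lambda>s. v j (of_int (k + 1) * d - s))"
      by (rule corner_triangle) measurable
    also have "\<dots> \<le> 2 * square_sum j k + 2 * square_sum j k"
      by (intro add_mono mult_left_mono order_trans[OF p(3) S(3)] order_trans[OF p(6) S(3)]) auto
    finally show "corner d (\<lambda>s. u (k + 1) (of_int j * d + s)) (\<lambda>s. v j (of_int k * d + (d - s))) \<le> 2 * square_sum j k + 2 * square_sum j k"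
      unfolding sh .
  qed measurable
  show "gag_sym d (corner_data d (\<lambda>s. u (k + 1) (of_int j * d + (d - s))) (\<lambda>s. v (j + 1) (of_int k * d + (d - s)))) \<le> 22 * square_sum j k"
  proof (rule 22)
    show "gag d (\<lambda>s. u (k + 1) (of_int j * d + (d - s))) \<le> square_sum j k"
      using order_trans[OF p(1) S(3)] gag_reflect[of "\<lambda>s. u (k + 1) (of_int j * d + s)" d] by simp
    show "gag d (\<lambda>s. v (j + 1) (of_int k * d + (d - s))) \<le> square_sum j k"
      using order_trans[OF p(2) S(2)] gag_reflect[of "\<lambda>s. v (j + 1) (of_int k * d + s)" d] by simp
    show "corner d (\<lambda>s. u (k + 1) (of_int j * d + (d - s))) (\<lambda>s. v (j + 1) (of_int k * d + (d - s))) \<le> 2 * square_sum j k + 2 * square_sum j k"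
      unfolding sh by (rule dbl[OF order_trans[OF p(4) S(4)]])
  qed measurable
qed

lemma square_sum_finite: "22 * square_sum j k < \<infinity>"
  using vertex_sum_finite by (simp add: square_sum_def ennreal_mult_less_top)

lemma cell_ac_on_grid:
  "AE x in lborel. x - of_int j * d \<in> {0<..<d} \<longrightarrow>
     ac_on 0 d (square_fun d u v j k (x - of_int j * d)) (square_dy d u v j k (x - of_int j * d)) \<and>
     square_fun d u v j k (x - of_int j * d) 0 = u k x \<and> square_fun d u v j k (x - of_int j * d) d = u (k + 1) x"
proof -
  have "AE x in lborel. x \<in> {0<..<d} \<longrightarrow> ac_on 0 d (square_fun d u v j k x) (square_dy d u v j k x) \<and>
    square_fun d u v j k x 0 = u k (of_int j * d + x) \<and> square_fun d u v j k x d = u (k + 1) (of_int j * d + x)"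
    unfolding square_fun_def square_dy_def
    by (intro cell_ac_on data_integrable d le_less_trans[OF gag_sym_le_square_sum(1) square_sum_finite] le_less_trans[OF gag_sym_le_square_sum(2) square_sum_finite]
        le_less_trans[OF gag_sym_le_square_sum(3) square_sum_finite] le_less_trans[OF gag_sym_le_square_sum(4) square_sum_finite]) measurable
  from AE_affine[of 1 _ "- (of_int j * d)", OF _ this] show ?thesis by simp
qed

lemma cell_energy:
  "(\<integral>\<^sup>+z. ennreal (indicator {0..d} (fst z - of_int j * d) * indicator {0..d} (snd z - of_int k * d) *
      (square_dy d u v j k (fst z - of_int j * d) (snd z - of_int k * d))\<^sup>2) \<partial>lborel) \<le> 7744 * square_sum j k"
proof -
  let ?f = "\<lambda>x y. ennreal (indicator {0..d} x * indicator {0..d} y * (square_dy d u v j k x y)\<^sup>2)"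
  have "(\<integral>\<^sup>+z. ?f (fst z - of_int j * d) (snd z - of_int k * d) \<partial>lborel) =
    (\<integral>\<^sup>+x. \<integral>\<^sup>+y. ?f (- (of_int j * d) + x) (- (of_int k * d) + y) \<partial>lborel \<partial>lborel)"
    by (subst nn_integral_plane(1)) (auto simp: algebra_simps)
  also have "\<dots> = (\<integral>\<^sup>+x. \<integral>\<^sup>+y. ?f (- (of_int j * d) + x) y \<partial>lborel \<partial>lborel)"
    by (intro nn_integral_cong nn_integral_translate) measurable
  also have "\<dots> = (\<integral>\<^sup>+x. \<integral>\<^sup>+y. ?f x y \<partial>lborel \<partial>lborel)"
    by (rule nn_integral_translate) measurable
  \<comment> \<open>Each of the four corners contributes at most 22, and 88 * (4 * 22) =
    7744.\<close>
  also have "\<dots> \<le> 88 * (22 * square_sum j k + 22 * square_sum j k + 22 * square_sum j k + 22 * square_sum j k)"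
    unfolding square_dy_def
    by (rule order_trans[OF cell_ext_dy_energy mult_left_mono], measurable)
      (intro data_integrable d add_mono gag_sym_le_square_sum zero_le)+
  also have "\<dots> = (88 * (22 + 22 + 22 + 22)) * square_sum j k" by (simp only: distrib_right mult.assoc)
  finally show ?thesis by simp
qed

text \<open>At each point the square of the derivative is one term of the sum over all squares.
  Exchanging the sum with the integral leaves the energies of the squares, and every vertex belongs
  to four squares.\<close>

lemma grid_ext_dy_sq_int: "sq_int (grid_ext_dy d u v)"
proof -
  let ?f = "\<lambda>jk z. ennreal (indicator {0..d} (fst z - of_int (fst jk) * d) * indicator {0..d} (snd z - of_int (snd jk) * d) *
      (square_dy d u v (fst jk) (snd jk) (fst z - of_int (fst jk) * d) (snd z - of_int (snd jk) * d))\<^sup>2)"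
  have fl: "x - of_int \<lfloor>x / d\<rfloor> * d \<in> {0..d}" for x
  proof -
    have "of_int \<lfloor>x / d\<rfloor> * d \<le> x"
      using of_int_floor_le[of "x / d"] unfolding pos_le_divide_eq[OF d] .
    moreover have "x \<le> (of_int \<lfloor>x / d\<rfloor> + 1) * d"
      using real_of_int_floor_add_one_ge[of "x / d"] unfolding pos_divide_le_eq[OF d] .
    ultimately show ?thesis by (simp add: algebra_simps)
  qed
  have "(\<integral>\<^sup>+z. ennreal ((grid_ext_dy d u v z)\<^sup>2) \<partial>lborel) \<le> (\<integral>\<^sup>+z. (\<integral>\<^sup>+jk. ?f jk z \<partial>count_space UNIV) \<partial>lborel)"
  proof (rule nn_integral_mono)
    fix z
    have "ennreal ((grid_ext_dy d u v z)\<^sup>2) = ?f (\<lfloor>fst z / d\<rfloor>, \<lfloor>snd z / d\<rfloor>) z"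
      using fl[of "fst z"] fl[of "snd z"] by (simp add: grid_ext_dy_def)
    also have "\<dots> \<le> (\<integral>\<^sup>+jk. ?f jk z \<partial>count_space UNIV)"
      by (rule nn_integral_ge_point) simp
    finally show "ennreal ((grid_ext_dy d u v z)\<^sup>2) \<le> (\<integral>\<^sup>+jk. ?f jk z \<partial>count_space UNIV)" .
  qed
  also have "\<dots> = (\<integral>\<^sup>+jk. (\<integral>\<^sup>+z. ?f jk z \<partial>lborel) \<partial>count_space UNIV)"
    by (rule nn_integral_count_space_swap[symmetric]) (auto intro: sigma_finite_lborel)
  also have "\<dots> \<le> (\<integral>\<^sup>+jk. 7744 * square_sum (fst jk) (snd jk) \<partial>count_space UNIV)"
    by (intro nn_integral_mono cell_energy)
  also have "\<dots> = 7744 * ((\<integral>\<^sup>+jk. vertex_sum d u v (fst jk, snd jk) \<partial>count_space UNIV) + (\<integral>\<^sup>+jk. vertex_sum d u v (fst jk + 1, snd jk) \<partial>count_space UNIV) +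
    (\<integral>\<^sup>+jk. vertex_sum d u v (fst jk, snd jk + 1) \<partial>count_space UNIV) + (\<integral>\<^sup>+jk. vertex_sum d u v (fst jk + 1, snd jk + 1) \<partial>count_space UNIV))"
    by (simp add: square_sum_def nn_integral_cmult nn_integral_add)
  also have "\<dots> < \<infinity>"
  proof -
    have "(\<integral>\<^sup>+jk. vertex_sum d u v (fst jk + p, snd jk + q) \<partial>count_space UNIV) < \<infinity>" for p q :: int
    proof -
      \<comment> \<open>Each of the four vertex sums is the whole norm with shifted indices.\<close>
      have "bij (\<lambda>jk :: int \<times> int. (fst jk + p, snd jk + q))"
        by (rule bij_betw_byWitness[where f'="\<lambda>jk. (fst jk - p, snd jk - q)"]) auto
      from nn_integral_bij_count_space[OF this, of "vertex_sum d u v"] fin show ?thesis by simp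
    qed
    from this[of 0 0] this[of 1 0] this[of 0 1] this[of 1 1] show ?thesis by (simp add: ennreal_mult_less_top)
  qed
  finally show ?thesis by (simp add: sq_int_def)
qed

lemma floor_cell: "of_int k * d \<le> y \<Longrightarrow> y < of_int k * d + d \<Longrightarrow> \<lfloor>y / d\<rfloor> = k"
  using d by (intro floor_unique) (auto simp: field_simps)

text \<open>On almost every vertical line the pieces from the squares of one column are absolutely
  continuous, and squares sharing a horizontal side both attain the datum there. The pieces
  therefore join to one absolutely continuous function; \<open>oint\<close> may then start at any
  grid line.\<close>

lemma grid_ext_line_rep: "line_rep (grid_ext d u v) (of_int k * d) (u k) (grid_ext_dy d u v)"
proof -
  have "AE x in lborel. \<forall>j k. x - of_int j * d \<in> {0<..<d} \<longrightarrow>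
     ac_on 0 d (square_fun d u v j k (x - of_int j * d)) (square_dy d u v j k (x - of_int j * d)) \<and>
     square_fun d u v j k (x - of_int j * d) 0 = u k x \<and> square_fun d u v j k (x - of_int j * d) d = u (k + 1) x"
    unfolding AE_all_countable using cell_ac_on_grid by blast
  moreover have "AE x in lborel. \<forall>j::int. x \<noteq> of_int j * d"
    unfolding AE_all_countable using AE_lborel_singleton by blast
  ultimately have "AE x in lborel. \<forall>y. grid_ext d u v (x, y) = u k x + oint (\<lambda>s. grid_ext_dy d u v (x, s)) (of_int k * d) y"
  proof (eventually_elim, intro allI)
    fix x y
    assume cells: "\<forall>j k. x - of_int j * d \<in> {0<..<d} \<longrightarrow>
       ac_on 0 d (square_fun d u v j k (x - of_int j * d)) (square_dy d u v j k (x - of_int j * d)) \<and>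
       square_fun d u v j k (x - of_int j * d) 0 = u k x \<and> square_fun d u v j k (x - of_int j * d) d = u (k + 1) x"
      and nj: "\<forall>j::int. x \<noteq> of_int j * d"
    define j where "j = \<lfloor>x / d\<rfloor>"
    have "of_int j \<le> x / d" "x / d < of_int j + 1" unfolding j_def by linarith+
    then have "of_int j * d \<le> x" "x < of_int j * d + d" using d by (auto simp: field_simps)
    then have xj: "x - of_int j * d \<in> {0<..<d}" using nj[rule_format, of j] by auto
    define \<psi> where "\<psi> y = grid_ext d u v (x, y)" for y
    define \<gamma> where "\<gamma> y = grid_ext_dy d u v (x, y)" for y
    have [measurable]: "\<gamma> \<in> borel_measurable borel" unfolding \<gamma>_def by measurable
    have \<psi>0: "\<psi> (of_int k * d) = u k x" for k
    proof -
      have "\<lfloor>of_int k * d / d\<rfloor> = k" using d by simp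
      then show ?thesis using cells xj d by (simp add: \<psi>_def grid_ext_def j_def[symmetric])
    qed
    have cell: "ac_on (of_int k * d) (of_int k * d + d) \<psi> \<gamma>" for k
    proof -
      have c: "ac_on 0 d (square_fun d u v j k (x - of_int j * d)) (square_dy d u v j k (x - of_int j * d))"
        and e: "square_fun d u v j k (x - of_int j * d) d = u (k + 1) x" using cells xj by blast+
      have "ac_on (of_int k * d) (of_int k * d + d) (\<lambda>y. square_fun d u v j k (x - of_int j * d) (y - of_int k * d)) (\<lambda>y. square_dy d u v j k (x - of_int j * d) (y - of_int k * d))"
        by (rule ac_on_shift[OF _ c]) measurable
      then show ?thesis
      proof (rule ac_on_cong)
        fix y assume y: "y \<in> {of_int k * d..of_int k * d + d}"
        show "square_fun d u v j k (x - of_int j * d) (y - of_int k * d) = \<psi> y"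
        \<comment> \<open>The floor assigns the upper side to the next square, so the two values
          agree only through the common datum \<open>u (k + 1) x\<close>.\<close>
        proof (cases "y = of_int k * d + d")
          case True
          have "of_int (k + 1) * d = of_int k * d + d" by (simp add: algebra_simps)
          then show ?thesis using \<psi>0[of "k + 1"] e True by simp
        next
          case False
          then have "\<lfloor>y / d\<rfloor> = k" using y by (intro floor_cell) auto
          then show ?thesis by (simp add: \<psi>_def grid_ext_def j_def)
        qed
      next
        show "AE s in lborel. s \<in> {of_int k * d..of_int k * d + d} \<longrightarrow> square_dy d u v j k (x - of_int j * d) (s - of_int k * d) = \<gamma> s"
          using AE_lborel_singleton[of "of_int k * d + d"]
        proof (eventually_elim, intro impI)
          fix s assume "s \<noteq> of_int k * d + d" "s \<in> {of_int k * d..of_int k * d + d}"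
          then have "\<lfloor>s / d\<rfloor> = k" by (intro floor_cell) auto
          then show "square_dy d u v j k (x - of_int j * d) (s - of_int k * d) = \<gamma> s" by (simp add: \<gamma>_def grid_ext_dy_def j_def)
        qed
      qed measurable
    qed
    \<comment> \<open>Counting \<open>Suc n\<close> squares makes the base case a single
      square.\<close>
    have cells_n: "ac_on (of_int k * d) (of_int (k + int (Suc n)) * d) \<psi> \<gamma>" for k n
    proof (induction n)
      case 0 then show ?case using cell[of k] by (simp add: algebra_simps)
    next
      case (Suc n)
      have "ac_on (of_int (k + int (Suc n)) * d) (of_int (k + int (Suc (Suc n))) * d) \<psi> \<gamma>"
        using cell[of "k + int (Suc n)"] by (simp add: algebra_simps)
      from ac_on_concat[OF Suc this] show ?case using d by (simp add: mult_right_mono)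
    qed
    have "\<psi> y = \<psi> (of_int k * d) + oint \<gamma> (of_int k * d) y"
    proof -
      \<comment> \<open>The \<open>2 * n + 1\<close> consecutive squares from index
        \<open>k - n\<close> on cover every height within \<open>n * d\<close> of the line
        \<open>k\<close>.\<close>
      obtain n :: nat where n: "real n * d > \<bar>y - of_int k * d\<bar>" using reals_Archimedean3[OF d] by blast
      have "ac_on (of_int (k - int n) * d) (of_int (k - int n + int (Suc (2 * n))) * d) \<psi> \<gamma>" by (rule cells_n)
      then show ?thesis
        using n d by (intro ac_on_diff) (auto simp: algebra_simps)
    qed
    then show "grid_ext d u v (x, y) = u k x + oint (\<lambda>s. grid_ext_dy d u v (x, s)) (of_int k * d) y"
      using \<psi>0 by (simp add: \<psi>_def \<gamma>_def[abs_def])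
  qed
  then have "AE x in lborel. AE y in lborel. grid_ext d u v (x, y) = u k x + oint (\<lambda>s. grid_ext_dy d u v (x, s)) (of_int k * d) y"
    by (auto elim!: eventually_mono)
  then show ?thesis
    unfolding line_rep_def
    using AE_plane(1)[of "\<lambda>z. grid_ext d u v z = u k (fst z) + oint (\<lambda>s. grid_ext_dy d u v (fst z, s)) (of_int k * d) (snd z)"] by simp
qed

end

section \<open>Symmetry of the extension and conclusion\<close>

lemma vertex_terms_swap: "vertex_terms d v u b a = vertex_terms d u v a b"
proof -
  have e: "corner d (\<lambda>y. v (b + y)) (\<lambda>x. u (a + x)) = corner d (\<lambda>x. u (a + x)) (\<lambda>y. v (b + y))"
    "corner d (\<lambda>y. v (b - y)) (\<lambda>x. u (a - x)) = corner d (\<lambda>x. u (a - x)) (\<lambda>y. v (b - y))"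
    by (rule corner_commute)+
  show ?thesis unfolding vertex_terms_def e by (simp only: add.assoc add.commute add.left_commute)
qed

lemma grid_data_swap:
  assumes "grid_data d u v"
  shows "grid_data d v u"
proof -
  interpret grid_data d u v by fact
  have "(\<integral>\<^sup>+jk. vertex_sum d v u jk \<partial>count_space UNIV) = (\<integral>\<^sup>+jk. vertex_sum d u v (prod.swap jk) \<partial>count_space UNIV)"
    by (intro nn_integral_cong) (simp add: vertex_sum_def vertex_terms_swap)
  also have "\<dots> = (\<integral>\<^sup>+jk. vertex_sum d u v jk \<partial>count_space UNIV)"
    by (rule nn_integral_bij_count_space) (rule bij_swap)
  finally show ?thesis using fin d ul vl by unfold_locales simp_all
qed

text \<open>The four corner extensions are swapped separately; excluding both diagonals of the
  square puts each of them off its own diagonal, where \<open>corner_ext_swap\<close>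
  applies.\<close>

lemma cell_ext_swap:
  assumes "x \<noteq> y" "d - x \<noteq> y" "d \<noteq> 0"
  shows "cell_ext d u0 u1 v0 v1 x y = cell_ext d v0 v1 u0 u1 y x"
proof -
  have sw: "corner_ext (corner_data d f g) p q = corner_ext (corner_data d g f) q p" if "p \<noteq> q" for f g p q
    using corner_ext_swap[OF that, of "corner_data d f g"] by (simp add: corner_data_uminus)
  have e: "corner_ext (corner_data d u0 v0) x y = corner_ext (corner_data d v0 u0) y x"
    "corner_ext (corner_data d (\<lambda>s. u0 (d - s)) v1) (d - x) y = corner_ext (corner_data d v1 (\<lambda>s. u0 (d - s))) y (d - x)"
    "corner_ext (corner_data d u1 (\<lambda>s. v0 (d - s))) x (d - y) = corner_ext (corner_data d (\<lambda>s. v0 (d - s)) u1) (d - y) x"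
    "corner_ext (corner_data d (\<lambda>s. u1 (d - s)) (\<lambda>s. v1 (d - s))) (d - x) (d - y) = corner_ext (corner_data d (\<lambda>s. v1 (d - s)) (\<lambda>s. u1 (d - s))) (d - y) (d - x)"
    using assms by (intro sw; auto)+
  show ?thesis unfolding cell_ext_def e using assms(3) by (simp add: field_simps)
qed

text \<open>This lets a single function have line representations in both directions: the horizontal
  ones for \<open>(u, v)\<close> are the vertical ones for \<open>(v, u)\<close>. The exceptional
  set consists of the diagonals of all squares, countably many lines.\<close>

lemma grid_ext_swap:
  assumes "grid_data d u v"
  shows "AE z in lborel. grid_ext d u v (prod.swap z) = grid_ext d v u z"
proof -
  interpret grid_data d u v by fact
  interpret sw: grid_data d v u by (rule grid_data_swap) fact
  have "AE x in lborel. AE y in lborel. \<forall>m::int. y \<noteq> x + of_int m * d \<and> y \<noteq> of_int m * d - x"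
  proof (rule AE_I2)
    fix x
    show "AE y in lborel. \<forall>m::int. y \<noteq> x + of_int m * d \<and> y \<noteq> of_int m * d - x"
      unfolding AE_all_countable
    proof
      fix m :: int
      show "AE y in lborel. y \<noteq> x + of_int m * d \<and> y \<noteq> of_int m * d - x"
        using AE_lborel_singleton[of "x + of_int m * d"] AE_lborel_singleton[of "of_int m * d - x"] by eventually_elim simp
    qed
  qed
  then have "AE x in lborel. AE y in lborel. grid_ext d u v (prod.swap (x, y)) = grid_ext d v u (x, y)"
  proof (eventually_elim)
    case (elim x)
    then show ?case
    proof eventually_elim
      case (elim y)
      define j where "j = \<lfloor>y / d\<rfloor>"
      define k where "k = \<lfloor>x / d\<rfloor>"
      \<comment> \<open>Within the square with indices \<open>j\<close> and \<open>k\<close>, the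
        rising diagonal belongs to \<open>m = j - k\<close> and the falling one to
        \<open>m = j + k + 1\<close>.\<close>
      have "y - of_int j * d \<noteq> x - of_int k * d" using elim[rule_format, of "j - k"] by (auto simp: algebra_simps)
      moreover have "d - (y - of_int j * d) \<noteq> x - of_int k * d" using elim[rule_format, of "j + k + 1"] by (auto simp: algebra_simps)
      ultimately show ?case
        unfolding grid_ext_def square_fun_def by (simp add: j_def[symmetric] k_def[symmetric]) (rule cell_ext_swap, use d in auto)
    qed
  qed
  then show ?thesis
    using AE_plane(1)[of "\<lambda>z. grid_ext d u v (prod.swap z) = grid_ext d v u z"] by simp
qed

theorem theorem3p5:
  fixes \<delta> :: real
  assumes "\<delta> > 0"
  shows "{f. \<exists>F. H1 F \<and> gp_trace \<delta> F f} = H_half_gp \<delta>"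
proof (intro set_eqI iffI)
  fix f assume "f \<in> {f. \<exists>F. H1 F \<and> gp_trace \<delta> F f}"
  then obtain F where F: "H1 F" "gp_trace \<delta> F f" by blast
  then have l: "gp_locL2 \<delta> f" by (auto simp: gp_trace_def gp_locL2_def htrace_def vtrace_def)
  then obtain u v where "line_data \<delta> f u v" by (rule gp_locL2_line_data)
  from trace_norm_finite[OF assms F this] l show "f \<in> H_half_gp \<delta>" by (simp add: H_half_gp_def)
next
  fix f assume "f \<in> H_half_gp \<delta>"
  then have l: "gp_locL2 \<delta> f" and fin: "gp_half_norm_sq \<delta> f < \<infinity>" by (auto simp: H_half_gp_def)
  obtain u v where ld: "line_data \<delta> f u v" using l by (rule gp_locL2_line_data)
  have "gp_half_norm_sq \<delta> f = (\<integral>\<^sup>+jk. vertex_sum \<delta> u v jk \<partial>count_space UNIV)"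
    unfolding gp_half_norm_sq_def gp_terms_eq[OF ld] vertex_sum_def ..
  then have gd: "grid_data \<delta> u v"
    using ld fin assms by unfold_locales (auto simp: line_data_def)
  interpret grid_data \<delta> u v by (rule gd)
  interpret sw: grid_data \<delta> v u by (rule grid_data_swap[OF gd])
  \<comment> \<open>The derivative in \<open>x\<close> is \<open>grid_ext_dy \<delta> v u\<close>
    with exchanged coordinates; the double \<open>prod.swap\<close> is the shape in which
    \<open>line_rep_trace\<close> receives it.\<close>
  have "line_rep (\<lambda>z. grid_ext \<delta> u v (prod.swap z)) (of_int j * \<delta>) (v j) (\<lambda>z. grid_ext_dy \<delta> v u (prod.swap (prod.swap z)))" for j
    using sw.grid_ext_line_rep[of j] grid_ext_swap[OF gd] unfolding line_rep_def
    by eventually_elim simp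
  from line_rep_trace[OF ld l grid_ext_measurable(1) _ grid_ext_measurable(2) sq_int_swap[OF sw.grid_ext_measurable(2) sw.grid_ext_dy_sq_int] grid_ext_dy_sq_int grid_ext_line_rep this]
  have "H1 (grid_ext \<delta> u v) \<and> gp_trace \<delta> (grid_ext \<delta> u v) f" by simp
  then show "f \<in> {f. \<exists>F. H1 F \<and> gp_trace \<delta> F f}" by blast
qed

end
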